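(* Let $\delta>0$, $S>0$, $U_0\in[w_1]^\perp\subset H^2_*(\Omega)$, $V_0\in[w_1]^\perp\subset L^2(\Omega)$, $\Lambda_1<P\le\Lambda_2$, and let $U$ be the weak solution on $[0,\infty)$ of the plate problem with data $(\delta,S,P,U_0,V_0)$ and $F\equiv0$. Then $U(t)\in[w_1]^\perp\subset H^2_*(\Omega)$ for all $t\ge0$, and $U(t)\to0$ in $H^2_*(\Omega)$, $U'(t)\to0$ in $L^2(\Omega)$ as $t\to\infty$.
   Context: Let $0<\sigma<\frac12$, $l>0$ and $\Omega=(0,\pi)\times(-l,l)$. Let $H^2_*(\Omega)=\{U\in H^2(\Omega): U=0 \text{ on } \{0,\pi\}\times[-l,l]\}$, equipped with the inner product $(U,V)_2=\int_\Omega\big(\Delta U\Delta V-(1-\sigma)(U_{xx}V_{yy}+U_{yy}V_{xx}-2U_{xy}V_{xy})\big)$ and norm $\|\cdot\|_2$. Let $(\cdot,\cdot)_0,\|\cdot\|_0$ be the inner product and norm of $L^2(\Omega)$, $\mathcal{H}$ the dual space of $H^2_*(\Omega)$ and $\langle\cdot,\cdot\rangle$ the duality $\mathcal{H}\times H^2_*(\Omega)$ (with $L^2(\Omega)\subset\mathcal H$ via $\langle f,V\rangle=(f,V)_0$). Primes denote time derivatives. Put $\phi(U)=-P+S\int_\Omega U_x^2$. The plate problem is $U_{tt}+\delta U_t+\Delta^2U-\phi(U)U_{xx}=F$ in $\Omega\times(0,\infty)$, with $U=U_{xx}=0$ on $\{0,\pi\}\times[-l,l]$, $U_{yy}+\sigma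 U_{xx}=U_{yyy}+(2-\sigma)U_{xxy}=0$ on $[0,\pi]\times\{-l,l\}$, $U(\cdot,0)=U_0$, $U_t(\cdot,0)=V_0$. A weak solution on $[0,T]$ is a function $U\in\mathcal{C}^0([0,T],H^2_*(\Omega))\cap\mathcal{C}^1([0,T],L^2(\Omega))\cap\mathcal{C}^2([0,T],\mathcal{H})$ with $U(0)=U_0$, $U'(0)=V_0$ and $\langle U'',V\rangle+\delta(U',V)_0+(U,V)_2+\phi(U)(U_x,V_x)_0=(F,V)_0$ for all $t\in[0,T]$, $V\in H^2_*(\Omega)$; a weak solution on $[0,\infty)$ is one on every $[0,T]$ (it exists and is unique). $\Lambda_1<\Lambda_2$ are the first and second eigenvalues $\Lambda$ of the buckling problem $\Delta^2w+\Lambda w_{xx}=0$ in $\Omega$ with the same boundary conditions, i.e. $(w,z)_2=\Lambda(w_x,z_x)_0$ for all $z\in H^2_*(\Omega)$. The function $w_1$ is an eigenfunction associated with the least eigenvalue $\Lambda_1$; it has the form $w_1(x,y)=\varphi_{1,1}(y)\sin x$, with $\|w_1\|_0=1$. Here $[w_1]^\perp$ denotes the orthogonal complement of the span of $w_1$: with respect to $(\cdot,\cdot)_0$ in $L^2(\Omega)$ and with respect to $(\cdot,\cdot)_2$ in $H^2_*(\Omega)$. *)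

theory Defs
  imports "HOL-Analysis.Analysis"
begin

(* Elements of L^2 and of Sobolev spaces are represented by functions on the plane, and
   only their values almost everywhere in the domain are relevant; accordingly norm0, norm2 and
   dual_norm are seminorms that vanish exactly on the representatives of zero. *)

type_synonym field = "real \<times> real \<Rightarrow> real"

definition plate :: "real \<Rightarrow> (real \<times> real) set" where
  "plate l = {0<..<pi} \<times> {-l<..<l}"

definition L2 :: "(real \<times> real) set \<Rightarrow> field set" where
  "L2 \<Omega> = {u \<in> borel_measurable (lebesgue_on \<Omega>). integrable (lebesgue_on \<Omega>) (\<lambda>p. (u p)\<^sup>2)}"

definition inner0 :: "(real \<times> real) set \<Rightarrow> field \<Rightarrow> field \<Rightarrow> real" where
  "inner0 \<Omega> u v = (LINT p|lebesgue_on \<Omega>. u p * v p)"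

definition norm0 :: "(real \<times> real) set \<Rightarrow> field \<Rightarrow> real" where
  "norm0 \<Omega> u = sqrt (inner0 \<Omega> u u)"

primrec Ck :: "nat \<Rightarrow> field \<Rightarrow> bool" where
  "Ck 0 f \<longleftrightarrow> continuous_on UNIV f"
| "Ck (Suc k) f \<longleftrightarrow> (\<exists>fx fy. Ck k fx \<and> Ck k fy \<and>
      (\<forall>p. (f has_derivative (\<lambda>h. fx p * fst h + fy p * snd h)) (at p)))"

definition test_function :: "(real \<times> real) set \<Rightarrow> field \<Rightarrow> bool" where
  "test_function \<Omega> f \<longleftrightarrow> (\<forall>k. Ck k f) \<and> (\<exists>K. compact K \<and> K \<subseteq> \<Omega> \<and> (\<forall>p. p \<notin> K \<longrightarrow> f p = 0))"

definition dx :: "field \<Rightarrow> field" where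
  "dx f = (\<lambda>(x, y). deriv (\<lambda>s. f (s, y)) x)"

definition dy :: "field \<Rightarrow> field" where
  "dy f = (\<lambda>(x, y). deriv (\<lambda>s. f (x, s)) y)"

definition is_weak_deriv :: "(real \<times> real) set \<Rightarrow> nat \<Rightarrow> nat \<Rightarrow> field \<Rightarrow> field \<Rightarrow> bool" where
  "is_weak_deriv \<Omega> i j u g \<longleftrightarrow>
     (\<forall>f. test_function \<Omega> f \<longrightarrow>
        (LINT p|lebesgue_on \<Omega>. u p * (dx ^^ i) ((dy ^^ j) f) p) =
        (-1) ^ (i + j) * (LINT p|lebesgue_on \<Omega>. g p * f p))"

(* The weak derivative in L^2, of order i in the first and j in the second variable;
   unique up to almost-everywhere equality, hence the choice of a representative. *)
definition wderiv :: "(real \<times> real) set \<Rightarrow> nat \<Rightarrow> nat \<Rightarrow> field \<Rightarrow> field" where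
  "wderiv \<Omega> i j u = (SOME g. g \<in> L2 \<Omega> \<and> is_weak_deriv \<Omega> i j u g)"

definition H2 :: "(real \<times> real) set \<Rightarrow> field set" where
  "H2 \<Omega> = {u \<in> L2 \<Omega>. \<forall>i j. i + j \<le> 2 \<longrightarrow> (\<exists>g \<in> L2 \<Omega>. is_weak_deriv \<Omega> i j u g)}"

(* H^2 of a planar rectangle embeds into the continuous functions on its closure, so the
   boundary condition is a condition on the continuous representative. *)
definition H2star :: "real \<Rightarrow> field set" where
  "H2star l = {u \<in> H2 (plate l).
     \<exists>v. continuous_on ({0..pi} \<times> {-l..l}) v
       \<and> (AE p in lebesgue_on (plate l). u p = v p)
       \<and> (\<forall>p \<in> {0, pi} \<times> {-l..l}. v p = 0)}"

definition inner2 :: "real \<Rightarrow> real \<Rightarrow> field \<Rightarrow> field \<Rightarrow> real" where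
  "inner2 l \<sigma> u v =
     (let xx = wderiv (plate l) 2 0; yy = wderiv (plate l) 0 2; xy = wderiv (plate l) 1 1
      in LINT p|lebesgue_on (plate l).
           (xx u p + yy u p) * (xx v p + yy v p)
           - (1 - \<sigma>) * (xx u p * yy v p + yy u p * xx v p - 2 * (xy u p * xy v p)))"

definition norm2 :: "real \<Rightarrow> real \<Rightarrow> field \<Rightarrow> real" where
  "norm2 l \<sigma> u = sqrt (inner2 l \<sigma> u u)"

definition inner_x :: "real \<Rightarrow> field \<Rightarrow> field \<Rightarrow> real" where
  "inner_x l u v = inner0 (plate l) (wderiv (plate l) 1 0 u) (wderiv (plate l) 1 0 v)"

definition orth_compl :: "field set \<Rightarrow> (field \<Rightarrow> field \<Rightarrow> real) \<Rightarrow> field \<Rightarrow> field set" where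
  "orth_compl X ip w = {u \<in> X. \<forall>c. ip u (\<lambda>p. c * w p) = 0}"

definition dual :: "real \<Rightarrow> real \<Rightarrow> (field \<Rightarrow> real) set" where
  "dual l \<sigma> = {f.
     (\<forall>u \<in> H2star l. \<forall>v \<in> H2star l. f (\<lambda>p. u p + v p) = f u + f v) \<and>
     (\<forall>c. \<forall>u \<in> H2star l. f (\<lambda>p. c * u p) = c * f u) \<and>
     (\<exists>C. \<forall>u \<in> H2star l. \<bar>f u\<bar> \<le> C * norm2 l \<sigma> u)}"

definition dual_norm :: "real \<Rightarrow> real \<Rightarrow> (field \<Rightarrow> real) \<Rightarrow> real" where
  "dual_norm l \<sigma> f = (SUP u \<in> {u \<in> H2star l. norm2 l \<sigma> u \<le> 1}. \<bar>f u\<bar>)"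

definition buckling_eigenfunction :: "real \<Rightarrow> real \<Rightarrow> real \<Rightarrow> field \<Rightarrow> bool" where
  "buckling_eigenfunction l \<sigma> \<Lambda> w \<longleftrightarrow>
     w \<in> H2star l \<and> \<not> (AE p in lebesgue_on (plate l). w p = 0) \<and>
     (\<forall>z \<in> H2star l. inner2 l \<sigma> w z = \<Lambda> * inner_x l w z)"

definition buckling_eigenvalues :: "real \<Rightarrow> real \<Rightarrow> real set" where
  "buckling_eigenvalues l \<sigma> = {\<Lambda>. \<exists>w. buckling_eigenfunction l \<sigma> \<Lambda> w}"

definition is_least :: "real set \<Rightarrow> real \<Rightarrow> bool" where
  "is_least A a \<longleftrightarrow> a \<in> A \<and> (\<forall>b \<in> A. a \<le> b)"

definition first_second_eigenvalues :: "real \<Rightarrow> real \<Rightarrow> real \<Rightarrow> real \<Rightarrow> bool" where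
  "first_second_eigenvalues l \<sigma> \<Lambda>1 \<Lambda>2 \<longleftrightarrow>
     is_least (buckling_eigenvalues l \<sigma>) \<Lambda>1 \<and>
     is_least (buckling_eigenvalues l \<sigma> - {\<Lambda>1}) \<Lambda>2"

(* X is the carrier and N the (semi)norm of a space of functions on 'p: either one of the
   spaces of fields, or (with 'p = field) the dual space. *)
definition C0_curve ::
    "real set \<Rightarrow> ('p \<Rightarrow> real) set \<Rightarrow> (('p \<Rightarrow> real) \<Rightarrow> real) \<Rightarrow> (real \<Rightarrow> 'p \<Rightarrow> real) \<Rightarrow> bool" where
  "C0_curve I X N c \<longleftrightarrow>
     (\<forall>t \<in> I. c t \<in> X \<and> ((\<lambda>s. N (\<lambda>p. c s p - c t p)) \<longlongrightarrow> 0) (at t within I))"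

definition has_curve_deriv ::
    "real set \<Rightarrow> (('p \<Rightarrow> real) \<Rightarrow> real) \<Rightarrow> (real \<Rightarrow> 'p \<Rightarrow> real) \<Rightarrow> (real \<Rightarrow> 'p \<Rightarrow> real) \<Rightarrow> bool" where
  "has_curve_deriv I N c c' \<longleftrightarrow>
     (\<forall>t \<in> I. ((\<lambda>s. N (\<lambda>p. (c s p - c t p) / (s - t) - c' t p)) \<longlongrightarrow> 0) (at t within I))"

definition nonlocal_coeff :: "real \<Rightarrow> real \<Rightarrow> real \<Rightarrow> field \<Rightarrow> real" where
  "nonlocal_coeff l P S u = - P + S * (LINT p|lebesgue_on (plate l). (wderiv (plate l) 1 0 u p)\<^sup>2)"

(* U' is the time derivative of U in L^2 and U'' that of U' in the dual space, where L^2 is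
   embedded into the dual by the L^2 inner product. *)
definition weak_solution_on ::
    "real \<Rightarrow> real \<Rightarrow> real \<Rightarrow> real \<Rightarrow> real \<Rightarrow> (real \<Rightarrow> field) \<Rightarrow> field \<Rightarrow> field \<Rightarrow> real
      \<Rightarrow> (real \<Rightarrow> field) \<Rightarrow> (real \<Rightarrow> field) \<Rightarrow> bool" where
  "weak_solution_on l \<sigma> \<delta> S P F U0 V0 T U U' \<longleftrightarrow>
     C0_curve {0..T} (H2star l) (norm2 l \<sigma>) U \<and>
     has_curve_deriv {0..T} (norm0 (plate l)) U U' \<and>
     C0_curve {0..T} (L2 (plate l)) (norm0 (plate l)) U' \<and>
     (AE p in lebesgue_on (plate l). U 0 p = U0 p) \<and>
     (AE p in lebesgue_on (plate l). U' 0 p = V0 p) \<and>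
     (\<exists>U''. has_curve_deriv {0..T} (dual_norm l \<sigma>) (\<lambda>t. inner0 (plate l) (U' t)) U'' \<and>
        C0_curve {0..T} (dual l \<sigma>) (dual_norm l \<sigma>) U'' \<and>
        (\<forall>t \<in> {0..T}. \<forall>V \<in> H2star l.
           U'' t V + \<delta> * inner0 (plate l) (U' t) V + inner2 l \<sigma> (U t) V
             + nonlocal_coeff l P S (U t) * inner_x l (U t) V
           = inner0 (plate l) (F t) V))"

definition weak_solution ::
    "real \<Rightarrow> real \<Rightarrow> real \<Rightarrow> real \<Rightarrow> real \<Rightarrow> (real \<Rightarrow> field) \<Rightarrow> field \<Rightarrow> field
      \<Rightarrow> (real \<Rightarrow> field) \<Rightarrow> (real \<Rightarrow> field) \<Rightarrow> bool" where
  "weak_solution l \<sigma> \<delta> S P F U0 V0 U U' \<longleftrightarrow>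
     (\<forall>T > 0. weak_solution_on l \<sigma> \<delta> S P F U0 V0 T U U')"

end

theory Submission
  imports Defs "HOL-Complex_Analysis.Great_Picard"
begin

text \<open>
  Write a for the plate form (.,.)_2, b for the form (u_x, v_x)_0 and (.,.) for the inner product of
  L2. The theorem rests on three facts.

  The orthogonal complement of w_1 is invariant. Since w_1 = \<phi>(y) sin x, integrating by parts in x
  gives b(u, w_1) = (u, w_1), and a(u, w_1) = \<Lambda>_1 b(u, w_1) because w_1 is an eigenfunction. So the weak
  equation tested with w_1 is a linear homogeneous ordinary differential equation for
  (U(t), w_1), whose only solution with zero data is zero (\<open>invariant_orthogonality\<close>).

  On that complement a(u, u) \<ge> \<Lambda>_2 b(u, u) (\<open>spectral_gap\<close>). Expand u in the sines sin(m x). Both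
  forms decouple into forms on the one-dimensional space H^2(-l, l) of profiles, one pair for each m
  (\<open>H2star_modes\<close>, \<open>mode_pairing\<close>, \<open>mode_mode\<close>), and it suffices to prove the inequality in each
  mode (\<open>mode_sum_bound\<close>). By compactness the quotient of the two forms attains its minimum in a mode,
  also under an orthogonality constraint to an eigenfunction (\<open>constrained_minimizer\<close>), and every such
  minimum is a buckling eigenvalue of the plate. It is at least \<Lambda>_2 as soon as it differs from \<Lambda>_1. In the
  modes m \<ge> 2 it exceeds 1, while \<Lambda>_1 < 1 (\<open>mode_a_lower\<close>, \<open>mode1_below_one\<close>). In the mode m = 1 the
  minimum is taken over profiles orthogonal to that of w_1, so it differs from \<Lambda>_1 because an
  eigenvalue between 0 and 1 is simple within the first mode (\<open>mode1_simple\<close>). Simplicity is seen from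
  boundary values: testing the eigenvalue equation with solutions cosh, sinh of the same differential
  equation leaves linear relations between the values at \<plusminus>l of an eigenfunction and of its derivative;
  these annihilate the even or the odd part of the boundary values, and a profile that vanishes at
  both ends cannot belong to an eigenvalue below 1.

  The energy decays. Let E = |U'|^2 + a(U, U) - P b(U, U) + (S/2) b(U, U)^2. The gap and P \<le> \<Lambda>_2 make
  all terms of E nonnegative (after grouping the two middle ones), and formally
  E' = -2 \<delta> |U'|^2 (\<open>energy_identity\<close>). The function Z = (U', U) + (\<delta>/2) |U|^2 + E/\<delta> is nonnegative with
  Z' \<le> -E, whence (Z + t E)' \<le> 0 and E(t) \<le> Z(0)/t. Thus U'(t) and b(U(t), U(t)) tend to zero; the latter
  uses S > 0 and yields a(U(t), U(t)) \<rightarrow> 0 even if P = \<Lambda>_2 (\<open>decay\<close>).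

  The energy identity needs an argument of its own, because U' takes values only in L2 and is no
  admissible test function. The antisymmetric expression
  (U'(s), U(s + h)) - (U'(s + h), U(s)) can be differentiated in s by testing the equation at s with
  U(s + h) and conversely; the terms of a cancel by symmetry. Dividing by h and letting h \<rightarrow> 0 gives
  the derivative of |U'|^2 - \<langle>U'', U\<rangle> (\<open>wronskian_rate_deriv\<close>), and the energy is this quantity up to terms that are
  differentiable anyway.
\<close>

section \<open>Semi-inner products and square-integrable functions\<close>

text \<open>The elements of the spaces at hand are functions modulo equality almost everywhere, so the inner
  products are only semidefinite. The carrier is an explicit set since the spaces are not types; its
  elements are functions on an arbitrary type, so that profiles with their derivatives fit as well.\<close>
locale semi_inner =
  fixes X :: "('p \<Rightarrow> real) set" and ip :: "('p \<Rightarrow> real) \<Rightarrow> ('p \<Rightarrow> real) \<Rightarrow> real"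
  assumes zero_mem: "(\<lambda>p. 0) \<in> X"
    and add_mem: "u \<in> X \<Longrightarrow> v \<in> X \<Longrightarrow> (\<lambda>p. u p + v p) \<in> X"
    and scale_mem: "u \<in> X \<Longrightarrow> (\<lambda>p. c * u p) \<in> X"
    and add_left: "u \<in> X \<Longrightarrow> v \<in> X \<Longrightarrow> w \<in> X \<Longrightarrow> ip (\<lambda>p. u p + v p) w = ip u w + ip v w"
    and scale_left: "u \<in> X \<Longrightarrow> w \<in> X \<Longrightarrow> ip (\<lambda>p. c * u p) w = c * ip u w"
    and sym: "u \<in> X \<Longrightarrow> v \<in> X \<Longrightarrow> ip u v = ip v u"
    and nonneg: "u \<in> X \<Longrightarrow> 0 \<le> ip u u"
begin

definition nrm :: "('p \<Rightarrow> real) \<Rightarrow> real" where "nrm u = sqrt (ip u u)"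

lemma diff_mem: assumes "u \<in> X" "v \<in> X" shows "(\<lambda>p. u p - v p) \<in> X"
  using add_mem[OF assms(1) scale_mem[OF assms(2), of "-1"]] by simp

lemma divide_mem: assumes "u \<in> X" shows "(\<lambda>p. u p / c) \<in> X"
  using scale_mem[OF assms, of "1/c"] by simp

lemma add_right: "u \<in> X \<Longrightarrow> v \<in> X \<Longrightarrow> w \<in> X \<Longrightarrow> ip w (\<lambda>p. u p + v p) = ip w u + ip w v"
  by (simp add: sym[of w] add_left add_mem)

lemma scale_right: "u \<in> X \<Longrightarrow> w \<in> X \<Longrightarrow> ip w (\<lambda>p. c * u p) = c * ip w u"
  by (simp add: sym[of w] scale_left scale_mem)

lemma diff_left:
  assumes "u \<in> X" "v \<in> X" "w \<in> X" shows "ip (\<lambda>p. u p - v p) w = ip u w - ip v w"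
  using add_left[OF assms(1) scale_mem[OF assms(2), of "-1"] assms(3)] scale_left[OF assms(2,3), of "-1"]
  by simp

lemma diff_right: "u \<in> X \<Longrightarrow> v \<in> X \<Longrightarrow> w \<in> X \<Longrightarrow> ip w (\<lambda>p. u p - v p) = ip w u - ip w v"
  by (simp add: sym[of w] diff_left diff_mem)

lemma divide_left: "u \<in> X \<Longrightarrow> w \<in> X \<Longrightarrow> ip (\<lambda>p. u p / c) w = ip u w / c"
  using scale_left[of u w "1/c"] by simp

lemma divide_right: "u \<in> X \<Longrightarrow> w \<in> X \<Longrightarrow> ip w (\<lambda>p. u p / c) = ip w u / c"
  using scale_right[of u w "1/c"] by simp

lemma zero_left: "w \<in> X \<Longrightarrow> ip (\<lambda>p. 0) w = 0"
  using scale_left[OF zero_mem, of w 0] by simp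

lemma sum_mem: "(\<And>i. i \<in> I \<Longrightarrow> u i \<in> X) \<Longrightarrow> (\<lambda>p. \<Sum>i\<in>I. u i p) \<in> X"
  by (induction I rule: infinite_finite_induct) (auto intro: zero_mem add_mem)

lemma sum_left:
  assumes "\<And>i. i \<in> I \<Longrightarrow> u i \<in> X" "w \<in> X"
  shows "ip (\<lambda>p. \<Sum>i\<in>I. u i p) w = (\<Sum>i\<in>I. ip (u i) w)"
  using assms by (induction I rule: infinite_finite_induct) (auto simp: zero_left add_left sum_mem)

lemma sum_right:
  assumes "\<And>i. i \<in> I \<Longrightarrow> u i \<in> X" "w \<in> X"
  shows "ip w (\<lambda>p. \<Sum>i\<in>I. u i p) = (\<Sum>i\<in>I. ip w (u i))"
  using assms sum_left[of I u w] by (simp add: sym[of w] sum_mem)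

lemma nrm_nonneg: "u \<in> X \<Longrightarrow> 0 \<le> nrm u"
  by (simp add: nrm_def nonneg)

lemma nrm_sq: "u \<in> X \<Longrightarrow> (nrm u)\<^sup>2 = ip u u"
  by (simp add: nrm_def nonneg)

lemma nrm_minus_commute:
  assumes "u \<in> X" "v \<in> X" shows "nrm (\<lambda>p. u p - v p) = nrm (\<lambda>p. v p - u p)"
  using assms by (simp add: nrm_def diff_left diff_right diff_mem sym)

lemma ip_add_square:
  assumes "u \<in> X" "v \<in> X"
  shows "ip (\<lambda>p. u p + c * v p) (\<lambda>p. u p + c * v p) = ip u u + 2 * c * ip u v + c\<^sup>2 * ip v v"
  using assms sym[of v u]
  by (simp add: add_left add_right scale_left scale_right add_mem scale_mem power2_eq_square algebra_simps)

text \<open>When v has norm zero the usual optimal multiple of v is not available; then the square of u + c v is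
  affine in c and nonnegative for every c, so its slope vanishes.\<close>
lemma Cauchy_Schwarz_sq:
  assumes "u \<in> X" "v \<in> X" shows "(ip u v)\<^sup>2 \<le> ip u u * ip v v"
proof (cases "ip v v = 0")
  case True
  have "ip u v = 0"
  proof (rule ccontr)
    assume nz: "ip u v \<noteq> 0"
    define c where "c = - (ip u u + 1) / (2 * ip u v)"
    have "0 \<le> ip u u + 2 * c * ip u v + c\<^sup>2 * ip v v"
      using nonneg[OF add_mem[OF assms(1) scale_mem[OF assms(2), of c]]] ip_add_square[OF assms, of c] by simp
    moreover have "2 * c * ip u v = - (ip u u + 1)" using nz by (simp add: c_def)
    ultimately show False using True by simp
  qed
  then show ?thesis using True by simp
next
  case False
  then have pos: "ip v v > 0" using nonneg[OF assms(2)] by simp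
  define c where "c = - ip u v / ip v v"
  have "0 \<le> ip u u + 2 * c * ip u v + c\<^sup>2 * ip v v"
    using nonneg[OF add_mem[OF assms(1) scale_mem[OF assms(2), of c]]] ip_add_square[OF assms, of c] by simp
  also have "\<dots> = ip u u - (ip u v)\<^sup>2 / ip v v"
    using pos by (simp add: c_def power2_eq_square field_simps)
  finally show ?thesis using pos by (simp add: field_simps)
qed

lemma Cauchy_Schwarz: "u \<in> X \<Longrightarrow> v \<in> X \<Longrightarrow> \<bar>ip u v\<bar> \<le> nrm u * nrm v"
  using Cauchy_Schwarz_sq[of u v] nonneg[of u] nonneg[of v]
  by (metis nrm_def real_sqrt_abs real_sqrt_le_iff real_sqrt_mult)

lemma nrm_scale: assumes "u \<in> X" shows "nrm (\<lambda>p. c * u p) = \<bar>c\<bar> * nrm u"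
proof -
  have "ip (\<lambda>p. c * u p) (\<lambda>p. c * u p) = c\<^sup>2 * ip u u"
    using assms by (simp add: scale_left scale_right scale_mem power2_eq_square)
  then show ?thesis by (simp add: nrm_def real_sqrt_mult)
qed

lemma nrm_triangle:
  assumes "u \<in> X" "v \<in> X" shows "nrm (\<lambda>p. u p + v p) \<le> nrm u + nrm v"
proof -
  have "(nrm (\<lambda>p. u p + v p))\<^sup>2 = (nrm u)\<^sup>2 + 2 * ip u v + (nrm v)\<^sup>2"
    using ip_add_square[OF assms, of 1] assms by (simp add: nrm_sq add_mem)
  also have "\<dots> \<le> (nrm u + nrm v)\<^sup>2"
    using Cauchy_Schwarz[OF assms] by (simp add: power2_sum abs_le_iff)
  finally show ?thesis using assms by (auto intro: power2_le_imp_le add_nonneg_nonneg nrm_nonneg)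
qed

lemma nrm_triangle_sub:
  assumes "u \<in> X" "v \<in> X" shows "nrm u \<le> nrm (\<lambda>p. u p - v p) + nrm v"
  using nrm_triangle[OF diff_mem[OF assms] assms(2)] by simp

lemma nrm_triangle_diff:
  assumes "u \<in> X" "v \<in> X" shows "nrm (\<lambda>p. u p - v p) \<le> nrm u + nrm v"
  using nrm_triangle[OF assms(1) scale_mem[OF assms(2), of "-1"]] nrm_scale[OF assms(2), of "-1"] by simp

lemma nrm_diff_abs:
  assumes "u \<in> X" "v \<in> X" shows "\<bar>nrm u - nrm v\<bar> \<le> nrm (\<lambda>p. u p - v p)"
  using nrm_triangle_sub[OF assms] nrm_triangle_sub[OF assms(2,1)] nrm_minus_commute[OF assms] by simp

lemma tendsto_nrm:
  assumes "eventually (\<lambda>s. f s \<in> X) F" "v \<in> X" "((\<lambda>s. nrm (\<lambda>p. f s p - v p)) \<longlongrightarrow> 0) F"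
  shows "((\<lambda>s. nrm (f s)) \<longlongrightarrow> nrm v) F"
proof -
  have "\<forall>\<^sub>F s in F. norm (nrm (f s) - nrm v) \<le> nrm (\<lambda>p. f s p - v p)"
    using assms(1) by eventually_elim (simp add: nrm_diff_abs assms(2))
  with assms(3) have "((\<lambda>s. nrm (f s) - nrm v) \<longlongrightarrow> 0) F"
    by (rule Lim_null_comparison[rotated])
  then show ?thesis by (simp add: LIM_zero_iff)
qed

lemma tendsto_ip:
  assumes f: "eventually (\<lambda>s. f s \<in> X) F" "v \<in> X" "((\<lambda>s. nrm (\<lambda>p. f s p - v p)) \<longlongrightarrow> 0) F"
    and g: "eventually (\<lambda>s. g s \<in> X) F" "w \<in> X" "((\<lambda>s. nrm (\<lambda>p. g s p - w p)) \<longlongrightarrow> 0) F"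
  shows "((\<lambda>s. ip (f s) (g s)) \<longlongrightarrow> ip v w) F"
proof -
  have "((\<lambda>s. nrm (\<lambda>p. f s p - v p) * nrm (g s) + nrm v * nrm (\<lambda>p. g s p - w p))
          \<longlongrightarrow> 0 * nrm w + nrm v * 0) F"
    by (intro tendsto_intros f(3) g(3) tendsto_nrm[OF g])
  then have lim: "((\<lambda>s. nrm (\<lambda>p. f s p - v p) * nrm (g s) + nrm v * nrm (\<lambda>p. g s p - w p)) \<longlongrightarrow> 0) F"
    by simp
  have "\<forall>\<^sub>F s in F. norm (ip (f s) (g s) - ip v w) \<le>
          nrm (\<lambda>p. f s p - v p) * nrm (g s) + nrm v * nrm (\<lambda>p. g s p - w p)"
    using f(1) g(1)
  proof eventually_elim
    case (elim s)
    have "ip (f s) (g s) - ip v w = ip (\<lambda>p. f s p - v p) (g s) + ip v (\<lambda>p. g s p - w p)"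
      using elim f(2) g(2) by (simp add: diff_left diff_right)
    moreover have "\<bar>ip (\<lambda>p. f s p - v p) (g s)\<bar> \<le> nrm (\<lambda>p. f s p - v p) * nrm (g s)"
      using elim f(2) by (intro Cauchy_Schwarz diff_mem)
    moreover have "\<bar>ip v (\<lambda>p. g s p - w p)\<bar> \<le> nrm v * nrm (\<lambda>p. g s p - w p)"
      using elim f(2) g(2) by (intro Cauchy_Schwarz diff_mem)
    ultimately show ?case by simp
  qed
  with lim have "((\<lambda>s. ip (f s) (g s) - ip v w) \<longlongrightarrow> 0) F"
    by (rule Lim_null_comparison[rotated])
  then show ?thesis by (simp add: LIM_zero_iff)
qed

end

definition sqint :: "'p measure \<Rightarrow> ('p \<Rightarrow> real) set" where
  "sqint M = {f \<in> borel_measurable M. integrable M (\<lambda>x. (f x)\<^sup>2)}"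

definition ipM :: "'p measure \<Rightarrow> ('p \<Rightarrow> real) \<Rightarrow> ('p \<Rightarrow> real) \<Rightarrow> real" where
  "ipM M f g = (LINT x|M. f x * g x)"

lemma sqint_measurable[measurable_dest]: "f \<in> sqint M \<Longrightarrow> f \<in> borel_measurable M"
  by (simp add: sqint_def)

lemma sqint_integrable_sq: "f \<in> sqint M \<Longrightarrow> integrable M (\<lambda>x. (f x)\<^sup>2)"
  by (simp add: sqint_def)

lemma sqint_mult_integrable:
  assumes "f \<in> sqint M" "g \<in> sqint M" shows "integrable M (\<lambda>x. f x * g x)"
proof (rule Bochner_Integration.integrable_bound)
  show "integrable M (\<lambda>x. (f x)\<^sup>2 + (g x)\<^sup>2)"
    using assms by (auto simp: sqint_def)
  show "(\<lambda>x. f x * g x) \<in> borel_measurable M"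
    using assms by (auto simp: sqint_def)
  show "AE x in M. norm (f x * g x) \<le> norm ((f x)\<^sup>2 + (g x)\<^sup>2)"
  proof (rule AE_I2)
    fix x
    have "0 \<le> (\<bar>f x\<bar> - \<bar>g x\<bar>)\<^sup>2" by simp
    then have "2 * (\<bar>f x\<bar> * \<bar>g x\<bar>) \<le> (f x)\<^sup>2 + (g x)\<^sup>2" by (simp add: power2_diff)
    moreover have "0 \<le> \<bar>f x\<bar> * \<bar>g x\<bar>" by simp
    ultimately have "\<bar>f x\<bar> * \<bar>g x\<bar> \<le> (f x)\<^sup>2 + (g x)\<^sup>2" by linarith
    then show "norm (f x * g x) \<le> norm ((f x)\<^sup>2 + (g x)\<^sup>2)" by (simp add: abs_mult)
  qed
qed

lemma sqint_add:
  assumes "f \<in> sqint M" "g \<in> sqint M" shows "(\<lambda>x. f x + g x) \<in> sqint M"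
proof -
  have "integrable M (\<lambda>x. (f x)\<^sup>2 + (g x)\<^sup>2 + 2 * (f x * g x))"
    using assms sqint_mult_integrable[OF assms] by (auto simp: sqint_def)
  then show ?thesis using assms by (auto simp: sqint_def power2_sum mult.assoc)
qed

lemma sqint_scale: "f \<in> sqint M \<Longrightarrow> (\<lambda>x. c * f x) \<in> sqint M"
  by (auto simp: sqint_def power_mult_distrib)

lemma semi_inner_sqint: "semi_inner (sqint M) (ipM M)"
proof
  fix u v w :: "'a \<Rightarrow> real" and c :: real
  show "(\<lambda>p. 0) \<in> sqint M" by (simp add: sqint_def)
  show "u \<in> sqint M \<Longrightarrow> v \<in> sqint M \<Longrightarrow> (\<lambda>p. u p + v p) \<in> sqint M" by (rule sqint_add)
  show "u \<in> sqint M \<Longrightarrow> (\<lambda>p. c * u p) \<in> sqint M" by (rule sqint_scale)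
  show "u \<in> sqint M \<Longrightarrow> v \<in> sqint M \<Longrightarrow> w \<in> sqint M \<Longrightarrow>
      ipM M (\<lambda>p. u p + v p) w = ipM M u w + ipM M v w"
    by (simp add: ipM_def distrib_right sqint_mult_integrable)
  show "u \<in> sqint M \<Longrightarrow> w \<in> sqint M \<Longrightarrow> ipM M (\<lambda>p. c * u p) w = c * ipM M u w"
    by (simp add: ipM_def mult.assoc)
  show "ipM M u v = ipM M v u" by (simp add: ipM_def mult.commute)
  show "0 \<le> ipM M u u" by (simp add: ipM_def)
qed

interpretation sq: semi_inner "sqint M" "ipM M" for M
  by (rule semi_inner_sqint)

lemma ipM_cong:
  assumes "AE x in M. f x = f' x" "AE x in M. g x = g' x"
    "f \<in> borel_measurable M" "f' \<in> borel_measurable M" "g \<in> borel_measurable M" "g' \<in> borel_measurable M"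
  shows "ipM M f g = ipM M f' g'"
  unfolding ipM_def by (rule integral_cong_AE) (use assms in auto)

lemma sqint_cong:
  assumes "AE x in M. f x = f' x" "f \<in> sqint M" "f' \<in> borel_measurable M"
  shows "f' \<in> sqint M"
proof -
  have "integrable M (\<lambda>x. (f' x)\<^sup>2)"
    using assms by (subst integrable_cong_AE[where g="\<lambda>x. (f x)\<^sup>2"]) (auto simp: sqint_def)
  then show ?thesis using assms by (simp add: sqint_def)
qed

lemma sqint_nrm_zero_AE:
  assumes "f \<in> sqint M" "ipM M f f = 0" shows "AE x in M. f x = 0"
proof -
  have "integral\<^sup>L M (\<lambda>x. (f x)\<^sup>2) = 0" using assms by (simp add: ipM_def power2_eq_square)
  then have "AE x in M. (f x)\<^sup>2 = 0"
    using integral_nonneg_eq_0_iff_AE[OF sqint_integrable_sq[OF assms(1)]] by simp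
  then show ?thesis by simp
qed

context finite_measure begin

lemma sqint_integrable: "f \<in> sqint M \<Longrightarrow> integrable M f"
  using square_integrable_imp_integrable by (auto simp: sqint_def)

lemma sqint_bounded:
  assumes "f \<in> borel_measurable M" "\<And>x. x \<in> space M \<Longrightarrow> \<bar>f x\<bar> \<le> B" shows "f \<in> sqint M"
proof -
  have "integrable M (\<lambda>x. (f x)\<^sup>2)"
  proof (rule integrable_const_bound[of _ "B\<^sup>2"])
    show "AE x in M. norm ((f x)\<^sup>2) \<le> B\<^sup>2"
      using assms(2) by (intro AE_I2) (metis abs_ge_zero norm_power power_mono real_norm_def)
  qed (use assms in auto)
  then show ?thesis using assms by (simp add: sqint_def)
qed

lemma integral_abs_le_nrm:
  assumes "f \<in> sqint M"
  shows "(LINT x|M. \<bar>f x\<bar>) \<le> sqrt (measure M (space M)) * sq.nrm M f"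
proof -
  have 1: "(\<lambda>x. 1) \<in> sqint M" by (rule sqint_bounded[of _ 1]) auto
  have 2: "(\<lambda>x. \<bar>f x\<bar>) \<in> sqint M" using assms by (auto simp: sqint_def)
  have "(LINT x|M. \<bar>f x\<bar>) = ipM M (\<lambda>x. 1) (\<lambda>x. \<bar>f x\<bar>)" by (simp add: ipM_def)
  also have "\<dots> \<le> sq.nrm M (\<lambda>x. 1) * sq.nrm M (\<lambda>x. \<bar>f x\<bar>)"
    using sq.Cauchy_Schwarz[OF 1 2] by simp
  also have "\<dots> = sqrt (measure M (space M)) * sq.nrm M f"
    by (simp add: sq.nrm_def ipM_def)
  finally show ?thesis .
qed

end

text \<open>Riesz-Fischer: a subsequence with geometrically small increments converges almost everywhere since
  the sum of the increments is integrable, and the lemma of Fatou turns the pointwise limit into a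
  limit in norm of the full sequence.\<close>
theorem sqint_complete:
  fixes f :: "nat \<Rightarrow> 'p \<Rightarrow> real"
  assumes fin: "finite_measure M" and f: "\<And>n. f n \<in> sqint M"
    and Cauchy: "\<And>e. e > 0 \<Longrightarrow> \<exists>N. \<forall>m\<ge>N. \<forall>n\<ge>N. sq.nrm M (\<lambda>x. f m x - f n x) < e"
  obtains g where "g \<in> sqint M" "(\<lambda>n. sq.nrm M (\<lambda>x. f n x - g x)) \<longlonglongrightarrow> 0"
proof -
  interpret finite_measure M by fact
  have [measurable]: "f n \<in> borel_measurable M" for n using f by (simp add: sqint_def)
  define C where "C = sqrt (measure M (space M))"
  have fdiff: "(\<lambda>x. f m x - f n x) \<in> sqint M" for m n by (intro sq.diff_mem f)
  have "\<exists>N. \<forall>k. (\<forall>m\<ge>N k. \<forall>n\<ge>N k. sq.nrm M (\<lambda>x. f m x - f n x) < (1/2)^k)"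
    by (rule choice) (use Cauchy in auto)
  then obtain N where N: "\<And>k m n. m \<ge> N k \<Longrightarrow> n \<ge> N k \<Longrightarrow> sq.nrm M (\<lambda>x. f m x - f n x) < (1/2)^k"
    by blast
  \<comment> \<open>The sum makes r k \<ge> N k and r (k + 1) \<ge> N k at the same time; the summand k makes r
    unbounded.\<close>
  define r where "r k = (\<Sum>i\<le>k. N i) + k" for k
  have rN: "r k \<ge> N k" for k unfolding r_def by (simp add: member_le_sum trans_le_add1)
  have rmono: "r (Suc k) \<ge> N k" for k using rN[of k] by (simp add: r_def)
  have rk: "r k \<ge> k" for k by (simp add: r_def)
  have small: "(LINT x|M. \<bar>f (r (Suc k)) x - f (r k) x\<bar>) \<le> C * (1/2)^k" for k
  proof -
    have "(LINT x|M. \<bar>f (r (Suc k)) x - f (r k) x\<bar>) \<le> C * sq.nrm M (\<lambda>x. f (r (Suc k)) x - f (r k) x)"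
      unfolding C_def by (rule integral_abs_le_nrm[OF fdiff])
    also have "\<dots> \<le> C * (1/2)^k"
      using N[OF rmono rN, of k] by (intro mult_left_mono) (auto simp: C_def)
    finally show ?thesis .
  qed
  have AEsum: "AE x in M. summable (\<lambda>k. f (r (Suc k)) x - f (r k) x)"
  proof -
    have "(\<integral>\<^sup>+x. (\<Sum>k. ennreal \<bar>f (r (Suc k)) x - f (r k) x\<bar>) \<partial>M)
        = (\<Sum>k. \<integral>\<^sup>+x. ennreal \<bar>f (r (Suc k)) x - f (r k) x\<bar> \<partial>M)"
      by (rule nn_integral_suminf) auto
    also have "\<dots> = (\<Sum>k. ennreal (LINT x|M. \<bar>f (r (Suc k)) x - f (r k) x\<bar>))"
      using sqint_integrable[OF fdiff] by (intro suminf_cong nn_integral_eq_integral) auto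
    also have "\<dots> \<le> (\<Sum>k. ennreal (C * (1/2)^k))"
      by (intro suminf_le ennreal_leI small) auto
    also have "\<dots> = ennreal (\<Sum>k. C * (1/2)^k)"
      by (rule suminf_ennreal2) (auto simp: C_def intro!: summable_mult summable_geometric)
    finally have "(\<integral>\<^sup>+x. (\<Sum>k. ennreal \<bar>f (r (Suc k)) x - f (r k) x\<bar>) \<partial>M) \<noteq> \<infinity>"
      by (auto simp: top_unique)
    then have "AE x in M. (\<Sum>k. ennreal \<bar>f (r (Suc k)) x - f (r k) x\<bar>) \<noteq> \<infinity>"
      by (intro nn_integral_noteq_infinite) auto
    then show ?thesis
    proof eventually_elim
      case (elim x)
      then have "summable (\<lambda>k. \<bar>f (r (Suc k)) x - f (r k) x\<bar>)"
        by (intro summable_suminf_not_top) auto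
      then show ?case by (rule summable_rabs_cancel)
    qed
  qed
  define g where "g x = lim (\<lambda>k. f (r k) x)" for x
  have [measurable]: "g \<in> borel_measurable M" unfolding g_def by measurable
  have glim: "AE x in M. (\<lambda>k. f (r k) x) \<longlonglongrightarrow> g x"
    using AEsum
  proof eventually_elim
    case (elim x)
    have "(\<lambda>n. f (r 0) x + (\<Sum>k<n. f (r (Suc k)) x - f (r k) x)) \<longlonglongrightarrow>
          f (r 0) x + (\<Sum>k. f (r (Suc k)) x - f (r k) x)"
      by (intro tendsto_intros summable_LIMSEQ elim)
    moreover have "(\<lambda>n. f (r 0) x + (\<Sum>k<n. f (r (Suc k)) x - f (r k) x)) = (\<lambda>k. f (r k) x)"
      by (intro ext) (simp add: sum_lessThan_telescope[of "\<lambda>k. f (r k) x"])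
    ultimately have "(\<lambda>k. f (r k) x) \<longlonglongrightarrow> f (r 0) x + (\<Sum>k. f (r (Suc k)) x - f (r k) x)"
      by metis
    then show ?case unfolding g_def by (simp add: limI)
  qed
  have bound: "(\<integral>\<^sup>+x. ennreal ((f n x - g x)\<^sup>2) \<partial>M) \<le> ennreal (((1/2)^k)\<^sup>2)" if n: "n \<ge> N k" for n k
  proof -
    have "(\<integral>\<^sup>+x. ennreal ((f n x - g x)\<^sup>2) \<partial>M) = (\<integral>\<^sup>+x. liminf (\<lambda>j. ennreal ((f n x - f (r j) x)\<^sup>2)) \<partial>M)"
    proof (rule nn_integral_cong_AE)
      show "AE x in M. ennreal ((f n x - g x)\<^sup>2) = liminf (\<lambda>j. ennreal ((f n x - f (r j) x)\<^sup>2))"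
        using glim
      proof eventually_elim
        case (elim x)
        have "(\<lambda>j. ennreal ((f n x - f (r j) x)\<^sup>2)) \<longlonglongrightarrow> ennreal ((f n x - g x)\<^sup>2)"
          by (intro tendsto_intros tendsto_ennrealI elim)
        then show ?case by (intro lim_imp_Liminf[symmetric]) auto
      qed
    qed
    also have "\<dots> \<le> liminf (\<lambda>j. \<integral>\<^sup>+x. ennreal ((f n x - f (r j) x)\<^sup>2) \<partial>M)"
      by (rule nn_integral_liminf) auto
    also have "\<dots> \<le> ennreal (((1/2)^k)\<^sup>2)"
    proof (rule Liminf_le)
      show "\<forall>\<^sub>F j in sequentially. (\<integral>\<^sup>+x. ennreal ((f n x - f (r j) x)\<^sup>2) \<partial>M) \<le> ennreal (((1/2)^k)\<^sup>2)"
        using eventually_ge_at_top[of "N k"]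
      proof eventually_elim
        case (elim j)
        then have j: "r j \<ge> N k" using rk[of j] by simp
        have "(\<integral>\<^sup>+x. ennreal ((f n x - f (r j) x)\<^sup>2) \<partial>M) = ennreal (ipM M (\<lambda>x. f n x - f (r j) x) (\<lambda>x. f n x - f (r j) x))"
          unfolding ipM_def using sqint_integrable_sq[OF fdiff[of n "r j"]]
          by (subst nn_integral_eq_integral) (auto simp: power2_eq_square)
        also have "\<dots> \<le> ennreal (((1/2)^k)\<^sup>2)"
          using N[OF n j] sq.nrm_nonneg[OF fdiff[of n "r j"]]
          by (intro ennreal_leI) (auto simp flip: sq.nrm_sq[OF fdiff] intro!: power_mono)
        finally show ?case .
      qed
    qed auto
    finally show ?thesis .
  qed
  have fg: "(\<lambda>x. f (N 0) x - g x) \<in> sqint M"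
  proof -
    have "integrable M (\<lambda>x. (f (N 0) x - g x)\<^sup>2)"
      using bound[of 0 "N 0"] by (intro integrableI_bounded) (auto simp: le_less_trans)
    then show ?thesis by (simp add: sqint_def)
  qed
  have g: "g \<in> sqint M"
    using sq.diff_mem[OF f[of "N 0"] fg] by simp
  have "(\<lambda>n. sq.nrm M (\<lambda>x. f n x - g x)) \<longlonglongrightarrow> 0"
  proof (rule LIMSEQ_I)
    fix e :: real assume e: "0 < e"
    obtain k where k: "(1/2)^k < e" using real_arch_pow_inv[of e "1/2"] e by auto
    have "norm (sq.nrm M (\<lambda>x. f n x - g x) - 0) < e" if n: "n \<ge> N k" for n
    proof -
      have d: "(\<lambda>x. f n x - g x) \<in> sqint M" by (intro sq.diff_mem f g)
      have "ennreal (ipM M (\<lambda>x. f n x - g x) (\<lambda>x. f n x - g x)) \<le> ennreal (((1/2)^k)\<^sup>2)"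
        using bound[OF n] sqint_integrable_sq[OF d] unfolding ipM_def
        by (subst (asm) nn_integral_eq_integral) (auto simp: power2_eq_square)
      then have "ipM M (\<lambda>x. f n x - g x) (\<lambda>x. f n x - g x) \<le> ((1/2)^k)\<^sup>2"
        by (subst (asm) ennreal_le_iff) auto
      then have "sq.nrm M (\<lambda>x. f n x - g x) \<le> (1/2)^k"
        unfolding sq.nrm_def by (intro real_le_lsqrt) auto
      then show ?thesis using k sq.nrm_nonneg[OF d] by simp
    qed
    then show "\<exists>no. \<forall>n\<ge>no. norm (sq.nrm M (\<lambda>x. f n x - g x) - 0) < e" by blast
  qed
  with g that show thesis by blast
qed

section \<open>Smooth functions and test functions of product form\<close>

text \<open>The one-variable analogue of \<open>Ck\<close>; a product of two smooth functions of one variable is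
  then smooth in the plane.\<close>
primrec Ck1 :: "nat \<Rightarrow> (real \<Rightarrow> real) \<Rightarrow> bool" where
  "Ck1 0 f \<longleftrightarrow> continuous_on UNIV f"
| "Ck1 (Suc k) f \<longleftrightarrow> (\<exists>f'. Ck1 k f' \<and> (\<forall>x. (f has_real_derivative f' x) (at x)))"

definition smooth :: "(real \<Rightarrow> real) \<Rightarrow> bool" where "smooth f \<longleftrightarrow> (\<forall>k. Ck1 k f)"

lemma Ck1_Suc_imp: "Ck1 (Suc k) f \<Longrightarrow> Ck1 k f"
proof (induction k arbitrary: f)
  case 0
  then obtain f' where "\<And>x. (f has_real_derivative f' x) (at x)" by auto
  then show ?case by (metis Ck1.simps(1) DERIV_isCont continuous_at_imp_continuous_on)
next
  case (Suc k) then show ?case by (metis Ck1.simps(2))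
qed

lemma Ck1_const: "Ck1 k (\<lambda>x. c)"
  by (induction k arbitrary: c) (auto intro!: exI[of _ "\<lambda>x. 0"] derivative_eq_intros)

lemma Ck1_add: "Ck1 k f \<Longrightarrow> Ck1 k g \<Longrightarrow> Ck1 k (\<lambda>x. f x + g x)"
proof (induction k arbitrary: f g)
  case 0 then show ?case by (auto intro: continuous_intros)
next
  case (Suc k)
  then obtain f' g' where "Ck1 k f'" "Ck1 k g'" "\<And>x. (f has_real_derivative f' x) (at x)"
    "\<And>x. (g has_real_derivative g' x) (at x)" by auto
  then show ?case using Suc.IH[of f' g'] by (auto intro!: exI[of _ "\<lambda>x. f' x + g' x"] derivative_intros)
qed

lemma Ck1_mult: "Ck1 k f \<Longrightarrow> Ck1 k g \<Longrightarrow> Ck1 k (\<lambda>x. f x * g x)"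
proof (induction k arbitrary: f g)
  case 0 then show ?case by (auto intro: continuous_intros)
next
  case (Suc k)
  then obtain f' g' where *: "Ck1 k f'" "Ck1 k g'" "\<And>x. (f has_real_derivative f' x) (at x)"
    "\<And>x. (g has_real_derivative g' x) (at x)" by auto
  have "Ck1 k f" "Ck1 k g" using Suc.prems Ck1_Suc_imp by blast+
  then have "Ck1 k (\<lambda>x. f' x * g x + g' x * f x)"
    using * Suc.IH by (intro Ck1_add) auto
  then show ?case using *(3,4) by (auto intro!: exI[of _ "\<lambda>x. f' x * g x + g' x * f x"] derivative_intros)
qed

lemma Ck1_affine: "Ck1 k f \<Longrightarrow> Ck1 k (\<lambda>x. f (c * x + d))"
proof (induction k arbitrary: f)
  case 0 then show ?case
    using continuous_on_compose2[of UNIV f UNIV "\<lambda>x. c * x + d"]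
    by (simp add: continuous_on_add continuous_on_mult_left)
next
  case (Suc k)
  then obtain f' where f': "Ck1 k f'" "\<And>x. (f has_real_derivative f' x) (at x)" by auto
  have "Ck1 k (\<lambda>x. c * f' (c * x + d))" using Suc.IH[OF f'(1)] Ck1_mult[OF Ck1_const] by auto
  moreover have "((\<lambda>x. f (c * x + d)) has_real_derivative c * f' (c * x + d)) (at x)" for x
  proof -
    have "((\<lambda>x. c * x + d) has_real_derivative c) (at x)" by (auto intro!: derivative_eq_intros)
    from DERIV_chain2[OF f'(2) this] show ?thesis by (simp add: mult.commute)
  qed
  ultimately show ?case by auto
qed

lemma smooth_const: "smooth (\<lambda>x. c)" by (simp add: smooth_def Ck1_const)
lemma smooth_add: "smooth f \<Longrightarrow> smooth g \<Longrightarrow> smooth (\<lambda>x. f x + g x)" by (simp add: smooth_def Ck1_add)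
lemma smooth_mult: "smooth f \<Longrightarrow> smooth g \<Longrightarrow> smooth (\<lambda>x. f x * g x)" by (simp add: smooth_def Ck1_mult)
lemma smooth_affine: "smooth f \<Longrightarrow> smooth (\<lambda>x. f (c * x + d))" by (simp add: smooth_def Ck1_affine)

lemma smooth_DERIV: assumes "smooth f" shows "(f has_real_derivative deriv f x) (at x)"
proof -
  have "Ck1 (Suc 0) f" using assms by (simp only: smooth_def)
  then obtain f' where "(f has_real_derivative f' x) (at x)" by auto
  then show ?thesis using DERIV_imp_deriv by fastforce
qed

lemma smooth_deriv: assumes "smooth f" shows "smooth (deriv f)"
  unfolding smooth_def
proof
  fix k
  have "Ck1 (Suc k) f" using assms by (simp only: smooth_def)
  then obtain f' where f': "Ck1 k f'" "\<And>x. (f has_real_derivative f' x) (at x)" by auto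
  then have "deriv f = f'" by (auto simp: DERIV_imp_deriv)
  with f' show "Ck1 k (deriv f)" by simp
qed

lemma smooth_primitive:
  assumes "smooth f" "\<And>x. (F has_real_derivative f x) (at x)" shows "smooth F"
  unfolding smooth_def
proof
  fix k
  have "Ck1 (Suc k) F" using assms by (auto simp: smooth_def)
  then show "Ck1 k F" by (rule Ck1_Suc_imp)
qed

lemma smooth_continuous: "smooth f \<Longrightarrow> continuous_on A f"
  by (meson DERIV_isCont continuous_at_imp_continuous_on smooth_DERIV)

lemma smooth_measurable[measurable_dest]: "smooth f \<Longrightarrow> f \<in> borel_measurable borel"
  using smooth_continuous[of f UNIV] by (simp add: borel_measurable_continuous_onI)

text \<open>The functions p(1/x) exp(-1/x), continued by 0 to x \<le> 0. The class is closed under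
  differentiation, which proves that all its members are smooth.\<close>
definition flat :: "real poly \<Rightarrow> real \<Rightarrow> real" where
  "flat p x = (if x > 0 then poly p (1/x) * exp (-1/x) else 0)"

lemma poly_exp_tendsto_0: "((\<lambda>t. poly p t / exp t) \<longlongrightarrow> (0::real)) at_top"
proof -
  have "((\<lambda>t. \<Sum>i\<le>degree p. coeff p i * (t ^ i / exp t)) \<longlongrightarrow> (\<Sum>i\<le>degree p. coeff p i * 0)) at_top"
    by (intro tendsto_intros tendsto_power_div_exp_0)
  then show ?thesis by (simp add: poly_altdef sum_divide_distrib)
qed

lemma flat_tendsto_0: "(flat p \<longlongrightarrow> 0) (at 0)"
proof -
  have "((\<lambda>x. poly p (inverse x) / exp (inverse x)) \<longlongrightarrow> 0) (at_right 0)"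
    by (rule filterlim_compose[OF poly_exp_tendsto_0 filterlim_inverse_at_top_right])
  then have "(flat p \<longlongrightarrow> 0) (at_right 0)"
    by (rule Lim_transform_eventually)
       (auto simp: flat_def eventually_at_right_field exp_minus field_simps intro!: exI[of _ 1])
  moreover have "(flat p \<longlongrightarrow> 0) (at_left 0)"
    by (rule tendsto_eventually) (auto simp: flat_def eventually_at_left_field intro!: exI[of _ "-1"])
  ultimately show ?thesis by (simp add: filterlim_at_split)
qed

lemma flat_DERIV:
  "(flat p has_real_derivative flat ([:0,0,1:] * (p - pderiv p)) x) (at x)"
proof -
  consider "x > 0" | "x < 0" | "x = 0" by linarith
  then show ?thesis
  proof cases
    case 1
    have "((\<lambda>x. poly p (1/x) * exp (-1/x)) has_real_derivative flat ([:0,0,1:] * (p - pderiv p)) x) (at x)"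
      using 1 by (auto intro!: derivative_eq_intros DERIV_chain2[OF poly_DERIV]
          simp: flat_def power2_eq_square field_simps)
    then show ?thesis
      by (rule has_field_derivative_transform_within_open[of _ _ _ "{0<..}"]) (use 1 in \<open>auto simp: flat_def\<close>)
  next
    case 2
    have "((\<lambda>x. 0) has_real_derivative flat ([:0,0,1:] * (p - pderiv p)) x) (at x)"
      using 2 by (auto simp: flat_def)
    then show ?thesis
      by (rule has_field_derivative_transform_within_open[of _ _ _ "{..<0}"]) (use 2 in \<open>auto simp: flat_def\<close>)
  next
    case 3
    have "((\<lambda>h. (flat p (0 + h) - flat p 0) / h) \<longlongrightarrow> 0) (at 0)"
      using flat_tendsto_0[of "[:0,1:] * p"]
      by (rule Lim_transform_eventually) (auto simp: flat_def intro!: always_eventually)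
    then show ?thesis using 3 by (simp add: DERIV_def flat_def)
  qed
qed

lemma smooth_flat: "smooth (flat p)"
proof -
  have "Ck1 k (flat p)" for k
  proof (induction k arbitrary: p)
    case 0
    show ?case using flat_DERIV[of p]
      by (auto intro!: continuous_at_imp_continuous_on DERIV_isCont)
  next
    case (Suc k)
    show ?case using Suc flat_DERIV[of p] by auto
  qed
  then show ?thesis by (simp add: smooth_def)
qed

text \<open>Test functions on the open interval from a to b; compact support in it is expressed by a closed
  interval strictly inside, possibly empty.\<close>
definition test1 :: "real \<Rightarrow> real \<Rightarrow> (real \<Rightarrow> real) \<Rightarrow> bool" where
  "test1 a b \<eta> \<longleftrightarrow> smooth \<eta> \<and> (\<exists>c d. a < c \<and> d < b \<and> (\<forall>x. x \<notin> {c..d} \<longrightarrow> \<eta> x = 0))"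

text \<open>The two factors are positive exactly for x > c + 1/k and x < d - 1/k; they tend to 1 there as k
  grows, so the bumps converge to the indicator of the open interval and stay between 0 and 1.\<close>
definition bump :: "real \<Rightarrow> real \<Rightarrow> nat \<Rightarrow> real \<Rightarrow> real" where
  "bump c d k x = flat 1 (real k * x + (- real k * c - 1)) * flat 1 ((- real k) * x + (real k * d - 1))"

lemma flat1_bounds: "0 \<le> flat 1 x" "flat 1 x \<le> 1"
  by (auto simp: flat_def)

lemma bump_bounds: "0 \<le> bump c d k x" "bump c d k x \<le> 1"
  using flat1_bounds by (auto simp: bump_def intro: mult_le_one)

lemma bump_test1: assumes "a \<le> c" "d \<le> b" "k > 0" shows "test1 a b (bump c d k)"
proof -
  have "smooth (bump c d k)"
    unfolding bump_def by (intro smooth_mult smooth_affine smooth_flat)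
  moreover have "bump c d k x = 0" if "x \<notin> {c + 1/k .. d - 1/k}" for x
    using that assms(3) by (auto simp: bump_def flat_def field_simps not_le)
  moreover have "1 / real k > 0" using assms by simp
  then have "a < c + 1 / real k" "d - 1 / real k < b" using assms by linarith+
  ultimately show ?thesis unfolding test1_def
    by (intro conjI exI[of _ "c + 1/k"] exI[of _ "d - 1/k"]) auto
qed

lemma bump_tendsto: "(\<lambda>k. bump c d k x) \<longlonglongrightarrow> indicator {c<..<d} x"
proof (cases "c < x \<and> x < d")
  case True
  have f: "(\<lambda>k. flat 1 (real k * u - 1)) \<longlonglongrightarrow> 1" if "u > 0" for u
  proof -
    have "filterlim (\<lambda>k. real k * u) at_top sequentially"
      using filterlim_tendsto_pos_mult_at_top[OF tendsto_const[of u] that filterlim_real_sequentially]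
      by (simp add: mult.commute)
    then have lim: "filterlim (\<lambda>k. real k * u - 1) at_top sequentially"
      using filterlim_tendsto_add_at_top[OF tendsto_const[of "-1"]] by (auto simp: add.commute)
    then have "(\<lambda>k. inverse (real k * u - 1)) \<longlonglongrightarrow> 0"
      by (rule tendsto_inverse_0_at_top)
    then have "(\<lambda>k. exp (- inverse (real k * u - 1))) \<longlonglongrightarrow> exp (- 0)"
      by (intro tendsto_intros)
    moreover have "\<forall>\<^sub>F k in sequentially. exp (- inverse (real k * u - 1)) = flat 1 (real k * u - 1)"
      using lim[unfolded filterlim_at_top_dense, rule_format, of 0]
      by eventually_elim (auto simp: flat_def field_simps)
    ultimately show ?thesis by (auto intro: Lim_transform_eventually)
  qed
  have "(\<lambda>k. flat 1 (real k * (x - c) - 1) * flat 1 (real k * (d - x) - 1)) \<longlonglongrightarrow> 1 * 1"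
    using True by (intro tendsto_mult f) auto
  then show ?thesis using True by (simp add: bump_def algebra_simps)
next
  case False
  have "bump c d k x = 0" for k
  proof -
    have "real k * x + (- real k * c - 1) \<le> 0 \<or> (- real k) * x + (real k * d - 1) \<le> 0"
    proof (cases "c < x")
      case True
      then have "real k * d \<le> real k * x" using False by (intro mult_left_mono) auto
      then show ?thesis by simp
    next
      case False
      then have "real k * x \<le> real k * c" by (intro mult_left_mono) auto
      then show ?thesis by simp
    qed
    then show ?thesis by (auto simp: bump_def flat_def)
  qed
  then show ?thesis using False by auto
qed

lemma test1_smooth: "test1 a b \<eta> \<Longrightarrow> smooth \<eta>" by (simp add: test1_def)

lemma test1_outside: "test1 a b \<eta> \<Longrightarrow> x \<le> a \<or> b \<le> x \<Longrightarrow> \<eta> x = 0"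
  by (force simp: test1_def)

lemma test1_deriv: assumes "test1 a b \<eta>" shows "test1 a b (deriv \<eta>)"
proof -
  obtain c d where cd: "a < c" "d < b" "\<And>x. x \<notin> {c..d} \<Longrightarrow> \<eta> x = 0" using assms by (auto simp: test1_def)
  have "deriv \<eta> x = 0" if "x \<notin> {c..d}" for x
  proof -
    have "((\<lambda>x. 0) has_real_derivative 0) (at x)" by simp
    then have "(\<eta> has_real_derivative 0) (at x)"
      by (rule has_field_derivative_transform_within_open[of _ _ _ "- {c..d}"]) (use that cd in \<open>auto intro!: open_Compl\<close>)
    then show ?thesis by (rule DERIV_imp_deriv)
  qed
  then show ?thesis using cd assms by (auto simp: test1_def smooth_deriv)
qed

lemma test1_add: assumes "test1 a b f" "test1 a b g" shows "test1 a b (\<lambda>x. f x + g x)"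
proof -
  obtain c d where cd: "a < c" "d < b" "\<And>x. x \<notin> {c..d} \<Longrightarrow> f x = 0" using assms by (auto simp: test1_def)
  obtain c' d' where cd': "a < c'" "d' < b" "\<And>x. x \<notin> {c'..d'} \<Longrightarrow> g x = 0" using assms by (auto simp: test1_def)
  have "f x + g x = 0" if "x \<notin> {min c c'..max d d'}" for x
  proof -
    have "x \<notin> {c..d}" "x \<notin> {c'..d'}" using that by auto
    then show ?thesis using cd(3) cd'(3) by simp
  qed
  moreover have "a < min c c'" "max d d' < b" using cd cd' by auto
  ultimately show ?thesis using assms smooth_add[of f g] unfolding test1_def by blast
qed

lemma test1_scale: "test1 a b f \<Longrightarrow> test1 a b (\<lambda>x. k * f x)"
  by (auto simp: test1_def intro!: smooth_mult smooth_const)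

lemma test1_bounded: assumes "test1 a b f" obtains B where "B \<ge> 0" "\<And>x. \<bar>f x\<bar> \<le> B"
proof -
  obtain c d where cd: "a < c" "d < b" "\<And>x. x \<notin> {c..d} \<Longrightarrow> f x = 0" using assms by (auto simp: test1_def)
  have "compact (f ` {c..d})" using assms
    by (intro compact_continuous_image smooth_continuous) (auto simp: test1_def)
  then obtain B where "\<And>x. x \<in> {c..d} \<Longrightarrow> \<bar>f x\<bar> \<le> B"
    using compact_imp_bounded[of "f ` {c..d}"] unfolding bounded_iff by force
  then have "\<bar>f x\<bar> \<le> max B 0" for x using cd(3)[of x] by (cases "x \<in> {c..d}") (auto simp: le_max_iff_disj)
  then show thesis using that[of "max B 0"] by auto
qed

text \<open>Products of functions of one variable separate integrable functions on a rectangle, and they reduce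
  identities in the plane to one variable by Fubini.\<close>
definition tens :: "(real \<Rightarrow> real) \<Rightarrow> (real \<Rightarrow> real) \<Rightarrow> field" where
  "tens f g = (\<lambda>p. f (fst p) * g (snd p))"

text \<open>The induction runs over all pairs of smooth factors, because the partial derivatives are again such
  products.\<close>
lemma Ck_tens:
  assumes "smooth f" "smooth g" shows "Ck k (tens f g)"
  using assms
proof (induction k arbitrary: f g)
  case 0
  have "continuous_on UNIV (\<lambda>p::real\<times>real. f (fst p))" "continuous_on UNIV (\<lambda>p::real\<times>real. g (snd p))"
    using continuous_on_compose2[OF smooth_continuous[OF 0(1)] continuous_on_fst[OF continuous_on_id] subset_UNIV]
      continuous_on_compose2[OF smooth_continuous[OF 0(2)] continuous_on_snd[OF continuous_on_id] subset_UNIV] by auto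
  then show ?case unfolding tens_def by (simp add: continuous_on_mult)
next
  case (Suc k)
  have "(tens f g has_derivative (\<lambda>h. tens (deriv f) g p * fst h + tens f (deriv g) p * snd h)) (at p)" for p
  proof -
    have 1: "((\<lambda>p. f (fst p)) has_derivative (\<lambda>h. deriv f (fst p) * fst h)) (at p)"
      using has_derivative_compose[OF has_derivative_fst[OF has_derivative_ident]
        smooth_DERIV[OF Suc.prems(1), of "fst p", unfolded has_field_derivative_def]] by simp
    have 2: "((\<lambda>p. g (snd p)) has_derivative (\<lambda>h. deriv g (snd p) * snd h)) (at p)"
      using has_derivative_compose[OF has_derivative_snd[OF has_derivative_ident]
        smooth_DERIV[OF Suc.prems(2), of "snd p", unfolded has_field_derivative_def]] by simp
    show ?thesis unfolding tens_def
      by (rule has_derivative_eq_rhs[OF has_derivative_mult[OF 1 2]]) (auto simp: algebra_simps)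
  qed
  moreover have "Ck k (tens (deriv f) g)" "Ck k (tens f (deriv g))"
    using Suc by (simp_all add: smooth_deriv)
  ultimately show ?case unfolding Ck.simps by blast
qed

lemma test_function_tens:
  assumes "test1 0 pi \<eta>" "test1 (-l) l \<zeta>" shows "test_function (plate l) (tens \<eta> \<zeta>)"
proof -
  obtain c d where cd: "0 < c" "d < pi" "\<And>x. x \<notin> {c..d} \<Longrightarrow> \<eta> x = 0" using assms by (auto simp: test1_def)
  obtain c' d' where cd': "-l < c'" "d' < l" "\<And>x. x \<notin> {c'..d'} \<Longrightarrow> \<zeta> x = 0" using assms by (auto simp: test1_def)
  show ?thesis unfolding test_function_def
  proof (intro conjI exI[of _ "{c..d} \<times> {c'..d'}"] allI impI)
    show "Ck k (tens \<eta> \<zeta>)" for k using assms by (simp add: Ck_tens test1_def)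
    show "compact ({c..d} \<times> {c'..d'})" by (intro compact_Times) auto
    show "{c..d} \<times> {c'..d'} \<subseteq> plate l" using cd cd' by (auto simp: plate_def)
    show "tens \<eta> \<zeta> p = 0" if "p \<notin> {c..d} \<times> {c'..d'}" for p
      using that cd(3) cd'(3) by (cases p) (auto simp: tens_def)
  qed
qed

lemma dx_tens: "smooth f \<Longrightarrow> dx (tens f g) = tens (deriv f) g"
  unfolding dx_def tens_def
  by (auto intro!: ext DERIV_imp_deriv derivative_eq_intros smooth_DERIV)

lemma dy_tens: "smooth g \<Longrightarrow> dy (tens f g) = tens f (deriv g)"
  unfolding dy_def tens_def
  by (auto intro!: ext DERIV_imp_deriv derivative_eq_intros smooth_DERIV)

section \<open>Primitives of integrable functions on an interval\<close>

text \<open>Borel sets rather than Lebesgue sets are used on intervals, since the product of two such measures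
  is then again of this kind and the theorem of Fubini applies directly.\<close>
definition iv :: "real \<Rightarrow> real \<Rightarrow> real measure" where
  "iv a b = restrict_space lborel {a<..<b}"

lemma space_iv[simp]: "space (iv a b) = {a<..<b}"
  by (simp add: iv_def)

lemma finite_measure_iv: "finite_measure (iv a b)"
  unfolding iv_def by (intro finite_measureI) (cases "a \<le> b"; simp add: emeasure_restrict_space)

interpretation iv: finite_measure "iv a b" for a b by (rule finite_measure_iv)
interpretation ivp: pair_sigma_finite "iv a b" "iv c d" for a b c d ..

lemma measurable_iv[measurable (raw)]: "f \<in> borel_measurable borel \<Longrightarrow> f \<in> borel_measurable (iv a b)"
  unfolding iv_def by (rule measurable_restrict_space1) simp

lemma id_measurable_iv[measurable]: "(\<lambda>x. x) \<in> iv a b \<rightarrow>\<^sub>M borel"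
  by (rule measurable_iv) simp

lemma AE_iv: "(AE x in iv a b. P x) \<longleftrightarrow> (AE x in lborel. a < x \<and> x < b \<longrightarrow> P x)"
  unfolding iv_def by (subst AE_restrict_space_iff) auto

lemma AE_iv_neq: "AE s in iv a b. s \<noteq> x"
  unfolding AE_iv by (rule AE_mp[OF AE_lborel_singleton[of x]]) auto

lemma integral_iv: "f \<in> borel_measurable borel \<Longrightarrow>
   integral\<^sup>L (iv a b) f = (LINT x|lborel. indicator {a<..<b} x * f x)" for f :: "real \<Rightarrow> real"
  unfolding iv_def by (subst integral_restrict_space) auto

lemma finite_measure_iv_pair: "finite_measure (iv a b \<Otimes>\<^sub>M iv c d)"
proof (rule finite_measureI)
  have s: "{a<..<b} \<in> sets (iv a b)" for a b using sets.top[of "iv a b"] by simp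
  have "emeasure (iv a b \<Otimes>\<^sub>M iv c d) ({a<..<b} \<times> {c<..<d}) = emeasure (iv a b) {a<..<b} * emeasure (iv c d) {c<..<d}"
    by (rule iv.emeasure_pair_measure_Times[OF s s])
  also have "\<dots> \<noteq> \<infinity>"
    using iv.emeasure_finite[of a b "{a<..<b}"] iv.emeasure_finite[of c d "{c<..<d}"] by (simp add: ennreal_mult_eq_top_iff)
  finally show "emeasure (iv a b \<Otimes>\<^sub>M iv c d) (space (iv a b \<Otimes>\<^sub>M iv c d)) \<noteq> \<infinity>"
    by (simp add: space_pair_measure)
qed

interpretation ivp: finite_measure "iv a b \<Otimes>\<^sub>M iv c d" for a b c d by (rule finite_measure_iv_pair)

lemma iv_pair: "iv a b \<Otimes>\<^sub>M iv c d = restrict_space lborel ({a<..<b} \<times> {c<..<d})"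
proof (rule pair_measure_eqI)
  show "sigma_finite_measure (iv a b)" "sigma_finite_measure (iv c d)" by unfold_locales
  show "sets (iv a b \<Otimes>\<^sub>M iv c d) = sets (restrict_space lborel ({a<..<b} \<times> {c<..<d}))"
  proof (intro equalityI subsetI)
    fix S assume S: "S \<in> sets (iv a b \<Otimes>\<^sub>M iv c d)"
    show "S \<in> sets (restrict_space lborel ({a<..<b} \<times> {c<..<d}))"
    proof -
      have "sets (iv a b \<Otimes>\<^sub>M iv c d) \<subseteq> sets (restrict_space lborel ({a<..<b} \<times> {c<..<d}))"
        unfolding sets_pair_measure space_iv
      proof (rule sets.sigma_sets_subset')
        show "{A \<times> B |A B. A \<in> sets (iv a b) \<and> B \<in> sets (iv c d)} \<subseteq> sets (restrict_space lborel ({a<..<b} \<times> {c<..<d}))"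
          by (auto simp: iv_def sets_restrict_space_iff open_Times borel_Times)
        show "{a<..<b} \<times> {c<..<d} \<in> sets (restrict_space lborel ({a<..<b} \<times> {c<..<d}))"
          by (auto simp: sets_restrict_space_iff open_Times)
      qed
      with S show ?thesis by auto
    qed
  next
    fix S assume "S \<in> sets (restrict_space lborel ({a<..<b} \<times> {c<..<d}))"
    then have S: "S \<in> sets borel" "S \<subseteq> {a<..<b} \<times> {c<..<d}"
      by (auto simp: sets_restrict_space_iff open_Times)
    have "(\<lambda>p. (fst p, snd p)) \<in> iv a b \<Otimes>\<^sub>M iv c d \<rightarrow>\<^sub>M borel \<Otimes>\<^sub>M borel"
      by measurable
    then have "(\<lambda>p. p) \<in> iv a b \<Otimes>\<^sub>M iv c d \<rightarrow>\<^sub>M borel" by (simp add: borel_prod)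
    from measurable_sets[OF this S(1)] show "S \<in> sets (iv a b \<Otimes>\<^sub>M iv c d)"
      using S(2) by (simp add: space_pair_measure Int_absorb2 vimage_def)
  qed
  show "emeasure (iv a b) A * emeasure (iv c d) B = emeasure (restrict_space lborel ({a<..<b} \<times> {c<..<d})) (A \<times> B)"
    if "A \<in> sets (iv a b)" "B \<in> sets (iv c d)" for A B
  proof -
    have AB: "A \<in> sets borel" "A \<subseteq> {a<..<b}" "B \<in> sets borel" "B \<subseteq> {c<..<d}"
      using that by (auto simp: iv_def sets_restrict_space_iff)
    have "emeasure (restrict_space lborel ({a<..<b} \<times> {c<..<d})) (A \<times> B) = emeasure (lborel \<Otimes>\<^sub>M lborel) (A \<times> B)"
      using AB by (subst emeasure_restrict_space) (auto simp: open_Times lborel_prod)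
    also have "\<dots> = emeasure lborel A * emeasure lborel B"
      using AB by (subst lborel.emeasure_pair_measure_Times) auto
    finally show ?thesis using AB by (auto simp: iv_def emeasure_restrict_space)
  qed
qed

lemma borel_measurable_ivp: "f \<in> borel_measurable borel \<Longrightarrow> f \<in> borel_measurable (iv a b \<Otimes>\<^sub>M iv c d)"
  unfolding iv_pair by (rule measurable_restrict_space1) simp

text \<open>The primitive that vanishes at the left end. The measure carries the interval, so that the function
  is defined on the whole line and constant outside of the interval.\<close>
definition prim :: "real measure \<Rightarrow> (real \<Rightarrow> real) \<Rightarrow> real \<Rightarrow> real" where
  "prim M g x = (LINT s|M. indicator {..x} s * g s)"

lemma prim_FTC:
  assumes F: "\<And>x. a \<le> x \<Longrightarrow> x \<le> b \<Longrightarrow> (F has_real_derivative f x) (at x)"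
    and f: "continuous_on UNIV f" and x: "a \<le> x" "x \<le> b"
  shows "prim (iv a b) f x = F x - F a"
proof -
  have [measurable]: "f \<in> borel_measurable borel" using f by (rule borel_measurable_continuous_onI)
  have "prim (iv a b) f x = (LINT s|lborel. indicator {a<..<b} s * (indicator {..x} s * f s))"
    unfolding prim_def by (subst integral_iv) auto
  also have "\<dots> = (LINT s|lborel. f s * indicator {a..x} s)"
  proof (rule integral_cong_AE)
    show "AE s in lborel. indicator {a<..<b} s * (indicator {..x} s * f s) = f s * indicator {a..x} s"
      using AE_lborel_singleton[of a] AE_lborel_singleton[of b]
      by eventually_elim (use x in \<open>auto simp: indicator_def\<close>)
  qed auto
  also have "\<dots> = F x - F a"
    using x F f by (intro integral_FTC_Icc_real) (auto simp: continuous_on_eq_continuous_at)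
  finally show ?thesis .
qed

lemma prim_integrable:
  fixes g :: "real \<Rightarrow> real"
  shows "integrable (iv a b) g \<Longrightarrow> integrable (iv a b) (\<lambda>s. indicator {..x} s * g s)"
  by (rule Bochner_Integration.integrable_bound[of _ g]) (auto simp: indicator_def)

lemma prim_abs_le:
  assumes "integrable (iv a b) g" shows "\<bar>prim (iv a b) g x\<bar> \<le> (LINT s|iv a b. \<bar>g s\<bar>)"
proof -
  have "\<bar>prim (iv a b) g x\<bar> \<le> (LINT s|iv a b. \<bar>indicator {..x} s * g s\<bar>)"
    unfolding prim_def by (rule integral_abs_bound)
  also have "\<dots> \<le> (LINT s|iv a b. \<bar>g s\<bar>)"
    using assms prim_integrable[OF assms, of x] by (intro integral_mono) (auto simp: indicator_def)
  finally show ?thesis .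
qed

lemma prim_diff:
  assumes "integrable (iv a b) g" "x \<le> y"
  shows "prim (iv a b) g y - prim (iv a b) g x = (LINT s|iv a b. indicator {x<..y} s * g s)"
proof -
  have "prim (iv a b) g y - prim (iv a b) g x = (LINT s|iv a b. indicator {..y} s * g s - indicator {..x} s * g s)"
    unfolding prim_def using prim_integrable[OF assms(1)] by simp
  also have "\<dots> = (LINT s|iv a b. indicator {x<..y} s * g s)"
    using assms(2) by (intro Bochner_Integration.integral_cong) (auto simp: indicator_def)
  finally show ?thesis .
qed

lemma prim_continuous:
  assumes "integrable (iv a b) g" shows "continuous_on UNIV (prim (iv a b) g)"
proof (rule continuous_at_imp_continuous_on, rule ballI)
  fix x :: real
  show "isCont (prim (iv a b) g) x"
    unfolding continuous_at_sequentially comp_def prim_def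
  proof (intro allI impI)
    fix X :: "nat \<Rightarrow> real" assume X: "X \<longlonglongrightarrow> x"
    show "(\<lambda>n. LINT s|iv a b. indicator {..X n} s * g s) \<longlonglongrightarrow> (LINT s|iv a b. indicator {..x} s * g s)"
    proof (rule integral_dominated_convergence[where w="\<lambda>s. \<bar>g s\<bar>"])
      show "AE s in iv a b. (\<lambda>n. indicator {..X n} s * g s) \<longlonglongrightarrow> indicator {..x} s * g s"
        using AE_iv_neq[of x]
      proof eventually_elim
        case (elim s)
        have "\<forall>\<^sub>F n in sequentially. indicator {..X n} s * g s = indicator {..x} s * g s"
        proof (cases "s < x")
          case True
          show ?thesis using order_tendstoD(1)[OF X True] by eventually_elim (use True in \<open>auto simp: indicator_def\<close>)
        next
          case False
          then have "x < s" using elim by auto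
          show ?thesis using order_tendstoD(2)[OF X \<open>x < s\<close>] by eventually_elim (use \<open>x < s\<close> in \<open>auto simp: indicator_def\<close>)
        qed
        then show ?case by (rule tendsto_eventually)
      qed
    qed (use assms in \<open>auto simp: indicator_def\<close>)
  qed
qed

lemma prim_measurable[measurable (raw)]:
  "integrable (iv a b) g \<Longrightarrow> prim (iv a b) g \<in> borel_measurable borel"
  using prim_continuous by (rule borel_measurable_continuous_onI)

lemma prim_left: "x \<le> a \<Longrightarrow> prim (iv a b) g x = 0"
proof -
  assume "x \<le> a"
  then have "prim (iv a b) g x = (LINT s|iv a b. 0)"
    unfolding prim_def by (intro Bochner_Integration.integral_cong) (auto simp: indicator_def)
  then show ?thesis by simp
qed

lemma prim_right: "b \<le> x \<Longrightarrow> prim (iv a b) g x = integral\<^sup>L (iv a b) g"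
  unfolding prim_def by (intro Bochner_Integration.integral_cong) (auto simp: indicator_def)

lemma prim_add: "integrable (iv a b) f \<Longrightarrow> integrable (iv a b) g \<Longrightarrow>
   prim (iv a b) (\<lambda>s. f s + g s) x = prim (iv a b) f x + prim (iv a b) g x"
  unfolding prim_def by (simp add: distrib_left prim_integrable)

lemma prim_scale: "prim (iv a b) (\<lambda>s. c * f s) x = c * prim (iv a b) f x"
  unfolding prim_def by (simp add: mult.left_commute[of _ c])

lemma prim_cong_AE:
  assumes "AE s in iv a b. f s = g s" "f \<in> borel_measurable (iv a b)" "g \<in> borel_measurable (iv a b)"
  shows "prim (iv a b) f x = prim (iv a b) g x"
  unfolding prim_def by (rule integral_cong_AE) (use assms in \<open>auto elim!: eventually_mono\<close>)

lemma integrable_tensor: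
  fixes f g :: "real \<Rightarrow> real"
  assumes "integrable (iv a b) f" "integrable (iv c d) g"
  shows "integrable (iv a b \<Otimes>\<^sub>M iv c d) (\<lambda>(x, s). f x * g s)"
proof (rule ivp.Fubini_integrable)
  show "(\<lambda>(x, s). f x * g s) \<in> borel_measurable (iv a b \<Otimes>\<^sub>M iv c d)" using assms by measurable
  show "integrable (iv a b) (\<lambda>x. LINT y|iv c d. norm (case (x, y) of (x, s) \<Rightarrow> f x * g s))"
    using assms by (auto simp: abs_mult)
  show "AE x in iv a b. integrable (iv c d) (\<lambda>y. case (x, y) of (x, s) \<Rightarrow> f x * g s)"
    using assms by auto
qed

text \<open>Both terms are integrals of f(x) g(s) over one half of the square, on the two sides of the diagonal;
  together they give the integral over the square, by Fubini.\<close>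
theorem prim_by_parts:
  assumes f: "integrable (iv a b) f" and g: "integrable (iv a b) g"
  shows "(LINT x|iv a b. f x * prim (iv a b) g x) + (LINT x|iv a b. prim (iv a b) f x * g x)
       = integral\<^sup>L (iv a b) f * integral\<^sup>L (iv a b) g"
proof -
  let ?M = "iv a b" let ?I = "\<lambda>x s. indicator {..x} s :: real"
  have fg: "integrable (?M \<Otimes>\<^sub>M ?M) (\<lambda>(x, s). f x * g s)" by (rule integrable_tensor[OF f g])
  have [measurable]: "f \<in> borel_measurable ?M" "g \<in> borel_measurable ?M" using f g by auto
  have int1: "integrable (?M \<Otimes>\<^sub>M ?M) (\<lambda>(x, s). ?I x s * (f x * g s))"
  proof (rule Bochner_Integration.integrable_bound[OF fg])
    have "(\<lambda>(x, s). if s \<le> x then f x * g s else 0) \<in> borel_measurable (?M \<Otimes>\<^sub>M ?M)" by measurable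
    then show "(\<lambda>(x, s). ?I x s * (f x * g s)) \<in> borel_measurable (?M \<Otimes>\<^sub>M ?M)"
      by (rule subst[rotated, where P="\<lambda>f. f \<in> borel_measurable (?M \<Otimes>\<^sub>M ?M)"]) (auto simp: indicator_def)
  qed (auto simp: indicator_def)
  have int2: "integrable (?M \<Otimes>\<^sub>M ?M) (\<lambda>(x, s). ?I s x * (f x * g s))"
  proof (rule Bochner_Integration.integrable_bound[OF fg])
    have "(\<lambda>(x, s). if x \<le> s then f x * g s else 0) \<in> borel_measurable (?M \<Otimes>\<^sub>M ?M)" by measurable
    then show "(\<lambda>(x, s). ?I s x * (f x * g s)) \<in> borel_measurable (?M \<Otimes>\<^sub>M ?M)"
      by (rule subst[rotated, where P="\<lambda>f. f \<in> borel_measurable (?M \<Otimes>\<^sub>M ?M)"]) (auto simp: indicator_def)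
  qed (auto simp: indicator_def)
  have 1: "(LINT x|?M. f x * prim ?M g x) = (LINT x|?M. LINT s|?M. ?I x s * (f x * g s))"
    unfolding prim_def by (simp add: mult.left_commute[of _ "f _"])
  have "(LINT x|?M. prim ?M f x * g x) = (LINT s|?M. LINT x|?M. ?I s x * (f x * g s))"
    unfolding prim_def by (simp add: mult.assoc flip: mult.assoc)
  also have "\<dots> = (LINT x|?M. LINT s|?M. ?I s x * (f x * g s))"
    by (rule ivp.Fubini_integral[OF int2])
  finally have 2: "(LINT x|?M. prim ?M f x * g x) = (LINT x|?M. LINT s|?M. ?I s x * (f x * g s))" .
  have "(LINT x|?M. f x * prim ?M g x) + (LINT x|?M. prim ?M f x * g x)
     = (LINT p|(?M \<Otimes>\<^sub>M ?M). (\<lambda>(x, s). ?I x s * (f x * g s)) p) + (LINT p|(?M \<Otimes>\<^sub>M ?M). (\<lambda>(x, s). ?I s x * (f x * g s)) p)"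
    unfolding 1 2 using ivp.integral_fst'[OF int1] ivp.integral_fst'[OF int2] by simp
  also have "\<dots> = (LINT p|(?M \<Otimes>\<^sub>M ?M). (\<lambda>(x, s). ?I x s * (f x * g s)) p + (\<lambda>(x, s). ?I s x * (f x * g s)) p)"
    using int1 int2 by (rule Bochner_Integration.integral_add[symmetric])
  also have "\<dots> = (LINT x|?M. LINT s|?M. ?I x s * (f x * g s) + ?I s x * (f x * g s))"
    using ivp.integral_fst'[OF Bochner_Integration.integrable_add[OF int1 int2]] by simp
  also have "\<dots> = (LINT x|?M. LINT s|?M. f x * g s)"
  proof (rule Bochner_Integration.integral_cong[OF refl])
    fix x :: real
    have flip: "indicator {..s} x = (indicator {x..} s :: real)" for s by (simp add: indicator_def)
    show "(LINT s|?M. ?I x s * (f x * g s) + ?I s x * (f x * g s)) = (LINT s|?M. f x * g s)"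
    proof (rule integral_cong_AE)
      show "AE s in ?M. ?I x s * (f x * g s) + ?I s x * (f x * g s) = f x * g s"
        using AE_iv_neq[of x] by eventually_elim (auto simp: indicator_def)
      show "(\<lambda>s. ?I x s * (f x * g s) + ?I s x * (f x * g s)) \<in> borel_measurable ?M"
        unfolding flip by measurable
    qed measurable
  qed
  also have "\<dots> = integral\<^sup>L ?M f * integral\<^sup>L ?M g" by simp
  finally show ?thesis .
qed

section \<open>Absolute continuity on lines of weakly differentiable functions\<close>

lemma AE_ivp_snd: assumes "AE y in iv c d. P y" shows "AE p in iv a b \<Otimes>\<^sub>M iv c d. P (snd p)"
proof -
  obtain N where N: "{y\<in>space (iv c d). \<not> P y} \<subseteq> N" "N \<in> null_sets (iv c d)"
    using assms by (auto elim!: AE_E simp: null_sets_def)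
  then have "AE p in iv a b \<Otimes>\<^sub>M iv c d. snd p \<notin> N"
    by (intro ivp.AE_pair_measure) (auto intro!: AE_not_in)
  then show ?thesis
    by (rule AE_mp) (use N in \<open>auto simp: space_pair_measure intro!: AE_I2\<close>)
qed

lemma integrable_mult_bounded:
  fixes f h :: "'a \<Rightarrow> real"
  assumes "integrable M f" "h \<in> borel_measurable M" "\<And>x. x \<in> space M \<Longrightarrow> \<bar>h x\<bar> \<le> B"
  shows "integrable M (\<lambda>x. f x * h x)"
proof (rule Bochner_Integration.integrable_bound)
  show "integrable M (\<lambda>x. B * f x)" using assms by simp
  show "(\<lambda>x. f x * h x) \<in> borel_measurable M" using assms by measurable
  show "AE x in M. norm (f x * h x) \<le> norm (B * f x)"
  proof (rule AE_I2)
    fix x assume "x \<in> space M"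
    then have "\<bar>h x\<bar> \<le> \<bar>B\<bar>" using assms(3)[of x] by simp
    then have "\<bar>h x\<bar> * \<bar>f x\<bar> \<le> \<bar>B\<bar> * \<bar>f x\<bar>" by (rule mult_right_mono) simp
    then show "norm (f x * h x) \<le> norm (B * f x)" by (simp add: abs_mult mult.commute)
  qed
qed

lemma tens_measurable[measurable]:
  assumes [measurable]: "\<eta> \<in> borel_measurable borel" "\<zeta> \<in> borel_measurable borel"
  shows "tens \<eta> \<zeta> \<in> borel_measurable (iv a b \<Otimes>\<^sub>M iv c d)"
  unfolding tens_def by measurable

lemma test1_measurable[measurable_dest]: "test1 a b \<eta> \<Longrightarrow> \<eta> \<in> borel_measurable borel"
  by (intro smooth_measurable test1_smooth)

lemma tens_test_bounded:
  assumes "test1 a b \<eta>" "test1 c d \<zeta>" obtains B where "\<And>p. \<bar>tens \<eta> \<zeta> p\<bar> \<le> B"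
proof -
  obtain B1 where B1: "B1 \<ge> 0" "\<And>x. \<bar>\<eta> x\<bar> \<le> B1" using test1_bounded[OF assms(1)] by blast
  obtain B2 where B2: "B2 \<ge> 0" "\<And>x. \<bar>\<zeta> x\<bar> \<le> B2" using test1_bounded[OF assms(2)] by blast
  have "\<bar>tens \<eta> \<zeta> p\<bar> \<le> B1 * B2" for p
    unfolding tens_def abs_mult by (intro mult_mono B1 B2) auto
  then show thesis by (rule that)
qed

lemma integrable_mult_tens:
  assumes "integrable (iv a b \<Otimes>\<^sub>M iv c d) f" "test1 a b \<eta>" "test1 c d \<zeta>"
  shows "integrable (iv a b \<Otimes>\<^sub>M iv c d) (\<lambda>p. f p * tens \<eta> \<zeta> p)"
proof -
  obtain B where "\<And>p. \<bar>tens \<eta> \<zeta> p\<bar> \<le> B" using tens_test_bounded[OF assms(2,3)] by blast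
  then show ?thesis using assms
    by (intro integrable_mult_bounded[of _ _ _ B] tens_measurable test1_measurable) auto
qed

text \<open>Bumps approximate indicators of rectangles, so the integral of f vanishes over all boxes. Then the
  positive and the negative part of f define finite measures that agree on a generator stable under
  intersections, hence everywhere.\<close>
theorem fundamental_lemma_tens:
  assumes f: "integrable (iv a b \<Otimes>\<^sub>M iv c d) f"
    and 0: "\<And>\<eta> \<zeta>. test1 a b \<eta> \<Longrightarrow> test1 c d \<zeta> \<Longrightarrow> (LINT p|(iv a b \<Otimes>\<^sub>M iv c d). f p * tens \<eta> \<zeta> p) = 0"
  shows "AE p in iv a b \<Otimes>\<^sub>M iv c d. f p = 0"
proof -
  let ?M = "iv a b \<Otimes>\<^sub>M iv c d" let ?R = "{a<..<b} \<times> {c<..<d}"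
  have [measurable]: "f \<in> borel_measurable ?M" using f by auto
  have rect: "(LINT p|?M. f p * tens (indicator {\<alpha><..<\<beta>}) (indicator {\<gamma><..<\<delta>}) p) = 0"
    if "a \<le> \<alpha>" "\<beta> \<le> b" "c \<le> \<gamma>" "\<delta> \<le> d" for \<alpha> \<beta> \<gamma> \<delta>
  proof -
    have t1: "test1 a b (bump \<alpha> \<beta> (Suc k))" and t2: "test1 c d (bump \<gamma> \<delta> (Suc k))" for k
      using that by (auto intro: bump_test1)
    have "(\<lambda>k. LINT p|?M. f p * tens (bump \<alpha> \<beta> (Suc k)) (bump \<gamma> \<delta> (Suc k)) p)
       \<longlonglongrightarrow> (LINT p|?M. f p * tens (indicator {\<alpha><..<\<beta>}) (indicator {\<gamma><..<\<delta>}) p)"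
    proof (rule integral_dominated_convergence[where w="\<lambda>p. \<bar>f p\<bar>"])
      show "(\<lambda>p. f p * tens (indicator {\<alpha><..<\<beta>}) (indicator {\<gamma><..<\<delta>}) p) \<in> borel_measurable ?M" by measurable
      show "(\<lambda>p. f p * tens (bump \<alpha> \<beta> (Suc k)) (bump \<gamma> \<delta> (Suc k)) p) \<in> borel_measurable ?M" for k
        using t1[of k] t2[of k] by measurable
      show "integrable ?M (\<lambda>p. \<bar>f p\<bar>)" using f by simp
      show "AE p in ?M. (\<lambda>k. f p * tens (bump \<alpha> \<beta> (Suc k)) (bump \<gamma> \<delta> (Suc k)) p)
          \<longlonglongrightarrow> f p * tens (indicator {\<alpha><..<\<beta>}) (indicator {\<gamma><..<\<delta>}) p"
        unfolding tens_def by (intro AE_I2 tendsto_intros LIMSEQ_Suc[OF bump_tendsto])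
      show "AE p in ?M. norm (f p * tens (bump \<alpha> \<beta> (Suc k)) (bump \<gamma> \<delta> (Suc k)) p) \<le> \<bar>f p\<bar>" for k
        unfolding tens_def
        by (intro AE_I2) (simp add: abs_mult bump_bounds mult_left_le mult_le_one)
    qed
    moreover have "(LINT p|?M. f p * tens (bump \<alpha> \<beta> (Suc k)) (bump \<gamma> \<delta> (Suc k)) p) = 0" for k
      by (rule 0[OF t1 t2])
    ultimately show ?thesis by (simp add: LIMSEQ_const_iff)
  qed
  define F where "F p = indicator ?R p * f p" for p
  have R[measurable]: "?R \<in> sets borel" by (simp add: open_Times)
  have Fint: "integrable lborel F"
    using f R unfolding iv_pair F_def by (subst (asm) integrable_restrict_space) auto
  have [measurable]: "F \<in> borel_measurable borel" using Fint by auto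
  have box0: "(LINT p|lborel. indicator (box u v) p * F p) = 0" for u v :: "real \<times> real"
  proof -
    have box: "box u v = {fst u<..<fst v} \<times> {snd u<..<snd v}"
      by (cases u; cases v) (auto simp: box_def Basis_prod_def)
    have "(LINT p|lborel. indicator (box u v) p * F p) = (LINT p|?M. indicator (box u v) p * f p)"
      unfolding iv_pair F_def using R
      by (subst integral_restrict_space) (auto simp: mult.left_commute)
    also have "\<dots> = (LINT p|?M. f p * tens (indicator {max a (fst u)<..<min b (fst v)}) (indicator {max c (snd u)<..<min d (snd v)}) p)"
      unfolding box tens_def by (intro Bochner_Integration.integral_cong) (auto simp: space_pair_measure indicator_def)
    also have "\<dots> = 0" by (rule rect) auto
    finally show ?thesis .
  qed
  define \<mu> where "\<mu> = density lborel (\<lambda>p. ennreal (F p))"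
  define \<nu> where "\<nu> = density lborel (\<lambda>p. ennreal (- F p))"
  have fin: "emeasure \<mu> X \<noteq> \<infinity>" if [measurable]: "X \<in> sets borel" for X
  proof -
    have "emeasure \<mu> X \<le> (\<integral>\<^sup>+p. ennreal (norm (F p)) \<partial>lborel)"
      unfolding \<mu>_def by (subst emeasure_density) (auto intro!: nn_integral_mono simp: indicator_def ennreal_leI)
    also have "\<dots> < \<infinity>" using Fint by (simp add: integrable_iff_bounded)
    finally show ?thesis by simp
  qed
  have "\<mu> = \<nu>"
  proof (rule measure_eqI_generator_eq)
    let ?E = "range (\<lambda>(a, b). box a b::(real \<times> real) set)"
    show "Int_stable ?E" by (auto simp: Int_stable_def box_Int_box)
    show "?E \<subseteq> Pow UNIV" "sets \<mu> = sigma_sets UNIV ?E" "sets \<nu> = sigma_sets UNIV ?E"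
      by (simp_all add: borel_eq_box \<mu>_def \<nu>_def)
    let ?A = "\<lambda>n::nat. box (- (real n *\<^sub>R One)) (real n *\<^sub>R One) :: (real \<times> real) set"
    show "range ?A \<subseteq> ?E" "(\<Union>i. ?A i) = UNIV" unfolding UN_box_eq_UNIV by auto
    show "emeasure \<mu> (?A i) \<noteq> \<infinity>" for i by (rule fin) auto
    show "emeasure \<mu> X = emeasure \<nu> X" if XE: "X \<in> ?E" for X
    proof -
      obtain w where "X = (case w of (u, v) \<Rightarrow> box u v)" using XE by blast
      then obtain u v where X: "X = box u v" by (cases w) auto
      have int: "integrable lborel (\<lambda>p. indicator X p * F p)"
        using integrable_mult_bounded[OF Fint, of "indicator X" 1] by (simp add: X mult.commute indicator_def)
      have "(LINT p|lborel. indicator X p * F p)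
          = enn2real (\<integral>\<^sup>+p. ennreal (indicator X p * F p) \<partial>lborel) - enn2real (\<integral>\<^sup>+p. ennreal (- (indicator X p * F p)) \<partial>lborel)"
        by (rule real_lebesgue_integral_def[OF int])
      also have "(\<lambda>p. ennreal (indicator X p * F p)) = (\<lambda>p. ennreal (F p) * indicator X p)"
        by (auto simp: indicator_def)
      also have "(\<lambda>p. ennreal (- (indicator X p * F p))) = (\<lambda>p. ennreal (- F p) * indicator X p)"
        by (auto simp: indicator_def)
      finally have "enn2real (emeasure \<mu> X) = enn2real (emeasure \<nu> X)"
        using box0[of u v] by (simp add: X \<mu>_def \<nu>_def emeasure_density)
      moreover have "emeasure \<nu> X \<noteq> \<infinity>"
      proof -
        have "emeasure \<nu> X \<le> (\<integral>\<^sup>+p. ennreal (norm (F p)) \<partial>lborel)"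
          unfolding \<nu>_def X by (subst emeasure_density) (auto intro!: nn_integral_mono simp: indicator_def ennreal_leI)
        also have "\<dots> < \<infinity>" using Fint by (simp add: integrable_iff_bounded)
        finally show ?thesis by simp
      qed
      ultimately show ?thesis using fin[of X]
        by (metis X borel_open ennreal_enn2real_if infinity_ennreal_def open_box)
    qed
  qed
  then have "AE p in lborel. ennreal (F p) = ennreal (- F p)"
    unfolding \<mu>_def \<nu>_def by (intro sigma_finite_measure.density_unique[OF lborel.sigma_finite_measure_axioms]) auto
  then have "AE p in lborel. F p = 0"
  proof eventually_elim
    case (elim p)
    then show ?case by (cases "F p \<ge> 0") (auto simp: ennreal_neg)
  qed
  then have "AE p in lborel. p \<in> ?R \<longrightarrow> f p = 0"
    by eventually_elim (auto simp: F_def)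
  then show ?thesis unfolding iv_pair using R by (subst AE_restrict_space_iff) auto
qed

lemma smooth_prim:
  assumes "smooth f" obtains F where "smooth F" "\<And>x. (F has_real_derivative f x) (at x)"
proof -
  have "isCont f x" for x by (rule DERIV_isCont[OF smooth_DERIV[OF assms]])
  then obtain F where "\<And>x. (F has_vector_derivative f x) (at x)"
    using einterval_antiderivative[of "-\<infinity>" "\<infinity>" f] by auto
  then have "\<And>x. (F has_real_derivative f x) (at x)"
    by (simp add: has_real_derivative_iff_has_vector_derivative)
  then show thesis using smooth_primitive[OF assms] that by blast
qed

lemma smooth_integral_deriv:
  assumes "smooth F" "a \<le> b" shows "(LINT x|iv a b. deriv F x) = F b - F a"
  using prim_FTC[of a b F "deriv F" b] prim_right[of b b a "deriv F"] assms
  by (simp add: smooth_DERIV smooth_continuous smooth_deriv)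

lemma test1_integrable: assumes "test1 a b \<eta>" shows "integrable (iv c d) \<eta>"
proof -
  obtain B where "\<And>x. \<bar>\<eta> x\<bar> \<le> B" using test1_bounded[OF assms] by blast
  then show ?thesis using assms by (intro iv.integrable_const_bound[of _ B]) (auto intro: test1_measurable)
qed

text \<open>A primitive is constant to the left and to the right of the support, and both constants vanish
  precisely when the integral does.\<close>
lemma test1_zero_mean_primitive:
  assumes t: "test1 a b f" and 0: "integral\<^sup>L (iv a b) f = 0"
  obtains F where "test1 a b F" "deriv F = f"
proof -
  obtain c d where cd: "a < c" "d < b" "\<And>x. x \<notin> {c..d} \<Longrightarrow> f x = 0" using t by (auto simp: test1_def)
  obtain G where G: "smooth G" "\<And>x. (G has_real_derivative f x) (at x)"
    using smooth_prim[OF test1_smooth[OF t]] by blast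
  show thesis
  proof (cases "a < b")
    case False
    then have "f x = 0" for x using cd(3)[of x] cd(1,2) by auto
    then have "f = (\<lambda>x. 0)" by auto
    moreover have "test1 a b (\<lambda>x. 0)" using t \<open>f = (\<lambda>x. 0)\<close> by simp
    ultimately show thesis using that[of "\<lambda>x. 0"] by simp
  next
    case True
    \<comment> \<open>Enlarges the interval from c to d, which may be empty, to a nonempty one.\<close>
    define c' d' where "c' = min c ((a + b) / 2)" and "d' = max d ((a + b) / 2)"
    have cd': "a < c'" "c' \<le> d'" "d' < b" using cd True by (auto simp: c'_def d'_def)
    have f0: "f x = 0" if "x < c' \<or> d' < x" for x
      using that cd(3)[of x] by (cases "x \<in> {c..d}") (auto simp: c'_def d'_def)
    have const: "F v = F u" if "u < v" "v \<le> c' \<or> d' \<le> u" "\<And>x. (F has_real_derivative f x) (at x)" for F u v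
    proof (rule DERIV_isconst_end[OF that(1)])
      show "continuous_on {u..v} F" using that(3) by (intro continuous_at_imp_continuous_on ballI DERIV_isCont)
      show "(F has_real_derivative 0) (at x)" if "u < x" "x < v" for x
        using \<open>\<And>x. (F has_real_derivative f x) (at x)\<close>[of x] f0[of x] \<open>v \<le> c' \<or> d' \<le> u\<close> that by auto
    qed
    define F where "F x = G x - G a" for x
    have F: "(F has_real_derivative f x) (at x)" for x
      unfolding F_def using DERIV_diff[OF G(2) DERIV_const] by simp
    have smF: "smooth F" by (rule smooth_primitive[OF test1_smooth[OF t] F])
    have dF: "deriv F = f" using F by (auto simp: DERIV_imp_deriv)
    have "F b = F a" using smooth_integral_deriv[OF smF, of a b] True 0 by (simp add: dF)
    then have Fb: "F b = 0" "F a = 0" by (auto simp: F_def)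
    have "F x = 0" if "x \<notin> {c'..d'}" for x
    proof (cases "x < c'")
      case True
      have "F x = F a" using const[of x a F] const[of a x F] F True cd' by (cases x a rule: linorder_cases) auto
      then show ?thesis using Fb by simp
    next
      case False
      then have x: "x > d'" using that by auto
      have "F x = F b" using const[of x b F] const[of b x F] F x cd' by (cases x b rule: linorder_cases) auto
      then show ?thesis using Fb by simp
    qed
    then have "test1 a b F" using smF cd' unfolding test1_def by blast
    then show thesis using dF that by blast
  qed
qed


lemma test1_prim_deriv:
  assumes "test1 a b \<eta>" "a \<le> x" "x \<le> b" shows "prim (iv a b) (deriv \<eta>) x = \<eta> x"
  using prim_FTC[of a b \<eta> "deriv \<eta>" x] assms test1_outside[OF assms(1), of a]
  by (simp add: smooth_DERIV smooth_continuous smooth_deriv test1_smooth)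

lemma test1_exists_unit_mass:
  assumes "a < b" obtains \<eta> where "test1 a b \<eta>" "integral\<^sup>L (iv a b) \<eta> = 1"
proof -
  \<comment> \<open>With this k the bump is positive on the middle third of the interval.\<close>
  define k where "k = nat \<lceil>4 / (b - a)\<rceil>"
  have k: "real k \<ge> 4 / (b - a)" "k > 0"
    using assms by (auto simp: k_def)
  let ?f = "bump a b k"
  have t: "test1 a b ?f" using k by (intro bump_test1) auto
  have nz: "integral\<^sup>L (iv a b) ?f \<noteq> 0"
  proof
    assume "integral\<^sup>L (iv a b) ?f = 0"
    then have "AE x in iv a b. ?f x = 0"
      using integral_nonneg_eq_0_iff_AE[OF test1_integrable[OF t, of a b]] bump_bounds by simp
    then have "AE x in lborel. x \<notin> {a + (b-a)/3 <..< b - (b-a)/3}"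
      unfolding AE_iv
    proof eventually_elim
      case (elim x)
      show ?case
      proof
        assume x: "x \<in> {a + (b-a)/3 <..< b - (b-a)/3}"
        have "(b - a) / 3 > 0" using assms by simp
        with x have r: "a < x" "x < b" unfolding greaterThanLessThan_iff by linarith+
        have "1 < (4 / (b - a)) * ((b - a) / 3)" using assms by simp
        also have "\<dots> \<le> real k * ((b - a) / 3)" using k(1) assms by (intro mult_right_mono) auto
        also have "\<dots> \<le> real k * (x - a)" using x unfolding greaterThanLessThan_iff by (intro mult_left_mono) linarith+
        finally have 1: "real k * x + (- real k * a - 1) > 0" by (simp add: algebra_simps)
        have "1 < (4 / (b - a)) * ((b - a) / 3)" using assms by simp
        also have "\<dots> \<le> real k * ((b - a) / 3)" using k(1) assms by (intro mult_right_mono) auto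
        also have "\<dots> \<le> real k * (b - x)" using x unfolding greaterThanLessThan_iff by (intro mult_left_mono) linarith+
        finally have 2: "(- real k) * x + (real k * b - 1) > 0" by (simp add: algebra_simps)
        have "?f x \<noteq> 0" unfolding bump_def flat_def if_P[OF 1] if_P[OF 2] by simp
        with elim r show False by simp
      qed
    qed
    then have "emeasure lborel {a + (b-a)/3 <..< b - (b-a)/3} = 0"
      by (subst (asm) AE_iff_measurable[where N="{a + (b-a)/3 <..< b - (b-a)/3}"]) auto
    then show False using assms by (simp add: field_simps)
  qed
  show thesis
  proof (rule that)
    show "test1 a b (\<lambda>x. (1 / integral\<^sup>L (iv a b) ?f) * ?f x)" by (rule test1_scale[OF t])
    show "integral\<^sup>L (iv a b) (\<lambda>x. (1 / integral\<^sup>L (iv a b) ?f) * ?f x) = 1"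
      using nz by simp
  qed
qed

text \<open>The primitive G of g in x has the same weak derivative as f, so h = f - G has weak derivative zero.
  Subtracting from a test function a multiple of a fixed one of mass 1 leaves a derivative of a test
  function; hence h equals its average C(y) against the fixed test function. This is the property of
  absolute continuity on lines, proved for almost every line at once.\<close>
theorem weak_deriv_fst_primitive:
  assumes ab: "a < b"
    and f: "integrable (iv a b \<Otimes>\<^sub>M iv c d) f" and g: "integrable (iv a b \<Otimes>\<^sub>M iv c d) g"
    and weak: "\<And>\<eta> \<zeta>. test1 a b \<eta> \<Longrightarrow> test1 c d \<zeta> \<Longrightarrow>
      (LINT p|(iv a b \<Otimes>\<^sub>M iv c d). f p * tens (deriv \<eta>) \<zeta> p) = - (LINT p|(iv a b \<Otimes>\<^sub>M iv c d). g p * tens \<eta> \<zeta> p)"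
  obtains C where "integrable (iv c d) C"
    "AE p in iv a b \<Otimes>\<^sub>M iv c d. f p = C (snd p) + prim (iv a b) (\<lambda>s. g (s, snd p)) (fst p)"
proof -
  let ?A = "iv a b" let ?C = "iv c d" let ?M = "?A \<Otimes>\<^sub>M ?C"
  have [measurable]: "f \<in> borel_measurable ?M" "g \<in> borel_measurable ?M" using f g by auto
  define G where "G p = prim ?A (\<lambda>s. g (s, snd p)) (fst p)" for p
  have [measurable]: "G \<in> borel_measurable ?M"
  proof -
    have "(\<lambda>p. LINT s|?A. (if s \<le> fst p then g (s, snd p) else 0)) \<in> borel_measurable ?M" by measurable
    moreover have "G = (\<lambda>p. LINT s|?A. (if s \<le> fst p then g (s, snd p) else 0))"
      unfolding G_def prim_def by (intro ext Bochner_Integration.integral_cong) (auto simp: indicator_def)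
    ultimately show ?thesis by simp
  qed
  have gy: "AE y in ?C. integrable ?A (\<lambda>s. g (s, y))"
    using ivp.AE_integrable_snd[where f="\<lambda>x y. g (x, y)"] g by simp
  define K where "K y = (LINT s|?A. \<bar>g (s, y)\<bar>)" for y
  have Kint: "integrable ?C K"
    unfolding K_def using ivp.integrable_snd[where f="\<lambda>x y. \<bar>g (x, y)\<bar>"] g by (simp add: case_prod_beta')
  have K2: "integrable ?M (\<lambda>p. K (snd p))"
    using integrable_tensor[of a b "\<lambda>x. 1" c d K] Kint by (simp add: case_prod_beta')
  have Gint: "integrable ?M G"
  proof (rule Bochner_Integration.integrable_bound[OF K2])
    show "AE p in ?M. norm (G p) \<le> norm (K (snd p))"
      using AE_ivp_snd[OF gy, of a b]
    proof eventually_elim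
      case (elim p)
      then have "\<bar>G p\<bar> \<le> K (snd p)" unfolding G_def K_def by (rule prim_abs_le)
      then show ?case by simp
    qed
  qed measurable
  define h where "h p = f p - G p" for p
  have hint: "integrable ?M h" unfolding h_def using f Gint by simp
  have Gweak: "(LINT p|?M. G p * tens (deriv \<eta>) \<zeta> p) = - (LINT p|?M. g p * tens \<eta> \<zeta> p)"
    if t: "test1 a b \<eta>" "test1 c d \<zeta>" for \<eta> \<zeta>
  proof -
    have i1: "integrable ?M (\<lambda>(x, y). G (x, y) * tens (deriv \<eta>) \<zeta> (x, y))"
      using integrable_mult_tens[OF Gint test1_deriv[OF t(1)] t(2)] by (simp add: case_prod_beta')
    have i2: "integrable ?M (\<lambda>(x, y). g (x, y) * tens \<eta> \<zeta> (x, y))"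
      using integrable_mult_tens[OF g t] by (simp add: case_prod_beta')
    have "(LINT p|?M. G p * tens (deriv \<eta>) \<zeta> p) = (LINT y|?C. LINT x|?A. G (x, y) * tens (deriv \<eta>) \<zeta> (x, y))"
      using ivp.integral_snd[OF i1] by (simp add: case_prod_beta')
    also have "\<dots> = (LINT y|?C. - (LINT x|?A. g (x, y) * tens \<eta> \<zeta> (x, y)))"
    proof (rule integral_cong_AE)
      show "AE y in ?C. (LINT x|?A. G (x, y) * tens (deriv \<eta>) \<zeta> (x, y)) = - (LINT x|?A. g (x, y) * tens \<eta> \<zeta> (x, y))"
        using gy
      proof eventually_elim
        case (elim y)
        have "(LINT x|?A. deriv \<eta> x * prim ?A (\<lambda>s. g (s, y)) x) + (LINT x|?A. prim ?A (deriv \<eta>) x * g (x, y))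
            = integral\<^sup>L ?A (deriv \<eta>) * integral\<^sup>L ?A (\<lambda>s. g (s, y))"
          by (rule prim_by_parts[OF test1_integrable[OF test1_deriv[OF t(1)]] elim])
        also have "integral\<^sup>L ?A (deriv \<eta>) = 0"
          using smooth_integral_deriv[OF test1_smooth[OF t(1)], of a b] ab test1_outside[OF t(1)] by simp
        also have "(LINT x|?A. prim ?A (deriv \<eta>) x * g (x, y)) = (LINT x|?A. \<eta> x * g (x, y))"
          by (intro Bochner_Integration.integral_cong) (auto simp: test1_prim_deriv[OF t(1)])
        finally have "(LINT x|?A. deriv \<eta> x * G (x, y)) = - (LINT x|?A. \<eta> x * g (x, y))"
          by (simp add: G_def)
        then have "\<zeta> y * (LINT x|?A. deriv \<eta> x * G (x, y)) = - (\<zeta> y * (LINT x|?A. \<eta> x * g (x, y)))" by simp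
        then show ?case unfolding tens_def
          by (simp flip: integral_mult_right_zero add: ac_simps)
      qed
      show "(\<lambda>y. LINT x|?A. G (x, y) * tens (deriv \<eta>) \<zeta> (x, y)) \<in> borel_measurable ?C"
        using ivp.integrable_snd[OF i1] by auto
      show "(\<lambda>y. - (LINT x|?A. g (x, y) * tens \<eta> \<zeta> (x, y))) \<in> borel_measurable ?C"
        using ivp.integrable_snd[OF i2] by auto
    qed
    also have "\<dots> = - (LINT p|?M. g p * tens \<eta> \<zeta> p)"
      using ivp.integral_snd[OF i2] by (simp add: case_prod_beta')
    finally show ?thesis .
  qed
  have hweak: "(LINT p|?M. h p * tens (deriv \<eta>) \<zeta> p) = 0" if t: "test1 a b \<eta>" "test1 c d \<zeta>" for \<eta> \<zeta>
    unfolding h_def left_diff_distrib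
    using weak[OF t] Gweak[OF t] integrable_mult_tens[OF Gint test1_deriv[OF t(1)] t(2)]
      integrable_mult_tens[OF f test1_deriv[OF t(1)] t(2)] by simp
  obtain \<eta>0 where t0: "test1 a b \<eta>0" and mass: "integral\<^sup>L ?A \<eta>0 = 1"
    using test1_exists_unit_mass[OF ab] by blast
  define C where "C y = (LINT x|?A. h (x, y) * \<eta>0 x)" for y
  obtain B0 where B0: "\<And>x. \<bar>\<eta>0 x\<bar> \<le> B0" using test1_bounded[OF t0] by blast
  have h\<eta>0: "integrable ?M (\<lambda>p. h p * \<eta>0 (fst p))"
    using hint B0 measurable_compose[OF measurable_fst measurable_iv[OF test1_measurable[OF t0]]]
    by (intro integrable_mult_bounded[of _ _ _ B0]) auto
  have Cint: "integrable ?C C"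
    unfolding C_def using ivp.integrable_snd[where f="\<lambda>x y. h (x, y) * \<eta>0 x"] h\<eta>0 by (simp add: case_prod_beta')
  have C2: "integrable ?M (\<lambda>p. C (snd p))"
    using integrable_tensor[of a b "\<lambda>x. 1" c d C] Cint by (simp add: case_prod_beta')
  have main: "(LINT p|?M. (h p - C (snd p)) * tens \<eta> \<zeta> p) = 0" if t: "test1 a b \<eta>" "test1 c d \<zeta>" for \<eta> \<zeta>
  proof -
    define m where "m = integral\<^sup>L ?A \<eta>"
    have t1: "test1 a b (\<lambda>x. \<eta> x + (- m) * \<eta>0 x)" by (intro test1_add test1_scale t t0)
    have "integral\<^sup>L ?A (\<lambda>x. \<eta> x + (- m) * \<eta>0 x) = 0"
      using test1_integrable[OF t(1)] test1_integrable[OF t0] mass by (simp add: m_def)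
    from test1_zero_mean_primitive[OF t1 this] obtain F where F: "test1 a b F" "deriv F = (\<lambda>x. \<eta> x + (- m) * \<eta>0 x)"
      by blast
    have ih: "integrable ?M (\<lambda>p. h p * tens \<eta> \<zeta> p)" and ih0: "integrable ?M (\<lambda>p. h p * tens \<eta>0 \<zeta> p)"
      by (intro integrable_mult_tens hint t t0)+
    have "0 = (LINT p|?M. h p * tens \<eta> \<zeta> p - m * (h p * tens \<eta>0 \<zeta> p))"
      using hweak[OF F(1) t(2)] unfolding F(2) tens_def by (simp add: algebra_simps)
    also have "\<dots> = (LINT p|?M. h p * tens \<eta> \<zeta> p) - m * (LINT p|?M. h p * tens \<eta>0 \<zeta> p)"
      using ih ih0 by simp
    finally have 1: "(LINT p|?M. h p * tens \<eta> \<zeta> p) = m * (LINT p|?M. h p * tens \<eta>0 \<zeta> p)" by simp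
    have "(LINT p|?M. h p * tens \<eta>0 \<zeta> p) = (LINT y|?C. LINT x|?A. h (x, y) * tens \<eta>0 \<zeta> (x, y))"
      using ivp.integral_snd[where f="\<lambda>x y. h (x, y) * tens \<eta>0 \<zeta> (x, y)"] ih0 by (simp add: case_prod_beta')
    also have "\<dots> = (LINT y|?C. C y * \<zeta> y)"
      unfolding C_def tens_def by (simp flip: integral_mult_right_zero add: ac_simps)
    finally have 2: "(LINT p|?M. h p * tens \<eta>0 \<zeta> p) = (LINT y|?C. C y * \<zeta> y)" .
    have iC: "integrable ?M (\<lambda>p. C (snd p) * tens \<eta> \<zeta> p)"
      by (intro integrable_mult_tens C2 t)
    have "(LINT p|?M. C (snd p) * tens \<eta> \<zeta> p) = (LINT y|?C. LINT x|?A. C y * tens \<eta> \<zeta> (x, y))"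
      using ivp.integral_snd[where f="\<lambda>x y. C y * tens \<eta> \<zeta> (x, y)"] iC by (simp add: case_prod_beta')
    also have "\<dots> = (LINT y|?C. m * (C y * \<zeta> y))"
      unfolding m_def tens_def by (simp add: ac_simps)
    finally have 3: "(LINT p|?M. C (snd p) * tens \<eta> \<zeta> p) = m * (LINT y|?C. C y * \<zeta> y)" by simp
    show ?thesis unfolding left_diff_distrib using ih iC 1 2 3 by simp
  qed
  have "AE p in ?M. h p - C (snd p) = 0"
    by (rule fundamental_lemma_tens[OF _ main]) (use hint C2 in auto)
  then have "AE p in ?M. f p = C (snd p) + prim ?A (\<lambda>s. g (s, snd p)) (fst p)"
    by eventually_elim (auto simp: h_def G_def)
  with Cint show thesis by (rule that)
qed

text \<open>Exchange of the two variables.\<close>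
theorem weak_deriv_snd_primitive:
  assumes cd: "c < d"
    and f: "integrable (iv a b \<Otimes>\<^sub>M iv c d) f" and g: "integrable (iv a b \<Otimes>\<^sub>M iv c d) g"
    and weak: "\<And>\<eta> \<zeta>. test1 a b \<eta> \<Longrightarrow> test1 c d \<zeta> \<Longrightarrow>
      (LINT p|(iv a b \<Otimes>\<^sub>M iv c d). f p * tens \<eta> (deriv \<zeta>) p) = - (LINT p|(iv a b \<Otimes>\<^sub>M iv c d). g p * tens \<eta> \<zeta> p)"
  obtains C where "integrable (iv a b) C"
    "AE p in iv a b \<Otimes>\<^sub>M iv c d. f p = C (fst p) + prim (iv c d) (\<lambda>s. g (fst p, s)) (snd p)"
proof -
  let ?M = "iv a b \<Otimes>\<^sub>M iv c d" let ?N = "iv c d \<Otimes>\<^sub>M iv a b"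
  have [measurable]: "f \<in> borel_measurable ?M" "g \<in> borel_measurable ?M" using f g by auto
  define f' where "f' = (\<lambda>(y, x). f (x, y))" define g' where "g' = (\<lambda>(y, x). g (x, y))"
  have f': "integrable ?N f'" "integrable ?N g'"
    unfolding f'_def g'_def using ivp.integrable_product_swap[OF f] ivp.integrable_product_swap[OF g] by auto
  have swap: "(LINT q|?N. (case q of (y, x) \<Rightarrow> F (x, y))) = (LINT p|?M. F p)"
    if "F \<in> borel_measurable ?M" for F :: "real \<times> real \<Rightarrow> real"
    using ivp.integral_product_swap[OF that] by simp
  obtain C where C: "integrable (iv a b) C"
    "AE q in ?N. f' q = C (snd q) + prim (iv c d) (\<lambda>s. g' (s, snd q)) (fst q)"
  proof (rule weak_deriv_fst_primitive[OF cd f'])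
    fix \<zeta> \<eta> assume t: "test1 c d \<zeta>" "test1 a b \<eta>"
    have "(LINT q|?N. f' q * tens (deriv \<zeta>) \<eta> q) = (LINT p|?M. f p * tens \<eta> (deriv \<zeta>) p)"
      using swap[of "\<lambda>p. f p * tens \<eta> (deriv \<zeta>) p"] t test1_deriv[OF t(1)] tens_measurable[OF test1_measurable[OF t(2)] test1_measurable[OF test1_deriv[OF t(1)]], of a b c d]
      by (simp add: case_prod_beta' f'_def tens_def mult.commute[of "\<eta> _"] borel_measurable_times)
    also have "\<dots> = - (LINT p|?M. g p * tens \<eta> \<zeta> p)" by (rule weak[OF t(2,1)])
    also have "(LINT p|?M. g p * tens \<eta> \<zeta> p) = (LINT q|?N. g' q * tens \<zeta> \<eta> q)"
      using swap[of "\<lambda>p. g p * tens \<eta> \<zeta> p"] t tens_measurable[OF test1_measurable[OF t(2)] test1_measurable[OF t(1)], of a b c d]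
      by (simp add: case_prod_beta' g'_def tens_def mult.commute[of "\<eta> _"] borel_measurable_times)
    finally show "(LINT q|?N. f' q * tens (deriv \<zeta>) \<eta> q) = - (LINT q|?N. g' q * tens \<zeta> \<eta> q)" .
  qed
  have "AE p in distr ?M ?N (\<lambda>(x, y). (y, x)). f' p = C (snd p) + prim (iv c d) (\<lambda>s. g' (s, snd p)) (fst p)"
    using C(2) ivp.distr_pair_swap[of c d a b] by metis
  then have "AE p in ?M. f' (prod.swap p) = C (snd (prod.swap p)) + prim (iv c d) (\<lambda>s. g' (s, snd (prod.swap p))) (fst (prod.swap p))"
    by (auto dest!: AE_distrD[rotated] simp: case_prod_beta' measurable_pair_swap' prod.swap_def)
  then have "AE p in ?M. f p = C (fst p) + prim (iv c d) (\<lambda>s. g (fst p, s)) (snd p)"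
    by eventually_elim (auto simp: f'_def g'_def)
  with C(1) show thesis by (rule that)
qed

section \<open>Borel representatives and weak derivatives on the plate\<close>

abbreviation PM :: "real \<Rightarrow> (real \<times> real) measure" where
  "PM l \<equiv> iv 0 pi \<Otimes>\<^sub>M iv (-l) l"

lemma plate_sets: "plate l \<in> sets borel"
  by (simp add: plate_def open_Times)

lemma PM_eq: "PM l = restrict_space lborel (plate l)"
  by (simp add: iv_pair plate_def)

lemma space_PM: "space (PM l) = plate l"
  by (simp add: space_pair_measure plate_def)

lemma AE_plate: "(AE p in lebesgue_on (plate l). P p) \<longleftrightarrow> (AE p in PM l. P p)"
  unfolding PM_eq using plate_sets
  by (subst (1 2) AE_restrict_space_iff) (auto simp: AE_completion_iff)

lemma PM_measurable: "f \<in> borel_measurable (PM l) \<Longrightarrow> f \<in> borel_measurable (lebesgue_on (plate l))"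
  for f :: "real \<times> real \<Rightarrow> real"
  unfolding PM_eq using plate_sets
  by (subst (asm) borel_measurable_restrict_space_iff, simp, subst borel_measurable_restrict_space_iff)
     (auto intro: measurable_completion)

lemma integral_plate: "f \<in> borel_measurable (PM l) \<Longrightarrow> integral\<^sup>L (lebesgue_on (plate l)) f = integral\<^sup>L (PM l) f"
  for f :: "real \<times> real \<Rightarrow> real"
  unfolding PM_eq using plate_sets
  by (subst (asm) borel_measurable_restrict_space_iff) (auto simp: integral_restrict_space integral_completion)

lemma integrable_plate: "f \<in> borel_measurable (PM l) \<Longrightarrow> integrable (lebesgue_on (plate l)) f \<longleftrightarrow> integrable (PM l) f"
  for f :: "real \<times> real \<Rightarrow> real"
  unfolding PM_eq using plate_sets
  by (subst (asm) borel_measurable_restrict_space_iff) (auto simp: integrable_restrict_space integrable_completion)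

lemma ex_rep:
  fixes f :: "real \<times> real \<Rightarrow> real"
  assumes "f \<in> borel_measurable (lebesgue_on (plate l))"
  shows "\<exists>f'. f' \<in> borel_measurable (PM l) \<and> (AE p in PM l. f p = f' p)"
proof -
  have "(\<lambda>p. indicator (plate l) p *\<^sub>R f p) \<in> borel_measurable (completion lborel)"
    using assms plate_sets by (subst (asm) borel_measurable_restrict_space_iff) auto
  then obtain g where g: "g \<in> borel_measurable lborel" "AE p in lborel. indicator (plate l) p *\<^sub>R f p = g p"
    using completion_ex_borel_measurable_real by blast
  have "AE p in PM l. f p = g p"
    unfolding PM_eq using plate_sets g(2)
    by (subst AE_restrict_space_iff) (auto simp: indicator_def elim!: eventually_mono split: if_splits)
  moreover have "g \<in> borel_measurable (PM l)" using g by (intro borel_measurable_ivp) simp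
  ultimately show ?thesis by blast
qed

text \<open>A Borel-measurable representative; functions of the plate space are only measurable for the
  completed measure, whose sections need not be measurable.\<close>
definition rep :: "real \<Rightarrow> field \<Rightarrow> field" where
  "rep l f = (SOME f'. f' \<in> borel_measurable (PM l) \<and> (AE p in PM l. f p = f' p))"

lemma L2_sqint: "L2 \<Omega> = sqint (lebesgue_on \<Omega>)" by (simp add: L2_def sqint_def)
lemma inner0_ipM: "inner0 \<Omega> = ipM (lebesgue_on \<Omega>)" by (intro ext) (simp add: inner0_def ipM_def)

lemma rep_props:
  assumes "f \<in> borel_measurable (lebesgue_on (plate l))"
  shows "rep l f \<in> borel_measurable (PM l)" "AE p in PM l. f p = rep l f p"
  using someI_ex[OF ex_rep[OF assms]] by (auto simp: rep_def)

lemma sqint_PM_iff: "f \<in> borel_measurable (PM l) \<Longrightarrow> f \<in> sqint (lebesgue_on (plate l)) \<longleftrightarrow> f \<in> sqint (PM l)"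
  by (auto simp: sqint_def PM_measurable integrable_plate)

lemma sqint_PM_L2: "f \<in> sqint (PM l) \<Longrightarrow> f \<in> L2 (plate l)"
  using sqint_PM_iff[of f l] by (auto simp: L2_sqint sqint_def)

lemma rep_L2:
  assumes "f \<in> L2 (plate l)"
  shows "rep l f \<in> sqint (PM l)" "AE p in PM l. f p = rep l f p" "AE p in lebesgue_on (plate l). f p = rep l f p"
proof -
  have m: "f \<in> borel_measurable (lebesgue_on (plate l))" using assms by (simp add: L2_def)
  note r = rep_props[OF m]
  show "AE p in PM l. f p = rep l f p" by (rule r)
  then show ae: "AE p in lebesgue_on (plate l). f p = rep l f p" by (simp add: AE_plate)
  have "rep l f \<in> sqint (lebesgue_on (plate l))"
    using sqint_cong[OF ae] assms PM_measurable[OF r(1)] by (simp add: L2_sqint)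
  then show "rep l f \<in> sqint (PM l)" using sqint_PM_iff[OF r(1)] by simp
qed

text \<open>The passage from the completed measure on the plate to the product of the two interval measures.\<close>
lemma integral_plate_AE:
  fixes f f' :: "real \<times> real \<Rightarrow> real"
  assumes "f \<in> borel_measurable (lebesgue_on (plate l))" "f' \<in> borel_measurable (PM l)" "AE p in PM l. f p = f' p"
  shows "integral\<^sup>L (lebesgue_on (plate l)) f = integral\<^sup>L (PM l) f'"
  unfolding integral_plate[OF assms(2), symmetric]
  by (rule integral_cong_AE[OF assms(1) PM_measurable[OF assms(2)]]) (use assms(3) in \<open>simp add: AE_plate\<close>)

lemma inner0_rep:
  assumes "u \<in> L2 (plate l)" "v \<in> L2 (plate l)"
  shows "inner0 (plate l) u v = ipM (PM l) (rep l u) (rep l v)"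
  unfolding inner0_def ipM_def
proof (rule integral_plate_AE)
  show "(\<lambda>p. u p * v p) \<in> borel_measurable (lebesgue_on (plate l))" using assms by (auto simp: L2_def)
  show "(\<lambda>p. rep l u p * rep l v p) \<in> borel_measurable (PM l)"
    using rep_L2(1)[OF assms(1)] rep_L2(1)[OF assms(2)] by (auto simp: sqint_def)
  show "AE p in PM l. u p * v p = rep l u p * rep l v p"
    using rep_L2(2)[OF assms(1)] rep_L2(2)[OF assms(2)] by eventually_elim auto
qed

lemma inner0_PM: "u \<in> sqint (PM l) \<Longrightarrow> v \<in> sqint (PM l) \<Longrightarrow> inner0 (plate l) u v = ipM (PM l) u v"
  unfolding inner0_def ipM_def by (rule integral_plate) (auto simp: sqint_def)

lemma dx_pow_tens: "smooth f \<Longrightarrow> (dx ^^ i) (tens f g) = tens ((deriv ^^ i) f) g \<and> smooth ((deriv ^^ i) f)"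
  by (induction i) (auto simp: dx_tens smooth_deriv)

lemma dy_pow_tens: "smooth g \<Longrightarrow> (dy ^^ i) (tens f g) = tens f ((deriv ^^ i) g) \<and> smooth ((deriv ^^ i) g)"
  by (induction i) (auto simp: dy_tens smooth_deriv)

lemma test1_deriv_pow: "test1 a b f \<Longrightarrow> test1 a b ((deriv ^^ i) f)"
  by (induction i) (auto intro: test1_deriv)

text \<open>The definition of a weak derivative, read for product test functions and Borel representatives.\<close>
lemma weak_deriv_tens:
  assumes w: "is_weak_deriv (plate l) i j u g" and u: "u \<in> L2 (plate l)" and g: "g \<in> L2 (plate l)"
    and t: "test1 0 pi \<eta>" "test1 (-l) l \<zeta>"
  shows "(LINT p|PM l. rep l u p * tens ((deriv ^^ i) \<eta>) ((deriv ^^ j) \<zeta>) p)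
     = (-1) ^ (i + j) * (LINT p|PM l. rep l g p * tens \<eta> \<zeta> p)"
proof -
  have int: "(LINT p|PM l. rep l h p * tens f1 f2 p) = (LINT p|lebesgue_on (plate l). h p * tens f1 f2 p)"
    if "h \<in> L2 (plate l)" "test1 0 pi f1" "test1 (-l) l f2" for h f1 f2
  proof (rule integral_plate_AE[symmetric])
    have [measurable]: "tens f1 f2 \<in> borel_measurable (PM l)"
      using that by (intro tens_measurable test1_measurable)
    have [measurable]: "tens f1 f2 \<in> borel_measurable (lebesgue_on (plate l))" by (rule PM_measurable) measurable
    show "(\<lambda>p. h p * tens f1 f2 p) \<in> borel_measurable (lebesgue_on (plate l))"
      using that(1) by (auto simp: L2_def)
    show "(\<lambda>p. rep l h p * tens f1 f2 p) \<in> borel_measurable (PM l)"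
      using rep_L2(1)[OF that(1)] by (auto simp: sqint_def)
    show "AE p in PM l. h p * tens f1 f2 p = rep l h p * tens f1 f2 p"
      using rep_L2(2)[OF that(1)] by eventually_elim auto
  qed
  have "(dx ^^ i) ((dy ^^ j) (tens \<eta> \<zeta>)) = tens ((deriv ^^ i) \<eta>) ((deriv ^^ j) \<zeta>)"
    using dx_pow_tens dy_pow_tens t by (simp add: test1_smooth)
  then show ?thesis
    using w[unfolded is_weak_deriv_def, rule_format, OF test_function_tens[OF t]]
      int[OF u test1_deriv_pow[OF t(1)] test1_deriv_pow[OF t(2)]] int[OF g t] by simp
qed

lemma integrable_rep: "f \<in> L2 (plate l) \<Longrightarrow> integrable (PM l) (rep l f)"
  by (intro ivp.sqint_integrable rep_L2)

text \<open>Product test functions already separate functions, which makes the derivative chosen in the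
  definition of the forms meaningful.\<close>
lemma weak_deriv_unique:
  assumes "is_weak_deriv (plate l) i j u g" "is_weak_deriv (plate l) i j u h"
    and u: "u \<in> L2 (plate l)" and g: "g \<in> L2 (plate l)" and h: "h \<in> L2 (plate l)"
  shows "AE p in PM l. g p = h p"
proof -
  have "AE p in PM l. rep l g p - rep l h p = 0"
  proof (rule fundamental_lemma_tens)
    show "integrable (PM l) (\<lambda>p. rep l g p - rep l h p)" using integrable_rep g h by auto
    fix \<eta> \<zeta> assume t: "test1 0 pi \<eta>" "test1 (-l) l \<zeta>"
    have "(-1::real) ^ (i + j) * (LINT p|PM l. rep l g p * tens \<eta> \<zeta> p) = (-1) ^ (i + j) * (LINT p|PM l. rep l h p * tens \<eta> \<zeta> p)"
      using weak_deriv_tens[OF assms(1) u g t] weak_deriv_tens[OF assms(2) u h t] by simp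
    then have "(LINT p|PM l. rep l g p * tens \<eta> \<zeta> p) = (LINT p|PM l. rep l h p * tens \<eta> \<zeta> p)" by simp
    then show "(LINT p|PM l. (rep l g p - rep l h p) * tens \<eta> \<zeta> p) = 0"
      unfolding left_diff_distrib
      using integrable_mult_tens[OF integrable_rep[OF g] t] integrable_mult_tens[OF integrable_rep[OF h] t] by simp
  qed
  then show ?thesis using rep_L2(2)[OF g] rep_L2(2)[OF h] by eventually_elim auto
qed

lemma wderiv_spec:
  assumes "u \<in> H2 (plate l)" "i + j \<le> 2"
  shows "wderiv (plate l) i j u \<in> L2 (plate l)" "is_weak_deriv (plate l) i j u (wderiv (plate l) i j u)"
proof -
  have "\<exists>g. g \<in> L2 (plate l) \<and> is_weak_deriv (plate l) i j u g" using assms by (auto simp: H2_def)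
  from someI_ex[OF this] show "wderiv (plate l) i j u \<in> L2 (plate l)" "is_weak_deriv (plate l) i j u (wderiv (plate l) i j u)"
    by (auto simp: wderiv_def)
qed

lemma wderiv_AE:
  assumes "u \<in> H2 (plate l)" "i + j \<le> 2" "g \<in> L2 (plate l)" "is_weak_deriv (plate l) i j u g"
  shows "AE p in PM l. wderiv (plate l) i j u p = g p"
  by (rule weak_deriv_unique[OF wderiv_spec(2)[OF assms(1,2)] assms(4) _ wderiv_spec(1)[OF assms(1,2)] assms(3)])
     (use assms in \<open>auto simp: H2_def\<close>)

interpretation l2: semi_inner "L2 (plate l)" "inner0 (plate l)" for l
  unfolding L2_sqint inner0_ipM by (rule semi_inner_sqint)

lemma Ck_measurable: assumes "Ck k f" shows "f \<in> borel_measurable borel"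
proof -
  have "continuous_on UNIV f"
  proof (cases k)
    case 0 then show ?thesis using assms by simp
  next
    case (Suc k')
    then obtain fx fy where "\<And>p. (f has_derivative (\<lambda>h. fx p * fst h + fy p * snd h)) (at p)" using assms by auto
    then show ?thesis by (meson continuous_at_imp_continuous_on has_derivative_continuous)
  qed
  then show ?thesis by (rule borel_measurable_continuous_onI)
qed

lemma Ck_dx_dy:
  assumes "Ck (Suc k) f" shows "Ck k (dx f)" "Ck k (dy f)"
    "((\<lambda>s. f (s, y)) has_real_derivative dx f (x, y)) (at x)"
    "((\<lambda>s. f (x, s)) has_real_derivative dy f (x, y)) (at y)"
proof -
  obtain fx fy where f: "Ck k fx" "Ck k fy" "\<And>p. (f has_derivative (\<lambda>h. fx p * fst h + fy p * snd h)) (at p)"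
    using assms by auto
  have 1: "((\<lambda>s. f (s, y)) has_real_derivative fx (x, y)) (at x)" for x y
  proof -
    have "((\<lambda>s. (s, y)) has_derivative (\<lambda>h. (h, 0))) (at x)" by (auto intro!: derivative_eq_intros)
    from has_derivative_compose[OF this f(3)] show ?thesis by (simp add: has_field_derivative_def)
  qed
  have 2: "((\<lambda>s. f (x, s)) has_real_derivative fy (x, y)) (at y)" for x y
  proof -
    have "((\<lambda>s. (x, s)) has_derivative (\<lambda>h. (0, h))) (at y)" by (auto intro!: derivative_eq_intros)
    from has_derivative_compose[OF this f(3)] show ?thesis by (simp add: has_field_derivative_def)
  qed
  have "dx f = fx" "dy f = fy" using DERIV_imp_deriv[OF 1] DERIV_imp_deriv[OF 2] by (auto simp: dx_def dy_def)
  then show "Ck k (dx f)" "Ck k (dy f)"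
    "((\<lambda>s. f (s, y)) has_real_derivative dx f (x, y)) (at x)"
    "((\<lambda>s. f (x, s)) has_real_derivative dy f (x, y)) (at y)" using f 1 2 by auto
qed

lemma test_function_dx_dy:
  assumes "test_function \<Omega> f" shows "test_function \<Omega> (dx f)" "test_function \<Omega> (dy f)"
proof -
  obtain K where K: "compact K" "K \<subseteq> \<Omega>" "\<And>p. p \<notin> K \<Longrightarrow> f p = 0" using assms by (auto simp: test_function_def)
  have C: "Ck (Suc k) f" for k using assms by (simp only: test_function_def)
  have "dx f (x, y) = 0 \<and> dy f (x, y) = 0" if xy: "(x, y) \<notin> K" for x y
  proof -
    have "open (- K)" using compact_imp_closed[OF K(1)] by (rule open_Compl)
    moreover have "(x, y) \<in> - K" using xy by simp
    ultimately obtain A B where "open A" "open B" "(x, y) \<in> A \<times> B" "A \<times> B \<subseteq> - K"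
      by (rule open_prod_elim)
    then have AB: "open A" "open B" "x \<in> A" "y \<in> B" "A \<times> B \<subseteq> - K" by auto
    have "((\<lambda>s. f (s, y)) has_real_derivative 0) (at x)"
      by (rule has_field_derivative_transform_within_open[OF DERIV_const[of 0] AB(1,3)]) (use AB K in auto)
    moreover have "((\<lambda>s. f (x, s)) has_real_derivative 0) (at y)"
      by (rule has_field_derivative_transform_within_open[OF DERIV_const[of 0] AB(2,4)]) (use AB K in auto)
    ultimately show ?thesis using Ck_dx_dy(3,4)[OF C, where x=x and y=y] DERIV_unique by blast
  qed
  then show "test_function \<Omega> (dx f)" "test_function \<Omega> (dy f)"
    unfolding test_function_def using Ck_dx_dy(1,2)[OF C] K by auto
qed

lemma test_function_pow:
  assumes "test_function \<Omega> f" shows "test_function \<Omega> ((dx ^^ i) ((dy ^^ j) f))"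
proof -
  have "test_function \<Omega> ((dy ^^ j) f)" using assms by (induction j) (auto intro: test_function_dx_dy)
  then show ?thesis by (induction i) (auto intro: test_function_dx_dy)
qed

lemma test_function_bounded: assumes "test_function \<Omega> f" obtains B where "\<And>p. \<bar>f p\<bar> \<le> B"
proof -
  obtain K where K: "compact K" "\<And>p. p \<notin> K \<Longrightarrow> f p = 0" using assms by (auto simp: test_function_def)
  have "Ck 0 f" using assms by (simp only: test_function_def)
  then have "continuous_on K f" by (auto intro: continuous_on_subset)
  then have "compact (f ` K)" using K by (intro compact_continuous_image)
  then obtain B where "\<And>p. p \<in> K \<Longrightarrow> \<bar>f p\<bar> \<le> B"
    using compact_imp_bounded[of "f ` K"] unfolding bounded_iff by force
  then have "\<bar>f p\<bar> \<le> max B 0" for p using K(2)[of p] by (cases "p \<in> K") (auto simp: le_max_iff_disj)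
  then show thesis by (rule that)
qed

lemma test_function_sqint: assumes "test_function \<Omega> f" shows "f \<in> sqint (PM l)"
proof -
  obtain B where "\<And>p. \<bar>f p\<bar> \<le> B" using test_function_bounded[OF assms] by blast
  moreover have "f \<in> borel_measurable borel" using assms Ck_measurable by (auto simp: test_function_def)
  ultimately show ?thesis by (intro ivp.sqint_bounded[of _ _ _ _ _ B] borel_measurable_ivp)
qed

lemma test_function_L2:
  assumes "test_function (plate l) f"
  shows "f \<in> L2 (plate l)" "(dx ^^ i) ((dy ^^ j) f) \<in> L2 (plate l)"
  using sqint_PM_L2[OF test_function_sqint[OF assms]]
    sqint_PM_L2[OF test_function_sqint[OF test_function_pow[OF assms]]] by auto

text \<open>In this form linearity of weak derivatives follows from bilinearity of the inner product.\<close>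
lemma is_weak_deriv_inner0:
  "is_weak_deriv (plate l) i j u g \<longleftrightarrow> (\<forall>f. test_function (plate l) f \<longrightarrow>
     inner0 (plate l) u ((dx ^^ i) ((dy ^^ j) f)) = (-1) ^ (i + j) * inner0 (plate l) g f)"
  by (simp add: is_weak_deriv_def inner0_def)

lemma is_weak_deriv_add:
  assumes "is_weak_deriv (plate l) i j u g" "is_weak_deriv (plate l) i j v h"
    "u \<in> L2 (plate l)" "g \<in> L2 (plate l)" "v \<in> L2 (plate l)" "h \<in> L2 (plate l)"
  shows "is_weak_deriv (plate l) i j (\<lambda>p. u p + v p) (\<lambda>p. g p + h p)"
  using assms unfolding is_weak_deriv_inner0
  by (auto simp: l2.add_left test_function_L2 distrib_left)

lemma is_weak_deriv_scale:
  assumes "is_weak_deriv (plate l) i j u g" "u \<in> L2 (plate l)" "g \<in> L2 (plate l)"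
  shows "is_weak_deriv (plate l) i j (\<lambda>p. c * u p) (\<lambda>p. c * g p)"
  using assms unfolding is_weak_deriv_inner0
  by (auto simp: l2.scale_left test_function_L2)

lemma H2_add: assumes "u \<in> H2 (plate l)" "v \<in> H2 (plate l)" shows "(\<lambda>p. u p + v p) \<in> H2 (plate l)"
proof -
  have "\<exists>g\<in>L2 (plate l). is_weak_deriv (plate l) i j (\<lambda>p. u p + v p) g" if "i + j \<le> 2" for i j
    using wderiv_spec[OF assms(1) that] wderiv_spec[OF assms(2) that] assms
    by (intro bexI[of _ "\<lambda>p. wderiv (plate l) i j u p + wderiv (plate l) i j v p"] is_weak_deriv_add l2.add_mem)
       (auto simp: H2_def)
  then show ?thesis using assms by (auto simp: H2_def l2.add_mem)
qed

lemma H2_scale: assumes "u \<in> H2 (plate l)" shows "(\<lambda>p. c * u p) \<in> H2 (plate l)"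
proof -
  have "\<exists>g\<in>L2 (plate l). is_weak_deriv (plate l) i j (\<lambda>p. c * u p) g" if "i + j \<le> 2" for i j
    using wderiv_spec[OF assms(1) that] assms
    by (intro bexI[of _ "\<lambda>p. c * wderiv (plate l) i j u p"] is_weak_deriv_scale l2.scale_mem)
       (auto simp: H2_def)
  then show ?thesis using assms by (auto simp: H2_def l2.scale_mem)
qed

definition W :: "real \<Rightarrow> nat \<Rightarrow> nat \<Rightarrow> field \<Rightarrow> field" where
  "W l i j u = rep l (wderiv (plate l) i j u)"

lemma W_sqint: "u \<in> H2 (plate l) \<Longrightarrow> i + j \<le> 2 \<Longrightarrow> W l i j u \<in> sqint (PM l)"
  unfolding W_def by (intro rep_L2 wderiv_spec)

lemma W_AE: "u \<in> H2 (plate l) \<Longrightarrow> i + j \<le> 2 \<Longrightarrow> AE p in PM l. wderiv (plate l) i j u p = W l i j u p"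
  unfolding W_def by (intro rep_L2 wderiv_spec)

lemma W_add:
  assumes "u \<in> H2 (plate l)" "v \<in> H2 (plate l)" "i + j \<le> 2"
  shows "AE p in PM l. W l i j (\<lambda>p. u p + v p) p = W l i j u p + W l i j v p"
proof -
  have "AE p in PM l. wderiv (plate l) i j (\<lambda>p. u p + v p) p = wderiv (plate l) i j u p + wderiv (plate l) i j v p"
    using wderiv_spec[OF assms(1,3)] wderiv_spec[OF assms(2,3)] assms
    by (intro wderiv_AE H2_add is_weak_deriv_add l2.add_mem) (auto simp: H2_def)
  then show ?thesis
    using W_AE[OF assms(1,3)] W_AE[OF assms(2,3)] W_AE[OF H2_add[OF assms(1,2)] assms(3)] by eventually_elim auto
qed

lemma W_scale:
  assumes "u \<in> H2 (plate l)" "i + j \<le> 2"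
  shows "AE p in PM l. W l i j (\<lambda>p. c * u p) p = c * W l i j u p"
proof -
  have "AE p in PM l. wderiv (plate l) i j (\<lambda>p. c * u p) p = c * wderiv (plate l) i j u p"
    using wderiv_spec[OF assms] assms
    by (intro wderiv_AE H2_scale is_weak_deriv_scale l2.scale_mem) (auto simp: H2_def)
  then show ?thesis
    using W_AE[OF assms] W_AE[OF H2_scale[OF assms(1), of c] assms(2)] by eventually_elim auto
qed

text \<open>The integrand of the plate form as a function of the second derivatives of both arguments.\<close>
definition plate_form :: "real \<Rightarrow> real \<Rightarrow> real \<Rightarrow> real \<Rightarrow> real \<Rightarrow> real \<Rightarrow> real \<Rightarrow> real" where
  "plate_form \<sigma> xx yy xy xx' yy' xy' = (xx + yy) * (xx' + yy') - (1 - \<sigma>) * (xx * yy' + yy * xx' - 2 * (xy * xy'))"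

lemma inner2_W:
  assumes u: "u \<in> H2 (plate l)" and v: "v \<in> H2 (plate l)"
  shows "inner2 l \<sigma> u v = (LINT p|PM l. plate_form \<sigma> (W l 2 0 u p) (W l 0 2 u p) (W l 1 1 u p) (W l 2 0 v p) (W l 0 2 v p) (W l 1 1 v p))"
proof -
  have *: "2 + 0 \<le> (2::nat)" "0 + 2 \<le> (2::nat)" "1 + 1 \<le> (2::nat)" by auto
  have m: "wderiv (plate l) i j w \<in> borel_measurable (lebesgue_on (plate l))"
    "W l i j w \<in> borel_measurable (PM l)"
    if "w \<in> H2 (plate l)" "i + j \<le> 2" for w i j
    using wderiv_spec(1)[OF that] W_sqint[OF that] by (auto simp: L2_def sqint_def)
  note m1 = m(1)[OF u *(1)] m(1)[OF u *(2)] m(1)[OF u *(3)] m(1)[OF v *(1)] m(1)[OF v *(2)] m(1)[OF v *(3)]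
  note m2 = m(2)[OF u *(1)] m(2)[OF u *(2)] m(2)[OF u *(3)] m(2)[OF v *(1)] m(2)[OF v *(2)] m(2)[OF v *(3)]
  show ?thesis
    unfolding inner2_def Let_def plate_form_def
  proof (rule integral_plate_AE)
    show "AE p in PM l. (wderiv (plate l) 2 0 u p + wderiv (plate l) 0 2 u p) * (wderiv (plate l) 2 0 v p + wderiv (plate l) 0 2 v p)
       - (1 - \<sigma>) * (wderiv (plate l) 2 0 u p * wderiv (plate l) 0 2 v p + wderiv (plate l) 0 2 u p * wderiv (plate l) 2 0 v p - 2 * (wderiv (plate l) 1 1 u p * wderiv (plate l) 1 1 v p))
       = (W l 2 0 u p + W l 0 2 u p) * (W l 2 0 v p + W l 0 2 v p)
       - (1 - \<sigma>) * (W l 2 0 u p * W l 0 2 v p + W l 0 2 u p * W l 2 0 v p - 2 * (W l 1 1 u p * W l 1 1 v p))"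
      using W_AE[OF u *(1)] W_AE[OF u *(2)] W_AE[OF u *(3)] W_AE[OF v *(1)] W_AE[OF v *(2)] W_AE[OF v *(3)]
      by eventually_elim auto
  qed (intro borel_measurable_diff borel_measurable_times borel_measurable_add borel_measurable_const m1 m2)+
qed

text \<open>Keeps the order 1 of a derivative from being rewritten to \<open>Suc 0\<close>.\<close>
declare One_nat_def [simp del]

section \<open>Traces and integration by parts on horizontal lines\<close>

abbreviation XM :: "real measure" where "XM \<equiv> iv 0 pi"
abbreviation YM :: "real \<Rightarrow> real measure" where "YM l \<equiv> iv (-l) l"

lemma AE_ivp_swap:
  assumes "AE p in iv a b \<Otimes>\<^sub>M iv c d. P p" shows "AE y in iv c d. AE x in iv a b. P (x, y)"
proof -
  have "AE p in distr (iv c d \<Otimes>\<^sub>M iv a b) (iv a b \<Otimes>\<^sub>M iv c d) (\<lambda>(x, y). (y, x)). P p"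
    using assms ivp.distr_pair_swap[of a b c d] by metis
  then have "AE q in iv c d \<Otimes>\<^sub>M iv a b. P (case q of (x, y) \<Rightarrow> (y, x))"
    by (rule AE_distrD[OF measurable_pair_swap'])
  then show ?thesis using ivp.AE_pair[of _ c d a b] by fastforce
qed

lemma slice_snd:
  assumes "f \<in> sqint (iv a b \<Otimes>\<^sub>M iv c d)" shows "AE y in iv c d. (\<lambda>x. f (x, y)) \<in> sqint (iv a b)"
proof -
  have [measurable]: "f \<in> borel_measurable (iv a b \<Otimes>\<^sub>M iv c d)" using assms by (simp add: sqint_def)
  have "AE y in iv c d. integrable (iv a b) (\<lambda>x. (f (x, y))\<^sup>2)"
    using ivp.AE_integrable_snd[where f="\<lambda>x y. (f (x, y))\<^sup>2"] sqint_integrable_sq[OF assms]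
    by (simp add: case_prod_beta')
  with AE_space show ?thesis by eventually_elim (auto simp: sqint_def)
qed

lemma ipM_snd:
  assumes "f \<in> sqint (iv a b \<Otimes>\<^sub>M iv c d)" "g \<in> sqint (iv a b \<Otimes>\<^sub>M iv c d)"
  shows "ipM (iv a b \<Otimes>\<^sub>M iv c d) f g = (LINT y|iv c d. LINT x|iv a b. f (x, y) * g (x, y))"
  unfolding ipM_def
  using ivp.integral_snd[where f="\<lambda>x y. f (x, y) * g (x, y)"] sqint_mult_integrable[OF assms]
  by (simp add: case_prod_beta')

lemma LINT_snd_measurable:
  fixes f :: "real \<times> real \<Rightarrow> real"
  assumes "integrable (iv a b \<Otimes>\<^sub>M iv c d) f"
  shows "(\<lambda>y. LINT x|iv a b. f (x, y)) \<in> borel_measurable (iv c d)"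
  using ivp.integrable_snd[where f="\<lambda>x y. f (x, y)"] assms by (auto simp: case_prod_beta')

lemma H2star_H2: "u \<in> H2star l \<Longrightarrow> u \<in> H2 (plate l)" by (simp add: H2star_def)
lemma H2_L2: "u \<in> H2 (plate l) \<Longrightarrow> u \<in> L2 (plate l)" by (simp add: H2_def)

lemma rep_integrable: "u \<in> H2 (plate l) \<Longrightarrow> integrable (PM l) (rep l u)"
  by (intro integrable_rep H2_L2)
lemma rep_sqint: "u \<in> H2 (plate l) \<Longrightarrow> rep l u \<in> sqint (PM l)"
  by (intro rep_L2 H2_L2)
lemma W_integrable: "u \<in> H2 (plate l) \<Longrightarrow> i + j \<le> 2 \<Longrightarrow> integrable (PM l) (W l i j u)"
  by (intro ivp.sqint_integrable W_sqint)

lemma W_weak: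
  assumes "u \<in> H2 (plate l)" "i + j \<le> 2" "test1 0 pi \<eta>" "test1 (-l) l \<zeta>"
  shows "(LINT p|PM l. rep l u p * tens ((deriv ^^ i) \<eta>) ((deriv ^^ j) \<zeta>) p)
     = (-1) ^ (i + j) * (LINT p|PM l. W l i j u p * tens \<eta> \<zeta> p)"
  unfolding W_def
  by (rule weak_deriv_tens[OF wderiv_spec(2)[OF assms(1,2)] H2_L2[OF assms(1)] wderiv_spec(1)[OF assms(1,2)] assms(3,4)])

lemma deriv_pow: "((deriv :: (real \<Rightarrow> real) \<Rightarrow> _) ^^ 1) = deriv" "((deriv :: (real \<Rightarrow> real) \<Rightarrow> _) ^^ 2) f = deriv (deriv f)"
  by (auto simp: numeral_2_eq_2 One_nat_def)

lemma u_fst_prim: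
  assumes u: "u \<in> H2 (plate l)" obtains C where "integrable (YM l) C"
    "AE p in PM l. rep l u p = C (snd p) + prim XM (\<lambda>s. W l 1 0 u (s, snd p)) (fst p)"
  by (rule weak_deriv_fst_primitive[OF pi_gt_zero rep_integrable[OF u] W_integrable[OF u, of 1 0]])
     (use W_weak[OF u, of 1 0] in \<open>auto simp: deriv_pow\<close>)

lemma ux_fst_prim:
  assumes u: "u \<in> H2 (plate l)" obtains C where "integrable (YM l) C"
    "AE p in PM l. W l 1 0 u p = C (snd p) + prim XM (\<lambda>s. W l 2 0 u (s, snd p)) (fst p)"
proof (rule weak_deriv_fst_primitive[OF pi_gt_zero W_integrable[OF u, of 1 0] W_integrable[OF u, of 2 0]])
  fix \<eta> \<zeta> assume t: "test1 0 pi \<eta>" "test1 (-l) l \<zeta>"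
  show "(LINT p|PM l. W l 1 0 u p * tens (deriv \<eta>) \<zeta> p) = - (LINT p|PM l. W l 2 0 u p * tens \<eta> \<zeta> p)"
    using W_weak[OF u _ t, of 2 0] W_weak[OF u _ test1_deriv[OF t(1)] t(2), of 1 0] by (simp add: deriv_pow)
qed auto

lemma u_snd_prim:
  assumes l: "0 < l" and u: "u \<in> H2 (plate l)" obtains C where "integrable XM C"
    "AE p in PM l. rep l u p = C (fst p) + prim (YM l) (\<lambda>s. W l 0 1 u (fst p, s)) (snd p)"
  by (rule weak_deriv_snd_primitive[OF _ rep_integrable[OF u] W_integrable[OF u, of 0 1]])
     (use l W_weak[OF u, of 0 1] in \<open>auto simp: deriv_pow\<close>)

lemma uy_snd_prim:
  assumes l: "0 < l" and u: "u \<in> H2 (plate l)" obtains C where "integrable XM C"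
    "AE p in PM l. W l 0 1 u p = C (fst p) + prim (YM l) (\<lambda>s. W l 0 2 u (fst p, s)) (snd p)"
proof (rule weak_deriv_snd_primitive[OF _ W_integrable[OF u, of 0 1] W_integrable[OF u, of 0 2]])
  fix \<eta> \<zeta> assume t: "test1 0 pi \<eta>" "test1 (-l) l \<zeta>"
  show "(LINT p|PM l. W l 0 1 u p * tens \<eta> (deriv \<zeta>) p) = - (LINT p|PM l. W l 0 2 u p * tens \<eta> \<zeta> p)"
    using W_weak[OF u _ t, of 0 2] W_weak[OF u _ t(1) test1_deriv[OF t(2)], of 0 1] by (simp add: deriv_pow)
qed (use l in auto)

lemma ux_snd_prim:
  assumes l: "0 < l" and u: "u \<in> H2 (plate l)" obtains C where "integrable XM C"
    "AE p in PM l. W l 1 0 u p = C (fst p) + prim (YM l) (\<lambda>s. W l 1 1 u (fst p, s)) (snd p)"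
proof (rule weak_deriv_snd_primitive[OF _ W_integrable[OF u, of 1 0] W_integrable[OF u, of 1 1]])
  fix \<eta> \<zeta> assume t: "test1 0 pi \<eta>" "test1 (-l) l \<zeta>"
  show "(LINT p|PM l. W l 1 0 u p * tens \<eta> (deriv \<zeta>) p) = - (LINT p|PM l. W l 1 1 u p * tens \<eta> \<zeta> p)"
    using W_weak[OF u _ t, of 1 1] W_weak[OF u _ t(1) test1_deriv[OF t(2)], of 1 0] by (simp add: deriv_pow)
qed (use l in auto)

text \<open>A nonempty open set is not null; continuity extends the equality to the closed interval.\<close>
lemma AE_eq_continuous:
  fixes f g :: "real \<Rightarrow> real"
  assumes "a < b" "AE x in iv a b. f x = g x" "continuous_on {a..b} f" "continuous_on {a..b} g" "x \<in> {a..b}"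
  shows "f x = g x"
proof -
  have cl: "closure {a<..<b} = {a..b}" using assms by simp
  have "f x - g x = 0" if x: "x \<in> {a<..<b}" for x
  proof (rule ccontr)
    assume nz: "f x - g x \<noteq> 0"
    have "continuous_on {a<..<b} (\<lambda>x. f x - g x)"
      by (intro continuous_on_diff continuous_on_subset[OF assms(3)] continuous_on_subset[OF assms(4)]) auto
    then have "open ((\<lambda>x. f x - g x) -` (- {0}) \<inter> {a<..<b})"
      using continuous_on_open_vimage[of "{a<..<b}" "\<lambda>x. f x - g x"] by auto
    then have "(\<lambda>x. f x - g x) -` (- {0}) \<inter> {a<..<b} \<notin> null_sets lborel"
      using x nz by (metis (no_types, lifting) ComplI IntI empty_iff open_not_negligible negligible_iff_null_sets null_sets_completionI singletonD vimageI)
    moreover have "AE x in lborel. x \<notin> (\<lambda>x. f x - g x) -` (- {0}) \<inter> {a<..<b}"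
      using assms(2) unfolding AE_iv by eventually_elim auto
    ultimately show False
      using AE_iff_null_sets[of "(\<lambda>x. f x - g x) -` (- {0}) \<inter> {a<..<b}" lborel]
        \<open>open ((\<lambda>x. f x - g x) -` (- {0}) \<inter> {a<..<b})\<close> by auto
  qed
  then have "f x - g x = 0"
    using continuous_constant_on_closure[of "{a<..<b}" "\<lambda>x. f x - g x" 0 x] assms(3-5) cl
    by (auto intro!: continuous_intros)
  then show ?thesis by simp
qed

text \<open>On almost every horizontal line u is C + the primitive of u_x and agrees with the continuous
  function that vanishes at both ends. The left end forces C = 0, the right end forces u_x to have
  mean zero.\<close>
lemma H2star_slice:
  assumes l: "0 < l" and u: "u \<in> H2star l"
  shows "AE y in YM l. (\<lambda>x. W l 1 0 u (x, y)) \<in> sqint XM \<and>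
    (AE x in XM. rep l u (x, y) = prim XM (\<lambda>s. W l 1 0 u (s, y)) x) \<and> (LINT x|XM. W l 1 0 u (x, y)) = 0"
proof -
  have u2: "u \<in> H2 (plate l)" using u by (rule H2star_H2)
  obtain v where v: "continuous_on ({0..pi} \<times> {-l..l}) v" "AE p in lebesgue_on (plate l). u p = v p"
    "\<And>p. p \<in> {0, pi} \<times> {-l..l} \<Longrightarrow> v p = 0" using u by (auto simp: H2star_def)
  obtain C where C: "AE p in PM l. rep l u p = C (snd p) + prim XM (\<lambda>s. W l 1 0 u (s, snd p)) (fst p)"
    using u_fst_prim[OF u2] by blast
  have "AE p in PM l. rep l u p = v p \<and> v p = C (snd p) + prim XM (\<lambda>s. W l 1 0 u (s, snd p)) (fst p)"
    using C rep_L2(2)[OF H2_L2[OF u2]] v(2)[unfolded AE_plate] by eventually_elim auto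
  from AE_ivp_swap[OF this] slice_snd[OF W_sqint[OF u2, of 1 0, simplified]] AE_space
  show ?thesis
  proof eventually_elim
    case (elim y)
    have y: "-l < y" "y < l" using elim(3) by auto
    have sq: "(\<lambda>x. W l 1 0 u (x, y)) \<in> sqint XM" using elim(2) by simp
    note int = iv.sqint_integrable[OF sq]
    have ae: "AE x in XM. v (x, y) = C y + prim XM (\<lambda>s. W l 1 0 u (s, y)) x"
      using elim(1) by eventually_elim auto
    have eq: "v (x, y) = C y + prim XM (\<lambda>s. W l 1 0 u (s, y)) x" if "x \<in> {0..pi}" for x
    proof (rule AE_eq_continuous[OF pi_gt_zero ae _ _ that])
      show "continuous_on {0..pi} (\<lambda>x. v (x, y))"
        by (rule continuous_on_compose2[OF v(1)]) (use y in \<open>auto intro!: continuous_intros\<close>)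
      show "continuous_on {0..pi} (\<lambda>x. C y + prim XM (\<lambda>s. W l 1 0 u (s, y)) x)"
        by (intro continuous_intros continuous_on_subset[OF prim_continuous[OF int]]) auto
    qed
    have C0: "C y = 0" using eq[of 0] v(3)[of "(0, y)"] y by (simp add: prim_left)
    have "prim XM (\<lambda>s. W l 1 0 u (s, y)) pi = 0" using eq[of pi] v(3)[of "(pi, y)"] y C0 by simp
    then have "(LINT x|XM. W l 1 0 u (x, y)) = 0" by (simp add: prim_right)
    moreover have "AE x in XM. rep l u (x, y) = prim XM (\<lambda>s. W l 1 0 u (s, y)) x"
      using elim(1) by eventually_elim (auto simp: C0)
    ultimately show ?case using sq by auto
  qed
qed

text \<open>On each line the boundary term vanishes by the boundary condition on v.\<close>
theorem inner_x_by_parts: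
  assumes l: "0 < l" and u: "u \<in> H2 (plate l)" and v: "v \<in> H2star l"
  shows "inner_x l u v = - ipM (PM l) (W l 2 0 u) (rep l v)"
proof -
  have v2: "v \<in> H2 (plate l)" using v by (rule H2star_H2)
  note s1 = W_sqint[OF u, of 1 0, simplified] W_sqint[OF v2, of 1 0, simplified] W_sqint[OF u, of 2 0, simplified] rep_sqint[OF v2]
  have "inner_x l u v = ipM (PM l) (W l 1 0 u) (W l 1 0 v)"
    unfolding inner_x_def W_def by (intro inner0_rep wderiv_spec u v2) auto
  also have "\<dots> = (LINT y|YM l. LINT x|XM. W l 1 0 u (x, y) * W l 1 0 v (x, y))"
    using s1 by (intro ipM_snd) auto
  also have "\<dots> = (LINT y|YM l. - (LINT x|XM. W l 2 0 u (x, y) * rep l v (x, y)))"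
  proof (rule integral_cong_AE)
    obtain C where C: "AE p in PM l. W l 1 0 u p = C (snd p) + prim XM (\<lambda>s. W l 2 0 u (s, snd p)) (fst p)"
      using ux_fst_prim[OF u] by blast
    show "AE y in YM l. (LINT x|XM. W l 1 0 u (x, y) * W l 1 0 v (x, y)) = - (LINT x|XM. W l 2 0 u (x, y) * rep l v (x, y))"
      using H2star_slice[OF l v] AE_ivp_swap[OF C] slice_snd[OF s1(3)] slice_snd[OF s1(1)[simplified]] slice_snd[OF s1(4)]
    proof eventually_elim
      case (elim y)
      define vx where "vx = (\<lambda>x. W l 1 0 v (x, y))"
      define uxx where "uxx = (\<lambda>x. W l 2 0 u (x, y))"
      have vx: "vx \<in> sqint XM" "AE x in XM. rep l v (x, y) = prim XM vx x" "(LINT x|XM. vx x) = 0"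
        using elim(1) by (auto simp: vx_def)
      have uxx: "uxx \<in> sqint XM" using elim(3) by (simp add: uxx_def)
      have ux: "AE x in XM. W l 1 0 u (x, y) = C y + prim XM uxx x" using elim(2) by (simp add: uxx_def)
      note int = iv.sqint_integrable[OF vx(1)] iv.sqint_integrable[OF uxx]
      have [measurable]: "vx \<in> borel_measurable XM" "uxx \<in> borel_measurable XM" using int by auto
      have [measurable]: "prim XM vx \<in> borel_measurable XM" "prim XM uxx \<in> borel_measurable XM"
        using prim_measurable[OF int(1)] prim_measurable[OF int(2)] by (auto intro: measurable_iv)
      have [measurable]: "(\<lambda>x. W l 1 0 u (x, y)) \<in> borel_measurable XM" "(\<lambda>x. rep l v (x, y)) \<in> borel_measurable XM"
        using elim(4,5) by (auto simp: sqint_def)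
      have "(LINT x|XM. W l 1 0 u (x, y) * vx x) = (LINT x|XM. C y * vx x + vx x * prim XM uxx x)"
      proof (rule integral_cong_AE)
        show "AE x in XM. W l 1 0 u (x, y) * vx x = C y * vx x + vx x * prim XM uxx x"
          using ux by eventually_elim (simp add: algebra_simps)
      qed measurable
      also have "\<dots> = C y * (LINT x|XM. vx x) + (LINT x|XM. vx x * prim XM uxx x)"
        using int prim_abs_le[OF int(2)]
        by (subst Bochner_Integration.integral_add) (auto intro!: integrable_mult_bounded)
      also have "\<dots> = (LINT x|XM. vx x) * (LINT x|XM. uxx x) - (LINT x|XM. prim XM vx x * uxx x)"
        using prim_by_parts[OF int] vx(3) by simp
      also have "\<dots> = - (LINT x|XM. prim XM vx x * uxx x)" using vx(3) by simp
      also have "(LINT x|XM. prim XM vx x * uxx x) = (LINT x|XM. uxx x * rep l v (x, y))"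
        by (rule integral_cong_AE) (use vx(2) in \<open>auto elim!: eventually_mono\<close>)
      finally show ?case by (simp add: vx_def uxx_def)
    qed
    show "(\<lambda>y. LINT x|XM. W l 1 0 u (x, y) * W l 1 0 v (x, y)) \<in> borel_measurable (YM l)"
      using s1 by (intro LINT_snd_measurable[where f="\<lambda>p. W l 1 0 u p * W l 1 0 v p"] sqint_mult_integrable) auto
    show "(\<lambda>y. - (LINT x|XM. W l 2 0 u (x, y) * rep l v (x, y))) \<in> borel_measurable (YM l)"
      using s1 by (intro borel_measurable_uminus LINT_snd_measurable[where f="\<lambda>p. W l 2 0 u p * rep l v p"] sqint_mult_integrable) auto
  qed
  also have "\<dots> = - ipM (PM l) (W l 2 0 u) (rep l v)"
    using s1 by (subst ipM_snd) auto
  finally show ?thesis .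
qed

section \<open>Fourier coefficients of plate functions\<close>

definition coef :: "(real \<Rightarrow> real) \<Rightarrow> field \<Rightarrow> real \<Rightarrow> real" where
  "coef g f y = (LINT x|XM. f (x, y) * g x)"

lemma bounded_cont:
  assumes "continuous_on UNIV (g :: real \<Rightarrow> real)" obtains B where "B \<ge> 0" "\<And>x. x \<in> {a..b} \<Longrightarrow> \<bar>g x\<bar> \<le> B"
proof -
  have "compact (g ` {a..b})" using assms by (intro compact_continuous_image) (auto intro: continuous_on_subset)
  then obtain B where "\<And>x. x \<in> {a..b} \<Longrightarrow> \<bar>g x\<bar> \<le> B"
    using compact_imp_bounded[of "g ` {a..b}"] unfolding bounded_iff by force
  then show thesis using that[of "max B 0"] by (force simp: le_max_iff_disj)
qed

lemma cont_sqint: assumes "continuous_on UNIV (g :: real \<Rightarrow> real)" shows "g \<in> sqint (iv a b)"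
proof -
  obtain B where "\<And>x. x \<in> {a..b} \<Longrightarrow> \<bar>g x\<bar> \<le> B" using bounded_cont[OF assms] by metis
  then show ?thesis
    by (intro iv.sqint_bounded[of _ _ _ B]) (auto intro: measurable_iv borel_measurable_continuous_onI[OF assms])
qed

lemma tensor_sqint:
  assumes f: "f \<in> sqint (iv a b)" and g: "g \<in> sqint (iv c d)"
  shows "tens f g \<in> sqint (iv a b \<Otimes>\<^sub>M iv c d)"
proof -
  have [measurable]: "f \<in> borel_measurable (iv a b)" "g \<in> borel_measurable (iv c d)" using assms by (auto simp: sqint_def)
  have "tens f g \<in> borel_measurable (iv a b \<Otimes>\<^sub>M iv c d)" unfolding tens_def by measurable
  moreover have "integrable (iv a b \<Otimes>\<^sub>M iv c d) (\<lambda>p. (tens f g p)\<^sup>2)"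
    using integrable_tensor[OF sqint_integrable_sq[OF f] sqint_integrable_sq[OF g]]
    by (simp add: tens_def case_prod_beta' power_mult_distrib)
  ultimately show ?thesis by (simp add: sqint_def)
qed

lemma coef_sqint:
  assumes f: "f \<in> sqint (PM l)" and g: "continuous_on UNIV g"
  shows "coef g f \<in> sqint (YM l)"
proof -
  have gs: "g \<in> sqint XM" by (rule cont_sqint[OF g])
  have one: "(\<lambda>x. 1) \<in> sqint (YM l)" by (rule cont_sqint) auto
  have i: "integrable (PM l) (\<lambda>p. f p * tens g (\<lambda>y. 1) p)"
    by (intro sqint_mult_integrable f tensor_sqint gs one)
  have m: "coef g f \<in> borel_measurable (YM l)"
    unfolding coef_def using LINT_snd_measurable[OF i] by (simp add: tens_def)
  define K where "K y = (LINT x|XM. (f (x, y))\<^sup>2) * ipM XM g g" for y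
  have Ki: "integrable (YM l) K"
    unfolding K_def using ivp.integrable_snd[where f="\<lambda>x y. (f (x, y))\<^sup>2"] sqint_integrable_sq[OF f]
    by (simp add: case_prod_beta')
  have "integrable (YM l) (\<lambda>y. (coef g f y)\<^sup>2)"
  proof (rule Bochner_Integration.integrable_bound[OF Ki])
    show "AE y in YM l. norm ((coef g f y)\<^sup>2) \<le> norm (K y)"
      using slice_snd[OF f]
    proof eventually_elim
      case (elim y)
      have "(coef g f y)\<^sup>2 \<le> K y"
        using sq.Cauchy_Schwarz_sq[OF elim gs] by (simp add: coef_def K_def ipM_def power2_eq_square)
      then show ?case by simp
    qed
  qed (use m in measurable)
  with m show ?thesis by (simp add: sqint_def)
qed

lemma ipM_tens:
  assumes f: "f \<in> sqint (PM l)" and g: "continuous_on UNIV g" and z: "\<zeta> \<in> sqint (YM l)"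
  shows "ipM (PM l) f (tens g \<zeta>) = ipM (YM l) (coef g f) \<zeta>"
  by (subst ipM_snd[OF f tensor_sqint[OF cont_sqint[OF g] z]])
     (simp add: ipM_def coef_def tens_def mult.assoc[symmetric])

text \<open>The lemma of du Bois-Reymond, obtained from the two-dimensional fundamental lemma by a dummy first
  variable.\<close>
lemma prim_const_zero:
  assumes g: "integrable (iv a b) g" and ab: "a < b" and 0: "\<And>x. x \<in> {a..b} \<Longrightarrow> prim (iv a b) g x = 0"
  shows "AE x in iv a b. g x = 0"
proof -
  let ?M = "iv 0 1 \<Otimes>\<^sub>M iv a b"
  have gi: "integrable ?M (\<lambda>p. g (snd p))"
    using integrable_tensor[of 0 1 "\<lambda>x. 1" a b g] g by (simp add: case_prod_beta')
  have gm: "(LINT x|iv a b. g x * \<zeta> x) = 0" if t: "test1 a b \<zeta>" for \<zeta>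
  proof -
    have "(LINT x|iv a b. deriv \<zeta> x * prim (iv a b) g x) + (LINT x|iv a b. prim (iv a b) (deriv \<zeta>) x * g x)
        = integral\<^sup>L (iv a b) (deriv \<zeta>) * integral\<^sup>L (iv a b) g"
      by (rule prim_by_parts[OF test1_integrable[OF test1_deriv[OF t]] g])
    moreover have "(LINT x|iv a b. deriv \<zeta> x * prim (iv a b) g x) = (LINT x|iv a b. 0)"
      by (rule Bochner_Integration.integral_cong) (auto simp: 0)
    moreover have "integral\<^sup>L (iv a b) g = 0" using 0[of b] ab by (simp add: prim_right)
    moreover have "(LINT x|iv a b. prim (iv a b) (deriv \<zeta>) x * g x) = (LINT x|iv a b. g x * \<zeta> x)"
      by (rule Bochner_Integration.integral_cong) (auto simp: test1_prim_deriv[OF t])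
    ultimately show ?thesis by simp
  qed
  have "AE p in ?M. g (snd p) = 0"
  proof (rule fundamental_lemma_tens[OF gi])
    fix \<eta> \<zeta> assume t: "test1 0 1 \<eta>" "test1 a b \<zeta>"
    have "integrable ?M (\<lambda>p. g (snd p) * tens \<eta> \<zeta> p)" by (rule integrable_mult_tens[OF gi t])
    then have "(LINT p|?M. g (snd p) * tens \<eta> \<zeta> p) = (LINT x|iv 0 1. LINT y|iv a b. \<eta> x * (g y * \<zeta> y))"
      by (subst ivp.integral_fst'[symmetric]) (auto simp: tens_def mult.left_commute)
    then show "(LINT p|?M. g (snd p) * tens \<eta> \<zeta> p) = 0" using gm[OF t(2)] by simp
  qed
  from ivp.AE_pair[OF this] have "AE x in iv 0 1. AE y in iv a b. g y = 0" by simp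
  moreover have "\<not> (AE x in iv 0 1. False)"
  proof
    assume "AE x in iv 0 1. False"
    then have "AE x in lborel. x \<notin> {0<..<1::real}" unfolding AE_iv by eventually_elim auto
    then have "emeasure lborel {0<..<1::real} = 0"
      by (subst (asm) AE_iff_measurable[where N="{0<..<1::real}"]) auto
    then show False by simp
  qed
  ultimately show ?thesis
    by (cases "AE y in iv a b. g y = 0") auto
qed

text \<open>Taking coefficients commutes with integration in y, by Fubini; the function C of x contributes a
  constant.\<close>
lemma coef_prim:
  assumes F: "F \<in> sqint (PM l)" and G: "G \<in> sqint (PM l)" and g: "continuous_on UNIV g" and C: "integrable XM C"
    and FG: "AE p in PM l. F p = C (fst p) + prim (YM l) (\<lambda>s. G (fst p, s)) (snd p)"
  shows "\<exists>\<alpha>. AE y in YM l. coef g F y = \<alpha> + prim (YM l) (coef g G) y"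
proof (intro exI)
  obtain B where B: "\<And>x. x \<in> {0..pi} \<Longrightarrow> \<bar>g x\<bar> \<le> B" using bounded_cont[OF g] by metis
  have [measurable]: "g \<in> borel_measurable borel" by (rule borel_measurable_continuous_onI[OF g])
  have [measurable]: "G \<in> borel_measurable (PM l)" "F \<in> borel_measurable (PM l)" "C \<in> borel_measurable XM"
    using F G C by (auto simp: sqint_def)
  have Cg: "integrable XM (\<lambda>x. C x * g x)"
    using C B by (intro integrable_mult_bounded[of _ _ _ B]) auto
  have one: "(\<lambda>x. 1) \<in> sqint (YM l)" by (rule cont_sqint) auto
  have Gg: "integrable (PM l) (\<lambda>p. G p * tens g (\<lambda>y. 1) p)"
    by (intro sqint_mult_integrable G tensor_sqint cont_sqint g one)
  show "AE y in YM l. coef g F y = (LINT x|XM. C x * g x) + prim (YM l) (coef g G) y"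
    using AE_ivp_swap[OF FG] slice_snd[OF F]
  proof eventually_elim
    case (elim y)
    have [measurable]: "(\<lambda>x. F (x, y)) \<in> borel_measurable XM" using elim(2) by (simp add: sqint_def)
    define Q where "Q = (\<lambda>p. indicator {..y} (snd p) * (G p * tens g (\<lambda>y. 1) p))"
    have Qi: "integrable (PM l) Q"
      unfolding Q_def
    proof (rule Bochner_Integration.integrable_bound[OF Gg])
      have "tens g (\<lambda>y. 1) \<in> borel_measurable (PM l)" by (intro tens_measurable) auto
      note [measurable] = this
      show "(\<lambda>p. indicat_real {..y} (snd p) * (G p * tens g (\<lambda>y. 1) p)) \<in> borel_measurable (PM l)"
        by measurable
    qed (auto simp: indicator_def)
    have Qp: "(LINT s|YM l. Q (x, s)) = prim (YM l) (\<lambda>s. G (x, s)) y * g x" for x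
      unfolding Q_def prim_def tens_def by (simp add: mult.assoc[symmetric])
    have Pi: "integrable XM (\<lambda>x. prim (YM l) (\<lambda>s. G (x, s)) y * g x)"
      using ivp.integrable_fst'[OF Qi] by (simp add: Qp)
    have "coef g F y = (LINT x|XM. C x * g x + prim (YM l) (\<lambda>s. G (x, s)) y * g x)"
      unfolding coef_def
    proof (rule integral_cong_AE)
      show "AE x in XM. F (x, y) * g x = C x * g x + prim (YM l) (\<lambda>s. G (x, s)) y * g x"
        using elim(1) by eventually_elim (simp add: algebra_simps)
      show "(\<lambda>x. C x * g x + prim (YM l) (\<lambda>s. G (x, s)) y * g x) \<in> borel_measurable XM" using Cg Pi by auto
    qed measurable
    also have "\<dots> = (LINT x|XM. C x * g x) + (LINT x|XM. LINT s|YM l. Q (x, s))"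
      using Cg Pi by (simp add: Qp)
    also have "(LINT x|XM. LINT s|YM l. Q (x, s)) = (LINT s|YM l. LINT x|XM. Q (x, s))"
      using ivp.Fubini_integral[where f="\<lambda>x s. Q (x, s)"] Qi by (simp add: case_prod_beta')
    also have "\<dots> = prim (YM l) (coef g G) y"
      unfolding prim_def coef_def Q_def tens_def by (simp add: mult.assoc)
    finally show ?case .
  qed
qed

text \<open>The space H^2(-l, l) with the first and second derivative given explicitly: \<phi>1 is a primitive
  of \<phi>2, and \<phi> of \<phi>1, on the closed interval. The ends are free, as the boundary
  conditions at y = \<plusminus>l are natural.\<close>
definition W2 :: "real \<Rightarrow> (real \<Rightarrow> real) \<Rightarrow> (real \<Rightarrow> real) \<Rightarrow> (real \<Rightarrow> real) \<Rightarrow> bool" where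
  "W2 l \<phi> \<phi>1 \<phi>2 \<longleftrightarrow> \<phi>2 \<in> sqint (YM l) \<and>
     (\<forall>y\<in>{-l..l}. \<phi>1 y = \<phi>1 (-l) + prim (YM l) \<phi>2 y) \<and>
     (\<forall>y\<in>{-l..l}. \<phi> y = \<phi> (-l) + prim (YM l) \<phi>1 y)"

definition sn :: "nat \<Rightarrow> real \<Rightarrow> real" where "sn m x = sin (real m * x)"
definition cs :: "nat \<Rightarrow> real \<Rightarrow> real" where "cs m x = cos (real m * x)"

lemma sn_cont: "continuous_on A (sn m)" unfolding sn_def by (intro continuous_intros)
lemma cs_cont: "continuous_on A (cs m)" unfolding cs_def by (intro continuous_intros)

lemma prim_sn: assumes "x \<in> {0..pi}" shows "prim XM (\<lambda>x. - real m * sn m x) x = cs m x - 1"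
proof -
  have "prim XM (\<lambda>x. - real m * sn m x) x = cs m x - cs m 0"
    using assms by (intro prim_FTC[where b=pi])
      (auto simp: cs_def sn_def intro!: derivative_eq_intros continuous_intros)
  then show ?thesis by (simp add: cs_def)
qed

lemma prim_cs: assumes "x \<in> {0..pi}" shows "prim XM (\<lambda>x. real m * cs m x) x = sn m x"
proof -
  have "prim XM (\<lambda>x. real m * cs m x) x = sn m x - sn m 0"
    using assms by (intro prim_FTC[where b=pi])
      (auto simp: cs_def sn_def intro!: derivative_eq_intros continuous_intros)
  then show ?thesis by (simp add: sn_def)
qed

lemma sn_pi: "sn m pi = 0" by (simp add: sn_def)

text \<open>Integration by parts on lines. Since u_x has mean zero, cos(m x) may be replaced by cos(m x) - 1,
  the primitive of -m sin(m x) that vanishes at 0.\<close>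
lemma coef_ux:
  assumes l: "0 < l" and u: "u \<in> H2star l"
  shows "AE y in YM l. coef (cs m) (W l 1 0 u) y = real m * coef (sn m) (rep l u) y"
  using H2star_slice[OF l u] slice_snd[OF rep_sqint[OF H2star_H2[OF u]]]
proof eventually_elim
  case (elim y)
  define f where "f = (\<lambda>x. W l 1 0 u (x, y))"
  have f: "f \<in> sqint XM" "AE x in XM. rep l u (x, y) = prim XM f x" "(LINT x|XM. f x) = 0"
    using elim by (auto simp: f_def)
  note int = iv.sqint_integrable[OF f(1)]
  have [measurable]: "(\<lambda>x. rep l u (x, y)) \<in> borel_measurable XM" using elim by (simp add: sqint_def)
  have [measurable]: "prim XM f \<in> borel_measurable XM" using prim_measurable[OF int] by (rule measurable_iv)
  have [measurable]: "sn m \<in> borel_measurable borel" "cs m \<in> borel_measurable borel"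
    by (auto intro!: borel_measurable_continuous_onI sn_cont cs_cont)
  have si: "integrable XM (\<lambda>x. - real m * sn m x)"
    by (intro iv.sqint_integrable cont_sqint continuous_intros sn_cont)
  have fc: "integrable XM (\<lambda>x. f x * cs m x)"
    using int by (intro integrable_mult_bounded[of _ _ _ 1]) (auto simp: cs_def)
  have "(LINT x|XM. f x * cs m x) = (LINT x|XM. f x * cs m x) - (LINT x|XM. f x)" using f(3) by simp
  also have "\<dots> = (LINT x|XM. f x * cs m x - f x)" using fc int by simp
  also have "\<dots> = (LINT x|XM. f x * prim XM (\<lambda>x. - real m * sn m x) x)"
  proof (intro Bochner_Integration.integral_cong refl)
    fix x assume "x \<in> space XM"
    then have x: "x \<in> {0..pi}" by auto
    show "f x * cs m x - f x = f x * prim XM (\<lambda>x. - real m * sn m x) x"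
      unfolding prim_sn[OF x] by (simp add: algebra_simps)
  qed
  also have "\<dots> = - (LINT x|XM. prim XM f x * (- real m * sn m x))"
    using prim_by_parts[OF int si] f(3) by simp
  also have "\<dots> = (LINT x|XM. real m * (prim XM f x * sn m x))"
    by (simp add: algebra_simps)
  also have "\<dots> = real m * (LINT x|XM. prim XM f x * sn m x)" by simp
  also have "(LINT x|XM. prim XM f x * sn m x) = (LINT x|XM. rep l u (x, y) * sn m x)"
  proof (rule integral_cong_AE)
    show "AE x in XM. prim XM f x * sn m x = rep l u (x, y) * sn m x" using f(2) by eventually_elim simp
  qed measurable
  finally show ?case by (simp add: coef_def f_def)
qed

text \<open>The boundary terms vanish because sin(m x) is zero at both ends.\<close>
lemma coef_uxx:
  assumes u: "u \<in> H2 (plate l)"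
  shows "AE y in YM l. coef (sn m) (W l 2 0 u) y = - real m * coef (cs m) (W l 1 0 u) y"
proof -
  obtain C where C: "AE p in PM l. W l 1 0 u p = C (snd p) + prim XM (\<lambda>s. W l 2 0 u (s, snd p)) (fst p)"
    using ux_fst_prim[OF u] by blast
  show ?thesis
    using AE_ivp_swap[OF C] slice_snd[OF W_sqint[OF u, of 2 0, simplified]] slice_snd[OF W_sqint[OF u, of 1 0, simplified]]
  proof eventually_elim
    case (elim y)
    define f where "f = (\<lambda>x. W l 2 0 u (x, y))"
    define h where "h = (\<lambda>x. W l 1 0 u (x, y))"
    have f: "f \<in> sqint XM" "AE x in XM. h x = C y + prim XM f x" "h \<in> sqint XM"
      using elim by (auto simp: f_def h_def)
    note int = iv.sqint_integrable[OF f(1)] iv.sqint_integrable[OF f(3)]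
    have [measurable]: "h \<in> borel_measurable XM" using f by (simp add: sqint_def)
    have [measurable]: "prim XM f \<in> borel_measurable XM" using prim_measurable[OF int(1)] by (rule measurable_iv)
    have [measurable]: "cs m \<in> borel_measurable borel"
      by (auto intro!: borel_measurable_continuous_onI cs_cont)
    have ci: "integrable XM (\<lambda>x. real m * cs m x)"
      by (intro iv.sqint_integrable cont_sqint continuous_intros cs_cont)
    have c0: "(LINT x|XM. real m * cs m x) = 0"
      using prim_cs[of pi m] prim_right[of pi pi 0 "\<lambda>x. real m * cs m x"] by (simp add: sn_pi)
    have hc: "integrable XM (\<lambda>x. h x * (real m * cs m x))"
      using int(2) by (intro integrable_mult_bounded[of _ _ _ "real m"]) (auto simp: cs_def abs_mult mult_left_le)
    have "(LINT x|XM. f x * sn m x) = (LINT x|XM. f x * prim XM (\<lambda>x. real m * cs m x) x)"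
      by (intro Bochner_Integration.integral_cong) (auto simp: prim_cs)
    also have "\<dots> = - (LINT x|XM. prim XM f x * (real m * cs m x))"
      using prim_by_parts[OF int(1) ci] unfolding c0 mult_zero_right by linarith
    also have "(LINT x|XM. prim XM f x * (real m * cs m x)) = (LINT x|XM. h x * (real m * cs m x) - C y * (real m * cs m x))"
    proof (rule integral_cong_AE)
      show "AE x in XM. prim XM f x * (real m * cs m x) = h x * (real m * cs m x) - C y * (real m * cs m x)"
        using f(2) by eventually_elim (simp add: algebra_simps)
    qed measurable
    also have "\<dots> = (LINT x|XM. h x * (real m * cs m x)) - C y * (LINT x|XM. real m * cs m x)"
      using hc ci by (subst Bochner_Integration.integral_diff) auto
    also have "\<dots> = (LINT x|XM. h x * (real m * cs m x))" unfolding c0 by simp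
    also have "\<dots> = (LINT x|XM. real m * (h x * cs m x))" by (simp add: ac_simps)
    finally show ?case by (simp add: coef_def f_def h_def)
  qed
qed

text \<open>Every sine coefficient of a plate function is a profile in H^2(-l, l). The coefficients of u and u_y
  are primitives of those of u_y and u_yy; the one of u_xy is found by computing the coefficient of
  u_x in two ways, by parts in x and as a primitive in y.\<close>
theorem H2star_modes:
  assumes l: "0 < l" and u: "u \<in> H2star l" and m: "m \<ge> 1"
  obtains \<phi> \<phi>1 where
    "W2 l \<phi> \<phi>1 (coef (sn m) (W l 0 2 u))"
    "AE y in YM l. coef (sn m) (rep l u) y = \<phi> y"
    "AE y in YM l. coef (sn m) (W l 2 0 u) y = - (real m)\<^sup>2 * \<phi> y"
    "AE y in YM l. coef (cs m) (W l 1 1 u) y = real m * \<phi>1 y"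
    "AE y in YM l. coef (cs m) (W l 1 0 u) y = real m * \<phi> y"
proof -
  have u2: "u \<in> H2 (plate l)" by (rule H2star_H2[OF u])
  note su = rep_sqint[OF u2] and s01 = W_sqint[OF u2, of 0 1, simplified] and s02 = W_sqint[OF u2, of 0 2, simplified]
    and s10 = W_sqint[OF u2, of 1 0, simplified] and s11 = W_sqint[OF u2, of 1 1, simplified]
  have "\<exists>\<alpha>. AE y in YM l. coef (sn m) (rep l u) y = \<alpha> + prim (YM l) (coef (sn m) (W l 0 1 u)) y"
    by (rule u_snd_prim[OF l u2], rule coef_prim[OF su s01 sn_cont])
  then obtain \<alpha> where \<alpha>: "AE y in YM l. coef (sn m) (rep l u) y = \<alpha> + prim (YM l) (coef (sn m) (W l 0 1 u)) y" by blast
  have "\<exists>\<beta>. AE y in YM l. coef (sn m) (W l 0 1 u) y = \<beta> + prim (YM l) (coef (sn m) (W l 0 2 u)) y"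
    by (rule uy_snd_prim[OF l u2], rule coef_prim[OF s01 s02 sn_cont])
  then obtain \<beta> where \<beta>: "AE y in YM l. coef (sn m) (W l 0 1 u) y = \<beta> + prim (YM l) (coef (sn m) (W l 0 2 u)) y" by blast
  have "\<exists>\<gamma>. AE y in YM l. coef (cs m) (W l 1 0 u) y = \<gamma> + prim (YM l) (coef (cs m) (W l 1 1 u)) y"
    by (rule ux_snd_prim[OF l u2], rule coef_prim[OF s10 s11 cs_cont])
  then obtain \<gamma> where \<gamma>: "AE y in YM l. coef (cs m) (W l 1 0 u) y = \<gamma> + prim (YM l) (coef (cs m) (W l 1 1 u)) y" by blast
  define \<phi>2 where "\<phi>2 = coef (sn m) (W l 0 2 u)"
  define \<phi>1 where "\<phi>1 y = \<beta> + prim (YM l) \<phi>2 y" for y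
  define \<phi> where "\<phi> y = \<alpha> + prim (YM l) \<phi>1 y" for y
  have \<phi>2: "\<phi>2 \<in> sqint (YM l)" unfolding \<phi>2_def by (rule coef_sqint[OF s02 sn_cont])
  have \<phi>1c: "continuous_on UNIV \<phi>1"
    unfolding \<phi>1_def by (intro continuous_intros prim_continuous iv.sqint_integrable \<phi>2)
  have \<phi>1i: "integrable (YM l) \<phi>1" by (intro iv.sqint_integrable cont_sqint \<phi>1c)
  have \<phi>c: "continuous_on UNIV \<phi>" unfolding \<phi>_def by (intro continuous_intros prim_continuous \<phi>1i)
  have d: "AE y in YM l. coef (sn m) (W l 0 1 u) y = \<phi>1 y" using \<beta> by (simp add: \<phi>1_def \<phi>2_def)
  have pd: "prim (YM l) (coef (sn m) (W l 0 1 u)) y = prim (YM l) \<phi>1 y" for y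
    by (rule prim_cong_AE[OF d]) (use coef_sqint[OF s01 sn_cont] \<phi>1i in \<open>auto simp: sqint_def\<close>)
  have a1: "AE y in YM l. coef (sn m) (rep l u) y = \<phi> y" using \<alpha> by (simp add: pd \<phi>_def)
  have a2: "AE y in YM l. coef (cs m) (W l 1 0 u) y = real m * \<phi> y"
    using coef_ux[OF l u, of m] a1 by eventually_elim simp
  have a3: "AE y in YM l. coef (sn m) (W l 2 0 u) y = - (real m)\<^sup>2 * \<phi> y"
    using coef_uxx[OF u2, of m] a2 by eventually_elim (simp add: power2_eq_square)
  define k where "k = coef (cs m) (W l 1 1 u)"
  have ki: "integrable (YM l) k" unfolding k_def by (intro iv.sqint_integrable coef_sqint s11 cs_cont)
  have eqk: "real m * \<phi> y = \<gamma> + prim (YM l) k y" if "y \<in> {-l..l}" for y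
  proof (rule AE_eq_continuous[where a="-l" and b=l and x=y and f="\<lambda>y. real m * \<phi> y" and g="\<lambda>y. \<gamma> + prim (YM l) k y"])
    show "AE y in YM l. real m * \<phi> y = \<gamma> + prim (YM l) k y"
      using a2 \<gamma> unfolding k_def by eventually_elim simp
    show "continuous_on {-l..l} (\<lambda>y. real m * \<phi> y)"
      by (intro continuous_intros continuous_on_subset[OF \<phi>c]) auto
    show "continuous_on {-l..l} (\<lambda>y. \<gamma> + prim (YM l) k y)"
      by (intro continuous_intros continuous_on_subset[OF prim_continuous[OF ki]]) auto
  qed (use l that in auto)
  have "AE y in YM l. k y + (- real m) * \<phi>1 y = 0"
  proof (rule prim_const_zero)
    show "integrable (YM l) (\<lambda>y. k y + - real m * \<phi>1 y)" using ki \<phi>1i by simp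
    show "prim (YM l) (\<lambda>y. k y + - real m * \<phi>1 y) y = 0" if y: "y \<in> {-l..l}" for y
    proof -
      have "prim (YM l) (\<lambda>y. k y + - real m * \<phi>1 y) y = prim (YM l) k y + (- real m) * prim (YM l) \<phi>1 y"
        using ki \<phi>1i by (simp only: prim_add prim_scale integrable_mult_right)
      moreover have "real m * \<alpha> = \<gamma>" using eqk[of "-l"] l by (simp add: prim_left \<phi>_def)
      ultimately show ?thesis using eqk[OF y] by (simp add: \<phi>_def algebra_simps)
    qed
  qed (use l in auto)
  then have a4: "AE y in YM l. coef (cs m) (W l 1 1 u) y = real m * \<phi>1 y"
    by eventually_elim (simp add: k_def)
  have "W2 l \<phi> \<phi>1 \<phi>2"
    unfolding W2_def using \<phi>2 by (simp add: \<phi>1_def \<phi>_def prim_left)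
  then show thesis using a1 a2 a3 a4 that unfolding \<phi>2_def by blast
qed

section \<open>Modes as plate functions\<close>

lemma ac_by_parts:
  assumes ab: "a < b" and h1: "integrable (iv a b) h1" and h: "\<And>x. x \<in> {a..b} \<Longrightarrow> h x = h a + prim (iv a b) h1 x"
    and G: "\<And>x. (G has_real_derivative G' x) (at x)" and G': "continuous_on UNIV G'" and G0: "G a = 0" "G b = 0"
  shows "(LINT x|iv a b. h x * G' x) = - (LINT x|iv a b. h1 x * G x)"
proof -
  have G'i: "integrable (iv a b) G'" by (intro iv.sqint_integrable cont_sqint G')
  have pG: "prim (iv a b) G' x = G x" if "x \<in> {a..b}" for x
    using prim_FTC[of a b G G' x] G G' G0 that by simp
  have iG: "integral\<^sup>L (iv a b) G' = 0" using pG[of b] ab G0 by (simp add: prim_right)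
  have i2: "integrable (iv a b) (\<lambda>x. G' x * prim (iv a b) h1 x)"
    using G'i prim_abs_le[OF h1] prim_measurable[OF h1]
    by (intro integrable_mult_bounded measurable_iv) auto
  have "(LINT x|iv a b. h x * G' x) = (LINT x|iv a b. h a * G' x + G' x * prim (iv a b) h1 x)"
  proof (intro Bochner_Integration.integral_cong refl)
    fix x assume "x \<in> space (iv a b)"
    then have "h x = h a + prim (iv a b) h1 x" by (intro h) auto
    then show "h x * G' x = h a * G' x + G' x * prim (iv a b) h1 x" by (simp add: algebra_simps)
  qed
  also have "\<dots> = (LINT x|iv a b. G' x * prim (iv a b) h1 x)"
    using G'i i2 iG by simp
  also have "\<dots> = - (LINT x|iv a b. prim (iv a b) G' x * h1 x)"
    using prim_by_parts[OF G'i h1] iG by simp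
  also have "(LINT x|iv a b. prim (iv a b) G' x * h1 x) = (LINT x|iv a b. h1 x * G x)"
    by (intro Bochner_Integration.integral_cong) (auto simp: pG)
  finally show ?thesis .
qed

lemma test_function_slice:
  assumes f: "test_function (plate l) f"
  shows "((\<lambda>s. f (s, y)) has_real_derivative dx f (x, y)) (at x)"
    "((\<lambda>s. f (x, s)) has_real_derivative dy f (x, y)) (at y)"
    "continuous_on UNIV (\<lambda>s. dx f (s, y))" "continuous_on UNIV (\<lambda>s. dy f (x, s))"
    "f (0, y) = 0" "f (pi, y) = 0" "f (x, -l) = 0" "f (x, l) = 0"
proof -
  have C: "Ck (Suc 0) f" using f by (simp only: test_function_def)
  note d = Ck_dx_dy[OF C]
  show "((\<lambda>s. f (s, y)) has_real_derivative dx f (x, y)) (at x)"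
    "((\<lambda>s. f (x, s)) has_real_derivative dy f (x, y)) (at y)" by (rule d)+
  show "continuous_on UNIV (\<lambda>s. dx f (s, y))"
    using d(1) by (auto intro!: continuous_on_compose2[of UNIV "dx f" UNIV "\<lambda>s. (s, y)"] continuous_intros)
  show "continuous_on UNIV (\<lambda>s. dy f (x, s))"
    using d(2) by (auto intro!: continuous_on_compose2[of UNIV "dy f" UNIV "\<lambda>s. (x, s)"] continuous_intros)
  obtain K where K: "K \<subseteq> plate l" "\<And>p. p \<notin> K \<Longrightarrow> f p = 0" using f by (auto simp: test_function_def)
  have "p \<notin> plate l \<Longrightarrow> f p = 0" for p using K by blast
  then show "f (0, y) = 0" "f (pi, y) = 0" "f (x, -l) = 0" "f (x, l) = 0" by (auto simp: plate_def)
qed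

lemma ipM_fst:
  assumes "f \<in> sqint (iv a b \<Otimes>\<^sub>M iv c d)" "g \<in> sqint (iv a b \<Otimes>\<^sub>M iv c d)"
  shows "ipM (iv a b \<Otimes>\<^sub>M iv c d) f g = (LINT x|iv a b. LINT y|iv c d. f (x, y) * g (x, y))"
  unfolding ipM_def using ivp.integral_fst'[OF sqint_mult_integrable[OF assms]] by simp

text \<open>Only absolute continuity of the factor h is available, so the integration by parts is done against
  the continuous derivative of the test function on each line.\<close>
lemma weak_dx_tens:
  assumes h1: "h1 \<in> sqint XM" and hs: "h \<in> sqint XM" and h: "\<And>x. x \<in> {0..pi} \<Longrightarrow> h x = h 0 + prim XM h1 x"
    and k: "k \<in> sqint (YM l)" and f: "test_function (plate l) f"
  shows "ipM (PM l) (tens h k) (dx f) = - ipM (PM l) (tens h1 k) f"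
proof -
  note t = test_function_sqint[OF f, of l] test_function_sqint[OF test_function_dx_dy(1)[OF f], of l]
  have "ipM (PM l) (tens h k) (dx f) = (LINT y|YM l. k y * (LINT x|XM. h x * dx f (x, y)))"
    by (subst ipM_snd[OF tensor_sqint[OF hs k] t(2)]) (simp add: tens_def ac_simps flip: integral_mult_right_zero)
  also have "\<dots> = (LINT y|YM l. k y * - (LINT x|XM. h1 x * f (x, y)))"
    using ac_by_parts[OF pi_gt_zero iv.sqint_integrable[OF h1] h test_function_slice(1)[OF f] test_function_slice(3)[OF f]
      test_function_slice(5)[OF f] test_function_slice(6)[OF f]] by simp
  also have "\<dots> = - ipM (PM l) (tens h1 k) f"
    by (subst ipM_snd[OF tensor_sqint[OF h1 k] t(1)]) (simp add: tens_def ac_simps flip: integral_mult_right_zero)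
  finally show ?thesis .
qed

lemma weak_dy_tens:
  assumes l: "0 < l" and h1: "h1 \<in> sqint (YM l)" and hs: "h \<in> sqint (YM l)"
    and h: "\<And>x. x \<in> {-l..l} \<Longrightarrow> h x = h (-l) + prim (YM l) h1 x"
    and k: "k \<in> sqint XM" and f: "test_function (plate l) f"
  shows "ipM (PM l) (tens k h) (dy f) = - ipM (PM l) (tens k h1) f"
proof -
  note t = test_function_sqint[OF f, of l] test_function_sqint[OF test_function_dx_dy(2)[OF f], of l]
  have "-l < l" using l by simp
  have "ipM (PM l) (tens k h) (dy f) = (LINT x|XM. k x * (LINT y|YM l. h y * dy f (x, y)))"
    by (subst ipM_fst[OF tensor_sqint[OF k hs] t(2)]) (simp add: tens_def mult.assoc)
  also have "\<dots> = (LINT x|XM. k x * - (LINT y|YM l. h1 y * f (x, y)))"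
    using ac_by_parts[OF \<open>-l < l\<close> iv.sqint_integrable[OF h1] h test_function_slice(2)[OF f] test_function_slice(4)[OF f]
      test_function_slice(7)[OF f] test_function_slice(8)[OF f]] by simp
  also have "\<dots> = - ipM (PM l) (tens k h1) f"
    by (subst ipM_fst[OF tensor_sqint[OF k h1] t(1)]) (simp add: tens_def mult.assoc)
  finally show ?thesis .
qed

lemma W2_cont1:
  assumes "W2 l \<phi> \<phi>1 \<phi>2" shows "continuous_on {-l..l} \<phi>1" "\<phi>1 \<in> sqint (YM l)"
proof -
  have "continuous_on UNIV (\<lambda>y. \<phi>1 (-l) + prim (YM l) \<phi>2 y)"
    using assms unfolding W2_def by (intro continuous_intros prim_continuous iv.sqint_integrable) blast
  note c = this
  have e: "\<phi>1 y = \<phi>1 (-l) + prim (YM l) \<phi>2 y" if "y \<in> {-l..l}" for y using assms that unfolding W2_def by blast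
  show "continuous_on {-l..l} \<phi>1"
    by (rule continuous_on_eq[OF continuous_on_subset[OF c]], simp, rule e[symmetric])
  have "(\<phi>1 \<in> borel_measurable (YM l)) = ((\<lambda>y. \<phi>1 (-l) + prim (YM l) \<phi>2 y) \<in> borel_measurable (YM l))"
    by (rule measurable_cong, rule e) auto
  then have "\<phi>1 \<in> borel_measurable (YM l)"
    using sqint_measurable[OF cont_sqint[OF c, of "-l" l]] by blast
  moreover have "AE y in YM l. \<phi>1 (-l) + prim (YM l) \<phi>2 y = \<phi>1 y"
    by (rule AE_I2, rule e[symmetric]) auto
  ultimately show "\<phi>1 \<in> sqint (YM l)"
    using sqint_cong[OF _ cont_sqint[OF c, of "-l" l]] by blast
qed

lemma W2_cont0:
  assumes "W2 l \<phi> \<phi>1 \<phi>2" shows "continuous_on {-l..l} \<phi>" "\<phi> \<in> sqint (YM l)"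
proof -
  have "continuous_on UNIV (\<lambda>y. \<phi> (-l) + prim (YM l) \<phi>1 y)"
    using W2_cont1[OF assms] by (intro continuous_intros prim_continuous iv.sqint_integrable) auto
  note c = this
  have e: "\<phi> y = \<phi> (-l) + prim (YM l) \<phi>1 y" if "y \<in> {-l..l}" for y using assms that unfolding W2_def by blast
  show "continuous_on {-l..l} \<phi>"
    by (rule continuous_on_eq[OF continuous_on_subset[OF c]], simp, rule e[symmetric])
  have "(\<phi> \<in> borel_measurable (YM l)) = ((\<lambda>y. \<phi> (-l) + prim (YM l) \<phi>1 y) \<in> borel_measurable (YM l))"
    by (rule measurable_cong, rule e) auto
  then have "\<phi> \<in> borel_measurable (YM l)"
    using sqint_measurable[OF cont_sqint[OF c, of "-l" l]] by blast
  moreover have "AE y in YM l. \<phi> (-l) + prim (YM l) \<phi>1 y = \<phi> y"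
    by (rule AE_I2, rule e[symmetric]) auto
  ultimately show "\<phi> \<in> sqint (YM l)"
    using sqint_cong[OF _ cont_sqint[OF c, of "-l" l]] by blast
qed

lemma W2_sqint2: "W2 l \<phi> \<phi>1 \<phi>2 \<Longrightarrow> \<phi>2 \<in> sqint (YM l)" by (simp add: W2_def)

lemma sn_prim: "x \<in> {0..pi} \<Longrightarrow> sn m x = sn m 0 + prim XM (\<lambda>x. real m * cs m x) x"
  by (subst prim_cs) (auto simp: sn_def)

lemma cs_prim: "x \<in> {0..pi} \<Longrightarrow> real m * cs m x = real m * cs m 0 + prim XM (\<lambda>x. - (real m)\<^sup>2 * sn m x) x"
proof -
  assume x: "x \<in> {0..pi}"
  have "prim XM (\<lambda>x. - (real m)\<^sup>2 * sn m x) x = real m * prim XM (\<lambda>x. - real m * sn m x) x"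
    using prim_scale[of 0 pi "real m" "\<lambda>x. - real m * sn m x" x] by (simp add: power2_eq_square mult.assoc)
  also have "\<dots> = real m * (cs m x - 1)" unfolding prim_sn[OF x] by (rule refl)
  finally have e: "prim XM (\<lambda>x. - (real m)\<^sup>2 * sn m x) x = real m * (cs m x - 1)" .
  show ?thesis unfolding e by (simp add: cs_def algebra_simps)
qed

lemma sn_sqint: "sn m \<in> sqint XM" by (intro cont_sqint sn_cont)
lemma cs_sqint: "(\<lambda>x. c * cs m x) \<in> sqint XM" by (intro cont_sqint continuous_intros cs_cont)
lemma sn_sqint': "(\<lambda>x. c * sn m x) \<in> sqint XM" by (intro cont_sqint continuous_intros sn_cont)

lemma is_weak_deriv_PM:
  assumes "u \<in> sqint (PM l)" "g \<in> sqint (PM l)"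
  shows "is_weak_deriv (plate l) i j u g \<longleftrightarrow> (\<forall>f. test_function (plate l) f \<longrightarrow>
     ipM (PM l) u ((dx ^^ i) ((dy ^^ j) f)) = (-1) ^ (i + j) * ipM (PM l) g f)"
  unfolding is_weak_deriv_inner0 using assms
  by (simp add: inner0_PM test_function_sqint[where \<Omega>="plate l"] test_function_pow cong: imp_cong)

text \<open>Weak derivatives against arbitrary test functions of two variables, by iterating the rules for
  products.\<close>
theorem mode_derivs:
  assumes l: "0 < l" and W: "W2 l \<phi> \<phi>1 \<phi>2"
  shows "is_weak_deriv (plate l) 0 0 (tens (sn m) \<phi>) (tens (sn m) \<phi>)"
    "is_weak_deriv (plate l) 1 0 (tens (sn m) \<phi>) (tens (\<lambda>x. real m * cs m x) \<phi>)"
    "is_weak_deriv (plate l) 0 1 (tens (sn m) \<phi>) (tens (sn m) \<phi>1)"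
    "is_weak_deriv (plate l) 2 0 (tens (sn m) \<phi>) (tens (\<lambda>x. - (real m)\<^sup>2 * sn m x) \<phi>)"
    "is_weak_deriv (plate l) 1 1 (tens (sn m) \<phi>) (tens (\<lambda>x. real m * cs m x) \<phi>1)"
    "is_weak_deriv (plate l) 0 2 (tens (sn m) \<phi>) (tens (sn m) \<phi>2)"
proof -
  note s = W2_cont0(2)[OF W] W2_cont1(2)[OF W] W2_sqint2[OF W]
  note t = tensor_sqint[OF sn_sqint s(1)] tensor_sqint[OF cs_sqint s(1)] tensor_sqint[OF sn_sqint s(2)]
    tensor_sqint[OF sn_sqint' s(1)] tensor_sqint[OF cs_sqint s(2)] tensor_sqint[OF sn_sqint s(3)]
  have e1: "\<And>x. x \<in> {-l..l} \<Longrightarrow> \<phi> x = \<phi> (-l) + prim (YM l) \<phi>1 x" and e2: "\<And>x. x \<in> {-l..l} \<Longrightarrow> \<phi>1 x = \<phi>1 (-l) + prim (YM l) \<phi>2 x"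
    using W unfolding W2_def by blast+
  note X1 = weak_dx_tens[OF cs_sqint sn_sqint sn_prim] and X2 = weak_dx_tens[OF sn_sqint' cs_sqint cs_prim]
    and Y1 = weak_dy_tens[OF l s(2) s(1) e1] and Y2 = weak_dy_tens[OF l s(3) s(2) e2]
  have p2: "(h ^^ 2) f = h (h f)" for h :: "field \<Rightarrow> field" and f by (simp add: numeral_2_eq_2)
  have p1: "(h ^^ 1) f = h f" for h :: "field \<Rightarrow> field" and f by (simp add: One_nat_def)
  show "is_weak_deriv (plate l) 0 0 (tens (sn m) \<phi>) (tens (sn m) \<phi>)"
    using t by (simp add: is_weak_deriv_PM)
  show "is_weak_deriv (plate l) 1 0 (tens (sn m) \<phi>) (tens (\<lambda>x. real m * cs m x) \<phi>)"
    using t X1[OF _ s(1)] by (simp add: is_weak_deriv_PM p1)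
  show "is_weak_deriv (plate l) 0 1 (tens (sn m) \<phi>) (tens (sn m) \<phi>1)"
    using t Y1[OF _ sn_sqint] by (simp add: is_weak_deriv_PM p1)
  show "is_weak_deriv (plate l) 2 0 (tens (sn m) \<phi>) (tens (\<lambda>x. - (real m)\<^sup>2 * sn m x) \<phi>)"
    using t t(4)[of "- (real m)\<^sup>2" m] X1[OF _ s(1)] X2[OF _ s(1)] by (simp add: is_weak_deriv_PM p2 test_function_dx_dy)
  show "is_weak_deriv (plate l) 1 1 (tens (sn m) \<phi>) (tens (\<lambda>x. real m * cs m x) \<phi>1)"
    using t X1[OF _ s(1)] Y1[OF _ cs_sqint] by (simp add: is_weak_deriv_PM p1 test_function_dx_dy)
  show "is_weak_deriv (plate l) 0 2 (tens (sn m) \<phi>) (tens (sn m) \<phi>2)"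
    using t Y1[OF _ sn_sqint] Y2[OF _ sn_sqint] by (simp add: is_weak_deriv_PM p2 test_function_dx_dy)
qed

text \<open>The profile is continuous on the closed interval and the sine vanishes at both ends, so the product
  itself is the continuous representative.\<close>
lemma mode_H2star:
  assumes l: "0 < l" and W: "W2 l \<phi> \<phi>1 \<phi>2" shows "tens (sn m) \<phi> \<in> H2star l"
proof -
  note s = W2_cont0(2)[OF W] W2_cont1(2)[OF W] W2_sqint2[OF W]
  note t = tensor_sqint[OF sn_sqint s(1)] tensor_sqint[OF cs_sqint s(1)] tensor_sqint[OF sn_sqint s(2)]
    tensor_sqint[OF sn_sqint' s(1)] tensor_sqint[OF cs_sqint s(2)] tensor_sqint[OF sn_sqint s(3)]
  note L = t[THEN sqint_PM_L2]
  note d = mode_derivs[OF l W]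
  have "\<exists>g\<in>L2 (plate l). is_weak_deriv (plate l) i j (tens (sn m) \<phi>) g" if ij: "i + j \<le> 2" for i j
  proof -
    have "(i = 0 \<and> j = 0) \<or> (i = 1 \<and> j = 0) \<or> (i = 0 \<and> j = 1) \<or> (i = 2 \<and> j = 0) \<or> (i = 1 \<and> j = 1) \<or> (i = 0 \<and> j = 2)"
      using ij by linarith
    then show ?thesis using d L by blast
  qed
  then have H: "tens (sn m) \<phi> \<in> H2 (plate l)" using L(1) by (simp add: H2_def)
  have "continuous_on ({0..pi} \<times> {-l..l}) (tens (sn m) \<phi>)"
    unfolding tens_def
    by (intro continuous_on_mult continuous_on_compose2[OF sn_cont[of UNIV m]] continuous_on_compose2[OF W2_cont0(1)[OF W]]
        continuous_on_fst continuous_on_snd continuous_on_id) auto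
  moreover have "\<forall>p\<in>{0, pi} \<times> {-l..l}. tens (sn m) \<phi> p = 0" by (auto simp: tens_def sn_def)
  ultimately show ?thesis using H by (auto simp: H2star_def intro!: exI[of _ "tens (sn m) \<phi>"])
qed

lemma mode_W:
  assumes l: "0 < l" and W: "W2 l \<phi> \<phi>1 \<phi>2"
  shows "AE p in PM l. W l 1 0 (tens (sn m) \<phi>) p = tens (\<lambda>x. real m * cs m x) \<phi> p"
    "AE p in PM l. W l 2 0 (tens (sn m) \<phi>) p = tens (\<lambda>x. - (real m)\<^sup>2 * sn m x) \<phi> p"
    "AE p in PM l. W l 1 1 (tens (sn m) \<phi>) p = tens (\<lambda>x. real m * cs m x) \<phi>1 p"
    "AE p in PM l. W l 0 2 (tens (sn m) \<phi>) p = tens (sn m) \<phi>2 p"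
    "AE p in PM l. rep l (tens (sn m) \<phi>) p = tens (sn m) \<phi> p"
proof -
  note s = W2_cont0(2)[OF W] W2_cont1(2)[OF W] W2_sqint2[OF W]
  note t = tensor_sqint[OF sn_sqint s(1)] tensor_sqint[OF cs_sqint s(1)] tensor_sqint[OF sn_sqint s(2)]
    tensor_sqint[OF sn_sqint' s(1)] tensor_sqint[OF cs_sqint s(2)] tensor_sqint[OF sn_sqint s(3)]
  note L = t[THEN sqint_PM_L2]
  note d = mode_derivs[OF l W]
  have H: "tens (sn m) \<phi> \<in> H2 (plate l)" using mode_H2star[OF l W] by (rule H2star_H2)
  have gen: "AE p in PM l. W l i j (tens (sn m) \<phi>) p = g p"
    if "i + j \<le> 2" "g \<in> L2 (plate l)" "is_weak_deriv (plate l) i j (tens (sn m) \<phi>) g" for i j g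
    using W_AE[OF H that(1)] wderiv_AE[OF H that] by eventually_elim simp
  show "AE p in PM l. W l 1 0 (tens (sn m) \<phi>) p = tens (\<lambda>x. real m * cs m x) \<phi> p"
    "AE p in PM l. W l 2 0 (tens (sn m) \<phi>) p = tens (\<lambda>x. - (real m)\<^sup>2 * sn m x) \<phi> p"
    "AE p in PM l. W l 1 1 (tens (sn m) \<phi>) p = tens (\<lambda>x. real m * cs m x) \<phi>1 p"
    "AE p in PM l. W l 0 2 (tens (sn m) \<phi>) p = tens (sn m) \<phi>2 p"
    by (intro gen L d; simp)+
  show "AE p in PM l. rep l (tens (sn m) \<phi>) p = tens (sn m) \<phi> p"
    using rep_L2(2)[OF L(1)[of m]] by eventually_elim simp
qed

text \<open>The plate form of two profiles in the m-th mode, with derivatives passed explicitly: for u = \<phi>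
  sin(m x) and v = \<zeta> sin(m x), integration over x leaves this expression times pi/2.\<close>
definition mode_form :: "real \<Rightarrow> real \<Rightarrow> nat \<Rightarrow> (real \<Rightarrow> real) \<Rightarrow> (real \<Rightarrow> real) \<Rightarrow> (real \<Rightarrow> real)
    \<Rightarrow> (real \<Rightarrow> real) \<Rightarrow> (real \<Rightarrow> real) \<Rightarrow> (real \<Rightarrow> real) \<Rightarrow> real" where
  "mode_form l \<sigma> m \<phi> \<phi>1 \<phi>2 \<zeta> \<zeta>1 \<zeta>2 =
     ipM (YM l) \<phi>2 \<zeta>2 - \<sigma> * (real m)\<^sup>2 * (ipM (YM l) \<phi> \<zeta>2 + ipM (YM l) \<phi>2 \<zeta>)
     + 2 * (1 - \<sigma>) * (real m)\<^sup>2 * ipM (YM l) \<phi>1 \<zeta>1 + (real m) ^ 4 * ipM (YM l) \<phi> \<zeta>"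

lemma ipM_cong_left:
  assumes "AE x in M. f x = f' x" "f \<in> sqint M" "f' \<in> borel_measurable M" "g \<in> sqint M"
  shows "ipM M f g = ipM M f' g"
  using assms by (intro ipM_cong) (auto simp: sqint_def)

lemma ipM_cong_right:
  assumes "AE x in M. g x = g' x" "f \<in> sqint M" "g \<in> sqint M" "g' \<in> borel_measurable M"
  shows "ipM M f g = ipM M f g'"
  using assms by (intro ipM_cong) (auto simp: sqint_def)

text \<open>Expanding the integrand separates the form into inner products of second derivatives.\<close>
lemma plate_form_integral:
  assumes "a \<in> sqint M" "b \<in> sqint M" "c \<in> sqint M" "a' \<in> sqint M" "b' \<in> sqint M" "c' \<in> sqint M"
  shows "(LINT p|M. plate_form \<sigma> (a p) (b p) (c p) (a' p) (b' p) (c' p))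
     = ipM M a a' + ipM M b b' + \<sigma> * (ipM M a b' + ipM M b a') + 2 * (1 - \<sigma>) * ipM M c c'"
proof -
  have "(LINT p|M. plate_form \<sigma> (a p) (b p) (c p) (a' p) (b' p) (c' p))
     = (LINT p|M. a p * a' p + b p * b' p + \<sigma> * (a p * b' p + b p * a' p) + 2 * (1 - \<sigma>) * (c p * c' p))"
    by (intro Bochner_Integration.integral_cong refl) (simp add: plate_form_def algebra_simps)
  also have "\<dots> = ipM M a a' + ipM M b b' + \<sigma> * (ipM M a b' + ipM M b a') + 2 * (1 - \<sigma>) * ipM M c c'"
    unfolding ipM_def using assms by (simp add: sqint_mult_integrable)
  finally show ?thesis .
qed

lemma inner2_ipM:
  assumes "u \<in> H2 (plate l)" "v \<in> H2 (plate l)"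
  shows "inner2 l \<sigma> u v = ipM (PM l) (W l 2 0 u) (W l 2 0 v) + ipM (PM l) (W l 0 2 u) (W l 0 2 v)
     + \<sigma> * (ipM (PM l) (W l 2 0 u) (W l 0 2 v) + ipM (PM l) (W l 0 2 u) (W l 2 0 v))
     + 2 * (1 - \<sigma>) * ipM (PM l) (W l 1 1 u) (W l 1 1 v)"
  unfolding inner2_W[OF assms] using assms by (intro plate_form_integral W_sqint) auto

text \<open>Pairing u with a mode only sees the m-th coefficient of u, since integration over x replaces every
  derivative of u by its coefficient against the sine or the cosine.\<close>
theorem mode_pairing:
  assumes l: "0 < l" and u: "u \<in> H2star l" and m: "m \<ge> 1"
  obtains \<phi> \<phi>1 \<phi>2 where "W2 l \<phi> \<phi>1 \<phi>2" "AE y in YM l. coef (sn m) (rep l u) y = \<phi> y"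
    "\<And>\<zeta> \<zeta>1 \<zeta>2. W2 l \<zeta> \<zeta>1 \<zeta>2 \<Longrightarrow> inner2 l \<sigma> u (tens (sn m) \<zeta>) = mode_form l \<sigma> m \<phi> \<phi>1 \<phi>2 \<zeta> \<zeta>1 \<zeta>2"
    "\<And>\<zeta> \<zeta>1 \<zeta>2. W2 l \<zeta> \<zeta>1 \<zeta>2 \<Longrightarrow> inner_x l u (tens (sn m) \<zeta>) = (real m)\<^sup>2 * ipM (YM l) \<phi> \<zeta>"
    "\<And>\<zeta> \<zeta>1 \<zeta>2. W2 l \<zeta> \<zeta>1 \<zeta>2 \<Longrightarrow> inner0 (plate l) u (tens (sn m) \<zeta>) = ipM (YM l) \<phi> \<zeta>"
proof -
  have u2: "u \<in> H2 (plate l)" by (rule H2star_H2[OF u])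
  obtain \<phi> \<phi>1 where M: "W2 l \<phi> \<phi>1 (coef (sn m) (W l 0 2 u))"
    "AE y in YM l. coef (sn m) (rep l u) y = \<phi> y"
    "AE y in YM l. coef (sn m) (W l 2 0 u) y = - (real m)\<^sup>2 * \<phi> y"
    "AE y in YM l. coef (cs m) (W l 1 1 u) y = real m * \<phi>1 y"
    "AE y in YM l. coef (cs m) (W l 1 0 u) y = real m * \<phi> y"
    by (rule H2star_modes[OF l u m])
  define \<phi>2 where "\<phi>2 = coef (sn m) (W l 0 2 u)"
  have W: "W2 l \<phi> \<phi>1 \<phi>2" using M(1) by (simp add: \<phi>2_def)
  note s\<phi> = W2_cont0(2)[OF W] W2_cont1(2)[OF W] W2_sqint2[OF W]
  note su = rep_sqint[OF u2] W_sqint[OF u2, of 1 0, simplified] W_sqint[OF u2, of 2 0, simplified]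
    W_sqint[OF u2, of 0 2, simplified] W_sqint[OF u2, of 1 1, simplified]
  have c: "ipM (YM l) (coef (sn m) (rep l u)) k = ipM (YM l) \<phi> k"
    "ipM (YM l) (coef (sn m) (W l 2 0 u)) k = - (real m)\<^sup>2 * ipM (YM l) \<phi> k"
    "ipM (YM l) (coef (cs m) (W l 1 1 u)) k = real m * ipM (YM l) \<phi>1 k"
    "ipM (YM l) (coef (cs m) (W l 1 0 u)) k = real m * ipM (YM l) \<phi> k"
    if k: "k \<in> sqint (YM l)" for k
  proof -
    show "ipM (YM l) (coef (sn m) (rep l u)) k = ipM (YM l) \<phi> k"
      using M(2) su s\<phi> k by (intro ipM_cong_left coef_sqint sn_cont) (auto simp: sqint_def)
    have "ipM (YM l) (coef (sn m) (W l 2 0 u)) k = ipM (YM l) (\<lambda>y. - (real m)\<^sup>2 * \<phi> y) k"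
      using M(3) su s\<phi> k by (intro ipM_cong_left coef_sqint sn_cont) (auto simp: sqint_def)
    then show "ipM (YM l) (coef (sn m) (W l 2 0 u)) k = - (real m)\<^sup>2 * ipM (YM l) \<phi> k"
      using sq.scale_left[OF s\<phi>(1) k, of "- (real m)\<^sup>2"] by simp
    have "ipM (YM l) (coef (cs m) (W l 1 1 u)) k = ipM (YM l) (\<lambda>y. real m * \<phi>1 y) k"
      using M(4) su s\<phi> k by (intro ipM_cong_left coef_sqint cs_cont) (auto simp: sqint_def)
    then show "ipM (YM l) (coef (cs m) (W l 1 1 u)) k = real m * ipM (YM l) \<phi>1 k"
      using sq.scale_left[OF s\<phi>(2) k] by simp
    have "ipM (YM l) (coef (cs m) (W l 1 0 u)) k = ipM (YM l) (\<lambda>y. real m * \<phi> y) k"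
      using M(5) su s\<phi> k by (intro ipM_cong_left coef_sqint cs_cont) (auto simp: sqint_def)
    then show "ipM (YM l) (coef (cs m) (W l 1 0 u)) k = real m * ipM (YM l) \<phi> k"
      using sq.scale_left[OF s\<phi>(1) k] by simp
  qed
  show thesis
  proof (rule that[OF W M(2)])
    fix \<zeta> \<zeta>1 \<zeta>2 assume Z: "W2 l \<zeta> \<zeta>1 \<zeta>2"
    define z where "z = tens (sn m) \<zeta>"
    have zH: "z \<in> H2star l" unfolding z_def by (rule mode_H2star[OF l Z])
    have z2: "z \<in> H2 (plate l)" by (rule H2star_H2[OF zH])
    note sz = W2_cont0(2)[OF Z] W2_cont1(2)[OF Z] W2_sqint2[OF Z]
    note zW = mode_W[OF l Z, of m, folded z_def]
    have tt: "tens (\<lambda>x. k * f x) g = (\<lambda>p. k * tens f g p)" for k f g by (auto simp: tens_def)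
    note swz = rep_sqint[OF z2] W_sqint[OF z2, of 1 0, simplified] W_sqint[OF z2, of 2 0, simplified]
      W_sqint[OF z2, of 0 2, simplified] W_sqint[OF z2, of 1 1, simplified]
    have p: "ipM (PM l) f (W l 1 0 z) = real m * ipM (YM l) (coef (cs m) f) \<zeta>"
      "ipM (PM l) f (W l 2 0 z) = - (real m)\<^sup>2 * ipM (YM l) (coef (sn m) f) \<zeta>"
      "ipM (PM l) f (W l 1 1 z) = real m * ipM (YM l) (coef (cs m) f) \<zeta>1"
      "ipM (PM l) f (W l 0 2 z) = ipM (YM l) (coef (sn m) f) \<zeta>2"
      "ipM (PM l) f (rep l z) = ipM (YM l) (coef (sn m) f) \<zeta>"
      if f: "f \<in> sqint (PM l)" for f
    proof -
      note tm = tensor_sqint[OF sn_sqint sz(1), of m] tensor_sqint[OF cs_sqint[of 1, simplified] sz(1), of m]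
        tensor_sqint[OF cs_sqint[of 1, simplified] sz(2), of m] tensor_sqint[OF sn_sqint sz(3), of m]
      have "ipM (PM l) f (W l 1 0 z) = ipM (PM l) f (\<lambda>p. real m * tens (cs m) \<zeta> p)"
        using zW(1) f swz tm by (intro ipM_cong_right) (auto simp: sqint_def tt)
      then show "ipM (PM l) f (W l 1 0 z) = real m * ipM (YM l) (coef (cs m) f) \<zeta>"
        using sq.scale_right[OF tm(2) f] ipM_tens[OF f cs_cont sz(1)] by simp
      have "ipM (PM l) f (W l 2 0 z) = ipM (PM l) f (\<lambda>p. - (real m)\<^sup>2 * tens (sn m) \<zeta> p)"
        using zW(2)[unfolded tt] f swz tm by (intro ipM_cong_right) (auto simp: sqint_def)
      then show "ipM (PM l) f (W l 2 0 z) = - (real m)\<^sup>2 * ipM (YM l) (coef (sn m) f) \<zeta>"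
        using sq.scale_right[OF tm(1) f, of "- (real m)\<^sup>2"] ipM_tens[OF f sn_cont sz(1)] by simp
      have "ipM (PM l) f (W l 1 1 z) = ipM (PM l) f (\<lambda>p. real m * tens (cs m) \<zeta>1 p)"
        using zW(3) f swz tm by (intro ipM_cong_right) (auto simp: sqint_def tt)
      then show "ipM (PM l) f (W l 1 1 z) = real m * ipM (YM l) (coef (cs m) f) \<zeta>1"
        using sq.scale_right[OF tm(3) f] ipM_tens[OF f cs_cont sz(2)] by simp
      have "ipM (PM l) f (W l 0 2 z) = ipM (PM l) f (tens (sn m) \<zeta>2)"
        using zW(4) f swz tm by (intro ipM_cong_right) (auto simp: sqint_def)
      then show "ipM (PM l) f (W l 0 2 z) = ipM (YM l) (coef (sn m) f) \<zeta>2"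
        using ipM_tens[OF f sn_cont sz(3)] by simp
      have "ipM (PM l) f (rep l z) = ipM (PM l) f (tens (sn m) \<zeta>)"
        using zW(5) f swz tm by (intro ipM_cong_right) (auto simp: sqint_def z_def)
      then show "ipM (PM l) f (rep l z) = ipM (YM l) (coef (sn m) f) \<zeta>"
        using ipM_tens[OF f sn_cont sz(1)] by simp
    qed
    have "inner2 l \<sigma> u z = mode_form l \<sigma> m \<phi> \<phi>1 \<phi>2 \<zeta> \<zeta>1 \<zeta>2"
      unfolding inner2_ipM[OF u2 z2] mode_form_def
      using su sz by (simp add: p c flip: \<phi>2_def) (simp add: power2_eq_square power4_eq_xxxx algebra_simps)
    then show "inner2 l \<sigma> u (tens (sn m) \<zeta>) = mode_form l \<sigma> m \<phi> \<phi>1 \<phi>2 \<zeta> \<zeta>1 \<zeta>2" by (simp add: z_def)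
    have "inner_x l u z = ipM (PM l) (W l 1 0 u) (W l 1 0 z)"
      unfolding inner_x_def W_def by (intro inner0_rep wderiv_spec u2 z2) auto
    then show "inner_x l u (tens (sn m) \<zeta>) = (real m)\<^sup>2 * ipM (YM l) \<phi> \<zeta>"
      using su sz by (simp add: p c power2_eq_square flip: z_def)
    have "inner0 (plate l) u z = ipM (PM l) (rep l u) (rep l z)"
      by (intro inner0_rep H2_L2 u2 z2)
    then show "inner0 (plate l) u (tens (sn m) \<zeta>) = ipM (YM l) \<phi> \<zeta>"
      using su sz by (simp add: p c flip: z_def)
  qed
qed

section \<open>Minimizing a quotient of forms under an orthogonality constraint\<close>

text \<open>The two properties that the direct method needs: a-bounded sequences have b-Cauchy subsequences, and
  sequences that are Cauchy for both forms converge for both.\<close>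
locale form_pair = a: semi_inner X a + b: semi_inner X b
  for X :: "('p \<Rightarrow> real) set" and a b :: "('p \<Rightarrow> real) \<Rightarrow> ('p \<Rightarrow> real) \<Rightarrow> real" +
  assumes compactness: "(\<And>n. f n \<in> X) \<Longrightarrow> (\<And>n. a (f n) (f n) \<le> M) \<Longrightarrow>
      \<exists>r. strict_mono (r :: nat \<Rightarrow> nat) \<and> (\<forall>e>0. \<exists>N. \<forall>i\<ge>N. \<forall>j\<ge>N. b.nrm (\<lambda>p. f (r i) p - f (r j) p) < e)"
    and completeness: "(\<And>n. f n \<in> X) \<Longrightarrow>
      (\<And>e. e > 0 \<Longrightarrow> \<exists>N. \<forall>i\<ge>N. \<forall>j\<ge>N. a.nrm (\<lambda>p. f i p - f j p) < e) \<Longrightarrow>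
      (\<And>e. e > 0 \<Longrightarrow> \<exists>N. \<forall>i\<ge>N. \<forall>j\<ge>N. b.nrm (\<lambda>p. f i p - f j p) < e) \<Longrightarrow>
      \<exists>g\<in>X. (\<lambda>n. a.nrm (\<lambda>p. f n p - g p)) \<longlonglongrightarrow> 0 \<and> (\<lambda>n. b.nrm (\<lambda>p. f n p - g p)) \<longlonglongrightarrow> 0"

lemma (in semi_inner) parallelogram:
  assumes "u \<in> X" "v \<in> X"
  shows "ip (\<lambda>p. u p - v p) (\<lambda>p. u p - v p) + ip (\<lambda>p. u p + v p) (\<lambda>p. u p + v p) = 2 * ip u u + 2 * ip v v"
  using assms sym[of u v] by (simp add: add_left add_right diff_left diff_right add_mem diff_mem)

text \<open>The form in which a minimum yields the Euler-Lagrange equation.\<close>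
lemma quadratic_nonneg_imp_linear_zero:
  fixes c d :: real assumes "\<And>t. 0 \<le> 2 * t * c + t\<^sup>2 * d" shows "c = 0"
proof (rule ccontr)
  assume c: "c \<noteq> 0"
  define t where "t = - c / (1 + \<bar>d\<bar>)"
  have "2 * t * c + t\<^sup>2 * d \<le> 2 * t * c + t\<^sup>2 * (1 + \<bar>d\<bar>)" by (intro add_left_mono mult_left_mono) auto
  also have "t\<^sup>2 * (1 + \<bar>d\<bar>) = - t * c" by (simp add: t_def power2_eq_square divide_simps)
  also have "2 * t * c + - t * c = t * c" by simp
  also have "t * c < 0" using c by (simp add: t_def divide_simps) (smt (verit) mult_minus_left not_real_square_gt_zero)
  finally show False using assms[of t] by simp
qed

text \<open>A minimizing sequence normalized by b has a b-Cauchy subsequence; the parallelogram law and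
  minimality make it a-Cauchy, so the infimum is attained. The minimizer satisfies the eigenvalue
  equation for test elements orthogonal to \<psi>, and since \<psi> is an eigenvector both sides
  vanish for z = \<psi> as well. Taking \<psi> = 0 gives the minimum without constraint.\<close>
theorem (in form_pair) constrained_minimizer:
  assumes \<psi>: "\<psi> \<in> X" "\<And>z. z \<in> X \<Longrightarrow> a \<psi> z = lam * b \<psi> z"
    and ex: "\<exists>f\<in>X. b f \<psi> = 0 \<and> b f f \<noteq> 0"
  obtains \<nu> \<phi> where "\<phi> \<in> X" "b \<phi> \<psi> = 0" "b \<phi> \<phi> = 1" "\<And>z. z \<in> X \<Longrightarrow> a \<phi> z = \<nu> * b \<phi> z"
    "\<And>z. z \<in> X \<Longrightarrow> b z \<psi> = 0 \<Longrightarrow> \<nu> * b z z \<le> a z z"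
proof -
  define S where "S = {a z z |z. z \<in> X \<and> b z \<psi> = 0 \<and> b z z = 1}"
  have norm: "(\<lambda>p. (1 / sqrt (b z z)) * z p) \<in> X \<and> b (\<lambda>p. (1 / sqrt (b z z)) * z p) \<psi> = 0
      \<and> b (\<lambda>p. (1 / sqrt (b z z)) * z p) (\<lambda>p. (1 / sqrt (b z z)) * z p) = 1
      \<and> a (\<lambda>p. (1 / sqrt (b z z)) * z p) (\<lambda>p. (1 / sqrt (b z z)) * z p) = a z z / b z z"
    if z: "z \<in> X" "b z \<psi> = 0" "b z z \<noteq> 0" for z
  proof -
    have p: "b z z > 0" using b.nonneg[OF z(1)] z(3) by simp
    have m: "(\<lambda>p. (1 / sqrt (b z z)) * z p) \<in> X" by (rule b.scale_mem[OF z(1)])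
    have "(1 / sqrt (b z z)) * ((1 / sqrt (b z z)) * c) = c / b z z" for c
      using p by (simp add: field_simps)
    then show ?thesis using m z \<psi>(1) p
      by (simp only: b.scale_left b.scale_right a.scale_left a.scale_right) simp
  qed
  have Sne: "S \<noteq> {}" using ex norm unfolding S_def by blast
  have Sbd: "bdd_below S" unfolding S_def by (rule bdd_belowI[of _ 0]) (auto simp: a.nonneg)
  define \<nu> where "\<nu> = Inf S"
  have lower: "\<nu> * b z z \<le> a z z" if z: "z \<in> X" "b z \<psi> = 0" for z
  proof (cases "b z z = 0")
    case True then show ?thesis using a.nonneg[OF z(1)] by simp
  next
    case False
    have "a z z / b z z \<in> S" using norm[OF z False] unfolding S_def by force
    then have "\<nu> \<le> a z z / b z z" unfolding \<nu>_def using Sbd by (rule cInf_lower)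
    moreover have "b z z > 0" using b.nonneg[OF z(1)] False by simp
    ultimately show ?thesis by (simp add: field_simps)
  qed
  have "\<exists>z. z \<in> X \<and> b z \<psi> = 0 \<and> b z z = 1 \<and> a z z < \<nu> + 1 / real (Suc n)" for n
  proof -
    have "\<exists>x\<in>S. x < \<nu> + 1 / real (Suc n)"
      using cInf_less_iff[OF Sne Sbd, of "\<nu> + 1 / real (Suc n)"] by (simp add: \<nu>_def)
    then show ?thesis by (auto simp: S_def)
  qed
  then obtain f where f: "\<And>n. f n \<in> X" "\<And>n. b (f n) \<psi> = 0" "\<And>n. b (f n) (f n) = 1"
    "\<And>n. a (f n) (f n) < \<nu> + 1 / real (Suc n)" by metis
  have "a (f n) (f n) \<le> \<nu> + 1" for n
  proof -
    have "1 / real (Suc n) \<le> 1" by simp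
    then show ?thesis using f(4)[of n] by linarith
  qed
  from compactness[of f, OF f(1) this] obtain r :: "nat \<Rightarrow> nat" where r: "strict_mono r"
    "\<And>e. e > 0 \<Longrightarrow> \<exists>N. \<forall>i\<ge>N. \<forall>j\<ge>N. b.nrm (\<lambda>p. f (r i) p - f (r j) p) < e" by blast
  define g where "g n = f (r n)" for n
  have g: "\<And>n. g n \<in> X" "\<And>n. b (g n) \<psi> = 0" "\<And>n. b (g n) (g n) = 1" using f by (auto simp: g_def)
  have ag: "a (g n) (g n) \<le> \<nu> + 1 / real (Suc n)" for n
  proof -
    have "real (Suc n) \<le> real (Suc (r n))" using seq_suble[OF r(1), of n] by simp
    then have "1 / real (Suc (r n)) \<le> 1 / real (Suc n)" by (intro divide_left_mono) auto
    then show ?thesis using f(4)[of "r n"] by (simp add: g_def)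
  qed
  have gb: "\<exists>N. \<forall>i\<ge>N. \<forall>j\<ge>N. b.nrm (\<lambda>p. g i p - g j p) < e" if "e > 0" for e
    using r(2)[OF that] by (simp add: g_def)
  have ga: "\<exists>N. \<forall>i\<ge>N. \<forall>j\<ge>N. a.nrm (\<lambda>p. g i p - g j p) < e" if e: "e > 0" for e
  proof -
    \<comment> \<open>This bounds the term with \<nu> by e^2/4, and the two defects of the minimizing sequence contribute
      less than e^2/2.\<close>
    define e' where "e' = e / (2 * (1 + \<bar>\<nu>\<bar>))"
    have e': "e' > 0" using e by (simp add: e'_def)
    obtain N1 where N1: "\<And>i j. i \<ge> N1 \<Longrightarrow> j \<ge> N1 \<Longrightarrow> b.nrm (\<lambda>p. g i p - g j p) < e'" using gb[OF e'] by blast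
    obtain N2 where N2: "real N2 > 8 / e\<^sup>2" using reals_Archimedean2 by blast
    have "a.nrm (\<lambda>p. g i p - g j p) < e" if ij: "i \<ge> max N1 N2" "j \<ge> max N1 N2" for i j
    proof -
      have small: "1 / real (Suc k) < e\<^sup>2 / 8" if "k \<ge> N2" for k
      proof -
        have "8 / e\<^sup>2 < real (Suc k)" using N2 that by linarith
        then show ?thesis using e by (simp add: field_simps)
      qed
      have d: "(\<lambda>p. g i p - g j p) \<in> X" by (intro b.diff_mem g)
      have s: "(\<lambda>p. g i p + g j p) \<in> X" by (intro b.add_mem g)
      have "b (\<lambda>p. g i p + g j p) \<psi> = 0" by (simp add: b.add_left g \<psi>(1))
      from lower[OF s this] have "\<nu> * b (\<lambda>p. g i p + g j p) (\<lambda>p. g i p + g j p) \<le> a (\<lambda>p. g i p + g j p) (\<lambda>p. g i p + g j p)" .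
      moreover have "b (\<lambda>p. g i p + g j p) (\<lambda>p. g i p + g j p) = 4 - (b.nrm (\<lambda>p. g i p - g j p))\<^sup>2"
        using b.parallelogram[OF g(1)[of i] g(1)[of j]] g(3) b.nrm_sq[OF d] by simp
      moreover have "a (\<lambda>p. g i p - g j p) (\<lambda>p. g i p - g j p) + a (\<lambda>p. g i p + g j p) (\<lambda>p. g i p + g j p) = 2 * a (g i) (g i) + 2 * a (g j) (g j)"
        by (rule a.parallelogram[OF g(1) g(1)])
      ultimately have "a (\<lambda>p. g i p - g j p) (\<lambda>p. g i p - g j p) \<le> 2 * (1 / real (Suc i)) + 2 * (1 / real (Suc j)) + \<nu> * (b.nrm (\<lambda>p. g i p - g j p))\<^sup>2"
        using ag[of i] ag[of j] by (simp add: algebra_simps)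
      also have "\<nu> * (b.nrm (\<lambda>p. g i p - g j p))\<^sup>2 \<le> (1 + \<bar>\<nu>\<bar>)\<^sup>2 * e'\<^sup>2"
      proof (intro mult_mono)
        have "\<bar>\<nu>\<bar> * 1 \<le> (1 + \<bar>\<nu>\<bar>) * (1 + \<bar>\<nu>\<bar>)" by (intro mult_mono) auto
        then show "\<nu> \<le> (1 + \<bar>\<nu>\<bar>)\<^sup>2" by (simp add: power2_eq_square)
        show "(b.nrm (\<lambda>p. g i p - g j p))\<^sup>2 \<le> e'\<^sup>2"
          using N1[of i j] ij b.nrm_nonneg[OF d] by (intro power_mono) auto
      qed auto
      also have "(1 + \<bar>\<nu>\<bar>)\<^sup>2 * e'\<^sup>2 = e\<^sup>2 / 4"
      proof -
        have "k * (e / (2 * k)) = e / 2" if "k > 0" for k :: real using that by simp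
        from this[of "1 + \<bar>\<nu>\<bar>"] have "(1 + \<bar>\<nu>\<bar>) * e' = e / 2" unfolding e'_def by linarith
        then have "((1 + \<bar>\<nu>\<bar>) * e')\<^sup>2 = (e / 2)\<^sup>2" by (rule arg_cong)
        then show ?thesis by (simp add: power_mult_distrib power_divide)
      qed
      finally have fin: "a (\<lambda>p. g i p - g j p) (\<lambda>p. g i p - g j p) \<le> 2 * (1 / real (Suc i)) + 2 * (1 / real (Suc j)) + e\<^sup>2 / 4"
        by simp
      have "0 < e\<^sup>2" "1 / real (Suc i) < e\<^sup>2 / 8" "1 / real (Suc j) < e\<^sup>2 / 8"
        using e small[of i] small[of j] ij by simp_all
      with fin have "a (\<lambda>p. g i p - g j p) (\<lambda>p. g i p - g j p) < e\<^sup>2" by linarith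
      then show ?thesis unfolding a.nrm_def using e by (intro real_less_lsqrt) auto
    qed
    then show ?thesis by blast
  qed
  obtain \<phi> where \<phi>: "\<phi> \<in> X" "(\<lambda>n. a.nrm (\<lambda>p. g n p - \<phi> p)) \<longlonglongrightarrow> 0" "(\<lambda>n. b.nrm (\<lambda>p. g n p - \<phi> p)) \<longlonglongrightarrow> 0"
    using completeness[of g, OF g(1) ga gb] by blast
  have ev: "eventually (\<lambda>n. g n \<in> X) sequentially" using g by simp
  have "(\<lambda>n. b (g n) (g n)) \<longlonglongrightarrow> b \<phi> \<phi>" by (intro b.tendsto_ip ev \<phi>)
  then have b1: "b \<phi> \<phi> = 1" using g(3) by (simp add: LIMSEQ_const_iff)
  have "(\<lambda>n. b (g n) \<psi>) \<longlonglongrightarrow> b \<phi> \<psi>"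
    by (intro b.tendsto_ip ev \<phi> \<psi>(1)) (auto simp: \<psi>(1) b.nrm_def b.zero_left b.zero_mem)
  then have b0: "b \<phi> \<psi> = 0" using g(2) by (simp add: LIMSEQ_const_iff)
  have "(\<lambda>n. a (g n) (g n)) \<longlonglongrightarrow> a \<phi> \<phi>" by (intro a.tendsto_ip ev \<phi>)
  moreover have "(\<lambda>n. \<nu> + 1 / real (Suc n)) \<longlonglongrightarrow> \<nu> + 0"
    by (intro tendsto_intros LIMSEQ_inverse_real_of_nat[unfolded inverse_eq_divide])
  ultimately have "a \<phi> \<phi> \<le> \<nu>" using ag by (intro LIMSEQ_le[where X="\<lambda>n. a (g n) (g n)"]) auto
  then have a1: "a \<phi> \<phi> = \<nu>" using lower[OF \<phi>(1) b0] b1 by simp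
  have EK: "a \<phi> z = \<nu> * b \<phi> z" if z: "z \<in> X" "b z \<psi> = 0" for z
  proof -
    have "a \<phi> z - \<nu> * b \<phi> z = 0"
    proof (rule quadratic_nonneg_imp_linear_zero)
      fix t
      have m: "(\<lambda>p. \<phi> p + t * z p) \<in> X" by (intro b.add_mem b.scale_mem \<phi> z)
      have "b (\<lambda>p. \<phi> p + t * z p) \<psi> = 0" using z b0 \<phi>(1) \<psi>(1) by (simp add: b.add_left b.scale_left b.scale_mem)
      from lower[OF m this] have "0 \<le> (a \<phi> \<phi> + 2 * t * a \<phi> z + t\<^sup>2 * a z z) - \<nu> * (b \<phi> \<phi> + 2 * t * b \<phi> z + t\<^sup>2 * b z z)"
        using a.ip_add_square[OF \<phi>(1) z(1), of t] b.ip_add_square[OF \<phi>(1) z(1), of t] by simp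
      then show "0 \<le> 2 * t * (a \<phi> z - \<nu> * b \<phi> z) + t\<^sup>2 * (a z z - \<nu> * b z z)"
        using a1 b1 by (simp add: algebra_simps)
    qed
    then show ?thesis by simp
  qed
  have "a \<phi> z = \<nu> * b \<phi> z" if z: "z \<in> X" for z
  proof (cases "b \<psi> \<psi> = 0")
    case True
    have "(b z \<psi>)\<^sup>2 \<le> b z z * b \<psi> \<psi>" by (rule b.Cauchy_Schwarz_sq[OF z \<psi>(1)])
    then have "b z \<psi> = 0" using True by simp
    then show ?thesis by (rule EK[OF z])
  next
    case False
    define c where "c = b z \<psi> / b \<psi> \<psi>"
    \<comment> \<open>The component of z orthogonal to \<psi>.\<close>
    define z' where "z' = (\<lambda>p. z p - c * \<psi> p)"
    have z': "z' \<in> X" unfolding z'_def by (intro b.diff_mem b.scale_mem z \<psi>)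
    have "b z' \<psi> = b z \<psi> - c * b \<psi> \<psi>" using z \<psi>(1) by (simp add: z'_def b.diff_left b.scale_left b.scale_mem)
    then have "b z' \<psi> = 0" using False by (simp add: c_def)
    note e = EK[OF z' this]
    have "a \<phi> \<psi> = 0" using \<psi>(2)[OF \<phi>(1)] b0 b.sym[OF \<phi>(1) \<psi>(1)] a.sym[OF \<phi>(1) \<psi>(1)] by simp
    then show ?thesis using e z \<phi>(1) \<psi>(1) b0
      by (simp add: z'_def a.diff_right b.diff_right a.scale_right b.scale_right b.scale_mem)
  qed
  with \<phi>(1) b0 b1 lower show thesis using that by blast
qed

section \<open>The one-dimensional forms of a mode\<close>

abbreviation c0 :: "(nat \<times> real \<Rightarrow> real) \<Rightarrow> real \<Rightarrow> real" where "c0 F \<equiv> \<lambda>y. F (0, y)"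
abbreviation c1 :: "(nat \<times> real \<Rightarrow> real) \<Rightarrow> real \<Rightarrow> real" where "c1 F \<equiv> \<lambda>y. F (1, y)"
abbreviation c2 :: "(nat \<times> real \<Rightarrow> real) \<Rightarrow> real \<Rightarrow> real" where "c2 F \<equiv> \<lambda>y. F (2, y)"

text \<open>Profiles with their two derivatives, coded as one function of an index in {0, 1, 2} and a point, so
  that the theory of semi-inner products applies to them.\<close>
definition W2s :: "real \<Rightarrow> (nat \<times> real \<Rightarrow> real) set" where
  "W2s l = {F. W2 l (c0 F) (c1 F) (c2 F)}"

definition mode_a :: "real \<Rightarrow> real \<Rightarrow> nat \<Rightarrow> (nat \<times> real \<Rightarrow> real) \<Rightarrow> (nat \<times> real \<Rightarrow> real) \<Rightarrow> real" where
  "mode_a l \<sigma> m F G = mode_form l \<sigma> m (c0 F) (c1 F) (c2 F) (c0 G) (c1 G) (c2 G)"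

text \<open>The form b; the factor comes from differentiating sin(m x).\<close>
definition mode_b :: "real \<Rightarrow> nat \<Rightarrow> (nat \<times> real \<Rightarrow> real) \<Rightarrow> (nat \<times> real \<Rightarrow> real) \<Rightarrow> real" where
  "mode_b l m F G = (real m)\<^sup>2 * ipM (YM l) (c0 F) (c0 G)"

definition triple :: "(real \<Rightarrow> real) \<Rightarrow> (real \<Rightarrow> real) \<Rightarrow> (real \<Rightarrow> real) \<Rightarrow> nat \<times> real \<Rightarrow> real" where
  "triple f f1 f2 = (\<lambda>(i, y). if i = 0 then f y else if i = 1 then f1 y else f2 y)"

lemma triple_simps[simp]: "c0 (triple f f1 f2) = f" "c1 (triple f f1 f2) = f1" "c2 (triple f f1 f2) = f2"
  by (auto simp: triple_def)

lemma triple_W2s: "W2 l f f1 f2 \<Longrightarrow> triple f f1 f2 \<in> W2s l" by (simp add: W2s_def)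

lemma W2s_sq:
  assumes "F \<in> W2s l" shows "c0 F \<in> sqint (YM l)" "c1 F \<in> sqint (YM l)" "c2 F \<in> sqint (YM l)"
  using assms W2_cont0(2) W2_cont1(2) W2_sqint2 unfolding W2s_def by blast+

lemma W2s_int:
  assumes "F \<in> W2s l" shows "integrable (YM l) (c0 F)" "integrable (YM l) (c1 F)" "integrable (YM l) (c2 F)"
  using W2s_sq[OF assms] by (auto intro: iv.sqint_integrable)

lemma W2s_eq:
  assumes "F \<in> W2s l" "y \<in> {-l..l}"
  shows "F (1, y) = F (1, -l) + prim (YM l) (c2 F) y" "F (0, y) = F (0, -l) + prim (YM l) (c1 F) y"
  using assms unfolding W2s_def W2_def by blast+

lemma W2s_add: assumes "F \<in> W2s l" "G \<in> W2s l" shows "(\<lambda>p. F p + G p) \<in> W2s l"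
  unfolding W2s_def W2_def mem_Collect_eq
proof (intro conjI ballI)
  show "(\<lambda>y. F (2, y) + G (2, y)) \<in> sqint (YM l)" using W2s_sq assms by (intro sqint_add) auto
  fix y assume y: "y \<in> {-l..l}"
  show "F (1, y) + G (1, y) = F (1, -l) + G (1, -l) + prim (YM l) (\<lambda>y. F (2, y) + G (2, y)) y"
    using W2s_eq(1)[OF assms(1) y] W2s_eq(1)[OF assms(2) y] prim_add[OF W2s_int(3)[OF assms(1)] W2s_int(3)[OF assms(2)], of y] by linarith
  show "F (0, y) + G (0, y) = F (0, -l) + G (0, -l) + prim (YM l) (\<lambda>y. F (1, y) + G (1, y)) y"
    using W2s_eq(2)[OF assms(1) y] W2s_eq(2)[OF assms(2) y] prim_add[OF W2s_int(2)[OF assms(1)] W2s_int(2)[OF assms(2)], of y] by linarith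
qed

lemma W2s_scale: assumes "F \<in> W2s l" shows "(\<lambda>p. c * F p) \<in> W2s l"
  unfolding W2s_def W2_def mem_Collect_eq
proof (intro conjI ballI)
  show "(\<lambda>y. c * F (2, y)) \<in> sqint (YM l)" using W2s_sq assms by (intro sqint_scale) auto
  fix y assume y: "y \<in> {-l..l}"
  show "c * F (1, y) = c * F (1, -l) + prim (YM l) (\<lambda>y. c * F (2, y)) y"
    using W2s_eq(1)[OF assms(1) y] unfolding prim_scale by (metis distrib_left)
  show "c * F (0, y) = c * F (0, -l) + prim (YM l) (\<lambda>y. c * F (1, y)) y"
    using W2s_eq(2)[OF assms(1) y] unfolding prim_scale by (metis distrib_left)
qed

lemma W2s_zero: "(\<lambda>p. 0) \<in> W2s l"
  by (simp add: W2s_def W2_def prim_def sqint_def)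

lemma mode_a_square:
  assumes "F \<in> W2s l"
  shows "mode_a l \<sigma> m F F = ipM (YM l) (c2 F) (c2 F) - 2 * \<sigma> * (real m)\<^sup>2 * ipM (YM l) (c0 F) (c2 F)
     + 2 * (1 - \<sigma>) * (real m)\<^sup>2 * ipM (YM l) (c1 F) (c1 F) + (real m) ^ 4 * ipM (YM l) (c0 F) (c0 F)"
  unfolding mode_a_def mode_form_def using sq.sym[OF W2s_sq(3)[OF assms] W2s_sq(1)[OF assms]] by simp

text \<open>Completing the square in two ways: f'' - \<sigma> m^2 f gives the constant 1 - \<sigma>^2 that
  separates the modes m \<ge> 2 from the value 1, and f'' - m^2 f gives coercivity.\<close>
lemma mode_a_lower:
  assumes F: "F \<in> W2s l" and s: "0 < \<sigma>" "\<sigma> < 1/2"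
  shows "(1 - \<sigma>\<^sup>2) * (real m) ^ 4 * ipM (YM l) (c0 F) (c0 F) \<le> mode_a l \<sigma> m F F"
    "(1 - \<sigma>) * (ipM (YM l) (c2 F) (c2 F) + (real m)\<^sup>2 * ipM (YM l) (c1 F) (c1 F) + (real m) ^ 4 * ipM (YM l) (c0 F) (c0 F)) \<le> mode_a l \<sigma> m F F"
proof -
  note sF = W2s_sq[OF F]
  have n: "0 \<le> ipM (YM l) (c2 F) (c2 F)" "0 \<le> ipM (YM l) (c1 F) (c1 F)" "0 \<le> ipM (YM l) (c0 F) (c0 F)"
    by (intro sq.nonneg sF)+
  have q: "0 \<le> ipM (YM l) (c2 F) (c2 F) + 2 * c * ipM (YM l) (c2 F) (c0 F) + c\<^sup>2 * ipM (YM l) (c0 F) (c0 F)" for c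
    using sq.nonneg[OF sq.add_mem[OF sF(3) sq.scale_mem[OF sF(1), of c]]] sq.ip_add_square[OF sF(3) sF(1), of c] by simp
  note sy = sq.sym[OF sF(3) sF(1)]
  have n1: "0 \<le> (1 - \<sigma>) * (real m)\<^sup>2 * ipM (YM l) (c1 F) (c1 F)" using s n by simp
  have "0 \<le> ipM (YM l) (c2 F) (c2 F) - 2 * \<sigma> * (real m)\<^sup>2 * ipM (YM l) (c0 F) (c2 F) + \<sigma>\<^sup>2 * (real m) ^ 4 * ipM (YM l) (c0 F) (c0 F)"
    using q[of "- \<sigma> * (real m)\<^sup>2"] sy by (simp add: power_mult_distrib power2_eq_square power4_eq_xxxx mult_ac)
  then show "(1 - \<sigma>\<^sup>2) * (real m) ^ 4 * ipM (YM l) (c0 F) (c0 F) \<le> mode_a l \<sigma> m F F"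
    unfolding mode_a_square[OF F] using n1 by (simp add: algebra_simps)
  have "0 \<le> \<sigma> * (ipM (YM l) (c2 F) (c2 F) + 2 * (- (real m)\<^sup>2) * ipM (YM l) (c2 F) (c0 F) + (- (real m)\<^sup>2)\<^sup>2 * ipM (YM l) (c0 F) (c0 F))"
    using q[of "- (real m)\<^sup>2"] s by (intro mult_nonneg_nonneg) auto
  moreover have "(- (real m)\<^sup>2)\<^sup>2 = (real m) ^ 4" by (simp add: power2_eq_square power4_eq_xxxx)
  ultimately show "(1 - \<sigma>) * (ipM (YM l) (c2 F) (c2 F) + (real m)\<^sup>2 * ipM (YM l) (c1 F) (c1 F) + (real m) ^ 4 * ipM (YM l) (c0 F) (c0 F)) \<le> mode_a l \<sigma> m F F"
    unfolding mode_a_square[OF F] using n1 sy by (simp add: algebra_simps)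
qed

lemma semi_inner_mode_a:
  assumes s: "0 < \<sigma>" "\<sigma> < 1/2" shows "semi_inner (W2s l) (mode_a l \<sigma> m)"
proof
  fix u v w :: "nat \<times> real \<Rightarrow> real" and c :: real
  show "(\<lambda>p. 0) \<in> W2s l" by (rule W2s_zero)
  show "u \<in> W2s l \<Longrightarrow> v \<in> W2s l \<Longrightarrow> (\<lambda>p. u p + v p) \<in> W2s l" by (rule W2s_add)
  show "u \<in> W2s l \<Longrightarrow> (\<lambda>p. c * u p) \<in> W2s l" by (rule W2s_scale)
  show "mode_a l \<sigma> m (\<lambda>p. u p + v p) w = mode_a l \<sigma> m u w + mode_a l \<sigma> m v w" if "u \<in> W2s l" "v \<in> W2s l" "w \<in> W2s l"
    unfolding mode_a_def mode_form_def using W2s_sq[OF that(1)] W2s_sq[OF that(2)] W2s_sq[OF that(3)]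
    by (simp add: sq.add_left algebra_simps)
  show "mode_a l \<sigma> m (\<lambda>p. c * u p) w = c * mode_a l \<sigma> m u w" if "u \<in> W2s l" "w \<in> W2s l"
    unfolding mode_a_def mode_form_def using W2s_sq[OF that(1)] W2s_sq[OF that(2)]
    by (simp add: sq.scale_left algebra_simps)
  show "mode_a l \<sigma> m u v = mode_a l \<sigma> m v u" if "u \<in> W2s l" "v \<in> W2s l"
    unfolding mode_a_def mode_form_def using W2s_sq[OF that(1)] W2s_sq[OF that(2)]
    by (simp add: sq.sym[of "\<lambda>y. u (_, y)"])
  show "0 \<le> mode_a l \<sigma> m u u" if u: "u \<in> W2s l"
  proof -
    have "0 \<le> (1 - \<sigma>\<^sup>2) * (real m) ^ 4 * ipM (YM l) (c0 u) (c0 u)"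
    proof -
      have "\<sigma>\<^sup>2 \<le> 1" using s by (intro power_le_one) auto
      then show ?thesis using sq.nonneg[OF W2s_sq(1)[OF u]] by simp
    qed
    then show ?thesis using mode_a_lower(1)[OF u s, of m] by linarith
  qed
qed

lemma semi_inner_mode_b: "semi_inner (W2s l) (mode_b l m)"
proof
  fix u v w :: "nat \<times> real \<Rightarrow> real" and c :: real
  show "(\<lambda>p. 0) \<in> W2s l" by (rule W2s_zero)
  show "u \<in> W2s l \<Longrightarrow> v \<in> W2s l \<Longrightarrow> (\<lambda>p. u p + v p) \<in> W2s l" by (rule W2s_add)
  show "u \<in> W2s l \<Longrightarrow> (\<lambda>p. c * u p) \<in> W2s l" by (rule W2s_scale)
  show "mode_b l m (\<lambda>p. u p + v p) w = mode_b l m u w + mode_b l m v w" if "u \<in> W2s l" "v \<in> W2s l" "w \<in> W2s l"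
    unfolding mode_b_def using W2s_sq[OF that(1)] W2s_sq[OF that(2)] W2s_sq[OF that(3)]
    by (simp add: sq.add_left algebra_simps)
  show "mode_b l m (\<lambda>p. c * u p) w = c * mode_b l m u w" if "u \<in> W2s l" "w \<in> W2s l"
    unfolding mode_b_def using W2s_sq[OF that(1)] W2s_sq[OF that(2)] by (simp add: sq.scale_left)
  show "mode_b l m u v = mode_b l m v u" if "u \<in> W2s l" "v \<in> W2s l"
    unfolding mode_b_def using sq.sym[OF W2s_sq(1)[OF that(1)] W2s_sq(1)[OF that(2)]] by simp
  show "0 \<le> mode_b l m u u" if "u \<in> W2s l"
    unfolding mode_b_def using sq.nonneg[OF W2s_sq(1)[OF that]] by simp
qed

lemma measure_iv: "a \<le> b \<Longrightarrow> measure (iv a b) (space (iv a b)) = b - a"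
  unfolding space_iv unfolding iv_def by (subst measure_restrict_space) auto

lemma prim_abs_le_nrm:
  assumes "g \<in> sqint (iv a b)" "a \<le> b"
  shows "\<bar>prim (iv a b) g x\<bar> \<le> sqrt (b - a) * sq.nrm (iv a b) g"
  using prim_abs_le[OF iv.sqint_integrable[OF assms(1)], of x] iv.integral_abs_le_nrm[OF assms(1)] measure_iv[OF assms(2)] by simp

text \<open>Hoelder continuity with exponent 1/2, by the inequality of Cauchy and Schwarz.\<close>
lemma prim_diff_le_nrm:
  assumes g: "g \<in> sqint (iv a b)" and xy: "x \<le> y"
  shows "\<bar>prim (iv a b) g y - prim (iv a b) g x\<bar> \<le> sqrt (y - x) * sq.nrm (iv a b) g"
proof -
  have ind: "indicator {x<..y} \<in> sqint (iv a b)"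
    by (rule iv.sqint_bounded[of _ _ _ 1]) (auto simp: indicator_def)
  have "ipM (iv a b) (indicator {x<..y}) (indicator {x<..y}) = measure (iv a b) ({x<..y} \<inter> {a<..<b})"
    by (simp add: ipM_def flip: indicator_inter_arith)
  also have "\<dots> = measure lborel ({x<..y} \<inter> {a<..<b})"
    unfolding iv_def by (subst measure_restrict_space) auto
  also have "\<dots> \<le> measure lborel {x<..y}"
    using xy by (intro measure_mono_fmeasurable fmeasurableI) auto
  also have "\<dots> = y - x" using xy by simp
  finally have "sq.nrm (iv a b) (indicator {x<..y}) \<le> sqrt (y - x)" by (simp add: sq.nrm_def)
  moreover have "\<bar>prim (iv a b) g y - prim (iv a b) g x\<bar> = \<bar>ipM (iv a b) (indicator {x<..y}) g\<bar>"
    using prim_diff[OF iv.sqint_integrable[OF g] xy] by (simp add: ipM_def)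
  moreover have "\<dots> \<le> sq.nrm (iv a b) (indicator {x<..y}) * sq.nrm (iv a b) g"
    by (rule sq.Cauchy_Schwarz[OF ind g])
  ultimately show ?thesis using mult_right_mono[of "sq.nrm (iv a b) (indicator {x<..y})" "sqrt (y - x)" "sq.nrm (iv a b) g"] sq.nrm_nonneg[OF g] by linarith
qed

lemma uniform_nrm_le:
  assumes "a \<le> b" "f \<in> sqint (iv a b)" "\<And>y. y \<in> {a..b} \<Longrightarrow> \<bar>f y\<bar> \<le> e" "0 \<le> e"
  shows "sq.nrm (iv a b) f \<le> sqrt (b - a) * e"
proof -
  have "ipM (iv a b) f f \<le> (LINT y|iv a b. e\<^sup>2)"
    unfolding ipM_def
  proof (rule integral_mono)
    show "integrable (iv a b) (\<lambda>y. f y * f y)" by (intro sqint_mult_integrable assms)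
    fix y assume "y \<in> space (iv a b)"
    then have "\<bar>f y\<bar> \<le> e" by (intro assms) auto
    then have "\<bar>f y\<bar>\<^sup>2 \<le> e\<^sup>2" by (intro power_mono) auto
    then show "f y * f y \<le> e\<^sup>2" by (simp add: power2_eq_square)
  qed simp
  also have "\<dots> = (b - a) * e\<^sup>2" using measure_iv[OF assms(1)] by simp
  finally have "sq.nrm (iv a b) f \<le> sqrt ((b - a) * e\<^sup>2)" by (simp add: sq.nrm_def)
  then show ?thesis using assms(4) by (simp add: real_sqrt_mult)
qed

lemma nrm_le_of_mode_a:
  assumes F: "F \<in> W2s l" and s: "0 < \<sigma>" "\<sigma> < 1/2" and m: "m \<ge> 1" and M: "mode_a l \<sigma> m F F \<le> M" "0 \<le> M"
  shows "sq.nrm (YM l) (c0 F) \<le> sqrt (2 * M)" "sq.nrm (YM l) (c1 F) \<le> sqrt (2 * M)" "sq.nrm (YM l) (c2 F) \<le> sqrt (2 * M)"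
proof -
  have n: "0 \<le> ipM (YM l) (c2 F) (c2 F)" "0 \<le> ipM (YM l) (c1 F) (c1 F)" "0 \<le> ipM (YM l) (c0 F) (c0 F)"
    by (intro sq.nonneg W2s_sq[OF F])+
  have m1: "1 \<le> (real m)\<^sup>2" "1 \<le> (real m) ^ 4" using m by (auto intro: one_le_power)
  define T where "T = ipM (YM l) (c2 F) (c2 F) + (real m)\<^sup>2 * ipM (YM l) (c1 F) (c1 F) + (real m) ^ 4 * ipM (YM l) (c0 F) (c0 F)"
  have m2: "ipM (YM l) (c1 F) (c1 F) \<le> (real m)\<^sup>2 * ipM (YM l) (c1 F) (c1 F)"
    "ipM (YM l) (c0 F) (c0 F) \<le> (real m) ^ 4 * ipM (YM l) (c0 F) (c0 F)"
    using mult_right_mono[OF m1(1) n(2)] mult_right_mono[OF m1(2) n(3)] by auto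
  have T0: "0 \<le> T" unfolding T_def using n by simp
  have "1/2 * T \<le> (1 - \<sigma>) * T" using s T0 by (intro mult_right_mono) auto
  also have "\<dots> \<le> M" using mode_a_lower(2)[OF F s, of m] M by (simp add: T_def)
  finally have T: "T \<le> 2 * M" by simp
  show "sq.nrm (YM l) (c0 F) \<le> sqrt (2 * M)" "sq.nrm (YM l) (c1 F) \<le> sqrt (2 * M)" "sq.nrm (YM l) (c2 F) \<le> sqrt (2 * M)"
    unfolding sq.nrm_def real_sqrt_le_iff using n m2 T unfolding T_def by linarith+
qed

text \<open>The smallest value of |f| is at most its mean, and the oscillation is controlled by the derivative.\<close>
lemma W2s_sup_bound:
  assumes l: "0 < l" and F: "F \<in> W2s l" and y: "y \<in> {-l..l}"
  shows "\<bar>F (0, y)\<bar> \<le> sq.nrm (YM l) (c0 F) / sqrt (2 * l) + 2 * sqrt (2 * l) * sq.nrm (YM l) (c1 F)"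
proof -
  note sF = W2s_sq[OF F]
  define K where "K = 2 * sqrt (2 * l) * sq.nrm (YM l) (c1 F)"
  have osc: "\<bar>F (0, y)\<bar> - K \<le> \<bar>F (0, z)\<bar>" if z: "z \<in> {-l..l}" for z
    using W2s_eq(2)[OF F y] W2s_eq(2)[OF F z] prim_abs_le_nrm[OF sF(2), of y] prim_abs_le_nrm[OF sF(2), of z] l
    unfolding K_def by simp
  have "(2 * l) * (\<bar>F (0, y)\<bar> - K) = (LINT z|YM l. \<bar>F (0, y)\<bar> - K)"
    using measure_iv[of "-l" l] l by simp
  also have "\<dots> \<le> (LINT z|YM l. \<bar>F (0, z)\<bar>)"
    using iv.sqint_integrable[OF sF(1)] by (intro integral_mono) (auto intro!: osc)
  also have "\<dots> \<le> sqrt (2 * l) * sq.nrm (YM l) (c0 F)"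
    using iv.integral_abs_le_nrm[OF sF(1)] measure_iv[of "-l" l] l by simp
  finally have "\<bar>F (0, y)\<bar> - K \<le> sqrt (2 * l) * sq.nrm (YM l) (c0 F) / (2 * l)"
    using l by (simp add: field_simps)
  also have "\<dots> = sq.nrm (YM l) (c0 F) / sqrt (2 * l)"
    using l real_sqrt_mult_self[of "2 * l"] by (simp add: field_simps)
  finally show ?thesis by (simp add: K_def)
qed

text \<open>Profiles bounded in the form a are uniformly bounded and uniformly Hoelder continuous, so the
  theorem of Arzela and Ascoli applies.\<close>
lemma W2s_compact:
  fixes f :: "nat \<Rightarrow> nat \<times> real \<Rightarrow> real"
  assumes l: "0 < l" and s: "0 < \<sigma>" "\<sigma> < 1/2" and m: "m \<ge> 1"
    and f: "\<And>n. f n \<in> W2s l" "\<And>n. mode_a l \<sigma> m (f n) (f n) \<le> M"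
  shows "\<exists>r. strict_mono (r :: nat \<Rightarrow> nat) \<and> (\<forall>e>0. \<exists>N. \<forall>i\<ge>N. \<forall>j\<ge>N.
      semi_inner.nrm (mode_b l m) (\<lambda>p. f (r i) p - f (r j) p) < e)"
proof -
  interpret A: semi_inner "W2s l" "mode_a l \<sigma> m" by (rule semi_inner_mode_a[OF s])
  interpret B: semi_inner "W2s l" "mode_b l m" by (rule semi_inner_mode_b)
  have M: "0 \<le> M" using A.nonneg[OF f(1)] f(2) order_trans by blast
  define R where "R = sqrt (2 * M)"
  have R: "0 \<le> R" by (simp add: R_def M)
  have nr: "sq.nrm (YM l) (c0 (f n)) \<le> R" "sq.nrm (YM l) (c1 (f n)) \<le> R" for n
    using nrm_le_of_mode_a[OF f(1) s m f(2) M] by (auto simp: R_def)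
  have ll: "-l \<le> l" using l by simp
  obtain g k where g: "strict_mono (k :: nat \<Rightarrow> nat)"
    "\<And>e. 0 < e \<Longrightarrow> \<exists>N. \<forall>n y. n \<ge> N \<and> y \<in> {-l..l} \<longrightarrow> norm (f (k n) (0, y) - g y) < e"
  proof (rule Arzela_Ascoli[of "{-l..l}" "\<lambda>n y. f n (0, y)" "R / sqrt (2 * l) + 2 * sqrt (2 * l) * R"])
    show "compact {-l..l}" by simp
    show "norm (f n (0, y)) \<le> R / sqrt (2 * l) + 2 * sqrt (2 * l) * R" if "y \<in> {-l..l}" for n y
    proof -
      have "sq.nrm (YM l) (c0 (f n)) / sqrt (2 * l) \<le> R / sqrt (2 * l)" using nr l by (intro divide_right_mono) auto
      moreover have "2 * sqrt (2 * l) * sq.nrm (YM l) (c1 (f n)) \<le> 2 * sqrt (2 * l) * R" using nr l by (intro mult_left_mono) auto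
      ultimately show ?thesis using W2s_sup_bound[OF l f(1) that, of n] by simp
    qed
    show "\<exists>d. 0 < d \<and> (\<forall>n y. y \<in> {-l..l} \<and> norm (x - y) < d \<longrightarrow> norm (f n (0, x) - f n (0, y)) < e)"
      if x: "x \<in> {-l..l}" and e: "0 < e" for x e
    proof (intro exI[of _ "(e / (R + 1))\<^sup>2"] conjI allI impI)
      show "0 < (e / (R + 1))\<^sup>2" using e R by simp
      fix n y assume y: "y \<in> {-l..l} \<and> norm (x - y) < (e / (R + 1))\<^sup>2"
      have c: "\<bar>prim (YM l) (c1 (f n)) u - prim (YM l) (c1 (f n)) v\<bar> < e" if uv: "v \<le> u" "u - v < (e / (R + 1))\<^sup>2" for u v
      proof -
        have "\<bar>prim (YM l) (c1 (f n)) u - prim (YM l) (c1 (f n)) v\<bar> \<le> sqrt (u - v) * sq.nrm (YM l) (c1 (f n))"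
          by (rule prim_diff_le_nrm[OF W2s_sq(2)[OF f(1)] uv(1)])
        also have "\<dots> \<le> sqrt (u - v) * R" using nr uv by (intro mult_left_mono) auto
        also have "sqrt (u - v) \<le> e / (R + 1)" using uv e R by (intro real_le_lsqrt) auto
        then have "sqrt (u - v) * R \<le> e / (R + 1) * R" using R by (intro mult_right_mono)
        also have "e / (R + 1) * R < e" using e R by (simp add: field_simps)
        finally show ?thesis .
      qed
      have "f n (0, x) - f n (0, y) = prim (YM l) (c1 (f n)) x - prim (YM l) (c1 (f n)) y"
        using W2s_eq(2)[OF f(1) x] W2s_eq(2)[OF f(1)[of n], of y] y by simp
      then show "norm (f n (0, x) - f n (0, y)) < e"
        using c[of x y] c[of y x] y by (cases "x \<le> y") auto
    qed
  qed blast
  have "\<exists>N. \<forall>i\<ge>N. \<forall>j\<ge>N. B.nrm (\<lambda>p. f (k i) p - f (k j) p) < e" if e: "e > 0" for e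
  proof -
    define e' where "e' = e / (4 * real m * sqrt (2 * l))"
    have mm: "real m > 0" using m by simp
    have e': "e' > 0" using e l mm by (simp add: e'_def)
    obtain N where N: "\<And>n y. n \<ge> N \<Longrightarrow> y \<in> {-l..l} \<Longrightarrow> norm (f (k n) (0, y) - g y) < e'" using g(2)[OF e'] by blast
    have "B.nrm (\<lambda>p. f (k i) p - f (k j) p) < e" if ij: "i \<ge> N" "j \<ge> N" for i j
    proof -
      have D: "(\<lambda>p. f (k i) p - f (k j) p) \<in> W2s l" by (intro B.diff_mem f)
      have "sq.nrm (YM l) (\<lambda>y. f (k i) (0, y) - f (k j) (0, y)) \<le> sqrt (l - - l) * (2 * e')"
      proof (rule uniform_nrm_le[OF ll W2s_sq(1)[OF D]])
        fix y assume y: "y \<in> {-l..l}"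
        show "\<bar>f (k i) (0, y) - f (k j) (0, y)\<bar> \<le> 2 * e'"
          using N[OF ij(1) y] N[OF ij(2) y] by (simp add: abs_less_iff abs_le_iff)
      qed (use e' in auto)
      moreover have "B.nrm (\<lambda>p. f (k i) p - f (k j) p) = real m * sq.nrm (YM l) (\<lambda>y. f (k i) (0, y) - f (k j) (0, y))"
        by (simp add: B.nrm_def mode_b_def sq.nrm_def real_sqrt_mult)
      ultimately have "B.nrm (\<lambda>p. f (k i) p - f (k j) p) \<le> real m * (sqrt (2 * l) * (2 * e'))"
        using mm by (simp add: mult_left_mono)
      also have "\<dots> = e / 2" using l mm by (simp add: e'_def)
      also have "\<dots> < e" using e by simp
      finally show ?thesis .
    qed
    then show ?thesis by blast
  qed
  with g(1) show ?thesis by blast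
qed

lemma nrm_const: assumes "0 < l" shows "sq.nrm (YM l) (\<lambda>y. c) = \<bar>c\<bar> * sqrt (2 * l)"
  using measure_iv[of "-l" l] assms by (simp add: sq.nrm_def ipM_def real_sqrt_mult power2_eq_square[symmetric] mult.commute)

text \<open>If functions and their derivatives converge in L2, the values at the left end converge too, because
  the constant functions h_n(-l) are differences of convergent sequences up to a uniformly small
  error.\<close>
lemma primitive_limit:
  fixes h h1 :: "nat \<Rightarrow> real \<Rightarrow> real"
  assumes l: "0 < l" and h: "\<And>n. h n \<in> sqint (YM l)" and h1: "\<And>n. h1 n \<in> sqint (YM l)"
    and eq: "\<And>n y. y \<in> {-l..l} \<Longrightarrow> h n y = h n (-l) + prim (YM l) (h1 n) y"
    and g1: "g1 \<in> sqint (YM l)" "(\<lambda>n. sq.nrm (YM l) (\<lambda>y. h1 n y - g1 y)) \<longlonglongrightarrow> 0"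
    and C: "\<And>e. e > 0 \<Longrightarrow> \<exists>N. \<forall>i\<ge>N. \<forall>j\<ge>N. sq.nrm (YM l) (\<lambda>y. h i y - h j y) < e"
  obtains c where "(\<lambda>n. sq.nrm (YM l) (\<lambda>y. h n y - (c + prim (YM l) g1 y))) \<longlonglongrightarrow> 0"
proof -
  have ll: "-l \<le> l" using l by simp
  obtain g where g: "g \<in> sqint (YM l)" "(\<lambda>n. sq.nrm (YM l) (\<lambda>y. h n y - g y)) \<longlonglongrightarrow> 0"
    using sqint_complete[OF finite_measure_iv h C] by blast
  define P where "P = prim (YM l) g1"
  have Pc: "continuous_on UNIV P" unfolding P_def by (intro prim_continuous iv.sqint_integrable g1)
  have Ps: "P \<in> sqint (YM l)" by (rule cont_sqint[OF Pc])
  have Q: "(\<lambda>y. c + P y) \<in> sqint (YM l)" for c by (intro cont_sqint continuous_intros Pc)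
  have pb: "\<bar>prim (YM l) (h1 n) y - P y\<bar> \<le> sqrt (2 * l) * sq.nrm (YM l) (\<lambda>y. h1 n y - g1 y)" for n y
  proof -
    have "prim (YM l) (\<lambda>y. h1 n y + (-1) * g1 y) y = prim (YM l) (h1 n) y + prim (YM l) (\<lambda>y. (-1) * g1 y) y"
      by (rule prim_add) (auto intro: iv.sqint_integrable h1 g1)
    then have "prim (YM l) (h1 n) y - P y = prim (YM l) (\<lambda>y. h1 n y - g1 y) y"
      unfolding P_def prim_scale by simp
    then show ?thesis using prim_abs_le_nrm[OF sq.diff_mem[OF h1 g1(1)] ll, of n y] by simp
  qed
  have part: "sq.nrm (YM l) (\<lambda>y. h n y - (h n (-l) + P y)) \<le> (2 * l) * sq.nrm (YM l) (\<lambda>y. h1 n y - g1 y)" for n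
  proof -
    have "sq.nrm (YM l) (\<lambda>y. h n y - (h n (-l) + P y)) \<le> sqrt (l - - l) * (sqrt (2 * l) * sq.nrm (YM l) (\<lambda>y. h1 n y - g1 y))"
    proof (rule uniform_nrm_le[OF ll])
      show "(\<lambda>y. h n y - (h n (-l) + P y)) \<in> sqint (YM l)" by (rule sq.diff_mem[OF h Q])
      fix y assume "y \<in> {-l..l}"
      then have "h n y - (h n (-l) + P y) = prim (YM l) (h1 n) y - P y" using eq[of y n] by linarith
      then show "\<bar>h n y - (h n (-l) + P y)\<bar> \<le> sqrt (2 * l) * sq.nrm (YM l) (\<lambda>y. h1 n y - g1 y)" using pb[of n y] by simp
    next
      show "0 \<le> sqrt (2 * l) * sq.nrm (YM l) (\<lambda>y. h1 n y - g1 y)"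
        using l sq.nrm_nonneg[OF sq.diff_mem[OF h1 g1(1)]] by simp
    qed
    then show ?thesis using l by (simp add: mult.assoc[symmetric])
  qed
  have gP: "(\<lambda>y. g y - P y) \<in> sqint (YM l)" by (rule sq.diff_mem[OF g(1) Ps])
  have dconst: "(\<lambda>n. sq.nrm (YM l) (\<lambda>y. h n (-l) - (g y - P y))) \<longlonglongrightarrow> 0"
  proof (rule tendsto_sandwich[OF _ _ tendsto_const])
    show "\<forall>\<^sub>F n in sequentially. 0 \<le> sq.nrm (YM l) (\<lambda>y. h n (-l) - (g y - P y))"
      by (intro always_eventually allI sq.nrm_nonneg sq.diff_mem gP cont_sqint) auto
    show "\<forall>\<^sub>F n in sequentially. sq.nrm (YM l) (\<lambda>y. h n (-l) - (g y - P y)) \<le>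
        sq.nrm (YM l) (\<lambda>y. h n y - g y) + (2 * l) * sq.nrm (YM l) (\<lambda>y. h1 n y - g1 y)"
    proof (intro always_eventually allI)
      fix n
      have "sq.nrm (YM l) (\<lambda>y. (h n y - g y) - (h n y - (h n (-l) + P y))) \<le>
        sq.nrm (YM l) (\<lambda>y. h n y - g y) + sq.nrm (YM l) (\<lambda>y. h n y - (h n (-l) + P y))"
        by (intro sq.nrm_triangle_diff sq.diff_mem h g Q)
      then show "sq.nrm (YM l) (\<lambda>y. h n (-l) - (g y - P y)) \<le>
        sq.nrm (YM l) (\<lambda>y. h n y - g y) + (2 * l) * sq.nrm (YM l) (\<lambda>y. h1 n y - g1 y)"
        using part[of n] by (simp add: algebra_simps)
    qed
    show "(\<lambda>n. sq.nrm (YM l) (\<lambda>y. h n y - g y) + (2 * l) * sq.nrm (YM l) (\<lambda>y. h1 n y - g1 y)) \<longlonglongrightarrow> 0"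
      using tendsto_add[OF g(2) tendsto_mult[OF tendsto_const[of "2 * l"] g1(2)]] by simp
  qed
  \<comment> \<open>The norm of a constant function on the interval is proportional to its absolute value.\<close>
  have "Cauchy (\<lambda>n. h n (-l))"
  proof (rule metric_CauchyI)
    fix e :: real assume e: "0 < e"
    define e' where "e' = e * sqrt (2 * l) / 2"
    have e': "0 < e'" using e l by (simp add: e'_def)
    obtain N where N: "\<And>n. n \<ge> N \<Longrightarrow> sq.nrm (YM l) (\<lambda>y. h n (-l) - (g y - P y)) < e'"
      using dconst[THEN order_tendstoD(2), OF e'] by (auto simp: eventually_sequentially)
    have "dist (h i (-l)) (h j (-l)) < e" if "i \<ge> N" "j \<ge> N" for i j
    proof -
      have "sq.nrm (YM l) (\<lambda>y. (h i (-l) - (g y - P y)) - (h j (-l) - (g y - P y))) \<le>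
        sq.nrm (YM l) (\<lambda>y. h i (-l) - (g y - P y)) + sq.nrm (YM l) (\<lambda>y. h j (-l) - (g y - P y))"
        by (intro sq.nrm_triangle_diff sq.diff_mem gP cont_sqint) auto
      then have "sq.nrm (YM l) (\<lambda>y. h i (-l) - h j (-l)) < e * sqrt (2 * l)"
        using N[OF that(1)] N[OF that(2)] by (simp add: e'_def)
      then show ?thesis using l by (simp add: nrm_const dist_real_def)
    qed
    then show "\<exists>M. \<forall>m\<ge>M. \<forall>n\<ge>M. dist (h m (-l)) (h n (-l)) < e" by blast
  qed
  then obtain c where c: "(\<lambda>n. h n (-l)) \<longlonglongrightarrow> c" using Cauchy_convergent_iff convergent_def by blast
  have "(\<lambda>n. sq.nrm (YM l) (\<lambda>y. h n y - (c + P y))) \<longlonglongrightarrow> 0"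
  proof (rule tendsto_sandwich[OF _ _ tendsto_const])
    show "\<forall>\<^sub>F n in sequentially. 0 \<le> sq.nrm (YM l) (\<lambda>y. h n y - (c + P y))"
      by (intro always_eventually allI sq.nrm_nonneg sq.diff_mem h Q)
    show "\<forall>\<^sub>F n in sequentially. sq.nrm (YM l) (\<lambda>y. h n y - (c + P y)) \<le>
       (2 * l) * sq.nrm (YM l) (\<lambda>y. h1 n y - g1 y) + \<bar>h n (-l) - c\<bar> * sqrt (2 * l)"
    proof (intro always_eventually allI)
      fix n
      have "sq.nrm (YM l) (\<lambda>y. (h n y - (h n (-l) + P y)) + (h n (-l) - c)) \<le>
        sq.nrm (YM l) (\<lambda>y. h n y - (h n (-l) + P y)) + sq.nrm (YM l) (\<lambda>y. h n (-l) - c)"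
        by (intro sq.nrm_triangle sq.diff_mem h Q cont_sqint) auto
      then show "sq.nrm (YM l) (\<lambda>y. h n y - (c + P y)) \<le>
       (2 * l) * sq.nrm (YM l) (\<lambda>y. h1 n y - g1 y) + \<bar>h n (-l) - c\<bar> * sqrt (2 * l)"
        using part[of n] nrm_const[OF l, of "h n (-l) - c"] by (simp add: algebra_simps)
    qed
    have z: "(\<lambda>n. \<bar>h n (-l) - c\<bar>) \<longlonglongrightarrow> 0" using c by (simp add: LIM_zero tendsto_rabs_zero)
    from tendsto_add[OF tendsto_mult[OF tendsto_const[of "2 * l"] g1(2)] tendsto_mult[OF z tendsto_const[of "sqrt (2 * l)"]]]
    show "(\<lambda>n. (2 * l) * sq.nrm (YM l) (\<lambda>y. h1 n y - g1 y) + \<bar>h n (-l) - c\<bar> * sqrt (2 * l)) \<longlonglongrightarrow> 0" by simp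
  qed
  then show thesis using that unfolding P_def by blast
qed

text \<open>The derivatives converge in L2; integrating the limit of the second ones twice, with the limiting
  constants, gives a profile with exact derivatives.\<close>
lemma W2s_complete:
  fixes f :: "nat \<Rightarrow> nat \<times> real \<Rightarrow> real"
  assumes l: "0 < l" and s: "0 < \<sigma>" "\<sigma> < 1/2" and m: "m \<ge> 1"
    and f: "\<And>n. f n \<in> W2s l"
    and C: "\<And>e. e > 0 \<Longrightarrow> \<exists>N. \<forall>i\<ge>N. \<forall>j\<ge>N. semi_inner.nrm (mode_a l \<sigma> m) (\<lambda>p. f i p - f j p) < e"
  shows "\<exists>g\<in>W2s l. (\<lambda>n. semi_inner.nrm (mode_a l \<sigma> m) (\<lambda>p. f n p - g p)) \<longlonglongrightarrow> 0
      \<and> (\<lambda>n. semi_inner.nrm (mode_b l m) (\<lambda>p. f n p - g p)) \<longlonglongrightarrow> 0"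
proof -
  interpret A: semi_inner "W2s l" "mode_a l \<sigma> m" by (rule semi_inner_mode_a[OF s])
  interpret B: semi_inner "W2s l" "mode_b l m" by (rule semi_inner_mode_b)
  have C': "\<exists>N. \<forall>i\<ge>N. \<forall>j\<ge>N. sq.nrm (YM l) (\<lambda>y. f i (k, y) - f j (k, y)) < e"
    if k: "k = 0 \<or> k = 1 \<or> k = 2" and e: "e > 0" for k e
  proof -
    have "e / 2 > 0" using e by simp
    from C[OF this] obtain N where N: "\<And>i j. i \<ge> N \<Longrightarrow> j \<ge> N \<Longrightarrow> A.nrm (\<lambda>p. f i p - f j p) < e / 2" by blast
    have "sq.nrm (YM l) (\<lambda>y. f i (k, y) - f j (k, y)) < e" if ij: "i \<ge> N" "j \<ge> N" for i j
    proof -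
      let ?D = "\<lambda>p. f i p - f j p"
      have D: "?D \<in> W2s l" by (intro A.diff_mem f)
      have "sq.nrm (YM l) (\<lambda>y. f i (k, y) - f j (k, y)) \<le> sqrt (2 * mode_a l \<sigma> m ?D ?D)"
        using nrm_le_of_mode_a[OF D s m order_refl A.nonneg[OF D]] k by auto
      also have "\<dots> = sqrt 2 * A.nrm ?D" by (simp add: A.nrm_def real_sqrt_mult)
      also have "\<dots> \<le> 2 * A.nrm ?D"
        using A.nrm_nonneg[OF D] real_sqrt_le_mono[of 2 "2\<^sup>2"] by (intro mult_right_mono) auto
      also have "\<dots> < e" using N[OF ij] by simp
      finally show ?thesis .
    qed
    then show ?thesis by blast
  qed
  note sf = W2s_sq[OF f]
  obtain g2 where g2: "g2 \<in> sqint (YM l)" "(\<lambda>n. sq.nrm (YM l) (\<lambda>y. f n (2, y) - g2 y)) \<longlonglongrightarrow> 0"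
    using sqint_complete[OF finite_measure_iv sf(3) C'[of 2]] by blast
  obtain d where d: "(\<lambda>n. sq.nrm (YM l) (\<lambda>y. f n (1, y) - (d + prim (YM l) g2 y))) \<longlonglongrightarrow> 0"
    by (rule primitive_limit[OF l sf(2) sf(3) W2s_eq(1)[OF f] g2 C'[of 1]]) auto
  define g1 where "g1 y = d + prim (YM l) g2 y" for y
  have g1c: "continuous_on UNIV g1" unfolding g1_def by (intro continuous_intros prim_continuous iv.sqint_integrable g2)
  have g1: "g1 \<in> sqint (YM l)" by (rule cont_sqint[OF g1c])
  have g1l: "(\<lambda>n. sq.nrm (YM l) (\<lambda>y. f n (1, y) - g1 y)) \<longlonglongrightarrow> 0" using d by (simp add: g1_def)
  obtain c where c: "(\<lambda>n. sq.nrm (YM l) (\<lambda>y. f n (0, y) - (c + prim (YM l) g1 y))) \<longlonglongrightarrow> 0"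
    by (rule primitive_limit[OF l sf(1) sf(2) W2s_eq(2)[OF f] g1 g1l C'[of 0]]) auto
  define g0 where "g0 y = c + prim (YM l) g1 y" for y
  have "W2 l g0 g1 g2" unfolding W2_def using g2(1) by (simp add: g0_def g1_def prim_left)
  define g where "g = triple g0 g1 g2"
  have g: "g \<in> W2s l" unfolding g_def by (rule triple_W2s) fact
  have gs: "\<And>y. g (0, y) = g0 y" "\<And>y. g (1, y) = g1 y" "\<And>y. g (2, y) = g2 y" by (auto simp: g_def triple_def)
  have lim: "(\<lambda>n. sq.nrm (YM l) (\<lambda>y. f n (0, y) - g (0, y))) \<longlonglongrightarrow> 0"
    "(\<lambda>n. sq.nrm (YM l) (\<lambda>y. f n (1, y) - g (1, y))) \<longlonglongrightarrow> 0"
    "(\<lambda>n. sq.nrm (YM l) (\<lambda>y. f n (2, y) - g (2, y))) \<longlonglongrightarrow> 0"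
    using c g1l g2(2) unfolding gs by (simp_all add: g0_def)
  have D: "(\<lambda>p. f n p - g p) \<in> W2s l" for n by (intro A.diff_mem f g)
  note sD = W2s_sq[OF D]
  have ip0: "(\<lambda>n. ipM (YM l) (F n) (G n)) \<longlonglongrightarrow> 0"
    if "\<And>n. F n \<in> sqint (YM l)" "\<And>n. G n \<in> sqint (YM l)"
      "(\<lambda>n. sq.nrm (YM l) (F n)) \<longlonglongrightarrow> 0" "(\<lambda>n. sq.nrm (YM l) (G n)) \<longlonglongrightarrow> 0" for F G
  proof (rule Lim_null_comparison)
    show "\<forall>\<^sub>F n in sequentially. norm (ipM (YM l) (F n) (G n)) \<le> sq.nrm (YM l) (F n) * sq.nrm (YM l) (G n)"
      using sq.Cauchy_Schwarz[OF that(1,2)] by simp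
    show "(\<lambda>n. sq.nrm (YM l) (F n) * sq.nrm (YM l) (G n)) \<longlonglongrightarrow> 0"
      using tendsto_mult[OF that(3,4)] by simp
  qed
  have "(\<lambda>n. mode_a l \<sigma> m (\<lambda>p. f n p - g p) (\<lambda>p. f n p - g p)) \<longlonglongrightarrow>
      0 - \<sigma> * (real m)\<^sup>2 * (0 + 0) + 2 * (1 - \<sigma>) * (real m)\<^sup>2 * 0 + (real m) ^ 4 * 0"
    unfolding mode_a_def mode_form_def by (intro tendsto_intros ip0 sD lim)
  from tendsto_real_sqrt[OF this] have a: "(\<lambda>n. A.nrm (\<lambda>p. f n p - g p)) \<longlonglongrightarrow> 0"
    unfolding A.nrm_def by simp
  have "(\<lambda>n. mode_b l m (\<lambda>p. f n p - g p) (\<lambda>p. f n p - g p)) \<longlonglongrightarrow> (real m)\<^sup>2 * 0"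
    unfolding mode_b_def by (intro tendsto_intros ip0 sD lim)
  from tendsto_real_sqrt[OF this] have b: "(\<lambda>n. B.nrm (\<lambda>p. f n p - g p)) \<longlonglongrightarrow> 0"
    unfolding B.nrm_def by simp
  show ?thesis using g a b by blast
qed

lemma form_pair_modes:
  assumes l: "0 < l" and s: "0 < \<sigma>" "\<sigma> < 1/2" and m: "m \<ge> 1"
  shows "form_pair (W2s l) (mode_a l \<sigma> m) (mode_b l m)"
proof -
  interpret A: semi_inner "W2s l" "mode_a l \<sigma> m" by (rule semi_inner_mode_a[OF s])
  interpret B: semi_inner "W2s l" "mode_b l m" by (rule semi_inner_mode_b)
  show ?thesis
  proof unfold_locales
    show "\<exists>r. strict_mono (r :: nat \<Rightarrow> nat) \<and> (\<forall>e>0. \<exists>N. \<forall>i\<ge>N. \<forall>j\<ge>N. B.nrm (\<lambda>p. f (r i) p - f (r j) p) < e)"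
      if "\<And>n. f n \<in> W2s l" "\<And>n. mode_a l \<sigma> m (f n) (f n) \<le> M" for f :: "nat \<Rightarrow> nat \<times> real \<Rightarrow> real" and M
      by (rule W2s_compact[OF l s m that])
    show "\<exists>g\<in>W2s l. (\<lambda>n. A.nrm (\<lambda>p. f n p - g p)) \<longlonglongrightarrow> 0 \<and> (\<lambda>n. B.nrm (\<lambda>p. f n p - g p)) \<longlonglongrightarrow> 0"
      if "\<And>n. f n \<in> W2s l"
        "\<And>e. e > 0 \<Longrightarrow> \<exists>N. \<forall>i\<ge>N. \<forall>j\<ge>N. A.nrm (\<lambda>p. f i p - f j p) < e"
      for f :: "nat \<Rightarrow> nat \<times> real \<Rightarrow> real"
      by (rule W2s_complete[OF l s m that])
  qed
qed

lemma W2_smooth: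
  assumes l: "0 < l" and "\<And>y. (f has_real_derivative f1 y) (at y)" "\<And>y. (f1 has_real_derivative f2 y) (at y)"
    and c: "continuous_on UNIV f2"
  shows "W2 l f f1 f2"
  unfolding W2_def
proof (intro conjI ballI)
  show "f2 \<in> sqint (YM l)" by (rule cont_sqint[OF c])
  fix y assume y: "y \<in> {-l..l}"
  show "f1 y = f1 (-l) + prim (YM l) f2 y"
    using prim_FTC[of "-l" l f1 f2 y] assms y by simp
  have "continuous_on UNIV f1" by (meson DERIV_isCont assms(3) continuous_at_imp_continuous_on)
  then show "f y = f (-l) + prim (YM l) f1 y"
    using prim_FTC[of "-l" l f f1 y] assms y by simp
qed

text \<open>The product rule for absolutely continuous functions.\<close>
lemma ac_product:
  assumes ab: "a < b" and h1: "integrable (iv a b) h1" and k1: "integrable (iv a b) k1"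
    and h: "\<And>x. x \<in> {a..b} \<Longrightarrow> h x = h a + prim (iv a b) h1 x"
    and k: "\<And>x. x \<in> {a..b} \<Longrightarrow> k x = k a + prim (iv a b) k1 x"
  shows "(LINT x|iv a b. h1 x * k x) + (LINT x|iv a b. h x * k1 x) = h b * k b - h a * k a"
proof -
  have i: "integrable (iv a b) (\<lambda>x. h1 x * prim (iv a b) k1 x)" "integrable (iv a b) (\<lambda>x. k1 x * prim (iv a b) h1 x)"
    using prim_abs_le[OF h1] prim_measurable[OF h1] prim_abs_le[OF k1] prim_measurable[OF k1]
    by (auto intro!: integrable_mult_bounded measurable_iv h1 k1)
  have "(LINT x|iv a b. h1 x * k x) = (LINT x|iv a b. k a * h1 x + h1 x * prim (iv a b) k1 x)"
  proof (intro Bochner_Integration.integral_cong refl)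
    fix x assume "x \<in> space (iv a b)"
    then have "k x = k a + prim (iv a b) k1 x" by (intro k) auto
    then show "h1 x * k x = k a * h1 x + h1 x * prim (iv a b) k1 x" by (simp add: algebra_simps)
  qed
  also have "\<dots> = k a * integral\<^sup>L (iv a b) h1 + (LINT x|iv a b. h1 x * prim (iv a b) k1 x)"
    using h1 i by simp
  finally have 1: "(LINT x|iv a b. h1 x * k x) = k a * integral\<^sup>L (iv a b) h1 + (LINT x|iv a b. h1 x * prim (iv a b) k1 x)" .
  have "(LINT x|iv a b. h x * k1 x) = (LINT x|iv a b. h a * k1 x + k1 x * prim (iv a b) h1 x)"
  proof (intro Bochner_Integration.integral_cong refl)
    fix x assume "x \<in> space (iv a b)"
    then have "h x = h a + prim (iv a b) h1 x" by (intro h) auto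
    then show "h x * k1 x = h a * k1 x + k1 x * prim (iv a b) h1 x" by (simp add: algebra_simps)
  qed
  also have "\<dots> = h a * integral\<^sup>L (iv a b) k1 + (LINT x|iv a b. prim (iv a b) h1 x * k1 x)"
    using k1 i by (simp add: mult.commute)
  finally have 2: "(LINT x|iv a b. h x * k1 x) = h a * integral\<^sup>L (iv a b) k1 + (LINT x|iv a b. prim (iv a b) h1 x * k1 x)" .
  have hb: "h b = h a + integral\<^sup>L (iv a b) h1" using h[of b] ab by (simp add: prim_right)
  have kb: "k b = k a + integral\<^sup>L (iv a b) k1" using k[of b] ab by (simp add: prim_right)
  show ?thesis unfolding 1 2 hb kb using prim_by_parts[OF h1 k1] by (simp add: algebra_simps)
qed

lemma W2s_parts:
  assumes l: "0 < l" and F: "F \<in> W2s l" and G: "G \<in> W2s l"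
  shows "ipM (YM l) (c2 F) (c0 G) = F (1, l) * G (0, l) - F (1, -l) * G (0, -l) - ipM (YM l) (c1 F) (c1 G)"
    "ipM (YM l) (c1 F) (c1 G) = F (0, l) * G (1, l) - F (0, -l) * G (1, -l) - ipM (YM l) (c0 F) (c2 G)"
proof -
  have ll: "-l < l" using l by simp
  show "ipM (YM l) (c2 F) (c0 G) = F (1, l) * G (0, l) - F (1, -l) * G (0, -l) - ipM (YM l) (c1 F) (c1 G)"
    using ac_product[OF ll W2s_int(3)[OF F] W2s_int(2)[OF G] W2s_eq(1)[OF F] W2s_eq(2)[OF G]] by (simp add: ipM_def)
  show "ipM (YM l) (c1 F) (c1 G) = F (0, l) * G (1, l) - F (0, -l) * G (1, -l) - ipM (YM l) (c0 F) (c2 G)"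
    using ac_product[OF ll W2s_int(2)[OF F] W2s_int(3)[OF G] W2s_eq(2)[OF F] W2s_eq(1)[OF G]] by (simp add: ipM_def)
qed

section \<open>Eigenvalues of the first mode\<close>

text \<open>The weak eigenvalue equation in mode m, with natural boundary conditions at \<plusminus>l.\<close>
definition mode_eigen :: "real \<Rightarrow> real \<Rightarrow> nat \<Rightarrow> real \<Rightarrow> (nat \<times> real \<Rightarrow> real) \<Rightarrow> bool" where
  "mode_eigen l \<sigma> m \<nu> F \<longleftrightarrow> F \<in> W2s l \<and> (\<forall>G\<in>W2s l. mode_a l \<sigma> m F G = \<nu> * mode_b l m F G)"

text \<open>The test profile satisfies g'' = k g with (k - 1)^2 = \<nu>, hence it solves the differential
  equation of the eigenvalue problem. Integrating by parts therefore removes all integrals and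
  leaves a relation between boundary values.\<close>
lemma eigen_boundary_relation:
  assumes l: "0 < l" and F: "mode_eigen l \<sigma> 1 \<nu> F" and Z: "G \<in> W2s l"
    and Z2: "\<And>y. G (2, y) = k * G (0, y)" and k: "(k - 1)\<^sup>2 = \<nu>"
  shows "(k - \<sigma>) * (F (1, l) * G (0, l) - F (1, -l) * G (0, -l))
       + (2 - \<sigma> - k) * (F (0, l) * G (1, l) - F (0, -l) * G (1, -l)) = 0"
proof -
  have FW: "F \<in> W2s l" and E: "mode_a l \<sigma> 1 F G = \<nu> * mode_b l 1 F G" using F Z by (auto simp: mode_eigen_def)
  note sF = W2s_sq[OF FW] and sZ = W2s_sq[OF Z]
  define I where "I = ipM (YM l) (c0 F) (c0 G)"
  have e2: "c2 G = (\<lambda>y. k * c0 G y)" using Z2 by auto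
  have r: "ipM (YM l) h (c2 G) = k * ipM (YM l) h (c0 G)" if "h \<in> sqint (YM l)" for h
    unfolding e2 by (rule sq.scale_right[OF sZ(1) that])
  define B1 where "B1 = F (1, l) * G (0, l) - F (1, -l) * G (0, -l)"
  define B0 where "B0 = F (0, l) * G (1, l) - F (0, -l) * G (1, -l)"
  have p2: "ipM (YM l) (c1 F) (c1 G) = B0 - k * I"
    using W2s_parts(2)[OF l FW Z] r[OF sF(1)] by (simp add: B0_def I_def)
  have p1: "ipM (YM l) (c2 F) (c0 G) = B1 - (B0 - k * I)"
    using W2s_parts(1)[OF l FW Z] p2 by (simp add: B1_def)
  have "k * (B1 - (B0 - k * I)) - \<sigma> * (k * I + (B1 - (B0 - k * I))) + 2 * (1 - \<sigma>) * (B0 - k * I) + I = \<nu> * I"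
    using E unfolding mode_a_def mode_form_def mode_b_def r[OF sF(3)] r[OF sF(1)] p1 p2 I_def[symmetric] by simp
  then have "(k - \<sigma>) * B1 + (2 - \<sigma> - k) * B0 + ((k - 1)\<^sup>2 - \<nu>) * I = 0"
    by (simp add: algebra_simps power2_eq_square)
  then show ?thesis using k by (simp add: B1_def B0_def)
qed

text \<open>With vanishing boundary values the mixed term integrates by parts, and the form dominates the square
  of the L2 norm.\<close>
lemma eigen_zero_boundary:
  assumes l: "0 < l" and F: "mode_eigen l \<sigma> 1 \<nu> F" and \<nu>: "\<nu> < 1"
    and z: "F (0, l) = 0" "F (0, -l) = 0"
  shows "mode_b l 1 F F = 0"
proof -
  have FW: "F \<in> W2s l" and E: "mode_a l \<sigma> 1 F F = \<nu> * mode_b l 1 F F" using F by (auto simp: mode_eigen_def)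
  note sF = W2s_sq[OF FW]
  have n: "0 \<le> ipM (YM l) (c2 F) (c2 F)" "0 \<le> ipM (YM l) (c1 F) (c1 F)" "0 \<le> ipM (YM l) (c0 F) (c0 F)"
    by (intro sq.nonneg sF)+
  have "ipM (YM l) (c0 F) (c2 F) = - ipM (YM l) (c1 F) (c1 F)"
    using W2s_parts(2)[OF l FW FW] z by simp
  then have "mode_a l \<sigma> 1 F F = ipM (YM l) (c2 F) (c2 F) + 2 * ipM (YM l) (c1 F) (c1 F) + ipM (YM l) (c0 F) (c0 F)"
    unfolding mode_a_square[OF FW] by (simp add: algebra_simps)
  then have "(1 - \<nu>) * ipM (YM l) (c0 F) (c0 F) \<le> 0"
    using E n by (simp add: mode_b_def algebra_simps)
  then have "ipM (YM l) (c0 F) (c0 F) \<le> 0" using \<nu> by (simp add: mult_le_0_iff)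
  then show ?thesis using n by (simp add: mode_b_def)
qed

lemma mode_eigen_comb:
  assumes s: "0 < \<sigma>" "\<sigma> < 1/2" and F: "mode_eigen l \<sigma> m \<nu> F" and G: "mode_eigen l \<sigma> m \<nu> G"
  shows "mode_eigen l \<sigma> m \<nu> (\<lambda>p. c * F p + d * G p)"
proof -
  interpret A: semi_inner "W2s l" "mode_a l \<sigma> m" by (rule semi_inner_mode_a[OF s])
  interpret B: semi_inner "W2s l" "mode_b l m" by (rule semi_inner_mode_b)
  show ?thesis using F G unfolding mode_eigen_def
    by (auto simp: A.add_mem A.scale_mem A.add_left A.scale_left B.add_left B.scale_left algebra_simps)
qed

text \<open>The hyperbolic functions with squared rates k = 1 + sqrt \<nu> and k = 1 - sqrt \<nu> give two
  relations for the even and two for the odd boundary data of an eigenfunction. Both determinants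
  cannot vanish together, as this would force \<alpha> = \<beta>. So one of the sum and the
  difference of the values at \<plusminus>l vanishes for all eigenfunctions, and the other is a
  linear functional whose kernel is trivial modulo null elements. Modulo null elements the space of
  eigenfunctions thus has dimension at most one.\<close>
theorem mode1_simple:
  assumes l: "0 < l" and s: "0 < \<sigma>" "\<sigma> < 1/2" and \<nu>: "0 < \<nu>" "\<nu> < 1"
    and F: "mode_eigen l \<sigma> 1 \<nu> F" and G: "mode_eigen l \<sigma> 1 \<nu> G"
    and orth: "mode_b l 1 F G = 0" and nz: "mode_b l 1 F F \<noteq> 0" "mode_b l 1 G G \<noteq> 0"
  shows False
proof -
  interpret B: semi_inner "W2s l" "mode_b l 1" by (rule semi_inner_mode_b)
  define t where "t = sqrt \<nu>"
  have t: "0 < t" "t < 1" "t\<^sup>2 = \<nu>" using \<nu> by (auto simp: t_def)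
  define \<alpha> where "\<alpha> = sqrt (1 + t)" define \<beta> where "\<beta> = sqrt (1 - t)"
  have ab: "0 < \<beta>" "\<beta> < \<alpha>" "\<alpha>\<^sup>2 = 1 + t" "\<beta>\<^sup>2 = 1 - t" using t by (auto simp: \<alpha>_def \<beta>_def)
  define p where "p = 1 + t - \<sigma>" define q where "q = 1 - t - \<sigma>"
  have p: "0 < p" using t s by (simp add: p_def)
  have Wc: "triple (\<lambda>y. cosh (k * y)) (\<lambda>y. k * sinh (k * y)) (\<lambda>y. k\<^sup>2 * cosh (k * y)) \<in> W2s l" for k
    by (intro triple_W2s W2_smooth[OF l]) (auto intro!: derivative_eq_intros continuous_intros simp: power2_eq_square)
  have Ws: "triple (\<lambda>y. sinh (k * y)) (\<lambda>y. k * cosh (k * y)) (\<lambda>y. k\<^sup>2 * sinh (k * y)) \<in> W2s l" for k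
    by (intro triple_W2s W2_smooth[OF l]) (auto intro!: derivative_eq_intros continuous_intros simp: power2_eq_square)
  \<comment> \<open>Even and odd combinations of the boundary values and boundary slopes.\<close>
  define E0 where "E0 H = H (0, l) + H (0, -l)" for H :: "nat \<times> real \<Rightarrow> real"
  define E1 where "E1 H = H (1, l) - H (1, -l)" for H :: "nat \<times> real \<Rightarrow> real"
  define O0 where "O0 H = H (0, l) - H (0, -l)" for H :: "nat \<times> real \<Rightarrow> real"
  define O1 where "O1 H = H (1, l) + H (1, -l)" for H :: "nat \<times> real \<Rightarrow> real"
  define Ca Sa Cb Sb where "Ca = cosh (\<alpha> * l)" and "Sa = sinh (\<alpha> * l)" and "Cb = cosh (\<beta> * l)" and "Sb = sinh (\<beta> * l)"
  have pos: "0 < Ca" "0 < Sa" "0 < Cb" "0 < Sb" using l ab by (auto simp: Ca_def Sa_def Cb_def Sb_def)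
  have k: "(\<alpha>\<^sup>2 - 1)\<^sup>2 = \<nu>" "(\<beta>\<^sup>2 - 1)\<^sup>2 = \<nu>" using ab t by auto
  have rel: "p * Ca * E1 H + q * \<alpha> * Sa * E0 H = 0" "q * Cb * E1 H + p * \<beta> * Sb * E0 H = 0"
    "p * Sa * O1 H + q * \<alpha> * Ca * O0 H = 0" "q * Sb * O1 H + p * \<beta> * Cb * O0 H = 0"
    if H: "mode_eigen l \<sigma> 1 \<nu> H" for H
  proof -
    show "p * Ca * E1 H + q * \<alpha> * Sa * E0 H = 0"
      using eigen_boundary_relation[OF l H Wc[of \<alpha>] _ k(1)] ab
      by (simp add: triple_def p_def q_def Ca_def Sa_def E0_def E1_def algebra_simps)
    show "q * Cb * E1 H + p * \<beta> * Sb * E0 H = 0"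
      using eigen_boundary_relation[OF l H Wc[of \<beta>] _ k(2)] ab
      by (simp add: triple_def p_def q_def Cb_def Sb_def E0_def E1_def algebra_simps)
    show "p * Sa * O1 H + q * \<alpha> * Ca * O0 H = 0"
      using eigen_boundary_relation[OF l H Ws[of \<alpha>] _ k(1)] ab
      by (simp add: triple_def p_def q_def Ca_def Sa_def O0_def O1_def algebra_simps)
    show "q * Sb * O1 H + p * \<beta> * Cb * O0 H = 0"
      using eigen_boundary_relation[OF l H Ws[of \<beta>] _ k(2)] ab
      by (simp add: triple_def p_def q_def Cb_def Sb_def O0_def O1_def algebra_simps)
  qed
  have evenz: "(p\<^sup>2 * \<beta> * (Ca * Sb) - q\<^sup>2 * \<alpha> * (Sa * Cb)) * E0 H = 0" if H: "mode_eigen l \<sigma> 1 \<nu> H" for H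
  proof -
    have "p * Ca * (q * Cb * E1 H + p * \<beta> * Sb * E0 H) - q * Cb * (p * Ca * E1 H + q * \<alpha> * Sa * E0 H) = 0"
      unfolding rel[OF H] by simp
    then show ?thesis by (simp add: algebra_simps power2_eq_square)
  qed
  have oddz: "(p\<^sup>2 * \<beta> * (Sa * Cb) - q\<^sup>2 * \<alpha> * (Ca * Sb)) * O0 H = 0" if H: "mode_eigen l \<sigma> 1 \<nu> H" for H
  proof -
    have "p * Sa * (q * Sb * O1 H + p * \<beta> * Cb * O0 H) - q * Sb * (p * Sa * O1 H + q * \<alpha> * Ca * O0 H) = 0"
      unfolding rel[OF H] by simp
    then show ?thesis by (simp add: algebra_simps power2_eq_square)
  qed
  have notboth: "p\<^sup>2 * \<beta> * (Ca * Sb) - q\<^sup>2 * \<alpha> * (Sa * Cb) \<noteq> 0 \<or> p\<^sup>2 * \<beta> * (Sa * Cb) - q\<^sup>2 * \<alpha> * (Ca * Sb) \<noteq> 0"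
  proof (rule ccontr)
    assume "\<not> ?thesis"
    then have e: "p\<^sup>2 * \<beta> * (Ca * Sb) = q\<^sup>2 * \<alpha> * (Sa * Cb)" "p\<^sup>2 * \<beta> * (Sa * Cb) = q\<^sup>2 * \<alpha> * (Ca * Sb)" by auto
    have "p\<^sup>2 * \<beta> * (Ca * Sb)\<^sup>2 = q\<^sup>2 * \<alpha> * (Sa * Cb) * (Ca * Sb)" using e(1) by (simp add: power2_eq_square)
    also have "\<dots> = p\<^sup>2 * \<beta> * (Sa * Cb)\<^sup>2" using e(2) by (simp add: power2_eq_square)
    finally have "(Ca * Sb)\<^sup>2 = (Sa * Cb)\<^sup>2" using p ab by simp
    then have "Ca * Sb = Sa * Cb" using pos by simp
    then have "sinh (\<alpha> * l - \<beta> * l) = 0" by (simp add: sinh_diff Ca_def Sa_def Cb_def Sb_def)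
    then have "(\<alpha> - \<beta>) * l = 0" by (simp add: algebra_simps)
    then show False using ab l by simp
  qed
  have bdry: "mode_b l 1 H H = 0" if H: "mode_eigen l \<sigma> 1 \<nu> H" "E0 H = 0" "O0 H = 0" for H
    using H by (intro eigen_zero_boundary[OF l H(1) \<nu>(2)]) (auto simp: E0_def O0_def)
  have nrm: "mode_b l 1 (\<lambda>z. c * F z + d * G z) (\<lambda>z. c * F z + d * G z) = c\<^sup>2 * mode_b l 1 F F + d\<^sup>2 * mode_b l 1 G G" for c d
    using F G orth B.sym[of F G] unfolding mode_eigen_def
    by (simp add: B.add_left B.add_right B.scale_left B.scale_right B.scale_mem B.add_mem power2_eq_square)
  have BF: "0 < mode_b l 1 F F" "0 < mode_b l 1 G G" using nz B.nonneg[of F] B.nonneg[of G] F G by (auto simp: mode_eigen_def)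
  \<comment> \<open>J is the boundary datum that the determinants leave undetermined.\<close>
  have contra: False if J: "\<And>H. mode_eigen l \<sigma> 1 \<nu> H \<Longrightarrow> J H = 0 \<Longrightarrow> mode_b l 1 H H = 0"
      "\<And>c d. J (\<lambda>z. c * F z + d * G z) = c * J F + d * J G" for J :: "(nat \<times> real \<Rightarrow> real) \<Rightarrow> real"
  proof -
    have "J (\<lambda>z. J G * F z + (- J F) * G z) = 0" unfolding J(2) by simp
    then have "mode_b l 1 (\<lambda>z. J G * F z + (- J F) * G z) (\<lambda>z. J G * F z + (- J F) * G z) = 0"
      by (intro J(1) mode_eigen_comb s F G)
    then have sum0: "(J G)\<^sup>2 * mode_b l 1 F F + (J F)\<^sup>2 * mode_b l 1 G G = 0" unfolding nrm by simp
    have "0 \<le> (J G)\<^sup>2 * mode_b l 1 F F" "0 \<le> (J F)\<^sup>2 * mode_b l 1 G G" using BF by simp_all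
    with sum0 have "(J F)\<^sup>2 * mode_b l 1 G G = 0" by linarith
    then have "J F = 0" using BF by simp
    from J(1)[OF F this] BF show False by simp
  qed
  from notboth show False
  proof
    assume "p\<^sup>2 * \<beta> * (Ca * Sb) - q\<^sup>2 * \<alpha> * (Sa * Cb) \<noteq> 0"
    then have "E0 H = 0" if "mode_eigen l \<sigma> 1 \<nu> H" for H using evenz[OF that] by simp
    then show False by (intro contra[of O0]) (auto simp: bdry O0_def algebra_simps)
  next
    assume "p\<^sup>2 * \<beta> * (Sa * Cb) - q\<^sup>2 * \<alpha> * (Ca * Sb) \<noteq> 0"
    then have "O0 H = 0" if "mode_eigen l \<sigma> 1 \<nu> H" for H using oddz[OF that] by simp
    then show False by (intro contra[of E0]) (auto simp: bdry E0_def algebra_simps)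
  qed
qed

text \<open>The constant profile gives the quotient 1 exactly. A small convex perturbation 1 + \<epsilon> y^2
  lowers it, because the term -2 \<sigma> f f'' is of first order in \<epsilon> and the other
  corrections are of second order.\<close>
lemma mode1_below_one:
  assumes l: "0 < l" and s: "0 < \<sigma>" "\<sigma> < 1/2"
  shows "\<exists>F\<in>W2s l. mode_b l 1 F F > 0 \<and> mode_a l \<sigma> 1 F F < mode_b l 1 F F"
proof -
  \<comment> \<open>Chosen such that \<epsilon> (1 + 2 l^2) is half of \<sigma>.\<close>
  define \<epsilon> where "\<epsilon> = \<sigma> / (2 * (1 + 2 * l\<^sup>2))"
  have k: "0 < 1 + 2 * l\<^sup>2" by (simp add: add_pos_nonneg)
  have "\<sigma> / (2 * K) * K = \<sigma> / 2" if "0 < K" for K :: real using that by simp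
  from this[OF k] have e: "0 < \<epsilon>" "\<epsilon> * (1 + 2 * l\<^sup>2) = \<sigma> / 2" using s k unfolding \<epsilon>_def by auto
  define F where "F = triple (\<lambda>y. 1 + \<epsilon> * y\<^sup>2) (\<lambda>y. 2 * \<epsilon> * y) (\<lambda>y. 2 * \<epsilon>)"
  have F: "F \<in> W2s l" unfolding F_def
    by (intro triple_W2s W2_smooth[OF l]) (auto intro!: derivative_eq_intros continuous_intros)
  note sF = W2s_sq[OF F]
  have FF: "c0 F = (\<lambda>y. 1 + \<epsilon> * y\<^sup>2)" "c1 F = (\<lambda>y. 2 * \<epsilon> * y)" "c2 F = (\<lambda>y. 2 * \<epsilon>)" by (auto simp: F_def triple_def)
  note i = sqint_mult_integrable[OF sF(1) sF(1)] sqint_mult_integrable[OF sF(1) sF(3)] sqint_mult_integrable[OF sF(2) sF(2)] sqint_mult_integrable[OF sF(3) sF(3)]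
  have "mode_a l \<sigma> 1 F F - mode_b l 1 F F = (LINT y|YM l. F (2, y) * F (2, y) - 2 * \<sigma> * (F (0, y) * F (2, y)) + 2 * (1 - \<sigma>) * (F (1, y) * F (1, y)))"
    unfolding mode_a_square[OF F] mode_b_def ipM_def using i by simp
  also have "\<dots> \<le> (LINT y|YM l. - 2 * \<sigma> * \<epsilon>)"
  proof (rule integral_mono)
    show "integrable (YM l) (\<lambda>y. F (2, y) * F (2, y) - 2 * \<sigma> * (F (0, y) * F (2, y)) + 2 * (1 - \<sigma>) * (F (1, y) * F (1, y)))"
      using i by simp
    fix y assume "y \<in> space (YM l)"
    then have "y\<^sup>2 \<le> l\<^sup>2" by (intro power2_le_iff_abs_le[THEN iffD2]) auto
    have "F (2, y) * F (2, y) - 2 * \<sigma> * (F (0, y) * F (2, y)) + 2 * (1 - \<sigma>) * (F (1, y) * F (1, y))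
        = 4 * \<epsilon> * (\<epsilon> - \<sigma> + (2 - 3 * \<sigma>) * (\<epsilon> * y\<^sup>2))"
      unfolding fun_cong[OF FF(1), of y] fun_cong[OF FF(2), of y] fun_cong[OF FF(3), of y]
      by (simp add: algebra_simps power2_eq_square)
    also have "\<dots> \<le> 4 * \<epsilon> * (\<epsilon> - \<sigma> + 2 * (\<epsilon> * l\<^sup>2))"
    proof -
      have "(2 - 3 * \<sigma>) * (\<epsilon> * y\<^sup>2) \<le> 2 * (\<epsilon> * l\<^sup>2)"
        using s e \<open>y\<^sup>2 \<le> l\<^sup>2\<close> by (intro mult_mono) auto
      then show ?thesis using e by (intro mult_left_mono) auto
    qed
    also have "\<dots> = 4 * \<epsilon> * (\<epsilon> * (1 + 2 * l\<^sup>2) - \<sigma>)" by (simp add: algebra_simps)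
    also have "\<dots> = - 2 * \<sigma> * \<epsilon>" unfolding e(2) by simp
    finally show "F (2, y) * F (2, y) - 2 * \<sigma> * (F (0, y) * F (2, y)) + 2 * (1 - \<sigma>) * (F (1, y) * F (1, y)) \<le> - 2 * \<sigma> * \<epsilon>" .
  qed simp
  also have "\<dots> < 0" using measure_iv[of "-l" l] l s e by simp
  finally have 1: "mode_a l \<sigma> 1 F F < mode_b l 1 F F" by simp
  have "0 \<le> mode_a l \<sigma> 1 F F" using semi_inner.nonneg[OF semi_inner_mode_a[OF s] F] .
  then show ?thesis using F 1 by (intro bexI[of _ F]) auto
qed

section \<open>The plate forms on the whole space\<close>

lemma H2star_add: assumes "u \<in> H2star l" "v \<in> H2star l" shows "(\<lambda>p. u p + v p) \<in> H2star l"
proof -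
  let ?R = "{0..pi} \<times> {-l..l}"
  obtain f where f: "continuous_on ?R f" "AE p in lebesgue_on (plate l). u p = f p" "\<forall>p\<in>{0, pi} \<times> {-l..l}. f p = 0"
    using assms(1) unfolding H2star_def by blast
  obtain g where g: "continuous_on ?R g" "AE p in lebesgue_on (plate l). v p = g p" "\<forall>p\<in>{0, pi} \<times> {-l..l}. g p = 0"
    using assms(2) unfolding H2star_def by blast
  have "AE p in lebesgue_on (plate l). u p + v p = f p + g p" using f(2) g(2) by eventually_elim simp
  moreover have "continuous_on ?R (\<lambda>p. f p + g p)" by (intro continuous_intros f g)
  moreover have "\<forall>p\<in>{0, pi} \<times> {-l..l}. f p + g p = 0" using f(3) g(3) by simp
  ultimately show ?thesis using H2_add[OF assms[THEN H2star_H2]] unfolding H2star_def by blast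
qed

lemma H2star_scale: assumes "u \<in> H2star l" shows "(\<lambda>p. c * u p) \<in> H2star l"
proof -
  let ?R = "{0..pi} \<times> {-l..l}"
  obtain f where f: "continuous_on ?R f" "AE p in lebesgue_on (plate l). u p = f p" "\<forall>p\<in>{0, pi} \<times> {-l..l}. f p = 0"
    using assms(1) unfolding H2star_def by blast
  have "AE p in lebesgue_on (plate l). c * u p = c * f p" using f(2) by eventually_elim simp
  moreover have "continuous_on ?R (\<lambda>p. c * f p)" by (intro continuous_intros f)
  moreover have "\<forall>p\<in>{0, pi} \<times> {-l..l}. c * f p = 0" using f(3) by simp
  ultimately show ?thesis using H2_scale[OF assms[THEN H2star_H2], of c] unfolding H2star_def by blast
qed

lemma H2star_zero: assumes "0 < l" shows "(\<lambda>p. 0) \<in> H2star l"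
proof -
  have "tens (sn 1) (\<lambda>y. 0) \<in> H2star l"
    by (rule mode_H2star[OF assms, of _ "\<lambda>y. 0" "\<lambda>y. 0"]) (simp add: W2_def prim_def sqint_def)
  then show ?thesis by (simp add: tens_def)
qed

text \<open>The estimate of the one-dimensional forms, pointwise for the integrand.\<close>
lemma inner2_lower:
  assumes u: "u \<in> H2 (plate l)" and s: "0 < \<sigma>" "\<sigma> < 1/2"
  shows "(1 - \<sigma>) * ipM (PM l) (W l 2 0 u) (W l 2 0 u) \<le> inner2 l \<sigma> u u"
proof -
  note w = W_sqint[OF u, of 2 0, simplified] W_sqint[OF u, of 0 2, simplified] W_sqint[OF u, of 1 1, simplified]
  define a where "a = ipM (PM l) (W l 2 0 u) (W l 2 0 u)"
  define b where "b = ipM (PM l) (W l 0 2 u) (W l 0 2 u)"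
  define c where "c = ipM (PM l) (W l 2 0 u) (W l 0 2 u)"
  have "0 \<le> a + 2 * c + b"
    using sq.nonneg[OF sq.add_mem[OF w(1,2)]] sq.ip_add_square[OF w(1,2), of 1] by (simp add: a_def b_def c_def)
  then have "0 \<le> \<sigma> * (a + 2 * c + b)" using s by simp
  moreover have "0 \<le> (1 - \<sigma>) * b" "0 \<le> 2 * (1 - \<sigma>) * ipM (PM l) (W l 1 1 u) (W l 1 1 u)"
    using s sq.nonneg[OF w(2)] sq.nonneg[OF w(3)] by (simp_all add: b_def)
  moreover have "inner2 l \<sigma> u u = a + b + \<sigma> * (2 * c) + 2 * (1 - \<sigma>) * ipM (PM l) (W l 1 1 u) (W l 1 1 u)"
    unfolding inner2_ipM[OF u u] using sq.sym[OF w(1,2)] by (simp add: a_def b_def c_def)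
  ultimately show ?thesis unfolding a_def[symmetric] by (simp add: algebra_simps)
qed

lemma semi_inner_H2star:
  assumes l: "0 < l" and s: "0 < \<sigma>" "\<sigma> < 1/2" shows "semi_inner (H2star l) (inner2 l \<sigma>)"
proof
  fix u v w :: field and c :: real
  have ix: "2 + 0 \<le> (2::nat)" "0 + 2 \<le> (2::nat)" "1 + 1 \<le> (2::nat)" by auto
  show "(\<lambda>p. 0) \<in> H2star l" by (rule H2star_zero[OF l])
  show "u \<in> H2star l \<Longrightarrow> v \<in> H2star l \<Longrightarrow> (\<lambda>p. u p + v p) \<in> H2star l" by (rule H2star_add)
  show "u \<in> H2star l \<Longrightarrow> (\<lambda>p. c * u p) \<in> H2star l" by (rule H2star_scale)
  show "inner2 l \<sigma> (\<lambda>p. u p + v p) w = inner2 l \<sigma> u w + inner2 l \<sigma> v w"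
    if "u \<in> H2star l" "v \<in> H2star l" "w \<in> H2star l"
  proof -
    note h = that[THEN H2star_H2]
    have e: "ipM (PM l) (W l i j (\<lambda>p. u p + v p)) f = ipM (PM l) (W l i j u) f + ipM (PM l) (W l i j v) f"
      if ij: "i + j \<le> 2" and f: "f \<in> sqint (PM l)" for i j f
    proof -
      have "ipM (PM l) (W l i j (\<lambda>p. u p + v p)) f = ipM (PM l) (\<lambda>p. W l i j u p + W l i j v p) f"
        by (rule ipM_cong_left[OF W_add[OF h(1,2) ij] W_sqint[OF H2_add[OF h(1,2)] ij] _ f])
           (rule sqint_measurable[OF sqint_add[OF W_sqint[OF h(1) ij] W_sqint[OF h(2) ij]]])
      also have "\<dots> = ipM (PM l) (W l i j u) f + ipM (PM l) (W l i j v) f"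
        by (rule sq.add_left[OF W_sqint[OF h(1) ij] W_sqint[OF h(2) ij] f])
      finally show ?thesis .
    qed
    show ?thesis
      unfolding inner2_ipM[OF H2_add[OF h(1,2)] h(3)] inner2_ipM[OF h(1,3)] inner2_ipM[OF h(2,3)]
      unfolding e[OF ix(1) W_sqint[OF h(3) ix(1)]] e[OF ix(2) W_sqint[OF h(3) ix(2)]] e[OF ix(3) W_sqint[OF h(3) ix(3)]]
        e[OF ix(1) W_sqint[OF h(3) ix(2)]] e[OF ix(2) W_sqint[OF h(3) ix(1)]]
      by (simp add: algebra_simps)
  qed
  show "inner2 l \<sigma> (\<lambda>p. c * u p) w = c * inner2 l \<sigma> u w" if "u \<in> H2star l" "w \<in> H2star l"
  proof -
    note h = that[THEN H2star_H2]
    have e: "ipM (PM l) (W l i j (\<lambda>p. c * u p)) f = c * ipM (PM l) (W l i j u) f"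
      if ij: "i + j \<le> 2" and f: "f \<in> sqint (PM l)" for i j f
    proof -
      have "ipM (PM l) (W l i j (\<lambda>p. c * u p)) f = ipM (PM l) (\<lambda>p. c * W l i j u p) f"
        by (rule ipM_cong_left[OF W_scale[OF h(1) ij] W_sqint[OF H2_scale[OF h(1)] ij] _ f])
           (rule sqint_measurable[OF sqint_scale[OF W_sqint[OF h(1) ij]]])
      also have "\<dots> = c * ipM (PM l) (W l i j u) f"
        by (rule sq.scale_left[OF W_sqint[OF h(1) ij] f])
      finally show ?thesis .
    qed
    show ?thesis
      unfolding inner2_ipM[OF H2_scale[OF h(1)] h(2)] inner2_ipM[OF h(1,2)]
      unfolding e[OF ix(1) W_sqint[OF h(2) ix(1)]] e[OF ix(2) W_sqint[OF h(2) ix(2)]] e[OF ix(3) W_sqint[OF h(2) ix(3)]]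
        e[OF ix(1) W_sqint[OF h(2) ix(2)]] e[OF ix(2) W_sqint[OF h(2) ix(1)]]
      by (simp add: algebra_simps)
  qed
  show "inner2 l \<sigma> u v = inner2 l \<sigma> v u"
    unfolding inner2_def Let_def by (intro Bochner_Integration.integral_cong refl) (simp add: algebra_simps)
  show "0 \<le> inner2 l \<sigma> u u" if "u \<in> H2star l"
  proof -
    have "0 \<le> (1 - \<sigma>) * ipM (PM l) (W l 2 0 u) (W l 2 0 u)"
      using s sq.nonneg[OF W_sqint[OF H2star_H2[OF that] ix(1)]] by simp
    then show ?thesis using inner2_lower[OF H2star_H2[OF that] s] by linarith
  qed
qed

lemma inner_x_ipM:
  assumes "u \<in> H2 (plate l)" "v \<in> H2 (plate l)" shows "inner_x l u v = ipM (PM l) (W l 1 0 u) (W l 1 0 v)"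
  unfolding inner_x_def W_def by (intro inner0_rep wderiv_spec assms) auto

lemma semi_inner_inner_x: assumes l: "0 < l" shows "semi_inner (H2star l) (inner_x l)"
proof
  fix u v w :: field and c :: real
  have ix: "1 + 0 \<le> (2::nat)" by auto
  show "(\<lambda>p. 0) \<in> H2star l" by (rule H2star_zero[OF l])
  show "u \<in> H2star l \<Longrightarrow> v \<in> H2star l \<Longrightarrow> (\<lambda>p. u p + v p) \<in> H2star l" by (rule H2star_add)
  show "u \<in> H2star l \<Longrightarrow> (\<lambda>p. c * u p) \<in> H2star l" by (rule H2star_scale)
  show "inner_x l (\<lambda>p. u p + v p) w = inner_x l u w + inner_x l v w"
    if "u \<in> H2star l" "v \<in> H2star l" "w \<in> H2star l"
  proof -
    note h = that[THEN H2star_H2]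
    have "ipM (PM l) (W l 1 0 (\<lambda>p. u p + v p)) (W l 1 0 w) = ipM (PM l) (\<lambda>p. W l 1 0 u p + W l 1 0 v p) (W l 1 0 w)"
      by (rule ipM_cong_left[OF W_add[OF h(1,2) ix] W_sqint[OF H2_add[OF h(1,2)] ix] _ W_sqint[OF h(3) ix]])
         (rule sqint_measurable[OF sqint_add[OF W_sqint[OF h(1) ix] W_sqint[OF h(2) ix]]])
    then show ?thesis
      unfolding inner_x_ipM[OF H2_add[OF h(1,2)] h(3)] inner_x_ipM[OF h(1,3)] inner_x_ipM[OF h(2,3)]
      using sq.add_left[OF W_sqint[OF h(1) ix] W_sqint[OF h(2) ix] W_sqint[OF h(3) ix]] by simp
  qed
  show "inner_x l (\<lambda>p. c * u p) w = c * inner_x l u w" if "u \<in> H2star l" "w \<in> H2star l"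
  proof -
    note h = that[THEN H2star_H2]
    have "ipM (PM l) (W l 1 0 (\<lambda>p. c * u p)) (W l 1 0 w) = ipM (PM l) (\<lambda>p. c * W l 1 0 u p) (W l 1 0 w)"
      by (rule ipM_cong_left[OF W_scale[OF h(1) ix] W_sqint[OF H2_scale[OF h(1)] ix] _ W_sqint[OF h(2) ix]])
         (rule sqint_measurable[OF sqint_scale[OF W_sqint[OF h(1) ix]]])
    then show ?thesis
      unfolding inner_x_ipM[OF H2_scale[OF h(1)] h(2)] inner_x_ipM[OF h(1,2)]
      using sq.scale_left[OF W_sqint[OF h(1) ix] W_sqint[OF h(2) ix]] by simp
  qed
  show "inner_x l u v = inner_x l v u" if "u \<in> H2star l" "v \<in> H2star l"
    unfolding inner_x_def inner0_def by (simp add: mult.commute)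
  show "0 \<le> inner_x l u u" if "u \<in> H2star l"
    unfolding inner_x_ipM[OF H2star_H2[OF that] H2star_H2[OF that]] by (rule sq.nonneg[OF W_sqint[OF H2star_H2[OF that] ix]])
qed

lemma H2star_L2: "u \<in> H2star l \<Longrightarrow> u \<in> L2 (plate l)" by (simp add: H2star_def H2_def)

lemma norm0_l2: "norm0 (plate l) u = l2.nrm l u" by (simp add: norm0_def l2.nrm_def)

lemma W_L2: "u \<in> H2 (plate l) \<Longrightarrow> i + j \<le> 2 \<Longrightarrow> W l i j u \<in> L2 (plate l)"
  by (intro sqint_PM_L2 W_sqint)

lemma norm0_PM: "f \<in> sqint (PM l) \<Longrightarrow> norm0 (plate l) f = sq.nrm (PM l) f"
  by (simp add: norm0_def sq.nrm_def inner0_PM)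

text \<open>On each horizontal line u is the primitive of u_x.\<close>
lemma Poincare_x:
  assumes l: "0 < l" and u: "u \<in> H2star l"
  shows "inner0 (plate l) u u \<le> pi\<^sup>2 * inner_x l u u"
proof -
  have u2: "u \<in> H2 (plate l)" by (rule H2star_H2[OF u])
  note s = rep_sqint[OF u2] W_sqint[OF u2, of 1 0, simplified]
  have i1: "integrable (YM l) (\<lambda>y. LINT x|XM. rep l u (x, y) * rep l u (x, y))"
    using ivp.integrable_snd[where f="\<lambda>x y. rep l u (x, y) * rep l u (x, y)"] sqint_mult_integrable[OF s(1) s(1)]
    by (simp add: case_prod_beta')
  have i2: "integrable (YM l) (\<lambda>y. LINT x|XM. W l 1 0 u (x, y) * W l 1 0 u (x, y))"
    using ivp.integrable_snd[where f="\<lambda>x y. W l 1 0 u (x, y) * W l 1 0 u (x, y)"] sqint_mult_integrable[OF s(2) s(2)]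
    by (simp add: case_prod_beta')
  have "inner0 (plate l) u u = (LINT y|YM l. LINT x|XM. rep l u (x, y) * rep l u (x, y))"
    using inner0_rep[OF H2_L2[OF u2] H2_L2[OF u2]] ipM_snd[OF s(1) s(1)] by simp
  also have "\<dots> \<le> (LINT y|YM l. pi\<^sup>2 * (LINT x|XM. W l 1 0 u (x, y) * W l 1 0 u (x, y)))"
  proof (rule integral_mono_AE)
    show "AE y in YM l. (LINT x|XM. rep l u (x, y) * rep l u (x, y)) \<le> pi\<^sup>2 * (LINT x|XM. W l 1 0 u (x, y) * W l 1 0 u (x, y))"
      using H2star_slice[OF l u] slice_snd[OF s(1)]
    proof eventually_elim
      case (elim y)
      define f where "f = (\<lambda>x. W l 1 0 u (x, y))"
      have f: "f \<in> sqint XM" "AE x in XM. rep l u (x, y) = prim XM f x" using elim(1) by (auto simp: f_def)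
      have ps: "prim XM f \<in> sqint XM" by (intro cont_sqint prim_continuous iv.sqint_integrable f)
      have n: "0 \<le> sqrt (pi - 0) * sq.nrm XM f" using sq.nrm_nonneg[OF f(1)] by simp
      have "sq.nrm XM (prim XM f) \<le> sqrt (pi - 0) * (sqrt (pi - 0) * sq.nrm XM f)"
        by (rule uniform_nrm_le[OF _ ps prim_abs_le_nrm[OF f(1)] n]) auto
      then have "sq.nrm XM (prim XM f) \<le> pi * sq.nrm XM f" by (simp add: mult.assoc[symmetric])
      then have "(sq.nrm XM (prim XM f))\<^sup>2 \<le> (pi * sq.nrm XM f)\<^sup>2"
        by (intro power_mono sq.nrm_nonneg ps)
      then have "ipM XM (prim XM f) (prim XM f) \<le> pi\<^sup>2 * ipM XM f f"
        by (simp add: sq.nrm_sq[OF ps] sq.nrm_sq[OF f(1)] power_mult_distrib)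
      moreover have "(LINT x|XM. rep l u (x, y) * rep l u (x, y)) = ipM XM (prim XM f) (prim XM f)"
        unfolding ipM_def
      proof (rule integral_cong_AE)
        have [measurable]: "(\<lambda>x. rep l u (x, y)) \<in> borel_measurable XM" "prim XM f \<in> borel_measurable XM"
          using elim(2) ps by (auto simp: sqint_def)
        show "AE x in XM. rep l u (x, y) * rep l u (x, y) = prim XM f x * prim XM f x"
          using f(2) by eventually_elim simp
        show "(\<lambda>x. rep l u (x, y) * rep l u (x, y)) \<in> borel_measurable XM" by measurable
        show "(\<lambda>x. prim XM f x * prim XM f x) \<in> borel_measurable XM" by measurable
      qed
      ultimately show ?case by (simp add: ipM_def f_def)
    qed
  qed (use i1 i2 in auto)
  also have "\<dots> = pi\<^sup>2 * inner_x l u u"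
    using inner_x_ipM[OF u2 u2] ipM_snd[OF s(2) s(2)] by simp
  finally show ?thesis .
qed

theorem inner_x_by_parts_inner0:
  assumes l: "0 < l" and u: "u \<in> H2 (plate l)" and v: "v \<in> H2star l"
  shows "inner_x l u v = - inner0 (plate l) (W l 2 0 u) v"
proof -
  have ix: "2 + 0 \<le> (2::nat)" by auto
  note s = W_sqint[OF u ix] rep_sqint[OF H2star_H2[OF v]]
  have "inner0 (plate l) (W l 2 0 u) v = ipM (PM l) (rep l (W l 2 0 u)) (rep l v)"
    by (intro inner0_rep W_L2[OF u ix] H2star_L2[OF v])
  also have "\<dots> = ipM (PM l) (W l 2 0 u) (rep l v)"
    by (rule ipM_cong_left[OF _ _ sqint_measurable[OF s(1)] s(2)])
       (use rep_L2[OF W_L2[OF u ix]] in \<open>auto elim: eventually_mono\<close>)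
  finally show ?thesis using inner_x_by_parts[OF l u v] by simp
qed

lemma norm0_W20_le:
  assumes u: "u \<in> H2 (plate l)" and s: "0 < \<sigma>" "\<sigma> < 1/2"
  shows "norm0 (plate l) (W l 2 0 u) \<le> 2 * norm2 l \<sigma> u"
proof -
  have ix: "2 + 0 \<le> (2::nat)" by auto
  define a where "a = ipM (PM l) (W l 2 0 u) (W l 2 0 u)"
  have a: "0 \<le> a" unfolding a_def by (rule sq.nonneg[OF W_sqint[OF u ix]])
  have "1/2 * a \<le> (1 - \<sigma>) * a" using s a by (intro mult_right_mono) auto
  then have "a \<le> 2 * inner2 l \<sigma> u u" using inner2_lower[OF u s] by (simp add: a_def)
  then have le: "a \<le> 4 * inner2 l \<sigma> u u" using a by linarith
  have "norm0 (plate l) (W l 2 0 u) = sqrt a" using norm0_PM[OF W_sqint[OF u ix]] by (simp add: sq.nrm_def a_def)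
  also have "\<dots> \<le> sqrt (4 * inner2 l \<sigma> u u)" using le by simp
  also have "\<dots> = 2 * norm2 l \<sigma> u" by (simp add: norm2_def real_sqrt_mult)
  finally show ?thesis .
qed

text \<open>The Poincare inequality bounds |u|^2 by b(u, u) = -(u_xx, u), where u_xx is controlled by the plate
  form; one factor |u| cancels.\<close>
lemma norm0_le_norm2:
  assumes l: "0 < l" and u: "u \<in> H2star l" and s: "0 < \<sigma>" "\<sigma> < 1/2"
  shows "norm0 (plate l) u \<le> 2 * pi\<^sup>2 * norm2 l \<sigma> u"
proof -
  have ix: "2 + 0 \<le> (2::nat)" by auto
  have u2: "u \<in> H2 (plate l)" by (rule H2star_H2[OF u])
  note L = H2star_L2[OF u] W_L2[OF u2 ix]
  have n: "0 \<le> norm0 (plate l) u" unfolding norm0_l2 by (rule l2.nrm_nonneg[OF L(1)])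
  have n2: "0 \<le> norm2 l \<sigma> u" unfolding norm2_def using semi_inner.nonneg[OF semi_inner_H2star[OF l s] u] by simp
  have "(norm0 (plate l) u)\<^sup>2 \<le> pi\<^sup>2 * inner_x l u u"
    using Poincare_x[OF l u] l2.nrm_sq[OF L(1)] by (simp add: norm0_l2)
  also have "inner_x l u u \<le> norm0 (plate l) (W l 2 0 u) * norm0 (plate l) u"
    using inner_x_by_parts_inner0[OF l u2 u] l2.Cauchy_Schwarz[OF L(2) L(1)] by (simp add: norm0_l2)
  also have "\<dots> \<le> (2 * norm2 l \<sigma> u) * norm0 (plate l) u"
    using norm0_W20_le[OF u2 s] n by (intro mult_right_mono)
  finally have "norm0 (plate l) u * norm0 (plate l) u \<le> (2 * pi\<^sup>2 * norm2 l \<sigma> u) * norm0 (plate l) u"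
    by (simp add: power2_eq_square algebra_simps mult_left_mono)
  then show ?thesis using n n2 by (cases "norm0 (plate l) u = 0") (auto simp: mult_le_cancel_right)
qed

lemma norm0_W20_diff:
  assumes u: "u \<in> H2 (plate l)" and v: "v \<in> H2 (plate l)" and s: "0 < \<sigma>" "\<sigma> < 1/2"
  shows "norm0 (plate l) (\<lambda>p. W l 2 0 u p - W l 2 0 v p) \<le> 2 * norm2 l \<sigma> (\<lambda>p. u p - v p)"
proof -
  have ix: "2 + 0 \<le> (2::nat)" by auto
  have v': "(\<lambda>p. (-1) * v p) \<in> H2 (plate l)" by (rule H2_scale[OF v])
  have d: "(\<lambda>p. u p + (-1) * v p) \<in> H2 (plate l)" by (rule H2_add[OF u v'])
  have ae: "AE p in PM l. W l 2 0 (\<lambda>p. u p + (-1) * v p) p = W l 2 0 u p - W l 2 0 v p"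
    using W_add[OF u v' ix] W_scale[OF v ix, of "-1"] by eventually_elim simp
  have sD: "(\<lambda>p. W l 2 0 u p - W l 2 0 v p) \<in> sqint (PM l)" by (intro sq.diff_mem W_sqint u v ix)
  have "ipM (PM l) (W l 2 0 (\<lambda>p. u p + (-1) * v p)) (W l 2 0 (\<lambda>p. u p + (-1) * v p))
      = ipM (PM l) (\<lambda>p. W l 2 0 u p - W l 2 0 v p) (\<lambda>p. W l 2 0 u p - W l 2 0 v p)"
    by (rule ipM_cong[OF ae ae]) (use W_sqint[OF d ix] sD in \<open>auto simp: sqint_def\<close>)
  then show ?thesis
    using norm0_W20_le[OF d s] norm0_PM[OF W_sqint[OF d ix]] norm0_PM[OF sD] by (simp add: sq.nrm_def)
qed

text \<open>Weak derivatives only depend on the class of the function.\<close>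
lemma W_cong:
  assumes u: "u \<in> H2 (plate l)" and v: "v \<in> H2 (plate l)" and ae: "AE p in PM l. u p = v p" and ij: "i + j \<le> 2"
  shows "AE p in PM l. W l i j u p = W l i j v p"
proof -
  note wu = wderiv_spec[OF u ij]
  have "is_weak_deriv (plate l) i j v (wderiv (plate l) i j u)"
    unfolding is_weak_deriv_inner0
  proof (intro allI impI)
    fix f assume f: "test_function (plate l) f"
    have "inner0 (plate l) v ((dx ^^ i) ((dy ^^ j) f)) = inner0 (plate l) u ((dx ^^ i) ((dy ^^ j) f))"
      unfolding inner0_def
    proof (rule integral_cong_AE)
      show "AE p in lebesgue_on (plate l). v p * (dx ^^ i) ((dy ^^ j) f) p = u p * (dx ^^ i) ((dy ^^ j) f) p"
        unfolding AE_plate using ae by eventually_elim simp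
    qed (use test_function_L2(2)[OF f, of i j] H2_L2[OF u] H2_L2[OF v] in \<open>auto simp: L2_def intro!: borel_measurable_times\<close>)
    then show "inner0 (plate l) v ((dx ^^ i) ((dy ^^ j) f)) = (-1) ^ (i + j) * inner0 (plate l) (wderiv (plate l) i j u) f"
      using wu(2) f by (simp add: is_weak_deriv_inner0)
  qed
  from wderiv_AE[OF v ij wu(1) this] W_AE[OF u ij] W_AE[OF v ij] show ?thesis
    by eventually_elim simp
qed

lemma inner_cong:
  assumes u: "u \<in> H2star l" and v: "v \<in> H2star l" and ae: "AE p in PM l. u p = v p" and z: "z \<in> H2star l"
  shows "inner2 l \<sigma> u z = inner2 l \<sigma> v z" "inner_x l u z = inner_x l v z" "inner0 (plate l) u z = inner0 (plate l) v z"
proof -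
  note h = u[THEN H2star_H2] v[THEN H2star_H2] z[THEN H2star_H2]
  have e: "ipM (PM l) (W l i j u) f = ipM (PM l) (W l i j v) f"
    if ij: "i + j \<le> 2" and f: "f \<in> sqint (PM l)" for i j f
    by (rule ipM_cong_left[OF W_cong[OF h(1,2) ae ij] W_sqint[OF h(1) ij] sqint_measurable[OF W_sqint[OF h(2) ij]] f])
  have ix: "2 + 0 \<le> (2::nat)" "0 + 2 \<le> (2::nat)" "1 + 1 \<le> (2::nat)" "1 + 0 \<le> (2::nat)" by auto
  show "inner2 l \<sigma> u z = inner2 l \<sigma> v z"
    unfolding inner2_ipM[OF h(1,3)] inner2_ipM[OF h(2,3)]
    unfolding e[OF ix(1) W_sqint[OF h(3) ix(1)]] e[OF ix(2) W_sqint[OF h(3) ix(2)]] e[OF ix(3) W_sqint[OF h(3) ix(3)]]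
        e[OF ix(1) W_sqint[OF h(3) ix(2)]] e[OF ix(2) W_sqint[OF h(3) ix(1)]] by (rule refl)
  show "inner_x l u z = inner_x l v z"
    unfolding inner_x_ipM[OF h(1,3)] inner_x_ipM[OF h(2,3)] by (rule e[OF ix(4) W_sqint[OF h(3) ix(4)]])
  show "inner0 (plate l) u z = inner0 (plate l) v z"
    unfolding inner0_def
  proof (rule integral_cong_AE)
    show "AE p in lebesgue_on (plate l). u p * z p = v p * z p" unfolding AE_plate using ae by eventually_elim simp
  qed (use H2star_L2[OF u] H2star_L2[OF v] H2star_L2[OF z] in \<open>auto simp: L2_def\<close>)
qed

lemma ipM_tens_tens:
  assumes "f \<in> sqint XM" "g \<in> sqint (YM l)" "f' \<in> sqint XM" "g' \<in> sqint (YM l)"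
  shows "ipM (PM l) (tens f g) (tens f' g') = ipM XM f f' * ipM (YM l) g g'"
proof -
  have "ipM (PM l) (tens f g) (tens f' g') = (LINT x|XM. LINT y|YM l. (f x * f' x) * (g y * g' y))"
    by (subst ipM_fst[OF tensor_sqint[OF assms(1,2)] tensor_sqint[OF assms(3,4)]]) (simp add: tens_def ac_simps)
  then show ?thesis by (simp add: ipM_def)
qed

lemma sn_orth: assumes "k \<ge> 1" "m \<ge> 1" shows "ipM XM (sn k) (sn m) = (if k = m then pi / 2 else 0)"
proof (cases "k = m")
  case True
  have k: "real m > 0" using assms by simp
  have "prim XM (\<lambda>x. sn m x * sn m x) pi = (pi / 2 - sin (2 * real m * pi) / (4 * real m)) - (0 / 2 - sin (2 * real m * 0) / (4 * real m))"
  proof (intro prim_FTC[where b=pi and F="\<lambda>x. x / 2 - sin (2 * real m * x) / (4 * real m)"])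
    show "((\<lambda>x. x / 2 - sin (2 * real m * x) / (4 * real m)) has_real_derivative sn m x * sn m x) (at x)" for x
    proof -
      have "((\<lambda>x. x / 2 - sin (2 * real m * x) / (4 * real m)) has_real_derivative 1 / 2 - cos (2 * real m * x) / 2) (at x)"
        using k by (auto intro!: derivative_eq_intros simp: field_simps)
      moreover have "1 / 2 - cos (2 * real m * x) / 2 = sn m x * sn m x"
        using cos_double_sin[of "real m * x"] by (simp add: sn_def power2_eq_square mult.assoc field_simps)
      ultimately show ?thesis by simp
    qed
  qed (auto intro!: continuous_intros sn_cont)
  moreover have "sin (2 * real m * pi) = 0" using sin_npi[of "2 * m"] by (simp add: mult.commute)
  ultimately show ?thesis using True by (simp add: ipM_def prim_right)
next
  case False
  let ?a = "real k - real m" and ?b = "real k + real m"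
  have ab: "?a \<noteq> 0" "?b \<noteq> 0" using assms False by auto
  have "prim XM (\<lambda>x. sn k x * sn m x) pi = (sin (?a * pi) / (2 * ?a) - sin (?b * pi) / (2 * ?b)) - (sin (?a * 0) / (2 * ?a) - sin (?b * 0) / (2 * ?b))"
  proof (intro prim_FTC[where b=pi and F="\<lambda>x. sin (?a * x) / (2 * ?a) - sin (?b * x) / (2 * ?b)"])
    show "((\<lambda>x. sin (?a * x) / (2 * ?a) - sin (?b * x) / (2 * ?b)) has_real_derivative sn k x * sn m x) (at x)" for x
    proof -
      have "((\<lambda>x. sin (?a * x) / (2 * ?a) - sin (?b * x) / (2 * ?b)) has_real_derivative cos (?a * x) / 2 - cos (?b * x) / 2) (at x)"
      proof -
        have "((\<lambda>x. sin (a * x) / (2 * a)) has_real_derivative cos (a * x) / 2) (at x)" if "a \<noteq> 0" for a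
          using that by (auto intro!: derivative_eq_intros)
        from DERIV_diff[OF this[OF ab(1)] this[OF ab(2)]] show ?thesis .
      qed
      moreover have "cos (?a * x) / 2 - cos (?b * x) / 2 = sn k x * sn m x"
        by (simp add: sn_def left_diff_distrib distrib_right cos_add cos_diff) (simp add: field_simps)
      ultimately show ?thesis by simp
    qed
  qed (auto intro!: continuous_intros sn_cont)
  moreover have "sin (?a * pi) = 0" using sin_integer_2pi sin_zero_iff_int2 by (metis of_int_diff of_int_of_nat_eq)
  moreover have "sin (?b * pi) = 0" using sin_zero_iff_int2 by (metis of_int_add of_int_of_nat_eq)
  ultimately show ?thesis using False by (simp add: ipM_def prim_right)
qed

text \<open>Obtained from the sines by parts; the factors k and m arise from the derivatives.\<close>
lemma cs_orth: assumes "k \<ge> 1" "m \<ge> 1" shows "real k * real m * ipM XM (cs k) (cs m) = (if k = m then (real m)\<^sup>2 * (pi / 2) else 0)"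
proof -
  have i: "integrable XM (\<lambda>x. real k * cs k x)" "integrable XM (\<lambda>x. - (real m)\<^sup>2 * sn m x)"
    by (intro iv.sqint_integrable cs_sqint sn_sqint')+
  have "(LINT x|XM. (real k * cs k x) * (real m * cs m x)) + (LINT x|XM. sn k x * (- (real m)\<^sup>2 * sn m x))
      = sn k pi * (real m * cs m pi) - sn k 0 * (real m * cs m 0)"
    by (rule ac_product[OF pi_gt_zero i sn_prim cs_prim]) auto
  moreover have "sn k pi = 0" "sn k 0 = 0" by (auto simp: sn_def)
  moreover have "(LINT x|XM. (real k * cs k x) * (real m * cs m x)) = (LINT x|XM. real k * real m * (cs k x * cs m x))"
    by (intro Bochner_Integration.integral_cong) auto
  moreover have "(LINT x|XM. sn k x * (- (real m)\<^sup>2 * sn m x)) = (LINT x|XM. - (real m)\<^sup>2 * (sn k x * sn m x))"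
    by (intro Bochner_Integration.integral_cong) auto
  ultimately have "real k * real m * ipM XM (cs k) (cs m) = (real m)\<^sup>2 * ipM XM (sn k) (sn m)"
    by (simp add: ipM_def)
  then show ?thesis using sn_orth[OF assms] by simp
qed

section \<open>Reduction of the form inequality to single modes\<close>

theorem mode_mode:
  assumes l: "0 < l" and F: "W2 l \<phi> \<phi>1 \<phi>2" and G: "W2 l \<zeta> \<zeta>1 \<zeta>2" and k: "k \<ge> 1" and m: "m \<ge> 1"
  shows "inner2 l \<sigma> (tens (sn k) \<phi>) (tens (sn m) \<zeta>) = (if k = m then pi / 2 * mode_form l \<sigma> m \<phi> \<phi>1 \<phi>2 \<zeta> \<zeta>1 \<zeta>2 else 0)"
    "inner0 (plate l) (tens (sn k) \<phi>) (tens (sn m) \<zeta>) = (if k = m then pi / 2 * ipM (YM l) \<phi> \<zeta> else 0)"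
proof -
  note H = mode_H2star[OF l F, of k, THEN H2star_H2] mode_H2star[OF l G, of m, THEN H2star_H2]
  note sF = W2_cont0(2)[OF F] W2_cont1(2)[OF F] W2_sqint2[OF F]
  note sG = W2_cont0(2)[OF G] W2_cont1(2)[OF G] W2_sqint2[OF G]
  note mF = mode_W[OF l F, of k] and mG = mode_W[OF l G, of m]
  have ix: "2 + 0 \<le> (2::nat)" "0 + 2 \<le> (2::nat)" "1 + 1 \<le> (2::nat)" by auto
  note wF = W_sqint[OF H(1) ix(1)] W_sqint[OF H(1) ix(2)] W_sqint[OF H(1) ix(3)]
  note wG = W_sqint[OF H(2) ix(1)] W_sqint[OF H(2) ix(2)] W_sqint[OF H(2) ix(3)]
  have tF: "tens (\<lambda>x. - (real k)\<^sup>2 * sn k x) \<phi> \<in> sqint (PM l)" "tens (sn k) \<phi>2 \<in> sqint (PM l)" "tens (\<lambda>x. real k * cs k x) \<phi>1 \<in> sqint (PM l)"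
    by (intro tensor_sqint sn_sqint' cs_sqint sn_sqint sF)+
  have tG: "tens (\<lambda>x. - (real m)\<^sup>2 * sn m x) \<zeta> \<in> sqint (PM l)" "tens (sn m) \<zeta>2 \<in> sqint (PM l)" "tens (\<lambda>x. real m * cs m x) \<zeta>1 \<in> sqint (PM l)"
    by (intro tensor_sqint sn_sqint' cs_sqint sn_sqint sG)+
  have c: "ipM M f g = ipM M f' g'"
    if "AE x in M. f x = f' x" "AE x in M. g x = g' x" "f \<in> sqint M" "f' \<in> sqint M" "g \<in> sqint M" "g' \<in> sqint M"
    for M :: "(real \<times> real) measure" and f g f' g'
    using that by (intro ipM_cong) (auto simp: sqint_def)
  have sc: "ipM XM (\<lambda>x. a * f x) (\<lambda>x. b * g x) = a * b * ipM XM f g" "ipM XM (\<lambda>x. a * f x) g = a * ipM XM f g" "ipM XM f (\<lambda>x. b * g x) = b * ipM XM f g"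
    if "f \<in> sqint XM" "g \<in> sqint XM" for a b f g
    using that by (simp_all add: sq.scale_left sq.scale_right sq.scale_mem)
  have css: "cs j \<in> sqint XM" for j using cs_sqint[of 1 j] by simp
  have e20: "ipM (PM l) (W l 2 0 (tens (sn k) \<phi>)) (W l 2 0 (tens (sn m) \<zeta>)) = (real k)\<^sup>2 * (real m)\<^sup>2 * ipM XM (sn k) (sn m) * ipM (YM l) \<phi> \<zeta>"
    unfolding c[OF mF(2) mG(2) wF(1) tF(1) wG(1) tG(1)] ipM_tens_tens[OF sn_sqint' sF(1) sn_sqint' sG(1)] sc(1)[OF sn_sqint sn_sqint] by simp
  have e02: "ipM (PM l) (W l 0 2 (tens (sn k) \<phi>)) (W l 0 2 (tens (sn m) \<zeta>)) = ipM XM (sn k) (sn m) * ipM (YM l) \<phi>2 \<zeta>2"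
    unfolding c[OF mF(4) mG(4) wF(2) tF(2) wG(2) tG(2)] ipM_tens_tens[OF sn_sqint sF(3) sn_sqint sG(3)] by simp
  have e22: "ipM (PM l) (W l 2 0 (tens (sn k) \<phi>)) (W l 0 2 (tens (sn m) \<zeta>)) = - (real k)\<^sup>2 * ipM XM (sn k) (sn m) * ipM (YM l) \<phi> \<zeta>2"
    unfolding c[OF mF(2) mG(4) wF(1) tF(1) wG(2) tG(2)] ipM_tens_tens[OF sn_sqint' sF(1) sn_sqint sG(3)] sc(2)[OF sn_sqint sn_sqint] by simp
  have e22': "ipM (PM l) (W l 0 2 (tens (sn k) \<phi>)) (W l 2 0 (tens (sn m) \<zeta>)) = - (real m)\<^sup>2 * ipM XM (sn k) (sn m) * ipM (YM l) \<phi>2 \<zeta>"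
    unfolding c[OF mF(4) mG(2) wF(2) tF(2) wG(1) tG(1)] ipM_tens_tens[OF sn_sqint sF(3) sn_sqint' sG(1)] sc(3)[OF sn_sqint sn_sqint] by simp
  have e11: "ipM (PM l) (W l 1 1 (tens (sn k) \<phi>)) (W l 1 1 (tens (sn m) \<zeta>)) = (real k * real m * ipM XM (cs k) (cs m)) * ipM (YM l) \<phi>1 \<zeta>1"
    unfolding c[OF mF(3) mG(3) wF(3) tF(3) wG(3) tG(3)] ipM_tens_tens[OF cs_sqint sF(2) cs_sqint sG(2)] sc(1)[OF css css] by simp
  show "inner2 l \<sigma> (tens (sn k) \<phi>) (tens (sn m) \<zeta>) = (if k = m then pi / 2 * mode_form l \<sigma> m \<phi> \<phi>1 \<phi>2 \<zeta> \<zeta>1 \<zeta>2 else 0)"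
    unfolding inner2_ipM[OF H] e20 e02 e22 e22' e11 cs_orth[OF k m] sn_orth[OF k m] mode_form_def
    by (cases "k = m") (simp_all add: field_simps power2_eq_square power4_eq_xxxx)
  have "inner0 (plate l) (tens (sn k) \<phi>) (tens (sn m) \<zeta>) = ipM (PM l) (tens (sn k) \<phi>) (tens (sn m) \<zeta>)"
    by (intro inner0_PM tensor_sqint sn_sqint sF sG)
  then show "inner0 (plate l) (tens (sn k) \<phi>) (tens (sn m) \<zeta>) = (if k = m then pi / 2 * ipM (YM l) \<phi> \<zeta> else 0)"
    unfolding ipM_tens_tens[OF sn_sqint sF(1) sn_sqint sG(1)] sn_orth[OF k m] by simp
qed

text \<open>Finite sums of modes with polynomial profiles. The index 0 is admitted although its sine vanishes,
  which makes the class closed under multiplication by cos x.\<close>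
inductive trigpoly :: "field \<Rightarrow> bool" where
  tp0: "trigpoly (\<lambda>p. 0)"
| tp_step: "trigpoly f \<Longrightarrow> real_polynomial_function q \<Longrightarrow> trigpoly (\<lambda>p. f p + tens (sn j) q p)"

lemma trigpoly_add: "trigpoly g \<Longrightarrow> trigpoly f \<Longrightarrow> trigpoly (\<lambda>p. f p + g p)"
proof (induction rule: trigpoly.induct)
  case tp0 then show ?case by simp
next
  case (tp_step g q j)
  then show ?case using trigpoly.tp_step[of "\<lambda>p. f p + g p" q j] by (simp add: add.assoc)
qed

lemma trigpoly_tens: "real_polynomial_function q \<Longrightarrow> trigpoly (tens (sn j) q)"
  using tp_step[OF tp0, of q j] by simp

lemma trigpoly_mult_y: "trigpoly f \<Longrightarrow> real_polynomial_function h \<Longrightarrow> trigpoly (\<lambda>p. h (snd p) * f p)"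
proof (induction rule: trigpoly.induct)
  case tp0 then show ?case using trigpoly.tp0 by simp
next
  case (tp_step g q j)
  then have "trigpoly (\<lambda>p. h (snd p) * g p + tens (sn j) (\<lambda>y. h y * q y) p)"
    by (intro trigpoly.tp_step real_polynomial_function.intros(4)) auto
  then show ?case by (simp add: tens_def algebra_simps)
qed

text \<open>2 cos x sin(j x) = sin((j + 1) x) + sin((j - 1) x).\<close>
lemma trigpoly_mult_cos: "trigpoly f \<Longrightarrow> trigpoly (\<lambda>p. cos (fst p) * f p)"
proof (induction rule: trigpoly.induct)
  case tp0 then show ?case using trigpoly.tp0 by simp
next
  case (tp_step g q j)
  have q: "real_polynomial_function (\<lambda>y. 1/2 * q y)"
    using tp_step by (intro real_polynomial_function.intros(4) real_polynomial_function.intros(2))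
  show ?case
  proof (cases j)
    case 0
    then show ?thesis using tp_step by (simp add: tens_def sn_def)
  next
    case (Suc i)
    have "trigpoly (\<lambda>p. cos (fst p) * g p + tens (sn (Suc j)) (\<lambda>y. 1/2 * q y) p + tens (sn i) (\<lambda>y. 1/2 * q y) p)"
      by (intro trigpoly.tp_step tp_step q)
    moreover have "cos (fst p) * (g p + tens (sn j) q p) = cos (fst p) * g p + tens (sn (Suc j)) (\<lambda>y. 1/2 * q y) p + tens (sn i) (\<lambda>y. 1/2 * q y) p" for p
    proof -
      have "sn (Suc j) x + sn i x = 2 * cos x * sn j x" for x
      proof -
        have "sn (Suc j) x = sin (real j * x + x)" "sn i x = sin (real j * x - x)"
          using Suc by (auto simp: sn_def algebra_simps)
        then show ?thesis by (simp add: sin_add sin_diff sn_def)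
      qed
      then have c: "cos x * sn j x = (sn (Suc j) x + sn i x) / 2" for x by simp
      have "cos (fst p) * (g p + tens (sn j) q p) = cos (fst p) * g p + (cos (fst p) * sn j (fst p)) * q (snd p)"
        by (simp add: tens_def algebra_simps)
      also have "\<dots> = cos (fst p) * g p + tens (sn (Suc j)) (\<lambda>y. 1/2 * q y) p + tens (sn i) (\<lambda>y. 1/2 * q y) p"
        unfolding c tens_def by (simp add: field_simps)
      finally show ?thesis .
    qed
    ultimately show ?thesis by simp
  qed
qed

lemma trigpoly_mult_poly:
  fixes P :: "real \<times> real \<Rightarrow> real"
  assumes "real_polynomial_function P" "trigpoly f"
  shows "trigpoly (\<lambda>p. P (cos (fst p), snd p) * f p)"
  using assms
proof (induction arbitrary: f rule: real_polynomial_function.induct)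
  case (linear h)
  then interpret h: bounded_linear h by simp
  have "h (cos x, y) = h (1, 0) * cos x + h (0, 1) * y" for x y
  proof -
    have "(cos x, y) = cos x *\<^sub>R (1, 0) + y *\<^sub>R (0, 1)" by simp
    then have "h (cos x, y) = h (cos x *\<^sub>R (1, 0) + y *\<^sub>R (0, 1))" by (rule arg_cong)
    also have "\<dots> = cos x * h (1, 0) + y * h (0, 1)" by (simp only: h.add h.scaleR real_scaleR_def)
    finally show ?thesis by (simp add: mult.commute)
  qed
  then have e: "h (cos (fst p), snd p) * f p = h (1, 0) * (cos (fst p) * f p) + h (0, 1) * snd p * f p" for p
    by (simp add: algebra_simps)
  have "trigpoly (\<lambda>p. (\<lambda>y. h (1, 0)) (snd p) * (cos (fst p) * f p))"
    by (intro trigpoly_mult_y trigpoly_mult_cos linear real_polynomial_function.intros(2))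
  moreover have "trigpoly (\<lambda>p. (\<lambda>y. h (0, 1) * y) (snd p) * f p)"
    by (intro trigpoly_mult_y linear real_polynomial_function.intros(1) bounded_linear_mult_right)
  ultimately show ?case unfolding e using trigpoly_add by simp
next
  case (const c)
  then show ?case using trigpoly_mult_y[of f "\<lambda>y. c"] by (simp add: real_polynomial_function.intros(2))
next
  case (add f1 f2)
  then show ?case using trigpoly_add[OF add(4)[OF add(5)] add(3)[OF add(5)]] by (simp add: distrib_right)
next
  case (mult f1 f2)
  then show ?case using mult(3)[OF mult(4)[OF mult(5)]] by (simp add: mult.assoc)
qed

text \<open>A continuous v that vanishes at x = 0 and x = pi is first truncated to a function T that vanishes
  near these lines. Then T / sin x is continuous, hence a continuous function of cos x and y, and is
  approximated by a polynomial in these; multiplied by sin x this is a finite sum of modes.\<close>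
theorem trigpoly_dense:
  assumes v: "continuous_on ({0..pi} \<times> {-l..l}) v" and v0: "\<And>p. p \<in> {0, pi} \<times> {-l..l} \<Longrightarrow> v p = (0::real)" and e: "0 < e"
  obtains f where "trigpoly f" "\<And>p. p \<in> {0..pi} \<times> {-l..l} \<Longrightarrow> \<bar>v p - f p\<bar> \<le> 2 * e"
proof -
  let ?R = "{0..pi} \<times> {-l..l}"
  have R: "compact ?R" by (intro compact_Times) auto
  \<comment> \<open>Soft thresholding keeps T continuous and makes it vanish where |v| \<le> e.\<close>
  define T where "T p = v p - max (- e) (min e (v p))" for p
  have T: "continuous_on ?R T" unfolding T_def by (intro continuous_intros v)
  have Tv: "\<bar>v p - T p\<bar> \<le> e" for p using e by (auto simp: T_def)
  define K where "K = {p \<in> ?R. e \<le> \<bar>v p\<bar>}"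
  have "closedin (top_of_set ?R) K"
    unfolding K_def using continuous_closedin_preimage[of ?R "\<lambda>p. \<bar>v p\<bar>" "{e..}"] v
    by (auto intro!: continuous_intros simp: vimage_def Collect_conj_eq[symmetric] Int_def)
  then have K: "compact K" using R closedin_compact by blast
  have sinpos: "0 < sin (fst p)" if "p \<in> K" for p
  proof -
    have p: "p \<in> ?R" "e \<le> \<bar>v p\<bar>" using that by (auto simp: K_def)
    then have "fst p \<noteq> 0" "fst p \<noteq> pi" using v0[of p] e by (auto simp: mem_Times_iff)
    then show ?thesis using p by (intro sin_gt_zero) (auto simp: mem_Times_iff)
  qed
  have "\<exists>\<eta>>0. \<forall>p\<in>K. \<eta> \<le> sin (fst p)"
  proof (cases "K = {}")
    case True then show ?thesis by (intro exI[of _ 1]) auto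
  next
    case False
    have "continuous_on K (\<lambda>p. sin (fst p))" by (intro continuous_intros)
    from continuous_attains_inf[OF K False this] obtain q where "q \<in> K" "\<forall>p\<in>K. sin (fst q) \<le> sin (fst p)" by blast
    then show ?thesis using sinpos by blast
  qed
  then obtain \<eta> where \<eta>: "0 < \<eta>" "\<And>p. p \<in> K \<Longrightarrow> \<eta> \<le> sin (fst p)" by blast
  \<comment> \<open>The maximum with \<eta> makes the denominator nonzero and is inactive on the set K that carries T.\<close>
  define g where "g p = T p / max (sin (fst p)) \<eta>" for p
  have gc: "continuous_on ?R g"
  proof -
    have "continuous_on ?R (\<lambda>p. max (sin (fst p)) \<eta>)" by (intro continuous_intros)
    moreover have "\<forall>p\<in>?R. max (sin (fst p)) \<eta> \<noteq> 0" using \<eta>(1) by (auto simp: max_def)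
    ultimately show ?thesis unfolding g_def by (intro continuous_on_divide T) auto
  qed
  have gT: "sin (fst p) * g p = T p" if "p \<in> ?R" for p
  proof (cases "p \<in> K")
    case True
    then show ?thesis using \<eta>(1) \<eta>(2)[OF True] by (simp add: g_def max_def)
  next
    case False
    then have "\<bar>v p\<bar> < e" using that by (auto simp: K_def)
    then have "T p = 0" by (auto simp: T_def)
    then show ?thesis by (simp add: g_def)
  qed
  let ?S = "{-1..1::real} \<times> {-l..l}"
  \<comment> \<open>The substitution s = cos x is a homeomorphism from the interval [0, pi] to [-1, 1].\<close>
  define h where "h q = g (arccos (fst q), snd q)" for q
  have hc: "continuous_on ?S h"
    unfolding h_def
  proof (rule continuous_on_compose2[OF gc])
    have "continuous_on ?S (\<lambda>q. arccos (fst q))"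
      by (rule continuous_on_compose2[OF continuous_on_arccos'])
         (auto intro!: continuous_intros)
    then show "continuous_on ?S (\<lambda>q. (arccos (fst q), snd q))" by (intro continuous_on_Pair continuous_on_snd continuous_on_id)
    show "(\<lambda>q. (arccos (fst q), snd q)) ` ?S \<subseteq> ?R" by (auto simp: arccos_lbound arccos_ubound)
  qed
  have S: "compact ?S" by (intro compact_Times) auto
  obtain P where P: "real_polynomial_function P" "\<And>q. q \<in> ?S \<Longrightarrow> \<bar>h q - P q\<bar> < e"
    using Stone_Weierstrass_real_polynomial_function[OF S hc e] by blast
  define f where "f p = P (cos (fst p), snd p) * tens (sn 1) (\<lambda>y. 1) p" for p
  have "trigpoly f" unfolding f_def
    by (intro trigpoly_mult_poly P trigpoly_tens real_polynomial_function.intros(2))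
  moreover have "\<bar>v p - f p\<bar> \<le> 2 * e" if p: "p \<in> ?R" for p
  proof -
    have "h (cos (fst p), snd p) = g p" using p by (auto simp: h_def arccos_cos mem_Times_iff)
    moreover have "(cos (fst p), snd p) \<in> ?S" using p by auto
    ultimately have 1: "\<bar>g p - P (cos (fst p), snd p)\<bar> < e" using P(2) by metis
    have "T p - f p = sin (fst p) * (g p - P (cos (fst p), snd p))"
      using gT[OF p] by (simp add: f_def tens_def sn_def algebra_simps)
    then have "\<bar>T p - f p\<bar> = \<bar>sin (fst p)\<bar> * \<bar>g p - P (cos (fst p), snd p)\<bar>" by (simp add: abs_mult)
    also have "\<dots> \<le> 1 * e" using 1 by (intro mult_mono) auto
    finally show ?thesis using Tv[of p] by linarith
  qed
  ultimately show thesis by (rule that)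
qed

lemma poly_W2:
  assumes l: "0 < l" and q: "real_polynomial_function (q :: real \<Rightarrow> real)"
  shows "\<exists>q1 q2. W2 l q q1 q2"
proof -
  obtain q1 where q1: "real_polynomial_function q1" "\<forall>x. (q has_real_derivative q1 x) (at x)"
    using has_real_derivative_polynomial_function[OF q] by blast
  obtain q2 where q2: "real_polynomial_function q2" "\<forall>x. (q1 has_real_derivative q2 x) (at x)"
    using has_real_derivative_polynomial_function[OF q1(1)] by blast
  have "continuous_on UNIV q2"
    using q2(1) by (simp add: continuous_on_polymonial_function real_polynomial_function_eq)
  then show ?thesis using W2_smooth[OF l, of q q1 q2] q1(2) q2(2) by blast
qed

text \<open>Let S_N be the N-th partial sum of the sine series of u. Bessel's inequality for a and the
  hypothesis on each mode give a(u, u) \<ge> a(S_N, S_N) \<ge> K b(u, S_N). As b(u, u - S_N) =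
  -(u_xx, u - S_N), only convergence of S_N to u in L2 is required, and this follows from the
  density of finite sums of modes since S_N is the orthogonal projection of u to the modes up to N.\<close>
theorem mode_sum_bound:
  assumes l: "0 < l" and s: "0 < \<sigma>" "\<sigma> < 1/2" and u: "u \<in> H2star l" and K: "0 \<le> K"
    and modes: "\<And>m \<phi> \<phi>1 \<phi>2. m \<ge> 1 \<Longrightarrow> W2 l \<phi> \<phi>1 \<phi>2 \<Longrightarrow> AE y in YM l. coef (sn m) (rep l u) y = \<phi> y \<Longrightarrow>
      K * mode_b l m (triple \<phi> \<phi>1 \<phi>2) (triple \<phi> \<phi>1 \<phi>2) \<le> mode_a l \<sigma> m (triple \<phi> \<phi>1 \<phi>2) (triple \<phi> \<phi>1 \<phi>2)"
  shows "K * inner_x l u u \<le> inner2 l \<sigma> u u"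
proof -
  interpret a: semi_inner "H2star l" "inner2 l \<sigma>" by (rule semi_inner_H2star[OF l s])
  interpret b: semi_inner "H2star l" "inner_x l" by (rule semi_inner_inner_x[OF l])
  have u2: "u \<in> H2 (plate l)" by (rule H2star_H2[OF u])
  \<comment> \<open>The square of sin(m x) has integral pi/2.\<close>
  define k0 where "k0 = 2 / pi"
  have k0: "0 \<le> k0" "k0 * (pi / 2 * x) = x" for x by (auto simp: k0_def)
  define Q where "Q m f f1 f2 \<longleftrightarrow> W2 l f f1 f2 \<and> (AE y in YM l. coef (sn m) (rep l u) y = f y) \<and>
    (\<forall>\<zeta> \<zeta>1 \<zeta>2. W2 l \<zeta> \<zeta>1 \<zeta>2 \<longrightarrow> inner2 l \<sigma> u (tens (sn m) \<zeta>) = mode_form l \<sigma> m f f1 f2 \<zeta> \<zeta>1 \<zeta>2) \<and>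
    (\<forall>\<zeta> \<zeta>1 \<zeta>2. W2 l \<zeta> \<zeta>1 \<zeta>2 \<longrightarrow> inner_x l u (tens (sn m) \<zeta>) = (real m)\<^sup>2 * ipM (YM l) f \<zeta>) \<and>
    (\<forall>\<zeta> \<zeta>1 \<zeta>2. W2 l \<zeta> \<zeta>1 \<zeta>2 \<longrightarrow> inner0 (plate l) u (tens (sn m) \<zeta>) = ipM (YM l) f \<zeta>)"
    for m f f1 f2
  have "\<exists>f f1 f2. Q m f f1 f2" if "m \<ge> 1" for m
    unfolding Q_def by (rule mode_pairing[OF l u that, of \<sigma>]) blast
  then have "\<exists>\<phi> \<phi>1 \<phi>2. \<forall>m. m \<ge> 1 \<longrightarrow> Q m (\<phi> m) (\<phi>1 m) (\<phi>2 m)" by metis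
  then obtain \<phi> \<phi>1 \<phi>2 where Q: "\<And>m. m \<ge> 1 \<Longrightarrow> Q m (\<phi> m) (\<phi>1 m) (\<phi>2 m)" by blast
  have P: "\<And>m. m \<ge> 1 \<Longrightarrow> W2 l (\<phi> m) (\<phi>1 m) (\<phi>2 m)"
    "\<And>m. m \<ge> 1 \<Longrightarrow> AE y in YM l. coef (sn m) (rep l u) y = \<phi> m y"
    "\<And>m \<zeta> \<zeta>1 \<zeta>2. m \<ge> 1 \<Longrightarrow> W2 l \<zeta> \<zeta>1 \<zeta>2 \<Longrightarrow> inner2 l \<sigma> u (tens (sn m) \<zeta>) = mode_form l \<sigma> m (\<phi> m) (\<phi>1 m) (\<phi>2 m) \<zeta> \<zeta>1 \<zeta>2"
    "\<And>m \<zeta> \<zeta>1 \<zeta>2. m \<ge> 1 \<Longrightarrow> W2 l \<zeta> \<zeta>1 \<zeta>2 \<Longrightarrow> inner_x l u (tens (sn m) \<zeta>) = (real m)\<^sup>2 * ipM (YM l) (\<phi> m) \<zeta>"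
    "\<And>m \<zeta> \<zeta>1 \<zeta>2. m \<ge> 1 \<Longrightarrow> W2 l \<zeta> \<zeta>1 \<zeta>2 \<Longrightarrow> inner0 (plate l) u (tens (sn m) \<zeta>) = ipM (YM l) (\<phi> m) \<zeta>"
    using Q unfolding Q_def by blast+
  define z where "z m = tens (sn m) (\<phi> m)" for m
  have z: "z m \<in> H2star l" if "m \<ge> 1" for m unfolding z_def by (rule mode_H2star[OF l P(1)[OF that]])
  define S where "S N = (\<lambda>p. \<Sum>m\<in>{1..N}. k0 * z m p)" for N
  have S: "S N \<in> H2star l" for N unfolding S_def by (intro a.sum_mem a.scale_mem z) auto
  define A where "A m = mode_form l \<sigma> m (\<phi> m) (\<phi>1 m) (\<phi>2 m) (\<phi> m) (\<phi>1 m) (\<phi>2 m)" for m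
  have uS: "inner2 l \<sigma> u (S N) = k0 * (\<Sum>m\<in>{1..N}. A m)" for N
    unfolding S_def using u z P(3)[OF _ P(1)]
    by (subst a.sum_right) (auto simp: a.scale_mem a.scale_right sum_distrib_left A_def z_def)
  have bS: "inner_x l u (S N) = k0 * (\<Sum>m\<in>{1..N}. mode_b l m (triple (\<phi> m) (\<phi>1 m) (\<phi>2 m)) (triple (\<phi> m) (\<phi>1 m) (\<phi>2 m)))" for N
    unfolding S_def using u z P(4)[OF _ P(1)]
    by (subst b.sum_right) (auto simp: b.scale_mem b.scale_right sum_distrib_left mode_b_def z_def)
  have zS: "inner2 l \<sigma> (z k) (S N) = A k" if k: "k \<in> {1..N}" for k N
  proof -
    have "inner2 l \<sigma> (z k) (S N) = (\<Sum>m\<in>{1..N}. k0 * inner2 l \<sigma> (z k) (z m))"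
      unfolding S_def using z k by (subst a.sum_right) (auto simp: a.scale_mem a.scale_right)
    also have "\<dots> = (\<Sum>m\<in>{1..N}. if k = m then A k else 0)"
      using k by (intro sum.cong refl) (auto simp only: z_def mode_mode(1)[OF l P(1) P(1)] A_def k0 atLeastAtMost_iff mult_zero_right if_True if_False split: if_split)
    also have "\<dots> = A k" using k by simp
    finally show ?thesis .
  qed
  have SS: "inner2 l \<sigma> (S N) (S N) = k0 * (\<Sum>m\<in>{1..N}. A m)" for N
  proof -
    have "inner2 l \<sigma> (S N) (S N) = (\<Sum>k\<in>{1..N}. k0 * inner2 l \<sigma> (z k) (S N))"
      using z S[of N] by (subst (1) S_def) (subst a.sum_left, auto simp: a.scale_mem a.scale_left)
    then show ?thesis using zS by (simp add: sum_distrib_left)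
  qed
  have Aeq: "mode_a l \<sigma> m (triple (\<phi> m) (\<phi>1 m) (\<phi>2 m)) (triple (\<phi> m) (\<phi>1 m) (\<phi>2 m)) = A m" for m
    by (simp add: mode_a_def A_def)
  have bound: "K * inner_x l u (S N) \<le> inner2 l \<sigma> u u" for N
  proof -
    have "K * inner_x l u (S N) = k0 * (\<Sum>m\<in>{1..N}. K * mode_b l m (triple (\<phi> m) (\<phi>1 m) (\<phi>2 m)) (triple (\<phi> m) (\<phi>1 m) (\<phi>2 m)))"
      by (simp add: bS sum_distrib_left mult.left_commute)
    also have "\<dots> \<le> k0 * (\<Sum>m\<in>{1..N}. A m)"
      using modes[OF _ P(1) P(2)] by (intro mult_left_mono sum_mono k0) (auto simp: Aeq)
    also have "\<dots> \<le> inner2 l \<sigma> u u"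
    proof -
      have "0 \<le> inner2 l \<sigma> (\<lambda>p. u p - S N p) (\<lambda>p. u p - S N p)" by (intro a.nonneg a.diff_mem u S)
      also have "\<dots> = inner2 l \<sigma> u u - 2 * inner2 l \<sigma> u (S N) + inner2 l \<sigma> (S N) (S N)"
        using u S[of N] a.sym[of u "S N"] by (simp add: a.diff_left a.diff_right a.diff_mem)
      finally show ?thesis unfolding uS SS by simp
    qed
    finally show ?thesis .
  qed
  note SL = H2star_L2[OF S] and uL = H2star_L2[OF u]
  have orth0: "inner0 (plate l) (\<lambda>p. u p - S N p) (tens (sn j) \<zeta>) = 0"
    if j: "1 \<le> j" "j \<le> N" and W: "W2 l \<zeta> \<zeta>1 \<zeta>2" for j N \<zeta> \<zeta>1 \<zeta>2
  proof -
    have tL: "tens (sn j) \<zeta> \<in> L2 (plate l)" by (rule H2star_L2[OF mode_H2star[OF l W]])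
    have "inner0 (plate l) (S N) (tens (sn j) \<zeta>) = (\<Sum>m\<in>{1..N}. k0 * inner0 (plate l) (z m) (tens (sn j) \<zeta>))"
      unfolding S_def using z[THEN H2star_L2] tL by (subst l2.sum_left) (auto simp: l2.scale_mem l2.scale_left)
    also have "\<dots> = (\<Sum>m\<in>{1..N}. if j = m then ipM (YM l) (\<phi> j) \<zeta> else 0)"
      using j by (intro sum.cong refl) (auto simp only: z_def mode_mode(2)[OF l P(1) W] k0 atLeastAtMost_iff mult_zero_right j split: if_split)
    also have "\<dots> = ipM (YM l) (\<phi> j) \<zeta>" using j by simp
    finally show ?thesis using P(5)[OF j(1) W] l2.diff_left[OF uL SL tL] by simp
  qed
  have tp: "f \<in> L2 (plate l) \<and> (\<exists>N0. \<forall>N\<ge>N0. inner0 (plate l) (\<lambda>p. u p - S N p) f = 0)" if "trigpoly f" for f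
    using that
  proof (induction rule: trigpoly.induct)
    case tp0
    have "inner0 (plate l) w (\<lambda>p. 0) = 0" for w by (simp add: inner0_def)
    then show ?case using l2.zero_mem by blast
  next
    case (tp_step f q j)
    then obtain N0 where N0: "f \<in> L2 (plate l)" "\<And>N. N \<ge> N0 \<Longrightarrow> inner0 (plate l) (\<lambda>p. u p - S N p) f = 0" by blast
    obtain q1 q2 where W: "W2 l q q1 q2" using poly_W2[OF l tp_step(2)] by blast
    have tL: "tens (sn j) q \<in> L2 (plate l)" by (rule H2star_L2[OF mode_H2star[OF l W]])
    have "inner0 (plate l) (\<lambda>p. u p - S N p) (\<lambda>p. f p + tens (sn j) q p) = 0" if N: "N \<ge> max N0 j" for N
    proof -
      have d: "(\<lambda>p. u p - S N p) \<in> L2 (plate l)" by (intro l2.diff_mem uL SL)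
      have "inner0 (plate l) (\<lambda>p. u p - S N p) (tens (sn j) q) = 0"
      proof (cases "j = 0")
        case True
        then have "tens (sn j) q = (\<lambda>p. 0)" by (auto simp: tens_def sn_def)
        then show ?thesis by (simp add: inner0_def)
      next
        case False then show ?thesis using N by (intro orth0[OF _ _ W]) auto
      qed
      then show ?thesis using N0(2)[of N] N l2.add_right[OF N0(1) tL d] by simp
    qed
    then show ?case using l2.add_mem[OF N0(1) tL] by blast
  qed
  obtain v where v: "continuous_on ({0..pi} \<times> {-l..l}) v" "AE p in lebesgue_on (plate l). u p = v p"
    "\<forall>p\<in>{0, pi} \<times> {-l..l}. v p = 0" using u by (auto simp: H2star_def)
  define D where "D = norm0 (plate l) (W l 2 0 u)"
  have DL: "W l 2 0 u \<in> L2 (plate l)" by (rule W_L2[OF u2]) simp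
  have D: "0 \<le> D" unfolding D_def norm0_l2 by (rule l2.nrm_nonneg[OF DL])
  have key: "K * inner_x l u u \<le> inner2 l \<sigma> u u + e * (K * D * (2 * sqrt (measure (PM l) (space (PM l)))))" if e: "0 < e" for e
  proof -
    obtain f where f: "trigpoly f" "\<And>p. p \<in> {0..pi} \<times> {-l..l} \<Longrightarrow> \<bar>v p - f p\<bar> \<le> 2 * e"
      using trigpoly_dense[OF v(1) _ e] v(3) by blast
    obtain N where N: "inner0 (plate l) (\<lambda>p. u p - S N p) f = 0" and fL: "f \<in> L2 (plate l)" using tp[OF f(1)] by blast
    define d where "d = (\<lambda>p. u p - S N p)"
    have dL: "d \<in> L2 (plate l)" unfolding d_def by (intro l2.diff_mem uL SL)
    have dS: "inner0 (plate l) d (S N) = 0"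
    proof -
      have "inner0 (plate l) d (S N) = (\<Sum>m\<in>{1..N}. k0 * inner0 (plate l) d (z m))"
        unfolding S_def using z[THEN H2star_L2] dL by (subst l2.sum_right) (auto simp: l2.scale_mem l2.scale_right)
      also have "\<dots> = 0" unfolding d_def z_def using orth0[OF _ _ P(1)] by (intro sum.neutral) auto
      finally show ?thesis .
    qed
    have ufL: "(\<lambda>p. u p - f p) \<in> L2 (plate l)" by (intro l2.diff_mem uL fL)
    have "inner0 (plate l) d d = inner0 (plate l) d (\<lambda>p. u p - f p)"
      using l2.diff_right[OF uL SL dL, of N] l2.diff_right[OF uL fL dL] dS N by (simp add: d_def)
    then have "(l2.nrm l d)\<^sup>2 \<le> l2.nrm l d * l2.nrm l (\<lambda>p. u p - f p)"
      using l2.Cauchy_Schwarz[OF dL ufL] by (simp add: l2.nrm_sq[OF dL])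
    then have dn: "l2.nrm l d \<le> l2.nrm l (\<lambda>p. u p - f p)"
      using l2.nrm_nonneg[OF dL] l2.nrm_nonneg[OF ufL] by (cases "l2.nrm l d = 0") (auto simp: power2_eq_square mult_le_cancel_left)
    have "inner0 (plate l) (\<lambda>p. u p - f p) (\<lambda>p. u p - f p) \<le> (2 * e)\<^sup>2 * measure (PM l) (space (PM l))"
    proof -
      note r = rep_L2[OF ufL]
      have "inner0 (plate l) (\<lambda>p. u p - f p) (\<lambda>p. u p - f p) = ipM (PM l) (rep l (\<lambda>p. u p - f p)) (rep l (\<lambda>p. u p - f p))"
        by (rule inner0_rep[OF ufL ufL])
      also have "\<dots> \<le> (LINT p|PM l. (2 * e)\<^sup>2)"
        unfolding ipM_def
      proof (rule integral_mono_AE)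
        show "AE p in PM l. rep l (\<lambda>p. u p - f p) p * rep l (\<lambda>p. u p - f p) p \<le> (2 * e)\<^sup>2"
          using r(2) v(2)[unfolded AE_plate] AE_space
        proof eventually_elim
          case (elim p)
          have "p \<in> {0..pi} \<times> {-l..l}" using elim(3) unfolding space_PM by (auto simp: plate_def)
          then have "\<bar>rep l (\<lambda>p. u p - f p) p\<bar> \<le> 2 * e" using f(2)[of p] elim by simp
          then have "\<bar>rep l (\<lambda>p. u p - f p) p\<bar>\<^sup>2 \<le> (2 * e)\<^sup>2" by (intro power_mono) auto
          then show ?case by (simp add: power2_eq_square)
        qed
      qed (auto intro: sqint_mult_integrable r)
      also have "\<dots> = (2 * e)\<^sup>2 * measure (PM l) (space (PM l))" by simp
      finally show ?thesis .
    qed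
    then have "l2.nrm l (\<lambda>p. u p - f p) \<le> sqrt ((2 * e)\<^sup>2 * measure (PM l) (space (PM l)))"
      unfolding l2.nrm_def by simp
    then have fn: "l2.nrm l d \<le> 2 * e * sqrt (measure (PM l) (space (PM l)))"
      using dn e by (simp add: real_sqrt_mult)
    have dH: "d \<in> H2star l" unfolding d_def by (intro a.diff_mem u S)
    have "inner_x l u u - inner_x l u (S N) = inner_x l u d"
      unfolding d_def using b.diff_right[OF u S u] by simp
    also have "\<dots> = - inner0 (plate l) (W l 2 0 u) d" by (rule inner_x_by_parts_inner0[OF l u2 dH])
    also have "\<dots> \<le> D * l2.nrm l d" using l2.Cauchy_Schwarz[OF DL dL] by (simp add: D_def norm0_l2)
    also have "\<dots> \<le> D * (2 * e * sqrt (measure (PM l) (space (PM l))))" using fn D by (intro mult_left_mono)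
    finally have "K * (inner_x l u u - inner_x l u (S N)) \<le> K * (D * (2 * e * sqrt (measure (PM l) (space (PM l)))))"
      using K by (intro mult_left_mono)
    then show ?thesis using bound[of N] by (simp add: algebra_simps)
  qed
  show ?thesis
  proof (rule field_le_epsilon)
    fix \<epsilon> :: real assume \<epsilon>: "0 < \<epsilon>"
    define C where "C = K * D * (2 * sqrt (measure (PM l) (space (PM l))))"
    have C: "0 \<le> C" unfolding C_def using K D by simp
    have "\<epsilon> / (C + 1) > 0" using \<epsilon> C by simp
    from key[OF this] have "K * inner_x l u u \<le> inner2 l \<sigma> u u + \<epsilon> / (C + 1) * C" by (simp add: C_def)
    also have "\<epsilon> / (C + 1) * C \<le> \<epsilon>" using \<epsilon> C by (simp add: field_simps)
    finally show "K * inner_x l u u \<le> inner2 l \<sigma> u u + \<epsilon>" by simp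
  qed
qed

section \<open>The spectral gap\<close>

text \<open>A test function of the plate enters only through its m-th coefficient, which is an admissible test
  profile.\<close>
lemma mode_eigen_plate:
  assumes l: "0 < l" and s: "0 < \<sigma>" "\<sigma> < 1/2" and m: "m \<ge> 1" and E: "mode_eigen l \<sigma> m \<nu> F" and nz: "mode_b l m F F \<noteq> 0"
  shows "buckling_eigenfunction l \<sigma> \<nu> (tens (sn m) (c0 F))"
proof -
  have F: "F \<in> W2s l" using E by (simp add: mode_eigen_def)
  then have W: "W2 l (c0 F) (c1 F) (c2 F)" by (simp add: W2s_def)
  let ?w = "tens (sn m) (c0 F)"
  have wH: "?w \<in> H2star l" by (rule mode_H2star[OF l W])
  have "\<not> (AE p in lebesgue_on (plate l). ?w p = 0)"
  proof
    assume "AE p in lebesgue_on (plate l). ?w p = 0"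
    then have "inner0 (plate l) ?w ?w = (LINT p|lebesgue_on (plate l). 0)"
      unfolding inner0_def using H2star_L2[OF wH]
      by (intro integral_cong_AE) (auto simp: L2_def elim: eventually_mono)
    then have "ipM (YM l) (c0 F) (c0 F) = 0" using mode_mode(2)[OF l W W m m] by simp
    then show False using nz by (simp add: mode_b_def)
  qed
  moreover have "inner2 l \<sigma> ?w z = \<nu> * inner_x l ?w z" if z: "z \<in> H2star l" for z
  proof -
    obtain \<phi> \<phi>1 \<phi>2 where M: "W2 l \<phi> \<phi>1 \<phi>2"
      "\<And>\<zeta> \<zeta>1 \<zeta>2. W2 l \<zeta> \<zeta>1 \<zeta>2 \<Longrightarrow> inner2 l \<sigma> z (tens (sn m) \<zeta>) = mode_form l \<sigma> m \<phi> \<phi>1 \<phi>2 \<zeta> \<zeta>1 \<zeta>2"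
      "\<And>\<zeta> \<zeta>1 \<zeta>2. W2 l \<zeta> \<zeta>1 \<zeta>2 \<Longrightarrow> inner_x l z (tens (sn m) \<zeta>) = (real m)\<^sup>2 * ipM (YM l) \<phi> \<zeta>"
      by (rule mode_pairing[OF l z m, of \<sigma>]) blast
    have T: "triple \<phi> \<phi>1 \<phi>2 \<in> W2s l" by (rule triple_W2s[OF M(1)])
    have "inner2 l \<sigma> z ?w = mode_a l \<sigma> m (triple \<phi> \<phi>1 \<phi>2) F" using M(2)[OF W] by (simp add: mode_a_def)
    also have "\<dots> = mode_a l \<sigma> m F (triple \<phi> \<phi>1 \<phi>2)" by (rule semi_inner.sym[OF semi_inner_mode_a[OF s] T F])
    also have "\<dots> = \<nu> * mode_b l m F (triple \<phi> \<phi>1 \<phi>2)" using E T by (simp add: mode_eigen_def)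
    also have "\<dots> = \<nu> * mode_b l m (triple \<phi> \<phi>1 \<phi>2) F" using semi_inner.sym[OF semi_inner_mode_b T F] by simp
    also have "\<dots> = \<nu> * inner_x l z ?w" using M(3)[OF W] by (simp add: mode_b_def)
    finally show ?thesis
      using semi_inner.sym[OF semi_inner_H2star[OF l s] z wH] semi_inner.sym[OF semi_inner_inner_x[OF l] z wH] by simp
  qed
  ultimately show ?thesis unfolding buckling_eigenfunction_def using wH by blast
qed

text \<open>In the span of 1 and y some nonzero combination is orthogonal to G, and an affine function of b-norm
  zero is zero. This makes the constrained minimization problem nonvoid.\<close>
lemma W2s_orth_exists:
  assumes l: "0 < l" and m: "m \<ge> 1" and G: "G \<in> W2s l"
  shows "\<exists>F\<in>W2s l. mode_b l m F G = 0 \<and> mode_b l m F F \<noteq> 0"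
proof -
  interpret B: semi_inner "W2s l" "mode_b l m" by (rule semi_inner_mode_b)
  define e where "e = triple (\<lambda>y. 1) (\<lambda>y. 0) (\<lambda>y. 0)"
  define y where "y = triple (\<lambda>y. y) (\<lambda>y. 1) (\<lambda>y. 0)"
  have e: "e \<in> W2s l" unfolding e_def by (intro triple_W2s W2_smooth[OF l]) (auto intro!: derivative_eq_intros)
  have y: "y \<in> W2s l" unfolding y_def by (intro triple_W2s W2_smooth[OF l]) (auto intro!: derivative_eq_intros)
  have nz: "c = 0 \<and> d = 0" if "mode_b l m (\<lambda>p. c * e p + d * y p) (\<lambda>p. c * e p + d * y p) = 0" for c d
  proof -
    have F: "(\<lambda>p. c * e p + d * y p) \<in> W2s l" by (intro B.add_mem B.scale_mem e y)
    have "ipM (YM l) (\<lambda>t. c + d * t) (\<lambda>t. c + d * t) = 0"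
      using that m by (simp add: mode_b_def e_def y_def triple_def)
    moreover have "(\<lambda>t. c + d * t) \<in> sqint (YM l)" using W2s_sq(1)[OF F] by (simp add: e_def y_def triple_def)
    ultimately have "AE t in YM l. c + d * t = 0" by (rule sqint_nrm_zero_AE[rotated])
    then have z: "c + d * t = 0" if "t \<in> {-l..l}" for t
      using l that by (intro AE_eq_continuous[where a="-l" and b=l and f="\<lambda>t. c + d * t" and g="\<lambda>t. 0" and x=t]) (auto intro!: continuous_intros)
    show ?thesis using z[of 0] z[of l] l by simp
  qed
  \<comment> \<open>b(y, G) e - b(e, G) y is orthogonal to G; if b(e, G) = 0 then e itself is, and the combination could
    be zero.\<close>
  define c d where "c = (if mode_b l m e G = 0 then 1 else mode_b l m y G)" and "d = (if mode_b l m e G = 0 then 0 else - mode_b l m e G)"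
  have "c \<noteq> 0 \<or> d \<noteq> 0" by (simp add: c_def d_def)
  then have "mode_b l m (\<lambda>p. c * e p + d * y p) (\<lambda>p. c * e p + d * y p) \<noteq> 0" using nz by blast
  moreover have "mode_b l m (\<lambda>p. c * e p + d * y p) G = 0"
    using e y G by (simp add: B.add_left B.scale_left B.scale_mem c_def d_def)
  moreover have "(\<lambda>p. c * e p + d * y p) \<in> W2s l" by (intro B.add_mem B.scale_mem e y)
  ultimately show ?thesis by blast
qed

text \<open>The form of w_1 makes it a mode with m = 1, and its profile an eigenfunction there. Every minimum in
  a mode is an eigenvalue of the plate, hence at least \<Lambda>_2 unless it equals \<Lambda>_1;
  this case is excluded by size for m \<ge> 2 and by simplicity for m = 1.\<close>
theorem spectral_gap:
  assumes l: "0 < l" and s: "0 < \<sigma>" "\<sigma> < 1/2"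
    and ev: "first_second_eigenvalues l \<sigma> \<Lambda>1 \<Lambda>2"
    and w1: "buckling_eigenfunction l \<sigma> \<Lambda>1 w1"
    and form: "AE p in lebesgue_on (plate l). w1 p = \<phi>11 (snd p) * sin (fst p)"
    and nw: "norm0 (plate l) w1 = 1"
  shows "0 < \<Lambda>1" "0 \<le> \<Lambda>2" "\<And>u. u \<in> H2star l \<Longrightarrow> inner_x l u w1 = inner0 (plate l) u w1"
    "\<And>u. u \<in> H2star l \<Longrightarrow> inner0 (plate l) u w1 = 0 \<Longrightarrow> \<Lambda>2 * inner_x l u u \<le> inner2 l \<sigma> u u"
proof -
  interpret a: semi_inner "H2star l" "inner2 l \<sigma>" by (rule semi_inner_H2star[OF l s])
  interpret b: semi_inner "H2star l" "inner_x l" by (rule semi_inner_inner_x[OF l])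
  have wH: "w1 \<in> H2star l" and eig: "\<And>z. z \<in> H2star l \<Longrightarrow> inner2 l \<sigma> w1 z = \<Lambda>1 * inner_x l w1 z"
    using w1 by (auto simp: buckling_eigenfunction_def)
  have w2: "w1 \<in> H2 (plate l)" by (rule H2star_H2[OF wH])
  have least1: "\<And>\<Lambda>. \<Lambda> \<in> buckling_eigenvalues l \<sigma> \<Longrightarrow> \<Lambda>1 \<le> \<Lambda>"
    and least2: "\<And>\<Lambda>. \<Lambda> \<in> buckling_eigenvalues l \<sigma> \<Longrightarrow> \<Lambda> \<noteq> \<Lambda>1 \<Longrightarrow> \<Lambda>2 \<le> \<Lambda>"
    and in2: "\<Lambda>2 \<in> buckling_eigenvalues l \<sigma>"
    using ev by (auto simp: first_second_eigenvalues_def is_least_def)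
  have one: "(1::nat) \<ge> 1" by simp
  obtain \<psi> \<psi>1 \<psi>2 where \<psi>: "W2 l \<psi> \<psi>1 \<psi>2" "AE y in YM l. coef (sn 1) (rep l w1) y = \<psi> y"
    "\<And>\<zeta> \<zeta>1 \<zeta>2. W2 l \<zeta> \<zeta>1 \<zeta>2 \<Longrightarrow> inner2 l \<sigma> w1 (tens (sn 1) \<zeta>) = mode_form l \<sigma> 1 \<psi> \<psi>1 \<psi>2 \<zeta> \<zeta>1 \<zeta>2"
    "\<And>\<zeta> \<zeta>1 \<zeta>2. W2 l \<zeta> \<zeta>1 \<zeta>2 \<Longrightarrow> inner_x l w1 (tens (sn 1) \<zeta>) = (real 1)\<^sup>2 * ipM (YM l) \<psi> \<zeta>"
    by (rule mode_pairing[OF l wH one, of \<sigma>]) blast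
  define G where "G = triple \<psi> \<psi>1 \<psi>2"
  have G: "G \<in> W2s l" unfolding G_def by (rule triple_W2s[OF \<psi>(1)])
  have Ge: "mode_eigen l \<sigma> 1 \<Lambda>1 G"
    unfolding mode_eigen_def
  proof (intro conjI G ballI)
    fix F assume "F \<in> W2s l"
    then have W: "W2 l (c0 F) (c1 F) (c2 F)" by (simp add: W2s_def)
    show "mode_a l \<sigma> 1 G F = \<Lambda>1 * mode_b l 1 G F"
      using \<psi>(3)[OF W] \<psi>(4)[OF W] eig[OF mode_H2star[OF l W, of 1]] by (simp add: mode_a_def mode_b_def G_def)
  qed
  \<comment> \<open>The coefficient of w1 is the integral of w1 sin x over x, so w1
    itself is 2/pi times the mode with profile \<psi>.\<close>
  define w where "w = (\<lambda>p. 2 / pi * tens (sn 1) \<psi> p)"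
  have tH: "tens (sn 1) \<psi> \<in> H2star l" by (rule mode_H2star[OF l \<psi>(1)])
  have wwH: "w \<in> H2star l" unfolding w_def by (rule a.scale_mem[OF tH])
  have repw: "AE p in PM l. rep l w1 p = \<phi>11 (snd p) * sin (fst p)"
    using rep_L2(2)[OF H2_L2[OF w2]] form[unfolded AE_plate] by eventually_elim simp
  have "AE y in YM l. \<phi>11 y = 2 / pi * \<psi> y"
    using AE_ivp_swap[OF repw] \<psi>(2) slice_snd[OF rep_sqint[OF w2]]
  proof eventually_elim
    case (elim y)
    have m: "(\<lambda>x. rep l w1 (x, y)) \<in> borel_measurable XM" using elim(3) by (simp add: sqint_def)
    have sm: "sn 1 \<in> borel_measurable XM" using sn_sqint by (rule sqint_measurable)
    have "coef (sn 1) (rep l w1) y = (LINT x|XM. \<phi>11 y * (sn 1 x * sn 1 x))"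
      unfolding coef_def
    proof (rule integral_cong_AE)
      show "AE x in XM. rep l w1 (x, y) * sn 1 x = \<phi>11 y * (sn 1 x * sn 1 x)"
        using elim(1) by eventually_elim (simp add: sn_def)
    qed (use m sm in measurable)
    also have "\<dots> = \<phi>11 y * (pi / 2)" using sn_orth[OF one one] by (simp add: ipM_def)
    finally show ?case using elim(2) by (simp add: field_simps)
  qed
  from AE_ivp_snd[OF this, of 0 pi] have ww: "AE p in PM l. w1 p = w p"
    using form[unfolded AE_plate] by eventually_elim (simp add: w_def tens_def sn_def)
  note cong = inner_cong[OF wH wwH ww]
  have i0: "inner0 (plate l) u w1 = 2 / pi * inner0 (plate l) u (tens (sn 1) \<psi>)"
    and ix: "inner_x l u w1 = 2 / pi * inner_x l u (tens (sn 1) \<psi>)" if u: "u \<in> H2star l" for u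
  proof -
    note L = H2star_L2[OF u] H2star_L2[OF wH] H2star_L2[OF wwH] H2star_L2[OF tH]
    have "inner0 (plate l) u w1 = inner0 (plate l) u w"
      using cong(3)[OF u] l2.sym[OF L(1,2)] l2.sym[OF L(1,3)] by simp
    also have "\<dots> = 2 / pi * inner0 (plate l) u (tens (sn 1) \<psi>)"
      unfolding w_def by (rule l2.scale_right[OF L(4,1)])
    finally show "inner0 (plate l) u w1 = 2 / pi * inner0 (plate l) u (tens (sn 1) \<psi>)" .
    have "inner_x l u w1 = inner_x l u w" using cong(2)[OF u] b.sym[OF u wH] b.sym[OF u wwH] by simp
    also have "\<dots> = 2 / pi * inner_x l u (tens (sn 1) \<psi>)"
      unfolding w_def by (rule b.scale_right[OF tH u])
    finally show "inner_x l u w1 = 2 / pi * inner_x l u (tens (sn 1) \<psi>)" .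
  qed
  have pair: "\<exists>\<phi> \<phi>1 \<phi>2. W2 l \<phi> \<phi>1 \<phi>2 \<and> (AE y in YM l. coef (sn 1) (rep l u) y = \<phi> y) \<and>
      inner_x l u w1 = 2 / pi * ipM (YM l) \<phi> \<psi> \<and> inner0 (plate l) u w1 = 2 / pi * ipM (YM l) \<phi> \<psi>"
    if u: "u \<in> H2star l" for u
    unfolding i0[OF u] ix[OF u] by (rule mode_pairing[OF l u one, of \<sigma>]) (use \<psi>(1) in \<open>auto intro!: exI\<close>)
  show bw: "inner_x l u w1 = inner0 (plate l) u w1" if "u \<in> H2star l" for u using pair[OF that] by auto
  have BG: "mode_b l 1 G G \<noteq> 0"
  proof
    assume "mode_b l 1 G G = 0"
    then have z: "ipM (YM l) \<psi> \<psi> = 0" by (simp add: mode_b_def G_def)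
    have "inner0 (plate l) w1 w1 = 1"
      using nw by (simp add: norm0_def)
    moreover have "inner0 (plate l) w1 w1 = 2 / pi * inner0 (plate l) w1 (tens (sn 1) \<psi>)" by (rule i0[OF wH])
    moreover have "inner0 (plate l) w1 (tens (sn 1) \<psi>) = inner0 (plate l) w (tens (sn 1) \<psi>)" by (rule cong(3)[OF tH])
    moreover have "inner0 (plate l) w (tens (sn 1) \<psi>) = 2 / pi * inner0 (plate l) (tens (sn 1) \<psi>) (tens (sn 1) \<psi>)"
      unfolding w_def by (rule l2.scale_left[OF H2star_L2[OF tH] H2star_L2[OF tH]])
    ultimately show False using mode_mode(2)[OF l \<psi>(1) \<psi>(1) one one] z by simp
  qed
  have BGp: "0 < mode_b l 1 G G" using BG semi_inner.nonneg[OF semi_inner_mode_b G, of 1] by simp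
  have sg: "\<sigma>\<^sup>2 < 1 / 4"
  proof -
    have "\<sigma> * \<sigma> < 1/2 * (1/2)" using s by (intro mult_strict_mono) auto
    then show ?thesis by (simp add: power2_eq_square)
  qed
  have lowerm: "(1 - \<sigma>\<^sup>2) * (real m)\<^sup>2 \<le> \<nu>" if m: "m \<ge> 1" and E: "mode_eigen l \<sigma> m \<nu> F" and p: "0 < mode_b l m F F" for m \<nu> F
  proof -
    have F: "F \<in> W2s l" and e: "mode_a l \<sigma> m F F = \<nu> * mode_b l m F F" using E by (auto simp: mode_eigen_def)
    have "(1 - \<sigma>\<^sup>2) * (real m)\<^sup>2 * mode_b l m F F = (1 - \<sigma>\<^sup>2) * (real m) ^ 4 * ipM (YM l) (c0 F) (c0 F)"
      by (simp add: mode_b_def power2_eq_square power4_eq_xxxx)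
    also have "\<dots> \<le> \<nu> * mode_b l m F F" using mode_a_lower(1)[OF F s, of m] e by simp
    finally show ?thesis using p by (simp add: mult_le_cancel_right)
  qed
  show L1: "0 < \<Lambda>1" using lowerm[OF one Ge BGp] sg by simp
  then show L2: "0 \<le> \<Lambda>2" using least1[OF in2] by simp
  have in_ev: "\<nu> \<in> buckling_eigenvalues l \<sigma>" if "m \<ge> 1" "mode_eigen l \<sigma> m \<nu> F" "mode_b l m F F \<noteq> 0" for m \<nu> F
    using mode_eigen_plate[OF l s that] by (auto simp: buckling_eigenvalues_def)
  have Z: "(\<lambda>p. 0) \<in> W2s l" by (rule W2s_zero)
  have min: "\<exists>\<nu> F. mode_eigen l \<sigma> m \<nu> F \<and> mode_b l m F F = 1 \<and> mode_b l m F H = 0 \<and>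
      (\<forall>z\<in>W2s l. mode_b l m z H = 0 \<longrightarrow> \<nu> * mode_b l m z z \<le> mode_a l \<sigma> m z z)"
    if m: "m \<ge> 1" and H: "H \<in> W2s l" "\<And>z. z \<in> W2s l \<Longrightarrow> mode_a l \<sigma> m H z = lam * mode_b l m H z" for m H lam
    by (rule form_pair.constrained_minimizer[OF form_pair_modes[OF l s m] H W2s_orth_exists[OF l m H(1)]])
       (auto simp: mode_eigen_def)
  have zeros: "mode_a l \<sigma> m (\<lambda>p. 0) z = 0 * mode_b l m (\<lambda>p. 0) z" "mode_b l m z (\<lambda>p. 0) = 0" if "z \<in> W2s l" for z m
    using semi_inner.zero_left[OF semi_inner_mode_a[OF s] that] by (simp_all add: mode_b_def ipM_def)
  \<comment> \<open>The minimum over the first mode is an eigenvalue of the plate and less than 1.\<close>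
  have L1lt: "\<Lambda>1 < 1"
  proof -
    obtain \<nu> F where F: "mode_eigen l \<sigma> 1 \<nu> F" "mode_b l 1 F F = 1" "\<And>z. z \<in> W2s l \<Longrightarrow> \<nu> * mode_b l 1 z z \<le> mode_a l \<sigma> 1 z z"
      using min[OF one Z zeros(1)] zeros(2) by blast
    obtain T where T: "T \<in> W2s l" "0 < mode_b l 1 T T" "mode_a l \<sigma> 1 T T < mode_b l 1 T T" using mode1_below_one[OF l s] by blast
    have "\<nu> * mode_b l 1 T T < 1 * mode_b l 1 T T" using F(3)[OF T(1)] T(3) by linarith
    then have "\<nu> < 1" using T(2) by (simp add: mult_less_cancel_right)
    moreover have "\<Lambda>1 \<le> \<nu>" using F by (intro least1 in_ev[OF one F(1)]) simp
    ultimately show ?thesis by simp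
  qed
  show "\<Lambda>2 * inner_x l u u \<le> inner2 l \<sigma> u u" if u: "u \<in> H2star l" and uo: "inner0 (plate l) u w1 = 0" for u
  proof (rule mode_sum_bound[OF l s u L2])
    fix m \<phi> \<phi>1 \<phi>2
    assume m: "m \<ge> 1" and W: "W2 l \<phi> \<phi>1 \<phi>2" and c: "AE y in YM l. coef (sn m) (rep l u) y = \<phi> y"
    define F where "F = triple \<phi> \<phi>1 \<phi>2"
    have F: "F \<in> W2s l" unfolding F_def by (rule triple_W2s[OF W])
    have Bn: "0 \<le> mode_b l m F F" by (rule semi_inner.nonneg[OF semi_inner_mode_b F])
    have "\<Lambda>2 * mode_b l m F F \<le> mode_a l \<sigma> m F F"
    proof (cases "m = 1")
      case False
      then have m2: "2 \<le> m" using m by simp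
      obtain \<nu> E where E: "mode_eigen l \<sigma> m \<nu> E" "mode_b l m E E = 1" "\<And>z. z \<in> W2s l \<Longrightarrow> \<nu> * mode_b l m z z \<le> mode_a l \<sigma> m z z"
        using min[OF m Z zeros(1)] zeros(2) by blast
      \<comment> \<open>The modes m \<ge> 2 only have eigenvalues \<ge> 4 (1 - \<sigma>^2), which is more than 1.\<close>
      have "1 \<le> (1 - \<sigma>\<^sup>2) * 4" using sg by simp
      also have "\<dots> \<le> (1 - \<sigma>\<^sup>2) * (real m)\<^sup>2"
        using power_mono[of 2 "real m" 2] m2 sg by (intro mult_left_mono) auto
      also have "\<dots> \<le> \<nu>" using E by (intro lowerm[OF m E(1)]) simp
      finally have "\<nu> \<noteq> \<Lambda>1" using L1lt by simp
      then have "\<Lambda>2 \<le> \<nu>" using E by (intro least2 in_ev[OF m E(1)]) auto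
      then have "\<Lambda>2 * mode_b l m F F \<le> \<nu> * mode_b l m F F" using Bn by (rule mult_right_mono)
      then show ?thesis using E(3)[OF F] by simp
    next
      case True
      obtain \<nu> E where E: "mode_eigen l \<sigma> 1 \<nu> E" "mode_b l 1 E E = 1" "mode_b l 1 E G = 0"
        "\<And>z. z \<in> W2s l \<Longrightarrow> mode_b l 1 z G = 0 \<Longrightarrow> \<nu> * mode_b l 1 z z \<le> mode_a l \<sigma> 1 z z"
        using min[OF one G, of \<Lambda>1] Ge unfolding mode_eigen_def by blast
      have "\<nu> \<noteq> \<Lambda>1"
      proof
        assume "\<nu> = \<Lambda>1"
        then show False using mode1_simple[OF l s L1 L1lt _ Ge E(3)] E BG by simp
      qed
      then have "\<Lambda>2 \<le> \<nu>" using E by (intro least2 in_ev[OF one E(1)]) auto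
      then have le: "\<Lambda>2 * mode_b l 1 F F \<le> \<nu> * mode_b l 1 F F" using Bn True by (intro mult_right_mono) auto
      \<comment> \<open>Orthogonality of u to w_1 is orthogonality of the first coefficient of u to the profile of w_1.\<close>
      obtain \<phi>' where \<phi>': "\<phi>' \<in> sqint (YM l)" "AE y in YM l. coef (sn 1) (rep l u) y = \<phi>' y" "2 / pi * ipM (YM l) \<phi>' \<psi> = 0"
        using pair[OF u] uo W2_cont0(2) by metis
      have "AE y in YM l. \<phi> y = \<phi>' y" using c \<phi>'(2) True by (auto elim: eventually_elim2)
      then have "ipM (YM l) \<phi> \<psi> = ipM (YM l) \<phi>' \<psi>"
        using \<phi>'(1) W2_cont0(2)[OF W] W2_cont0(2)[OF \<psi>(1)] by (intro ipM_cong_left sqint_measurable)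
      then have "mode_b l 1 F G = 0" using \<phi>'(3) by (simp add: mode_b_def F_def G_def)
      from E(4)[OF F this] le show ?thesis using True by simp
    qed
    then show "\<Lambda>2 * mode_b l m (triple \<phi> \<phi>1 \<phi>2) (triple \<phi> \<phi>1 \<phi>2) \<le> mode_a l \<sigma> m (triple \<phi> \<phi>1 \<phi>2) (triple \<phi> \<phi>1 \<phi>2)"
      by (simp add: F_def)
  qed
qed

section \<open>Dynamics of the damped nonlinear wave equation\<close>

text \<open>An abstract version of the plate problem: X is the energy space with form a, Y the pivot space with
  inner product i, and D plays the role of the second derivative in x. The last assumption states
  that U' is differentiable as a curve in the dual space of X, with derivative prescribed by the
  equation; uniformity over v replaces the dual norm.\<close>
locale wave = H: semi_inner X a + L: semi_inner Y i + B: semi_inner X b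
  for X Y :: "('p \<Rightarrow> real) set" and a i b :: "('p \<Rightarrow> real) \<Rightarrow> ('p \<Rightarrow> real) \<Rightarrow> real" +
  fixes D :: "('p \<Rightarrow> real) \<Rightarrow> 'p \<Rightarrow> real" and C \<delta> S P :: real and U U' :: "real \<Rightarrow> 'p \<Rightarrow> real"
  assumes XY: "X \<subseteq> Y" and D_mem: "u \<in> X \<Longrightarrow> D u \<in> Y" and b_D: "u \<in> X \<Longrightarrow> v \<in> X \<Longrightarrow> b u v = - i (D u) v"
    and D_diff: "u \<in> X \<Longrightarrow> v \<in> X \<Longrightarrow> L.nrm (\<lambda>p. D u p - D v p) \<le> C * H.nrm (\<lambda>p. u p - v p)"
    and L_le: "u \<in> X \<Longrightarrow> L.nrm u \<le> C * H.nrm u"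
    and \<delta>: "0 < \<delta>" and S: "0 < S"
    and U_mem: "t \<ge> 0 \<Longrightarrow> U t \<in> X" and U'_mem: "t \<ge> 0 \<Longrightarrow> U' t \<in> Y"
    and U_cont: "t \<ge> 0 \<Longrightarrow> ((\<lambda>s. H.nrm (\<lambda>p. U s p - U t p)) \<longlongrightarrow> 0) (at t within {0..})"
    and U'_cont: "t \<ge> 0 \<Longrightarrow> ((\<lambda>s. L.nrm (\<lambda>p. U' s p - U' t p)) \<longlongrightarrow> 0) (at t within {0..})"
    and U_der: "t \<ge> 0 \<Longrightarrow> ((\<lambda>s. L.nrm (\<lambda>p. (U s p - U t p) / (s - t) - U' t p)) \<longlongrightarrow> 0) (at t within {0..})"
    and U'_der: "t \<ge> 0 \<Longrightarrow> 0 < e \<Longrightarrow> \<forall>\<^sub>F s in at t within {0..}. \<forall>v\<in>X.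
       \<bar>(i (U' s) v - i (U' t) v) / (s - t) + (\<delta> * i (U' t) v + a (U t) v + (- P + S * b (U t) (U t)) * b (U t) v)\<bar> \<le> e * H.nrm v"
begin

definition \<beta> :: "real \<Rightarrow> real" where "\<beta> t = b (U t) (U t)"
definition \<beta>' :: "real \<Rightarrow> real" where "\<beta>' t = - 2 * i (D (U t)) (U' t)"
definition \<phi> :: "real \<Rightarrow> real" where "\<phi> t = - P + S * \<beta> t"
text \<open>The functional U''(t), as given by the equation.\<close>
definition accel :: "real \<Rightarrow> ('p \<Rightarrow> real) \<Rightarrow> real" where
  "accel t v = - (\<delta> * i (U' t) v + a (U t) v + \<phi> t * b (U t) v)"

lemma U_Y: "t \<ge> 0 \<Longrightarrow> U t \<in> Y" using U_mem XY by blast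

lemma U'_der': "t \<ge> 0 \<Longrightarrow> 0 < e \<Longrightarrow> \<forall>\<^sub>F s in at t within {0..}. \<forall>v\<in>X.
       \<bar>(i (U' s) v - i (U' t) v) / (s - t) - accel t v\<bar> \<le> e * H.nrm v"
  unfolding accel_def \<phi>_def \<beta>_def diff_minus_eq_add by (rule U'_der)

lemma ev_nonneg: "\<forall>\<^sub>F s in at t within {0..}. (0::real) \<le> s"
  by (auto simp: eventually_at_filter)

lemma C_bound: assumes "u \<in> X" shows "L.nrm u \<le> \<bar>C\<bar> * H.nrm u"
  using L_le[OF assms] mult_right_mono[of C "\<bar>C\<bar>" "H.nrm u"] H.nrm_nonneg[OF assms] by linarith

lemma accel_diff: "t \<ge> 0 \<Longrightarrow> u \<in> X \<Longrightarrow> v \<in> X \<Longrightarrow> accel t (\<lambda>p. u p - v p) = accel t u - accel t v"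
  unfolding accel_def using U_mem[of t] U'_mem[of t] XY
  by (simp add: L.diff_right H.diff_right B.diff_right subset_iff algebra_simps)

lemma accel_bound: assumes "t \<ge> 0" obtains K where "\<And>v. v \<in> X \<Longrightarrow> \<bar>accel t v\<bar> \<le> K * H.nrm v"
proof -
  have "\<bar>accel t v\<bar> \<le> (\<delta> * (L.nrm (U' t) * \<bar>C\<bar>) + H.nrm (U t) + \<bar>\<phi> t\<bar> * (L.nrm (D (U t)) * \<bar>C\<bar>)) * H.nrm v" if v: "v \<in> X" for v
  proof -
    have vY: "v \<in> Y" using v XY by blast
    note m = U_mem[OF assms] U'_mem[OF assms]
    note n = L.nrm_nonneg[OF m(2)] L.nrm_nonneg[OF D_mem[OF m(1)]]
    have "\<bar>i (U' t) v\<bar> \<le> L.nrm (U' t) * (\<bar>C\<bar> * H.nrm v)"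
      using L.Cauchy_Schwarz[OF m(2) vY] mult_left_mono[OF C_bound[OF v] n(1)] by linarith
    then have 1: "\<bar>\<delta> * i (U' t) v\<bar> \<le> \<delta> * (L.nrm (U' t) * (\<bar>C\<bar> * H.nrm v))" using \<delta> by (simp add: abs_mult)
    have 2: "\<bar>a (U t) v\<bar> \<le> H.nrm (U t) * H.nrm v" by (rule H.Cauchy_Schwarz[OF m(1) v])
    have "\<bar>b (U t) v\<bar> \<le> L.nrm (D (U t)) * (\<bar>C\<bar> * H.nrm v)"
      using L.Cauchy_Schwarz[OF D_mem[OF m(1)] vY] mult_left_mono[OF C_bound[OF v] n(2)] b_D[OF m(1) v] by simp
    then have 3: "\<bar>\<phi> t * b (U t) v\<bar> \<le> \<bar>\<phi> t\<bar> * (L.nrm (D (U t)) * (\<bar>C\<bar> * H.nrm v))"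
      by (simp add: abs_mult mult_left_mono)
    have "\<bar>accel t v\<bar> \<le> \<bar>\<delta> * i (U' t) v\<bar> + \<bar>a (U t) v\<bar> + \<bar>\<phi> t * b (U t) v\<bar>" unfolding accel_def by linarith
    also have "\<dots> \<le> \<delta> * (L.nrm (U' t) * (\<bar>C\<bar> * H.nrm v)) + H.nrm (U t) * H.nrm v + \<bar>\<phi> t\<bar> * (L.nrm (D (U t)) * (\<bar>C\<bar> * H.nrm v))"
      using 1 2 3 by linarith
    also have "\<dots> = (\<delta> * (L.nrm (U' t) * \<bar>C\<bar>) + H.nrm (U t) + \<bar>\<phi> t\<bar> * (L.nrm (D (U t)) * \<bar>C\<bar>)) * H.nrm v"
      by (simp add: algebra_simps)
    finally show ?thesis .
  qed
  then show thesis by (rule that)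
qed

text \<open>Product rule for a curve V that is differentiable in the dual space only, and a curve f that is
  continuous in X and differentiable in Y. The difference quotient splits into ((V(s) - V(t))/(s -
  t), f(s)), where convergence is uniform on bounded subsets of X, and (V(t), (f(s) - f(t))/(s -
  t)), which only uses Y.\<close>
lemma pair_deriv:
  assumes t: "(t::real) \<ge> 0"
    and V: "\<And>s. s \<ge> 0 \<Longrightarrow> V s \<in> Y"
    and Vd: "\<And>e. 0 < e \<Longrightarrow> \<forall>\<^sub>F s in at t within {0..}. \<forall>v\<in>X. \<bar>(i (V s) v - i (V t) v) / (s - t) - \<Gamma> v\<bar> \<le> e * H.nrm v"
    and \<Gamma>: "\<And>u v. u \<in> X \<Longrightarrow> v \<in> X \<Longrightarrow> \<Gamma> (\<lambda>p. u p - v p) = \<Gamma> u - \<Gamma> v" "\<And>v. v \<in> X \<Longrightarrow> \<bar>\<Gamma> v\<bar> \<le> K * H.nrm v"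
    and f: "\<And>s. s \<ge> 0 \<Longrightarrow> f s \<in> X" "((\<lambda>s. H.nrm (\<lambda>p. f s p - f t p)) \<longlongrightarrow> 0) (at t within {0..})"
    and f': "f' \<in> Y" "((\<lambda>s. L.nrm (\<lambda>p. (f s p - f t p) / (s - t) - f' p)) \<longlongrightarrow> 0) (at t within {0..})"
  shows "((\<lambda>s. i (V s) (f s)) has_real_derivative \<Gamma> (f t) + i (V t) f') (at t within {0..})"
proof -
  let ?F = "at t within {0..}"
  have evX: "\<forall>\<^sub>F s in ?F. f s \<in> X" using ev_nonneg by eventually_elim (rule f)
  have fY: "f s \<in> Y" if "s \<ge> 0" for s using f(1)[OF that] XY by blast
  have nlim: "((\<lambda>s. H.nrm (f s)) \<longlongrightarrow> H.nrm (f t)) ?F" by (rule H.tendsto_nrm[OF evX f(1)[OF t] f(2)])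
  define N where "N = H.nrm (f t) + 1"
  have N: "0 < N" using H.nrm_nonneg[OF f(1)[OF t]] by (simp add: N_def)
  have evN: "\<forall>\<^sub>F s in ?F. H.nrm (f s) < N" using nlim by (rule order_tendstoD) (simp add: N_def)
  have t1: "((\<lambda>s. (i (V s) (f s) - i (V t) (f s)) / (s - t) - \<Gamma> (f s)) \<longlongrightarrow> 0) ?F"
  proof (rule tendstoI)
    fix e :: real assume e: "0 < e"
    have "0 < e / (2 * N)" using e N by simp
    from Vd[OF this] evN ev_nonneg
    show "\<forall>\<^sub>F s in ?F. dist ((i (V s) (f s) - i (V t) (f s)) / (s - t) - \<Gamma> (f s)) 0 < e"
    proof eventually_elim
      case (elim s)
      have "\<bar>(i (V s) (f s) - i (V t) (f s)) / (s - t) - \<Gamma> (f s)\<bar> \<le> e / (2 * N) * H.nrm (f s)" using elim f by blast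
      also have "\<dots> \<le> e / (2 * N) * N" using elim e N by (intro mult_left_mono) auto
      also have "\<dots> < e" using e N by simp
      finally show ?case by simp
    qed
  qed
  have t2: "((\<lambda>s. \<Gamma> (f s) - \<Gamma> (f t)) \<longlongrightarrow> 0) ?F"
  proof (rule Lim_null_comparison)
    show "\<forall>\<^sub>F s in ?F. norm (\<Gamma> (f s) - \<Gamma> (f t)) \<le> K * H.nrm (\<lambda>p. f s p - f t p)"
      using evX by eventually_elim (metis H.diff_mem \<Gamma> f(1) real_norm_def t)
    show "((\<lambda>s. K * H.nrm (\<lambda>p. f s p - f t p)) \<longlongrightarrow> 0) ?F" using tendsto_mult_left[OF f(2), of K] by simp
  qed
  have t3: "((\<lambda>s. i (V t) (\<lambda>p. (f s p - f t p) / (s - t))) \<longlongrightarrow> i (V t) f') ?F"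
  proof (rule L.tendsto_ip)
    show "\<forall>\<^sub>F s in ?F. V t \<in> Y" using V[OF t] by simp
    show "((\<lambda>s. L.nrm (\<lambda>p. V t p - V t p)) \<longlongrightarrow> 0) ?F" by (simp add: L.nrm_def L.zero_left L.zero_mem)
    show "\<forall>\<^sub>F s in ?F. (\<lambda>p. (f s p - f t p) / (s - t)) \<in> Y"
      using ev_nonneg by eventually_elim (intro L.divide_mem L.diff_mem fY t)
  qed (use V[OF t] f' in auto)
  have "((\<lambda>s. ((i (V s) (f s) - i (V t) (f s)) / (s - t) - \<Gamma> (f s)) + (\<Gamma> (f s) - \<Gamma> (f t)) + \<Gamma> (f t) + i (V t) (\<lambda>p. (f s p - f t p) / (s - t)))
      \<longlongrightarrow> 0 + 0 + \<Gamma> (f t) + i (V t) f') ?F"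
    by (intro tendsto_add t1 t2 t3 tendsto_const)
  then have "((\<lambda>s. ((i (V s) (f s) - i (V t) (f s)) / (s - t) - \<Gamma> (f s)) + (\<Gamma> (f s) - \<Gamma> (f t)) + \<Gamma> (f t) + i (V t) (\<lambda>p. (f s p - f t p) / (s - t)))
      \<longlongrightarrow> \<Gamma> (f t) + i (V t) f') ?F" by simp
  then have "((\<lambda>s. (i (V s) (f s) - i (V t) (f t)) / (s - t)) \<longlongrightarrow> \<Gamma> (f t) + i (V t) f') ?F"
  proof (rule Lim_transform_eventually)
    show "\<forall>\<^sub>F s in ?F. ((i (V s) (f s) - i (V t) (f s)) / (s - t) - \<Gamma> (f s)) + (\<Gamma> (f s) - \<Gamma> (f t)) + \<Gamma> (f t) + i (V t) (\<lambda>p. (f s p - f t p) / (s - t))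
        = (i (V s) (f s) - i (V t) (f t)) / (s - t)"
      using ev_nonneg
    proof eventually_elim
      case (elim s)
      have "i (V t) (\<lambda>p. (f s p - f t p) / (s - t)) = (i (V t) (f s) - i (V t) (f t)) / (s - t)"
        using V[OF t] fY[OF elim] fY[OF t] by (simp add: L.divide_right L.diff_right L.diff_mem)
      then show ?case by (simp add: diff_divide_distrib)
    qed
  qed
  then show ?thesis by (simp add: has_field_derivative_iff)
qed

lemma strong_pair_deriv:
  assumes t: "(t::real) \<ge> 0" and V: "V \<in> Y" and f: "\<And>s. s \<ge> 0 \<Longrightarrow> f s \<in> Y" and f': "f' \<in> Y"
    "((\<lambda>s. L.nrm (\<lambda>p. (f s p - f t p) / (s - t) - f' p)) \<longlongrightarrow> 0) (at t within {0..})"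
  shows "((\<lambda>s. i V (f s)) has_real_derivative i V f') (at t within {0..})"
proof -
  let ?F = "at t within {0..}"
  have "((\<lambda>s. i V (\<lambda>p. (f s p - f t p) / (s - t))) \<longlongrightarrow> i V f') ?F"
  proof (rule L.tendsto_ip)
    show "((\<lambda>s. L.nrm (\<lambda>p. V p - V p)) \<longlongrightarrow> 0) ?F" by (simp add: L.nrm_def L.zero_left L.zero_mem)
    show "\<forall>\<^sub>F s in ?F. (\<lambda>p. (f s p - f t p) / (s - t)) \<in> Y"
      using ev_nonneg by eventually_elim (intro L.divide_mem L.diff_mem f t)
  qed (use V f' in auto)
  then have "((\<lambda>s. (i V (f s) - i V (f t)) / (s - t)) \<longlongrightarrow> i V f') ?F"
    by (rule Lim_transform_eventually)
       (use ev_nonneg in \<open>eventually_elim, simp add: L.divide_right L.diff_right L.diff_mem V f t\<close>)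
  then show ?thesis by (simp add: has_field_derivative_iff)
qed

lemma shift_filter:
  assumes "0 \<le> h" shows "filterlim (\<lambda>s. s + h) (at (t + h) within {0..}) (at (t::real) within {0..})"
  unfolding filterlim_at
proof
  have "\<forall>\<^sub>F s in at t within {0..}. s \<noteq> t" by (simp add: eventually_at_filter)
  with ev_nonneg show "\<forall>\<^sub>F s in at t within {0..}. s + h \<in> {0..} \<and> s + h \<noteq> t + h"
    by eventually_elim (use assms in auto)
  show "((\<lambda>s. s + h) \<longlongrightarrow> t + h) (at t within {0..})" by (intro tendsto_intros)
qed

lemma U_shift:
  assumes t: "t \<ge> 0" and h: "h \<ge> 0"
  shows "((\<lambda>s. H.nrm (\<lambda>p. U (s + h) p - U (t + h) p)) \<longlongrightarrow> 0) (at t within {0..})"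
    "((\<lambda>s. L.nrm (\<lambda>p. (U (s + h) p - U (t + h) p) / (s - t) - U' (t + h) p)) \<longlongrightarrow> 0) (at t within {0..})"
    "0 < e \<Longrightarrow> \<forall>\<^sub>F s in at t within {0..}. \<forall>v\<in>X. \<bar>(i (U' (s + h)) v - i (U' (t + h)) v) / (s - t) - accel (t + h) v\<bar> \<le> e * H.nrm v"
proof -
  have th: "t + h \<ge> 0" using t h by simp
  show "((\<lambda>s. H.nrm (\<lambda>p. U (s + h) p - U (t + h) p)) \<longlongrightarrow> 0) (at t within {0..})"
    using filterlim_compose[OF U_cont[OF th] shift_filter[OF h]] by simp
  show "((\<lambda>s. L.nrm (\<lambda>p. (U (s + h) p - U (t + h) p) / (s - t) - U' (t + h) p)) \<longlongrightarrow> 0) (at t within {0..})"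
    using filterlim_compose[OF U_der[OF th] shift_filter[OF h]] by simp
  show "\<forall>\<^sub>F s in at t within {0..}. \<forall>v\<in>X. \<bar>(i (U' (s + h)) v - i (U' (t + h)) v) / (s - t) - accel (t + h) v\<bar> \<le> e * H.nrm v" if "0 < e"
    using filterlim_iff[THEN iffD1, OF shift_filter[OF h], rule_format, OF U'_der'[OF th that]] by simp
qed

lemma weak_strong_deriv:
  assumes t: "t \<ge> 0" and h: "h \<ge> 0"
  shows "((\<lambda>s. i (U' s) (U (s + h))) has_real_derivative accel t (U (t + h)) + i (U' t) (U' (t + h))) (at t within {0..})"
    "((\<lambda>s. i (U' (s + h)) (U s)) has_real_derivative accel (t + h) (U t) + i (U' (t + h)) (U' t)) (at t within {0..})"
proof -
  have th: "t + h \<ge> 0" using t h by simp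
  obtain K where K: "\<And>v. v \<in> X \<Longrightarrow> \<bar>accel t v\<bar> \<le> K * H.nrm v" using accel_bound[OF t] by blast
  obtain K' where K': "\<And>v. v \<in> X \<Longrightarrow> \<bar>accel (t + h) v\<bar> \<le> K' * H.nrm v" using accel_bound[OF th] by blast
  show "((\<lambda>s. i (U' s) (U (s + h))) has_real_derivative accel t (U (t + h)) + i (U' t) (U' (t + h))) (at t within {0..})"
    by (rule pair_deriv[OF t U'_mem U'_der'[OF t] accel_diff[OF t] K _ U_shift(1)[OF t h] U'_mem[OF th] U_shift(2)[OF t h]])
       (use h U_mem in auto)
  show "((\<lambda>s. i (U' (s + h)) (U s)) has_real_derivative accel (t + h) (U t) + i (U' (t + h)) (U' t)) (at t within {0..})"
    by (rule pair_deriv[OF t _ U_shift(3)[OF t h] accel_diff[OF th] K' U_mem U_cont[OF t] U'_mem[OF t] U_der[OF t]])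
       (use h U'_mem in auto)
qed

lemma cross_term_deriv: "t \<ge> 0 \<Longrightarrow> ((\<lambda>s. i (U' s) (U s)) has_real_derivative accel t (U t) + i (U' t) (U' t)) (at t within {0..})"
  using weak_strong_deriv(1)[of t 0] by simp

lemma norm_sq_deriv:
  assumes t: "t \<ge> 0" shows "((\<lambda>s. i (U s) (U s)) has_real_derivative 2 * i (U' t) (U t)) (at t within {0..})"
proof -
  let ?F = "at t within {0..}"
  have c: "((\<lambda>s. L.nrm (\<lambda>p. U s p - U t p)) \<longlongrightarrow> 0) ?F"
  proof (rule Lim_null_comparison)
    show "\<forall>\<^sub>F s in ?F. norm (L.nrm (\<lambda>p. U s p - U t p)) \<le> C * H.nrm (\<lambda>p. U s p - U t p)"
      using ev_nonneg
    proof eventually_elim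
      case (elim s)
      have "(\<lambda>p. U s p - U t p) \<in> X" by (intro H.diff_mem U_mem elim t)
      then show ?case using L_le L.nrm_nonneg XY by auto
    qed
    show "((\<lambda>s. C * H.nrm (\<lambda>p. U s p - U t p)) \<longlongrightarrow> 0) ?F" using tendsto_mult_left[OF U_cont[OF t], of C] by simp
  qed
  have "((\<lambda>s. i (\<lambda>p. (U s p - U t p) / (s - t)) (\<lambda>p. U s p + U t p)) \<longlongrightarrow> i (U' t) (\<lambda>p. U t p + U t p)) ?F"
  proof (rule L.tendsto_ip[OF _ U'_mem[OF t] U_der[OF t]])
    show "\<forall>\<^sub>F s in ?F. (\<lambda>p. (U s p - U t p) / (s - t)) \<in> Y"
      using ev_nonneg by eventually_elim (intro L.divide_mem L.diff_mem U_Y t)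
    show "\<forall>\<^sub>F s in ?F. (\<lambda>p. U s p + U t p) \<in> Y" using ev_nonneg by eventually_elim (intro L.add_mem U_Y t)
    show "(\<lambda>p. U t p + U t p) \<in> Y" by (intro L.add_mem U_Y t)
    show "((\<lambda>s. L.nrm (\<lambda>p. U s p + U t p - (U t p + U t p))) \<longlongrightarrow> 0) ?F" using c by simp
  qed
  then have "((\<lambda>s. (i (U s) (U s) - i (U t) (U t)) / (s - t)) \<longlongrightarrow> 2 * i (U' t) (U t)) ?F"
    unfolding L.add_right[OF U_Y[OF t] U_Y[OF t] U'_mem[OF t]] mult_2
  proof (rule Lim_transform_eventually)
    show "\<forall>\<^sub>F s in ?F. i (\<lambda>p. (U s p - U t p) / (s - t)) (\<lambda>p. U s p + U t p) = (i (U s) (U s) - i (U t) (U t)) / (s - t)"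
      using ev_nonneg
    proof eventually_elim
      case (elim s)
      note m = U_Y[OF elim] U_Y[OF t]
      show ?case using m L.sym[OF m] by (simp add: L.divide_left L.diff_left L.add_right L.diff_mem L.add_mem)
    qed
  qed
  then show ?thesis by (simp add: has_field_derivative_iff)
qed

lemma DU_cont:
  assumes t: "t \<ge> 0" shows "((\<lambda>s. L.nrm (\<lambda>p. D (U s) p - D (U t) p)) \<longlongrightarrow> 0) (at t within {0..})"
proof (rule Lim_null_comparison)
  show "\<forall>\<^sub>F s in at t within {0..}. norm (L.nrm (\<lambda>p. D (U s) p - D (U t) p)) \<le> C * H.nrm (\<lambda>p. U s p - U t p)"
    using ev_nonneg
  proof eventually_elim
    case (elim s)
    have "(\<lambda>p. D (U s) p - D (U t) p) \<in> Y" by (intro L.diff_mem D_mem U_mem elim t)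
    then show ?case using D_diff[OF U_mem[OF elim] U_mem[OF t]] L.nrm_nonneg by simp
  qed
  show "((\<lambda>s. C * H.nrm (\<lambda>p. U s p - U t p)) \<longlongrightarrow> 0) (at t within {0..})" using tendsto_mult_left[OF U_cont[OF t], of C] by simp
qed

text \<open>b(U, U) = -(D U, U) is differentiated without U' being in X: the increment of b equals minus the
  increment of U paired with D U(s) + D U(t), and D is continuous from X to Y.\<close>
lemma \<beta>_deriv:
  assumes t: "t \<ge> 0" shows "(\<beta> has_real_derivative \<beta>' t) (at t within {0..})"
proof -
  let ?F = "at t within {0..}"
  have evd: "\<forall>\<^sub>F s in ?F. (\<lambda>p. (U s p - U t p) / (s - t)) \<in> Y"
    using ev_nonneg by eventually_elim (intro L.divide_mem L.diff_mem U_Y t)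
  have "((\<lambda>s. i (D (U s)) (\<lambda>p. (U s p - U t p) / (s - t)) + i (D (U t)) (\<lambda>p. (U s p - U t p) / (s - t)))
      \<longlongrightarrow> i (D (U t)) (U' t) + i (D (U t)) (U' t)) ?F"
  proof (intro tendsto_add L.tendsto_ip[OF _ _ _ evd U'_mem[OF t] U_der[OF t]] D_mem U_mem[OF t] DU_cont[OF t])
    show "\<forall>\<^sub>F s in ?F. D (U s) \<in> Y" using ev_nonneg by eventually_elim (intro D_mem U_mem)
    show "\<forall>\<^sub>F s in ?F. D (U t) \<in> Y" using D_mem U_mem t by simp
    show "((\<lambda>s. L.nrm (\<lambda>p. D (U t) p - D (U t) p)) \<longlongrightarrow> 0) ?F" by (simp add: L.nrm_def L.zero_left L.zero_mem)
  qed
  then have lim: "((\<lambda>s. - (i (D (U s)) (\<lambda>p. (U s p - U t p) / (s - t)) + i (D (U t)) (\<lambda>p. (U s p - U t p) / (s - t)))) \<longlongrightarrow> \<beta>' t) ?F"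
    using tendsto_minus by (fastforce simp: \<beta>'_def)
  have "((\<lambda>s. (\<beta> s - \<beta> t) / (s - t)) \<longlongrightarrow> \<beta>' t) ?F"
  proof (rule Lim_transform_eventually[OF lim])
    show "\<forall>\<^sub>F s in ?F. - (i (D (U s)) (\<lambda>p. (U s p - U t p) / (s - t)) + i (D (U t)) (\<lambda>p. (U s p - U t p) / (s - t))) = (\<beta> s - \<beta> t) / (s - t)"
      using ev_nonneg
    proof eventually_elim
      case (elim s)
      note m = U_mem[OF elim] U_mem[OF t] and y = U_Y[OF elim] U_Y[OF t]
      have d: "i (D u) (\<lambda>p. (U s p - U t p) / (s - t)) = - (b u (U s) - b u (U t)) / (s - t)" if "u \<in> X" for u
        using that m y D_mem[OF that] by (simp add: L.divide_right L.diff_right L.diff_mem b_D)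
      show ?case unfolding d[OF m(1)] d[OF m(2)] \<beta>_def using B.sym[OF m] by (simp add: diff_divide_distrib)
    qed
  qed
  then show ?thesis by (simp add: has_field_derivative_iff)
qed

lemma \<beta>'_cont: "continuous_on {0..} \<beta>'"
  unfolding continuous_on_def
proof
  fix t :: real assume "t \<in> {0..}"
  then have t: "t \<ge> 0" by simp
  have "((\<lambda>s. i (D (U s)) (U' s)) \<longlongrightarrow> i (D (U t)) (U' t)) (at t within {0..})"
  proof (rule L.tendsto_ip[OF _ D_mem[OF U_mem[OF t]] DU_cont[OF t] _ U'_mem[OF t] U'_cont[OF t]])
    show "\<forall>\<^sub>F s in at t within {0..}. D (U s) \<in> Y" using ev_nonneg by eventually_elim (intro D_mem U_mem)
    show "\<forall>\<^sub>F s in at t within {0..}. U' s \<in> Y" using ev_nonneg by eventually_elim (rule U'_mem)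
  qed
  then show "(\<beta>' \<longlongrightarrow> \<beta>' t) (at t within {0..})" unfolding \<beta>'_def by (intro tendsto_intros)
qed

lemma \<beta>_cont: "continuous_on {0..} \<beta>"
  by (rule DERIV_continuous_on[where D=\<beta>']) (simp add: \<beta>_deriv)

text \<open>The Wronskian of U and its translate by h.\<close>
definition wronskian :: "real \<Rightarrow> real \<Rightarrow> real" where
  "wronskian h s = i (U' s) (U (s + h)) - i (U' (s + h)) (U s)"

text \<open>The terms with a cancel by symmetry of the form, and the damping is absorbed by the exponential
  factor.\<close>
lemma wronskian_deriv:
  assumes t: "t \<ge> 0" and h: "h \<ge> 0"
  shows "((\<lambda>s. exp (\<delta> * s) * wronskian h s) has_real_derivative exp (\<delta> * t) * ((\<phi> (t + h) - \<phi> t) * b (U t) (U (t + h)))) (at t within {0..})"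
proof -
  have th: "t + h \<ge> 0" using t h by simp
  note m = U_mem[OF t] U_mem[OF th] and m' = U'_mem[OF t] U'_mem[OF th]
  have "(wronskian h has_real_derivative (accel t (U (t + h)) + i (U' t) (U' (t + h))) - (accel (t + h) (U t) + i (U' (t + h)) (U' t))) (at t within {0..})"
    unfolding wronskian_def by (rule DERIV_diff[OF weak_strong_deriv[OF t h]])
  moreover have "(accel t (U (t + h)) + i (U' t) (U' (t + h))) - (accel (t + h) (U t) + i (U' (t + h)) (U' t))
     = - \<delta> * wronskian h t + (\<phi> (t + h) - \<phi> t) * b (U t) (U (t + h))"
    unfolding accel_def wronskian_def using L.sym[OF m'] H.sym[OF m] B.sym[OF m] by (simp add: algebra_simps)
  ultimately have d: "(wronskian h has_real_derivative - \<delta> * wronskian h t + (\<phi> (t + h) - \<phi> t) * b (U t) (U (t + h))) (at t within {0..})" by simp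
  have e: "((\<lambda>s. exp (\<delta> * s)) has_real_derivative \<delta> * exp (\<delta> * t)) (at t within {0..})"
    by (auto intro!: derivative_eq_intros)
  show ?thesis
    by (rule DERIV_cong[OF DERIV_mult[OF e d]]) (simp add: algebra_simps)
qed

text \<open>|U'|^2 - \<langle>U'', U\<rangle>, the limit of the Wronskian divided by h.\<close>
definition wronskian_rate :: "real \<Rightarrow> real" where "wronskian_rate t = i (U' t) (U' t) - accel t (U t)"

text \<open>Steps 1/(n + 1) turn difference quotients into sequences, for which dominated convergence is
  available.\<close>
lemma right_seq: "filterlim (\<lambda>n. t + 1 / real (Suc n)) (at t within {0..}) sequentially" if "t \<ge> 0" for t :: real
  unfolding filterlim_at
proof
  show "\<forall>\<^sub>F n in sequentially. t + 1 / real (Suc n) \<in> {0..} \<and> t + 1 / real (Suc n) \<noteq> t"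
    using that by (intro always_eventually) simp
  have "(\<lambda>n. t + inverse (real (Suc n))) \<longlonglongrightarrow> t + 0" by (intro tendsto_intros LIMSEQ_inverse_real_of_nat)
  then show "(\<lambda>n. t + 1 / real (Suc n)) \<longlonglongrightarrow> t" by (simp add: inverse_eq_divide)
qed

lemma wronskian_limit:
  assumes t: "t \<ge> 0" shows "(\<lambda>n. wronskian (1 / real (Suc n)) t / (1 / real (Suc n))) \<longlonglongrightarrow> wronskian_rate t"
proof -
  have d1: "((\<lambda>s. (i (U' t) (U s) - i (U' t) (U t)) / (s - t)) \<longlongrightarrow> i (U' t) (U' t)) (at t within {0..})"
    using strong_pair_deriv[OF t U'_mem[OF t] U_Y U'_mem[OF t] U_der[OF t]] by (simp add: has_field_derivative_iff)
  have d2: "((\<lambda>s. (i (U' s) (U t) - i (U' t) (U t)) / (s - t)) \<longlongrightarrow> accel t (U t)) (at t within {0..})"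
  proof (rule LIM_zero_cancel, rule tendstoI)
    fix e :: real assume e: "0 < e"
    define N where "N = H.nrm (U t) + 1"
    have N: "0 < N" using H.nrm_nonneg[OF U_mem[OF t]] by (simp add: N_def)
    have "0 < e / N" using e N by simp
    from U'_der'[OF t this]
    show "\<forall>\<^sub>F s in at t within {0..}. dist ((i (U' s) (U t) - i (U' t) (U t)) / (s - t) - accel t (U t)) 0 < e"
    proof eventually_elim
      case (elim s)
      have "\<bar>(i (U' s) (U t) - i (U' t) (U t)) / (s - t) - accel t (U t)\<bar> \<le> e / N * H.nrm (U t)" using elim U_mem[OF t] by blast
      also have "\<dots> < e / N * N" using e N by (intro mult_strict_left_mono) (auto simp: N_def)
      also have "\<dots> = e" using N by simp
      finally show ?case by simp
    qed
  qed
  have "((\<lambda>s. (i (U' t) (U s) - i (U' t) (U t)) / (s - t) - (i (U' s) (U t) - i (U' t) (U t)) / (s - t)) \<longlongrightarrow> wronskian_rate t) (at t within {0..})"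
    unfolding wronskian_rate_def by (intro tendsto_diff d1 d2)
  then have "((\<lambda>s. (i (U' t) (U s) - i (U' s) (U t)) / (s - t)) \<longlongrightarrow> wronskian_rate t) (at t within {0..})"
    by (simp flip: diff_divide_distrib)
  from filterlim_compose[OF this right_seq[OF t]] show ?thesis
    by (simp add: wronskian_def)
qed

lemma \<phi>_diff_bound:
  assumes "0 \<le> s" "0 < h" and K: "\<And>r. s \<le> r \<Longrightarrow> r \<le> s + h \<Longrightarrow> \<bar>\<beta>' r\<bar> \<le> K"
  shows "\<bar>\<phi> (s + h) - \<phi> s\<bar> \<le> S * K * h"
proof -
  have sh: "s < s + h" using assms by simp
  have c: "continuous_on {s..s + h} \<beta>" by (rule continuous_on_subset[OF \<beta>_cont]) (use assms in auto)
  have d: "(\<beta> has_real_derivative \<beta>' r) (at r)" if "s < r" "r < s + h" for r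
  proof -
    have "(\<beta> has_real_derivative \<beta>' r) (at r within {0..})" using that assms by (intro \<beta>_deriv) auto
    then show ?thesis using at_within_interior[of r "{0..}"] that assms by simp
  qed
  obtain l z where z: "s < z" "z < s + h" "(\<beta> has_real_derivative l) (at z)" "\<beta> (s + h) - \<beta> s = (s + h - s) * l"
    using MVT[OF sh c] d real_differentiable_def by blast
  have "l = \<beta>' z" using d[OF z(1,2)] z(3) DERIV_unique by blast
  then have "\<bar>\<beta> (s + h) - \<beta> s\<bar> \<le> h * K" using z K[of z] assms by (simp add: abs_mult)
  then have "S * \<bar>\<beta> (s + h) - \<beta> s\<bar> \<le> S * (h * K)" using S by (intro mult_left_mono) auto
  moreover have "\<bar>\<phi> (s + h) - \<phi> s\<bar> = S * \<bar>\<beta> (s + h) - \<beta> s\<bar>"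
    using S by (simp add: \<phi>_def abs_mult flip: right_diff_distrib)
  ultimately show ?thesis by (simp add: mult.assoc mult.commute mult.left_commute)
qed

text \<open>Integrate the derivative of the Wronskian from 0 to T, divide by h and let h tend to 0. The
  integrands are bounded since \<beta> has a continuous derivative.\<close>
theorem wronskian_rate_integral:
  assumes T: "0 \<le> T"
  shows "exp (\<delta> * T) * wronskian_rate T - wronskian_rate 0 = integral {0..T} (\<lambda>s. exp (\<delta> * s) * (S * \<beta>' s * \<beta> s))"
proof -
  define h where "h n = 1 / real (Suc n)" for n
  have h: "0 < h n" "h n \<le> 1" for n by (auto simp: h_def)
  define g where "g n s = exp (\<delta> * s) * ((\<phi> (s + h n) - \<phi> s) * b (U s) (U (s + h n))) / h n" for n s
  have gi: "(g n has_integral (exp (\<delta> * T) * wronskian (h n) T - exp (\<delta> * 0) * wronskian (h n) 0) / h n) {0..T}" for n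
  proof -
    have "((\<lambda>s. exp (\<delta> * s) * ((\<phi> (s + h n) - \<phi> s) * b (U s) (U (s + h n)))) has_integral
        (exp (\<delta> * T) * wronskian (h n) T - exp (\<delta> * 0) * wronskian (h n) 0)) {0..T}"
    proof (rule fundamental_theorem_of_calculus[OF T])
      fix s assume "s \<in> {0..T}"
      then have "((\<lambda>s. exp (\<delta> * s) * wronskian (h n) s) has_real_derivative exp (\<delta> * s) * ((\<phi> (s + h n) - \<phi> s) * b (U s) (U (s + h n)))) (at s within {0..})"
        using h[of n] by (intro wronskian_deriv) auto
      then show "((\<lambda>s. exp (\<delta> * s) * wronskian (h n) s) has_vector_derivative exp (\<delta> * s) * ((\<phi> (s + h n) - \<phi> s) * b (U s) (U (s + h n)))) (at s within {0..T})"
        unfolding has_real_derivative_iff_has_vector_derivative by (rule has_vector_derivative_within_subset) auto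
    qed
    from has_integral_divide[OF this, of "h n"] show ?thesis unfolding g_def .
  qed
  obtain K1 where K1: "\<And>s. s \<in> {0..T + 1} \<Longrightarrow> \<bar>\<beta> s\<bar> \<le> K1"
    using compact_imp_bounded[OF compact_continuous_image[OF continuous_on_subset[OF \<beta>_cont, of "{0..T + 1}"]]]
    unfolding bounded_iff by force
  obtain K2 where K2: "\<And>s. s \<in> {0..T + 1} \<Longrightarrow> \<bar>\<beta>' s\<bar> \<le> K2"
    using compact_imp_bounded[OF compact_continuous_image[OF continuous_on_subset[OF \<beta>'_cont, of "{0..T + 1}"]]]
    unfolding bounded_iff by force
  have K: "0 \<le> K1" "0 \<le> K2" using K1[of 0] K2[of 0] T by auto
  have "(\<lambda>n. integral {0..T} (g n)) \<longlonglongrightarrow> integral {0..T} (\<lambda>s. exp (\<delta> * s) * (S * \<beta>' s * \<beta> s))"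
  proof (rule dominated_convergence(2)[where h="\<lambda>s. exp (\<delta> * T) * (S * K2 * K1)"])
    show "g n integrable_on {0..T}" for n using gi by blast
    show "(\<lambda>s. exp (\<delta> * T) * (S * K2 * K1)) integrable_on {0..T}" by (rule integrable_const_ivl)
    fix s assume s: "s \<in> {0..T}"
    show "norm (g n s) \<le> exp (\<delta> * T) * (S * K2 * K1)" for n
    proof -
      note m = U_mem[of s] U_mem[of "s + h n"]
      have "(b (U s) (U (s + h n)))\<^sup>2 \<le> \<beta> s * \<beta> (s + h n)"
        unfolding \<beta>_def using s h[of n] by (intro B.Cauchy_Schwarz_sq U_mem) auto
      also have "\<dots> \<le> K1 * K1"
      proof (intro mult_mono)
        show "\<beta> s \<le> K1" using K1[of s] s by auto
        show "\<beta> (s + h n) \<le> K1" using K1[of "s + h n"] s h[of n] by auto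
        show "0 \<le> \<beta> (s + h n)" unfolding \<beta>_def using s h[of n] by (intro B.nonneg U_mem) auto
      qed (rule K)
      finally have 1: "\<bar>b (U s) (U (s + h n))\<bar> \<le> K1" by (intro power2_le_imp_le[OF _ K(1)]) (simp add: power2_eq_square)
      have "\<bar>\<phi> (s + h n) - \<phi> s\<bar> \<le> S * K2 * h n"
        using s h[of n] by (intro \<phi>_diff_bound K2) auto
      then have 2: "\<bar>\<phi> (s + h n) - \<phi> s\<bar> / h n \<le> S * K2" using h[of n] by (simp add: field_simps)
      have 3: "exp (\<delta> * s) \<le> exp (\<delta> * T)" using s \<delta> by simp
      have "norm (g n s) = exp (\<delta> * s) * ((\<bar>\<phi> (s + h n) - \<phi> s\<bar> / h n) * \<bar>b (U s) (U (s + h n))\<bar>)"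
        using h[of n] by (simp add: g_def abs_mult)
      also have "\<dots> \<le> exp (\<delta> * T) * (S * K2 * K1)"
        using 1 2 3 h[of n] S K by (intro mult_mono mult_nonneg_nonneg) auto
      finally show ?thesis .
    qed
    show "(\<lambda>n. g n s) \<longlonglongrightarrow> exp (\<delta> * s) * (S * \<beta>' s * \<beta> s)"
    proof -
      have s0: "s \<ge> 0" using s by simp
      have "((\<lambda>r. (\<beta> r - \<beta> s) / (r - s)) \<longlongrightarrow> \<beta>' s) (at s within {0..})"
        using \<beta>_deriv[OF s0] by (simp add: has_field_derivative_iff)
      from filterlim_compose[OF this right_seq[OF s0]]
      have 1: "(\<lambda>n. (\<beta> (s + h n) - \<beta> s) / h n) \<longlonglongrightarrow> \<beta>' s" by (simp add: h_def)
      have "((\<lambda>r. - i (D (U s)) (U r)) \<longlongrightarrow> - i (D (U s)) (U s)) (at s within {0..})"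
        using DERIV_continuous[OF strong_pair_deriv[OF s0 D_mem[OF U_mem[OF s0]] U_Y U'_mem[OF s0] U_der[OF s0]]]
        by (intro tendsto_minus) (simp add: continuous_within)
      from filterlim_compose[OF this right_seq[OF s0]]
      have "(\<lambda>n. - i (D (U s)) (U (s + h n))) \<longlonglongrightarrow> - i (D (U s)) (U s)" by (simp add: h_def)
      then have 2: "(\<lambda>n. b (U s) (U (s + h n))) \<longlonglongrightarrow> \<beta> s"
        using b_D[OF U_mem[OF s0]] U_mem h s0 by (simp add: \<beta>_def less_imp_le)
      have "(\<lambda>n. exp (\<delta> * s) * (S * ((\<beta> (s + h n) - \<beta> s) / h n) * b (U s) (U (s + h n)))) \<longlonglongrightarrow> exp (\<delta> * s) * (S * \<beta>' s * \<beta> s)"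
        by (intro tendsto_intros 1 2)
      moreover have "exp (\<delta> * s) * (S * ((\<beta> (s + h n) - \<beta> s) / h n) * b (U s) (U (s + h n))) = g n s" for n
        by (simp add: g_def \<phi>_def right_diff_distrib)
      ultimately show ?thesis by simp
    qed
  qed
  then have "(\<lambda>n. exp (\<delta> * T) * (wronskian (h n) T / h n) - wronskian (h n) 0 / h n) \<longlonglongrightarrow> integral {0..T} (\<lambda>s. exp (\<delta> * s) * (S * \<beta>' s * \<beta> s))"
    unfolding integral_unique[OF gi] by (simp add: diff_divide_distrib)
  moreover have "(\<lambda>n. exp (\<delta> * T) * (wronskian (h n) T / h n) - wronskian (h n) 0 / h n) \<longlonglongrightarrow> exp (\<delta> * T) * wronskian_rate T - wronskian_rate 0"
    unfolding h_def by (intro tendsto_intros wronskian_limit T order_refl)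
  ultimately show ?thesis by (rule LIMSEQ_unique[symmetric])
qed

lemma wronskian_rate_deriv:
  assumes t: "0 < t" shows "(wronskian_rate has_real_derivative - \<delta> * wronskian_rate t + S * \<beta>' t * \<beta> t) (at t)"
proof -
  define J where "J s = exp (\<delta> * s) * (S * \<beta>' s * \<beta> s)" for s
  have Jc: "continuous_on {0..t + 1} J" unfolding J_def
    by (intro continuous_intros continuous_on_subset[OF \<beta>_cont] continuous_on_subset[OF \<beta>'_cont]) auto
  have "((\<lambda>u. integral {0..u} J) has_real_derivative J t) (at t within {0..t + 1})"
    using t by (intro integral_has_real_derivative Jc) auto
  then have d: "((\<lambda>u. integral {0..u} J) has_real_derivative J t) (at t)"
    using at_within_interior[of t "{0..t + 1}"] t by simp
  have e: "((\<lambda>u. exp (- \<delta> * u)) has_real_derivative - \<delta> * exp (- \<delta> * t)) (at t)" by (auto intro!: derivative_eq_intros)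
  have "((\<lambda>u. exp (- \<delta> * u) * (wronskian_rate 0 + integral {0..u} J)) has_real_derivative
      - \<delta> * exp (- \<delta> * t) * (wronskian_rate 0 + integral {0..t} J) + (0 + J t) * exp (- \<delta> * t)) (at t)"
    by (rule DERIV_mult[OF e DERIV_add[OF DERIV_const d]])
  moreover have eq: "exp (- \<delta> * u) * (wronskian_rate 0 + integral {0..u} J) = wronskian_rate u" if "u \<ge> 0" for u
  proof -
    have "wronskian_rate 0 + integral {0..u} J = exp (\<delta> * u) * wronskian_rate u" using wronskian_rate_integral[OF that] unfolding J_def by simp
    then show ?thesis by (simp add: exp_minus)
  qed
  moreover have "- \<delta> * exp (- \<delta> * t) * (wronskian_rate 0 + integral {0..t} J) + (0 + J t) * exp (- \<delta> * t) = - \<delta> * wronskian_rate t + S * \<beta>' t * \<beta> t"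
  proof -
    have "- \<delta> * exp (- \<delta> * t) * (wronskian_rate 0 + integral {0..t} J) = - \<delta> * wronskian_rate t" using eq[of t] t by (simp add: mult.assoc)
    moreover have "(0 + J t) * exp (- \<delta> * t) = S * \<beta>' t * \<beta> t" by (simp add: J_def exp_minus)
    ultimately show ?thesis by simp
  qed
  ultimately have "((\<lambda>u. exp (- \<delta> * u) * (wronskian_rate 0 + integral {0..u} J)) has_real_derivative - \<delta> * wronskian_rate t + S * \<beta>' t * \<beta> t) (at t)" by simp
  then show ?thesis
    by (rule has_field_derivative_transform_within_open[of _ _ _ "{0<..}"]) (use t eq in auto)
qed

lemma at_pos: "0 < (t::real) \<Longrightarrow> at t within {0..} = at t"
  by (rule at_within_interior) simp

text \<open>Twice the physical energy.\<close>
definition twice_energy :: "real \<Rightarrow> real" where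
  "twice_energy t = i (U' t) (U' t) + a (U t) (U t) - P * \<beta> t + S / 2 * (\<beta> t)\<^sup>2"

lemma twice_energy_wronskian_rate: "twice_energy t = wronskian_rate t - \<delta> * i (U' t) (U t) - S / 2 * (\<beta> t)\<^sup>2"
  by (simp add: twice_energy_def wronskian_rate_def accel_def \<phi>_def \<beta>_def power2_eq_square algebra_simps)

text \<open>Twice the energy differs from the quantity \<open>wronskian_rate\<close> by \<delta> (U', U) and a multiple of
  the square of \<beta>; both are differentiable, and the terms with the derivative of \<beta>
  cancel.\<close>
theorem energy_identity:
  assumes t: "0 < t" shows "(twice_energy has_real_derivative - 2 * \<delta> * i (U' t) (U' t)) (at t)"
proof -
  have X: "((\<lambda>s. i (U' s) (U s)) has_real_derivative accel t (U t) + i (U' t) (U' t)) (at t)"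
    using cross_term_deriv[of t] t by (simp add: at_pos)
  have b: "(\<beta> has_real_derivative \<beta>' t) (at t)" using \<beta>_deriv[of t] t by (simp add: at_pos)
  have "((\<lambda>s. wronskian_rate s - \<delta> * i (U' s) (U s) - S / 2 * (\<beta> s)\<^sup>2) has_real_derivative
     (- \<delta> * wronskian_rate t + S * \<beta>' t * \<beta> t) - \<delta> * (accel t (U t) + i (U' t) (U' t)) - S / 2 * (2 * \<beta> t * \<beta>' t)) (at t)"
    by (auto intro!: derivative_eq_intros wronskian_rate_deriv[OF t] X b simp: algebra_simps)
  then show ?thesis unfolding twice_energy_wronskian_rate[abs_def]
    by (rule DERIV_cong) (simp add: wronskian_rate_def algebra_simps)
qed

lemma a_cont: "continuous_on {0..} (\<lambda>t. a (U t) (U t))"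
  unfolding continuous_on_def
proof
  fix t :: real assume "t \<in> {0..}"
  then have t: "t \<ge> 0" by simp
  have ev: "\<forall>\<^sub>F s in at t within {0..}. U s \<in> X" using ev_nonneg by eventually_elim (rule U_mem)
  show "((\<lambda>s. a (U s) (U s)) \<longlongrightarrow> a (U t) (U t)) (at t within {0..})"
    by (rule H.tendsto_ip[OF ev U_mem[OF t] U_cont[OF t] ev U_mem[OF t] U_cont[OF t]])
qed

lemma U'_sq_cont: "continuous_on {0..} (\<lambda>t. i (U' t) (U' t))"
  unfolding continuous_on_def
proof
  fix t :: real assume "t \<in> {0..}"
  then have t: "t \<ge> 0" by simp
  have ev: "\<forall>\<^sub>F s in at t within {0..}. U' s \<in> Y" using ev_nonneg by eventually_elim (rule U'_mem)
  show "((\<lambda>s. i (U' s) (U' s)) \<longlongrightarrow> i (U' t) (U' t)) (at t within {0..})"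
    by (rule L.tendsto_ip[OF ev U'_mem[OF t] U'_cont[OF t] ev U'_mem[OF t] U'_cont[OF t]])
qed

lemma twice_energy_cont: "continuous_on {0..} twice_energy"
  unfolding twice_energy_def by (intro continuous_intros a_cont U'_sq_cont \<beta>_cont)

text \<open>The hypothesis makes all contributions to the energy nonnegative. The rate is E(t) = O(1/t),
  obtained from the monotone function Z + t E.\<close>
theorem decay:
  assumes gap: "\<And>t. t \<ge> 0 \<Longrightarrow> P * \<beta> t \<le> a (U t) (U t)"
  shows "((\<lambda>t. H.nrm (U t)) \<longlongrightarrow> 0) at_top" "((\<lambda>t. L.nrm (U' t)) \<longlongrightarrow> 0) at_top"
proof -
  have E: "i (U' t) (U' t) \<le> twice_energy t" "a (U t) (U t) - P * \<beta> t \<le> twice_energy t" "S / 2 * (\<beta> t)\<^sup>2 \<le> twice_energy t" if t: "t \<ge> 0" for t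
  proof -
    have "0 \<le> S / 2 * (\<beta> t)\<^sup>2" using S by simp
    moreover have "0 \<le> i (U' t) (U' t)" by (rule L.nonneg[OF U'_mem[OF t]])
    ultimately show "i (U' t) (U' t) \<le> twice_energy t" "a (U t) (U t) - P * \<beta> t \<le> twice_energy t" "S / 2 * (\<beta> t)\<^sup>2 \<le> twice_energy t"
      using gap[OF t] by (auto simp: twice_energy_def)
  qed
  \<comment> \<open>Nonnegativity follows from |U' + \<delta> U|^2 \<ge> 0, using that |U'|^2 \<le> E.\<close>
  define Z where "Z t = i (U' t) (U t) + \<delta> / 2 * i (U t) (U t) + 1 / \<delta> * twice_energy t" for t
  have Z0: "0 \<le> Z t" if t: "t \<ge> 0" for t
  proof -
    have "0 \<le> i (\<lambda>p. U' t p + \<delta> * U t p) (\<lambda>p. U' t p + \<delta> * U t p)"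
      by (intro L.nonneg L.add_mem L.scale_mem U_Y U'_mem t)
    also have "\<dots> = i (U' t) (U' t) + 2 * \<delta> * i (U' t) (U t) + \<delta>\<^sup>2 * i (U t) (U t)"
      by (rule L.ip_add_square[OF U'_mem[OF t] U_Y[OF t]])
    also have "\<dots> \<le> 2 * twice_energy t + 2 * \<delta> * i (U' t) (U t) + \<delta>\<^sup>2 * i (U t) (U t)"
      using E(1)[OF t] L.nonneg[OF U'_mem[OF t]] by simp
    also have "\<dots> = 2 * \<delta> * Z t" using \<delta> by (simp add: Z_def field_simps power2_eq_square)
    finally show ?thesis using \<delta> by (simp add: zero_le_mult_iff)
  qed
  define Q where "Q t = Z t + t * twice_energy t" for t
  have Qd: "(Q has_real_derivative (accel t (U t) + i (U' t) (U' t)) + \<delta> / 2 * (2 * i (U' t) (U t)) + 1 / \<delta> * (- 2 * \<delta> * i (U' t) (U' t))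
      + (twice_energy t + t * (- 2 * \<delta> * i (U' t) (U' t)))) (at t)" if t: "0 < t" for t
  proof -
    have X: "((\<lambda>s. i (U' s) (U s)) has_real_derivative accel t (U t) + i (U' t) (U' t)) (at t)"
      using cross_term_deriv[of t] t by (simp add: at_pos)
    have u: "((\<lambda>s. i (U s) (U s)) has_real_derivative 2 * i (U' t) (U t)) (at t)"
      using norm_sq_deriv[of t] t by (simp add: at_pos)
    show ?thesis unfolding Q_def Z_def
      by (auto intro!: derivative_eq_intros X u energy_identity[OF t])
  qed
  have Qneg: "(accel t (U t) + i (U' t) (U' t)) + \<delta> / 2 * (2 * i (U' t) (U t)) + 1 / \<delta> * (- 2 * \<delta> * i (U' t) (U' t))
      + (twice_energy t + t * (- 2 * \<delta> * i (U' t) (U' t))) \<le> 0" if t: "0 < t" for t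
  proof -
    have "accel t (U t) = - \<delta> * i (U' t) (U t) - a (U t) (U t) + P * \<beta> t - S * (\<beta> t)\<^sup>2"
      by (simp add: accel_def \<phi>_def \<beta>_def power2_eq_square algebra_simps)
    moreover have "1 / \<delta> * (- 2 * \<delta> * i (U' t) (U' t)) = - 2 * i (U' t) (U' t)" using \<delta> by simp
    moreover have "0 \<le> t * (2 * \<delta> * i (U' t) (U' t))" using \<delta> t L.nonneg[OF U'_mem[of t]] by simp
    moreover have "0 \<le> S / 2 * (\<beta> t)\<^sup>2" using S by simp
    ultimately show ?thesis by (simp add: twice_energy_def algebra_simps)
  qed
  have cX: "continuous_on {0..} (\<lambda>s. i (U' s) (U s))"
    by (rule DERIV_continuous_on) (rule cross_term_deriv, simp)
  have cU: "continuous_on {0..} (\<lambda>s. i (U s) (U s))"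
    by (rule DERIV_continuous_on) (rule norm_sq_deriv, simp)
  have Qc: "continuous_on {0..} Q" unfolding Q_def Z_def by (intro continuous_intros cX cU twice_energy_cont)
  have Q: "Q t \<le> Q 0" if t: "0 < t" for t
  proof (rule DERIV_nonpos_imp_decreasing_open[of 0 t Q])
    show "\<exists>y. (Q has_real_derivative y) (at s) \<and> y \<le> 0" if "0 < s" "s < t" for s
      using Qd[OF that(1)] Qneg[OF that(1)] by blast
    show "continuous_on {0..t} Q" by (rule continuous_on_subset[OF Qc]) auto
  qed (use t in auto)
  have Eb: "twice_energy t \<le> Z 0 / t" if t: "0 < t" for t
  proof -
    have "t * twice_energy t \<le> Q t" using Z0[of t] t by (simp add: Q_def)
    also have "\<dots> \<le> Z 0" using Q[OF t] by (simp add: Q_def)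
    finally show ?thesis using t by (simp add: field_simps)
  qed
  have evp: "\<forall>\<^sub>F t in at_top. (0::real) < t" by (rule eventually_gt_at_top)
  have lim: "((\<lambda>t. Z 0 / t) \<longlongrightarrow> 0) at_top"
    by (rule tendsto_divide_0[OF tendsto_const]) (rule filterlim_at_top_imp_at_infinity[OF filterlim_ident])
  have E0: "0 \<le> twice_energy t" if "t \<ge> 0" for t using E(1)[OF that] L.nonneg[OF U'_mem[OF that]] by linarith
  have Elim: "(twice_energy \<longlongrightarrow> 0) at_top"
  proof (rule tendsto_sandwich[OF _ _ tendsto_const lim])
    show "\<forall>\<^sub>F t in at_top. 0 \<le> twice_energy t" using evp by eventually_elim (simp add: E0)
    show "\<forall>\<^sub>F t in at_top. twice_energy t \<le> Z 0 / t" using evp by eventually_elim (rule Eb)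
  qed
  have "((\<lambda>t. i (U' t) (U' t)) \<longlongrightarrow> 0) at_top"
  proof (rule tendsto_sandwich[OF _ _ tendsto_const Elim])
    show "\<forall>\<^sub>F t in at_top. 0 \<le> i (U' t) (U' t)" using evp by eventually_elim (simp add: L.nonneg U'_mem)
    show "\<forall>\<^sub>F t in at_top. i (U' t) (U' t) \<le> twice_energy t" using evp by eventually_elim (simp add: E)
  qed
  from tendsto_real_sqrt[OF this] show "((\<lambda>t. L.nrm (U' t)) \<longlongrightarrow> 0) at_top" unfolding L.nrm_def by simp
  have b0: "0 \<le> \<beta> t" if "t \<ge> 0" for t unfolding \<beta>_def by (rule B.nonneg[OF U_mem[OF that]])
  have "((\<lambda>t. twice_energy t + \<bar>P\<bar> * sqrt (2 / S * twice_energy t)) \<longlongrightarrow> 0 + \<bar>P\<bar> * sqrt (2 / S * 0)) at_top"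
    by (intro tendsto_intros Elim)
  then have alim0: "((\<lambda>t. twice_energy t + \<bar>P\<bar> * sqrt (2 / S * twice_energy t)) \<longlongrightarrow> 0) at_top" by simp
  have "((\<lambda>t. a (U t) (U t)) \<longlongrightarrow> 0) at_top"
  proof (rule tendsto_sandwich[OF _ _ tendsto_const alim0])
    show "\<forall>\<^sub>F t in at_top. 0 \<le> a (U t) (U t)" using evp by eventually_elim (simp add: H.nonneg U_mem)
    show "\<forall>\<^sub>F t in at_top. a (U t) (U t) \<le> twice_energy t + \<bar>P\<bar> * sqrt (2 / S * twice_energy t)" using evp
    proof eventually_elim
      case (elim t)
      then have t: "t \<ge> 0" by simp
      have "(\<beta> t)\<^sup>2 \<le> 2 / S * twice_energy t" using E(3)[OF t] S by (simp add: field_simps)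
      then have "\<beta> t \<le> sqrt (2 / S * twice_energy t)" by (rule real_le_rsqrt)
      then have "\<bar>P\<bar> * \<beta> t \<le> \<bar>P\<bar> * sqrt (2 / S * twice_energy t)" by (rule mult_left_mono) simp
      moreover have "P * \<beta> t \<le> \<bar>P\<bar> * \<beta> t" using b0[OF t] by (intro mult_right_mono) auto
      ultimately show ?case using E(2)[OF t] by linarith
    qed
  qed
  from tendsto_real_sqrt[OF this] show "((\<lambda>t. H.nrm (U t)) \<longlongrightarrow> 0) at_top" unfolding H.nrm_def by simp
qed

text \<open>The functions f = (U, w) and k = (U', w) solve f' = k, k' = -\<delta> k - (lam + \<phi>) f, a linear
  system with continuous coefficients and zero initial values. Gronwall's argument for f^2 + k^2
  shows that they vanish.\<close>
theorem invariant_orthogonality: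
  assumes w: "w \<in> X" and aw: "\<And>u. u \<in> X \<Longrightarrow> a u w = lam * b u w" and bw: "\<And>u. u \<in> X \<Longrightarrow> b u w = i u w"
    and z: "i (U 0) w = 0" "i (U' 0) w = 0" and t: "t \<ge> 0"
  shows "i (U t) w = 0"
proof -
  have wY: "w \<in> Y" using w XY by blast
  define f where "f t = i (U t) w" for t
  define k where "k t = i (U' t) w" for t
  have fd: "(f has_real_derivative k t) (at t within {0..})" if t: "t \<ge> 0" for t
  proof -
    have "((\<lambda>s. i w (U s)) has_real_derivative i w (U' t)) (at t within {0..})"
      by (rule strong_pair_deriv[OF t wY U_Y U'_mem[OF t] U_der[OF t]])
    then have "((\<lambda>s. i w (U s)) has_real_derivative k t) (at t within {0..})"
      using L.sym[OF U'_mem[OF t] wY] by (simp add: k_def)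
    then show ?thesis
      by (rule has_field_derivative_transform_within[where d=1])
         (use t L.sym[OF U_Y wY] in \<open>auto simp: f_def\<close>)
  qed
  have kd: "(k has_real_derivative - \<delta> * k t - (lam + \<phi> t) * f t) (at t within {0..})" if t: "t \<ge> 0" for t
  proof -
    obtain K where K: "\<And>v. v \<in> X \<Longrightarrow> \<bar>accel t v\<bar> \<le> K * H.nrm v" using accel_bound[OF t] by blast
    have z: "L.nrm (\<lambda>p. 0) = 0" "H.nrm (\<lambda>p. 0) = 0" by (simp_all add: L.nrm_def H.nrm_def L.zero_left H.zero_left L.zero_mem H.zero_mem)
    have "((\<lambda>s. i (U' s) w) has_real_derivative accel t w + i (U' t) (\<lambda>p. 0)) (at t within {0..})"
      by (rule pair_deriv[OF t U'_mem U'_der'[OF t] accel_diff[OF t] K w _ L.zero_mem]) (simp_all add: z)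
    moreover have "i (U' t) (\<lambda>p. 0) = 0" using L.sym[OF U'_mem[OF t] L.zero_mem] L.zero_left[OF U'_mem[OF t]] by simp
    moreover have "accel t w = - \<delta> * k t - (lam + \<phi> t) * f t"
      unfolding accel_def using aw[OF U_mem[OF t]] bw[OF U_mem[OF t]] by (simp add: k_def f_def algebra_simps)
    ultimately show ?thesis unfolding k_def[abs_def] by simp
  qed
  have fc: "continuous_on {0..} f" by (rule DERIV_continuous_on) (rule fd, simp)
  have kc: "continuous_on {0..} k" by (rule DERIV_continuous_on) (rule kd, simp)
  show ?thesis
  proof (cases "t = 0")
    case True then show ?thesis using z by simp
  next
    case False
    then have t: "0 < t" using t by simp
    have c: "continuous_on {0..t} (\<lambda>s. 1 + \<bar>lam + \<phi> s\<bar>)"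
      unfolding \<phi>_def by (intro continuous_intros continuous_on_subset[OF \<beta>_cont]) auto
    obtain K where K: "\<And>s. s \<in> {0..t} \<Longrightarrow> 1 + \<bar>lam + \<phi> s\<bar> \<le> K"
      using compact_imp_bounded[OF compact_continuous_image[OF c compact_Icc]] unfolding bounded_iff by force
    \<comment> \<open>The constant K bounds the coefficients of the linear system on [0, t].\<close>
    define q where "q s = exp (- K * s) * ((f s)\<^sup>2 + (k s)\<^sup>2)" for s
    have "q t \<le> q 0"
    proof (rule DERIV_nonpos_imp_decreasing_open[of 0 t q])
      show "continuous_on {0..t} q" unfolding q_def
        by (intro continuous_intros continuous_on_subset[OF fc] continuous_on_subset[OF kc]) auto
      fix s assume s: "0 < s" "s < t"
      have f1: "(f has_real_derivative k s) (at s)" using fd[of s] s by (simp add: at_pos)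
      have k1: "(k has_real_derivative - \<delta> * k s - (lam + \<phi> s) * f s) (at s)" using kd[of s] s by (simp add: at_pos)
      have d: "(q has_real_derivative exp (- K * s) * (2 * f s * k s + 2 * k s * (- \<delta> * k s - (lam + \<phi> s) * f s) - K * ((f s)\<^sup>2 + (k s)\<^sup>2))) (at s)"
        unfolding q_def by (auto intro!: derivative_eq_intros f1 k1 simp: algebra_simps)
      have "2 * f s * k s + 2 * k s * (- \<delta> * k s - (lam + \<phi> s) * f s) = (1 - (lam + \<phi> s)) * (2 * (f s * k s)) - 2 * \<delta> * (k s)\<^sup>2"
        by (simp add: algebra_simps power2_eq_square)
      also have "\<dots> \<le> (1 - (lam + \<phi> s)) * (2 * (f s * k s))" using \<delta> by simp
      also have "\<dots> \<le> \<bar>(1 - (lam + \<phi> s)) * (2 * (f s * k s))\<bar>" by simp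
      also have "\<dots> = \<bar>1 - (lam + \<phi> s)\<bar> * (2 * \<bar>f s * k s\<bar>)" by (simp only: abs_mult abs_numeral)
      also have "\<dots> \<le> K * ((f s)\<^sup>2 + (k s)\<^sup>2)"
      proof (intro mult_mono)
        show "\<bar>1 - (lam + \<phi> s)\<bar> \<le> K" using K[of s] s by auto
        have "0 \<le> (\<bar>f s\<bar> - \<bar>k s\<bar>)\<^sup>2" by simp
        then show "2 * \<bar>f s * k s\<bar> \<le> (f s)\<^sup>2 + (k s)\<^sup>2" by (simp add: power2_diff abs_mult)
        show "0 \<le> K" using K[of s] s by auto
      qed simp
      finally have "exp (- K * s) * (2 * f s * k s + 2 * k s * (- \<delta> * k s - (lam + \<phi> s) * f s) - K * ((f s)\<^sup>2 + (k s)\<^sup>2)) \<le> 0"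
        by (simp add: mult_le_0_iff)
      with d show "\<exists>y. (q has_real_derivative y) (at s) \<and> y \<le> 0" by blast
    qed (use t in auto)
    moreover have "q 0 = 0" using z by (simp add: q_def f_def k_def)
    ultimately have "(f t)\<^sup>2 + (k t)\<^sup>2 \<le> 0" by (simp add: q_def mult_le_0_iff)
    then have "f t = 0" by (metis sum_power2_le_zero_iff)
    then show ?thesis by (simp add: f_def)
  qed
qed

end

section \<open>Weak solutions of the plate problem\<close>

text \<open>Homogeneity reduces the estimate to the unit ball. If v has norm zero, boundedness of f gives f(v) =
  0.\<close>
lemma dual_le_dual_norm:
  assumes l: "0 < l" and s: "0 < \<sigma>" "\<sigma> < 1/2" and f: "f \<in> dual l \<sigma>" and v: "v \<in> H2star l"
  shows "\<bar>f v\<bar> \<le> dual_norm l \<sigma> f * norm2 l \<sigma> v"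
proof -
  interpret a: semi_inner "H2star l" "inner2 l \<sigma>" by (rule semi_inner_H2star[OF l s])
  have nrm: "norm2 l \<sigma> = a.nrm" by (rule ext) (simp add: norm2_def a.nrm_def)
  obtain C where C: "\<And>u. u \<in> H2star l \<Longrightarrow> \<bar>f u\<bar> \<le> C * a.nrm u" using f unfolding dual_def nrm by blast
  have sc: "f (\<lambda>p. c * v p) = c * f v" for c using f v by (auto simp: dual_def)
  show ?thesis
  proof (cases "a.nrm v = 0")
    case True
    then show ?thesis using C[OF v] by (simp add: nrm)
  next
    case False
    then have n: "0 < a.nrm v" using a.nrm_nonneg[OF v] by simp
    have "\<bar>f (\<lambda>p. (1 / a.nrm v) * v p)\<bar> \<le> dual_norm l \<sigma> f"
      unfolding dual_norm_def
    proof (rule cSUP_upper)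
      show "(\<lambda>p. (1 / a.nrm v) * v p) \<in> {u \<in> H2star l. norm2 l \<sigma> u \<le> 1}"
        using a.scale_mem[OF v, of "1 / a.nrm v"] a.nrm_scale[OF v, of "1 / a.nrm v"] n by (simp add: nrm)
      show "bdd_above ((\<lambda>u. \<bar>f u\<bar>) ` {u \<in> H2star l. norm2 l \<sigma> u \<le> 1})"
      proof (rule bdd_aboveI2)
        fix u assume "u \<in> {u \<in> H2star l. norm2 l \<sigma> u \<le> 1}"
        then have u: "u \<in> H2star l" "a.nrm u \<le> 1" by (auto simp: nrm)
        have "\<bar>f u\<bar> \<le> C * a.nrm u" by (rule C[OF u(1)])
        also have "\<dots> \<le> \<bar>C\<bar> * a.nrm u" using a.nrm_nonneg[OF u(1)] by (intro mult_right_mono) auto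
        also have "\<dots> \<le> \<bar>C\<bar> * 1" using u(2) by (intro mult_left_mono) auto
        finally show "\<bar>f u\<bar> \<le> \<bar>C\<bar>" by simp
      qed
    qed
    also have "\<bar>f (\<lambda>p. (1 / a.nrm v) * v p)\<bar> = \<bar>f v\<bar> / a.nrm v" unfolding sc using n by (simp add: abs_mult)
    finally show ?thesis using n by (simp add: nrm field_simps)
  qed
qed

text \<open>The supremum in the dual norm is meaningful only for bounded functionals; this holds for the
  difference quotients since the L2 norm is bounded by the norm of the energy space.\<close>
lemma dual_diff_quotient:
  assumes l: "0 < l" and s: "0 < \<sigma>" "\<sigma> < 1/2" and x: "x \<in> L2 (plate l)" and y: "y \<in> L2 (plate l)" and g: "g \<in> dual l \<sigma>"
  shows "(\<lambda>v. (inner0 (plate l) x v - inner0 (plate l) y v) / c - g v) \<in> dual l \<sigma>"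
proof -
  obtain K where K: "\<And>u. u \<in> H2star l \<Longrightarrow> \<bar>g u\<bar> \<le> K * norm2 l \<sigma> u" using g unfolding dual_def by blast
  define d where "d = (\<lambda>p. (x p - y p) / c)"
  have d: "d \<in> L2 (plate l)" unfolding d_def by (intro l2.divide_mem l2.diff_mem x y)
  have e: "(inner0 (plate l) x v - inner0 (plate l) y v) / c = inner0 (plate l) d v" if "v \<in> H2star l" for v
    using that x y by (simp add: d_def l2.divide_left l2.diff_left l2.diff_mem H2star_L2)
  have b: "\<bar>inner0 (plate l) d v - g v\<bar> \<le> (norm0 (plate l) d * (2 * pi\<^sup>2) + K) * norm2 l \<sigma> v" if v: "v \<in> H2star l" for v
  proof -
    have "\<bar>inner0 (plate l) d v\<bar> \<le> norm0 (plate l) d * norm0 (plate l) v"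
      unfolding norm0_l2 by (rule l2.Cauchy_Schwarz[OF d H2star_L2[OF v]])
    also have "\<dots> \<le> norm0 (plate l) d * (2 * pi\<^sup>2 * norm2 l \<sigma> v)"
      using l2.nrm_nonneg[OF d] by (intro mult_left_mono norm0_le_norm2 l v s) (simp add: norm0_l2)
    finally show ?thesis using K[OF v] by (simp add: algebra_simps)
  qed
  interpret a: semi_inner "H2star l" "inner2 l \<sigma>" by (rule semi_inner_H2star[OF l s])
  show ?thesis
    unfolding dual_def mem_Collect_eq
  proof (intro conjI ballI allI exI[of _ "norm0 (plate l) d * (2 * pi\<^sup>2) + K"])
    fix u v assume u: "u \<in> H2star l" and v: "v \<in> H2star l"
    have "g (\<lambda>p. u p + v p) = g u + g v" using g u v by (auto simp: dual_def)
    then show "(inner0 (plate l) x (\<lambda>p. u p + v p) - inner0 (plate l) y (\<lambda>p. u p + v p)) / c - g (\<lambda>p. u p + v p) =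
       (inner0 (plate l) x u - inner0 (plate l) y u) / c - g u + ((inner0 (plate l) x v - inner0 (plate l) y v) / c - g v)"
      using u v by (simp add: e a.add_mem l2.add_right[OF H2star_L2 H2star_L2 d])
  next
    fix k :: real and u assume u: "u \<in> H2star l"
    have "g (\<lambda>p. k * u p) = k * g u" using g u by (auto simp: dual_def)
    then show "(inner0 (plate l) x (\<lambda>p. k * u p) - inner0 (plate l) y (\<lambda>p. k * u p)) / c - g (\<lambda>p. k * u p) =
       k * ((inner0 (plate l) x u - inner0 (plate l) y u) / c - g u)"
      using u by (simp add: e a.scale_mem l2.scale_right[OF H2star_L2 d] right_diff_distrib)
  next
    fix u assume u: "u \<in> H2star l"
    show "\<bar>(inner0 (plate l) x u - inner0 (plate l) y u) / c - g u\<bar> \<le> (norm0 (plate l) d * (2 * pi\<^sup>2) + K) * norm2 l \<sigma> u"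
      using b[OF u] by (simp add: e[OF u])
  qed
qed

lemma weak_solution_wave:
  assumes l: "0 < l" and s: "0 < \<sigma>" "\<sigma> < 1/2" and \<delta>: "0 < \<delta>" and S: "0 < S"
    and ws: "weak_solution l \<sigma> \<delta> S P (\<lambda>t p. 0) U0 V0 U U'"
  shows "wave (H2star l) (L2 (plate l)) (inner2 l \<sigma>) (inner0 (plate l)) (inner_x l) (W l 2 0) (2 * pi\<^sup>2) \<delta> S P U U'"
proof -
  interpret a: semi_inner "H2star l" "inner2 l \<sigma>" by (rule semi_inner_H2star[OF l s])
  interpret b: semi_inner "H2star l" "inner_x l" by (rule semi_inner_inner_x[OF l])
  have nrm: "norm2 l \<sigma> = a.nrm" by (rule ext) (simp add: norm2_def a.nrm_def)
  have nrm0: "norm0 (plate l) = l2.nrm l" by (rule ext) (simp add: norm0_l2)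
  \<comment> \<open>Limits within the interval [0, t + 1] are limits within the half-line, as t is not its right end.\<close>
  have at: "at t within {0..t + 1} = at t within {0..}" if "0 \<le> t" for t :: real
    by (rule at_within_nhd[of t "{..<t + 1}"]) auto
  \<comment> \<open>A single constant serves both bounds: 2 for the second derivative and 2 pi^2 for the L2 norm.\<close>
  have C: "2 \<le> 2 * pi\<^sup>2" using pi_gt3 power_mono[of 1 pi 2] by simp
  have on: "weak_solution_on l \<sigma> \<delta> S P (\<lambda>t p. 0) U0 V0 (t + 1) U U'" if "0 \<le> t" for t
    using ws that by (simp add: weak_solution_def)
  have ix: "2 + 0 \<le> (2::nat)" by auto
  show ?thesis
  proof (intro wave.intro wave_axioms.intro a.semi_inner_axioms b.semi_inner_axioms l2.semi_inner_axioms \<delta> S)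
    show "H2star l \<subseteq> L2 (plate l)" using H2star_L2 by blast
    show "W l 2 0 u \<in> L2 (plate l)" if "u \<in> H2star l" for u by (rule W_L2[OF H2star_H2[OF that] ix])
    show "inner_x l u v = - inner0 (plate l) (W l 2 0 u) v" if "u \<in> H2star l" "v \<in> H2star l" for u v
      by (rule inner_x_by_parts_inner0[OF l H2star_H2[OF that(1)] that(2)])
    show "l2.nrm l (\<lambda>p. W l 2 0 u p - W l 2 0 v p) \<le> 2 * pi\<^sup>2 * a.nrm (\<lambda>p. u p - v p)"
      if "u \<in> H2star l" "v \<in> H2star l" for u v
      using norm0_W20_diff[OF H2star_H2[OF that(1)] H2star_H2[OF that(2)] s]
        mult_right_mono[OF C a.nrm_nonneg[OF a.diff_mem[OF that]]] by (simp add: nrm nrm0)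
    show "l2.nrm l u \<le> 2 * pi\<^sup>2 * a.nrm u" if "u \<in> H2star l" for u
      using norm0_le_norm2[OF l that s] by (simp add: nrm nrm0)
  next
    fix t :: real assume t: "0 \<le> t"
    have tI: "t \<in> {0..t + 1}" using t by simp
    note d = on[OF t, unfolded weak_solution_on_def C0_curve_def has_curve_deriv_def]
    show "U t \<in> H2star l" using d tI by blast
    show "U' t \<in> L2 (plate l)" using d tI by blast
    show "((\<lambda>s. a.nrm (\<lambda>p. U s p - U t p)) \<longlongrightarrow> 0) (at t within {0..})"
      using d tI unfolding at[OF t, symmetric] nrm by blast
    show "((\<lambda>s. l2.nrm l (\<lambda>p. U' s p - U' t p)) \<longlongrightarrow> 0) (at t within {0..})"
      using d tI unfolding at[OF t, symmetric] nrm0 by blast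
    show "((\<lambda>s. l2.nrm l (\<lambda>p. (U s p - U t p) / (s - t) - U' t p)) \<longlongrightarrow> 0) (at t within {0..})"
      using d tI unfolding at[OF t, symmetric] nrm0 by blast
    fix e :: real assume e: "0 < e"
    obtain U'' where U'': "((\<lambda>s. dual_norm l \<sigma> (\<lambda>v. (inner0 (plate l) (U' s) v - inner0 (plate l) (U' t) v) / (s - t) - U'' t v)) \<longlongrightarrow> 0) (at t within {0..t + 1})"
        "U'' t \<in> dual l \<sigma>"
        "\<And>v. v \<in> H2star l \<Longrightarrow> U'' t v + \<delta> * inner0 (plate l) (U' t) v + inner2 l \<sigma> (U t) v
             + nonlocal_coeff l P S (U t) * inner_x l (U t) v = inner0 (plate l) (\<lambda>p. 0) v"
      using d tI by blast
    have eq: "- U'' t v = \<delta> * inner0 (plate l) (U' t) v + inner2 l \<sigma> (U t) v + (- P + S * inner_x l (U t) (U t)) * inner_x l (U t) v"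
      if v: "v \<in> H2star l" for v
      using U''(3)[OF v] l2.zero_left[OF H2star_L2[OF v]]
      by (simp add: nonlocal_coeff_def inner_x_def inner0_def power2_eq_square)
    have "\<forall>\<^sub>F s in at t within {0..t + 1}.
        dual_norm l \<sigma> (\<lambda>v. (inner0 (plate l) (U' s) v - inner0 (plate l) (U' t) v) / (s - t) - U'' t v) < e"
      using U''(1) e by (rule order_tendstoD)
    moreover have "\<forall>\<^sub>F s in at t within {0..t + 1}. s \<in> {0..t + 1}" by (auto simp: eventually_at_filter)
    ultimately have "\<forall>\<^sub>F s in at t within {0..t + 1}. \<forall>v\<in>H2star l.
       \<bar>(inner0 (plate l) (U' s) v - inner0 (plate l) (U' t) v) / (s - t) - U'' t v\<bar> \<le> e * a.nrm v"
    proof eventually_elim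
      case (elim s')
      show ?case
      proof
        fix v assume v: "v \<in> H2star l"
        have m: "U' s' \<in> L2 (plate l)" "U' t \<in> L2 (plate l)" using d tI elim(2) by blast+
        note D = dual_diff_quotient[OF l s m U''(2), of "s' - t"]
        have "\<bar>(inner0 (plate l) (U' s') v - inner0 (plate l) (U' t) v) / (s' - t) - U'' t v\<bar>
          \<le> dual_norm l \<sigma> (\<lambda>v. (inner0 (plate l) (U' s') v - inner0 (plate l) (U' t) v) / (s' - t) - U'' t v) * a.nrm v"
          using dual_le_dual_norm[OF l s D v] by (simp add: nrm)
        also have "\<dots> \<le> e * a.nrm v" using elim(1) a.nrm_nonneg[OF v] by (intro mult_right_mono) auto
        finally show "\<bar>(inner0 (plate l) (U' s') v - inner0 (plate l) (U' t) v) / (s' - t) - U'' t v\<bar> \<le> e * a.nrm v" .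
      qed
    qed
    then show "\<forall>\<^sub>F s in at t within {0..}. \<forall>v\<in>H2star l.
       \<bar>(inner0 (plate l) (U' s) v - inner0 (plate l) (U' t) v) / (s - t) +
        (\<delta> * inner0 (plate l) (U' t) v + inner2 l \<sigma> (U t) v + (- P + S * inner_x l (U t) (U t)) * inner_x l (U t) v)\<bar> \<le> e * a.nrm v"
      unfolding at[OF t] by eventually_elim (simp only: eq[symmetric] add_uminus_conv_diff ball_triv simp_thms cong: ball_cong)
  qed
qed

theorem corollary8:
  fixes \<sigma> l \<delta> S P \<Lambda>1 \<Lambda>2 :: real
    and w1 U0 V0 :: "real \<times> real \<Rightarrow> real"
    and \<phi>11 :: "real \<Rightarrow> real"
    and U U' :: "real \<Rightarrow> real \<times> real \<Rightarrow> real"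
  assumes "0 < \<sigma>" and "\<sigma> < 1 / 2" and "0 < l"
    and "first_second_eigenvalues l \<sigma> \<Lambda>1 \<Lambda>2"
    and "buckling_eigenfunction l \<sigma> \<Lambda>1 w1"
    and "AE p in lebesgue_on (plate l). w1 p = \<phi>11 (snd p) * sin (fst p)"
    and "norm0 (plate l) w1 = 1"
    and "0 < \<delta>" and "0 < S"
    and "U0 \<in> orth_compl (H2star l) (inner2 l \<sigma>) w1"
    and "V0 \<in> orth_compl (L2 (plate l)) (inner0 (plate l)) w1"
    and "\<Lambda>1 < P" and "P \<le> \<Lambda>2"
    and "weak_solution l \<sigma> \<delta> S P (\<lambda>t p. 0) U0 V0 U U'"
  shows "(\<forall>t\<ge>0. U t \<in> orth_compl (H2star l) (inner2 l \<sigma>) w1)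
       \<and> ((\<lambda>t. norm2 l \<sigma> (U t)) \<longlongrightarrow> 0) at_top
       \<and> ((\<lambda>t. norm0 (plate l) (U' t)) \<longlongrightarrow> 0) at_top"
proof -
  note s = assms(1,2) and l = assms(3) and eig = assms(5) and ws = assms(14)
  note gap = spectral_gap[OF l s assms(4,5,6,7)]
  interpret wave "H2star l" "L2 (plate l)" "inner2 l \<sigma>" "inner0 (plate l)" "inner_x l" "W l 2 0" "2 * pi\<^sup>2" \<delta> S P U U'
    by (rule weak_solution_wave[OF l s assms(8,9) ws])
  have w: "w1 \<in> H2star l" and ew: "\<And>z. z \<in> H2star l \<Longrightarrow> inner2 l \<sigma> w1 z = \<Lambda>1 * inner_x l w1 z"
    using eig by (auto simp: buckling_eigenfunction_def)
  have ew': "inner2 l \<sigma> u w1 = \<Lambda>1 * inner_x l u w1" if u: "u \<in> H2star l" for u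
    using ew[OF u] H.sym[OF u w] B.sym[OF u w] by simp
  have init: "AE p in lebesgue_on (plate l). U 0 p = U0 p" "AE p in lebesgue_on (plate l). U' 0 p = V0 p"
    using ws[unfolded weak_solution_def, rule_format, of 1] by (auto simp: weak_solution_on_def)
  have U0: "U0 \<in> H2star l" "inner2 l \<sigma> U0 (\<lambda>p. 1 * w1 p) = 0"
    and V0: "V0 \<in> L2 (plate l)" "inner0 (plate l) V0 (\<lambda>p. 1 * w1 p) = 0"
    using assms(10,11) unfolding orth_compl_def by blast+
  have "inner_x l U0 w1 = 0" using U0 ew'[OF U0(1)] gap(1) by simp
  then have z0: "inner0 (plate l) (U 0) w1 = 0"
    using inner_cong(3)[OF U_mem[OF order_refl] U0(1) init(1)[unfolded AE_plate] w] gap(3)[OF U0(1)] by simp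
  have "inner0 (plate l) (U' 0) w1 = inner0 (plate l) V0 w1"
    unfolding inner0_def
  proof (rule integral_cong_AE)
    show "AE p in lebesgue_on (plate l). U' 0 p * w1 p = V0 p * w1 p"
      using init(2) by eventually_elim simp
  qed (use V0(1) U'_mem[OF order_refl] H2star_L2[OF w] in \<open>auto simp: L2_def\<close>)
  then have z1: "inner0 (plate l) (U' 0) w1 = 0" using V0(2) by simp
  have inv: "inner0 (plate l) (U t) w1 = 0" if "t \<ge> 0" for t
    by (rule invariant_orthogonality[OF w ew' gap(3) z0 z1 that])
  have "U t \<in> orth_compl (H2star l) (inner2 l \<sigma>) w1" if t: "t \<ge> 0" for t
  proof -
    have "inner2 l \<sigma> (U t) (\<lambda>p. c * w1 p) = 0" for c
      using H.scale_right[OF w U_mem[OF t]] ew'[OF U_mem[OF t]] gap(3)[OF U_mem[OF t]] inv[OF t] by simp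
    then show ?thesis using U_mem[OF t] by (simp add: orth_compl_def)
  qed
  moreover have g: "P * \<beta> t \<le> inner2 l \<sigma> (U t) (U t)" if t: "t \<ge> 0" for t
  proof -
    have "P * \<beta> t \<le> \<Lambda>2 * \<beta> t"
      using assms(13) B.nonneg[OF U_mem[OF t]] by (intro mult_right_mono) (auto simp: \<beta>_def)
    also have "\<dots> \<le> inner2 l \<sigma> (U t) (U t)"
      using gap(4)[OF U_mem[OF t] inv[OF t]] by (simp add: \<beta>_def)
    finally show ?thesis .
  qed
  moreover have "norm2 l \<sigma> = H.nrm" "norm0 (plate l) = l2.nrm l"
    by (auto simp: norm2_def norm0_l2 H.nrm_def)
  ultimately show ?thesis using decay[OF g] by simp
qed

end
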